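(* Let $Q=\overline{\mathbb{A}_2}^{\emptyset}$ be the quiver with vertices $1,2$ and arrows $a_1:1\to 2$, $b_1:2\to 1$, and let $\Lambda=\widehat{\mathrm{J}}(Q,(a_1b_1)^3)$ be its completed Jacobian algebra. The 2-cyclic Caldero–Chapoton map $CC(-):\operatorname{mod}\Lambda\to\mathbb{Z}[x_1^{\pm1},x_2^{\pm1}]$ provides a bijection between the indecomposable $\tau$-rigid modules in $\operatorname{mod}\Lambda$ (up to isomorphism) and the non-initial cluster variables of the generalized cluster algebra $\mathcal{A}(\overline{\mathbb{A}_2}^{\emptyset})$, which are $$\frac{2x_2}{x_1},\ \frac{2x_1}{x_2},\ \frac{6}{x_1},\ \frac{6}{x_2}.$$
   Context: $K$ is an algebraically closed field. Paths are written left to right. $\widehat{KQ}$ is the completion of the path algebra with respect to the ideal generated by the arrows; for an arrow $a$ and a cycle $p$, $\partial_a(p)$ is the sum of $vu$ over all decompositions $p=uav$; the completed Jacobian algebra $\widehat{\mathrm{J}}(Q,W)$ is $\widehat{KQ}$ modulo the closure of the two-sided ideal generated by all $\partial_a(W)$, $a\in Q_1$. Finite-dimensional modules are identified with finite-dimensional representations $M=(M_i,\ M_a:M_{s(a)}\to M_{t(a)})$ of $Q$ satisfying the relations; $P_i$ is the indecomposable projective at vertex $i$. A module $M$ is $\tau$-rigid if $\operatorname{Hom}(M,\tau M)=0$, with $\tau$ the Auslander–Reiten translation. If $\bigoplus_i P_i^{b_i}\to\bigoplus_i P_i^{a_i}\to M\to 0$ is the minimal projective presentation of $M$, its $g$-vector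 is $g_M=(a_i-b_i)_i\in\mathbb{Z}^n$, $n$ being the number of vertices. For $e\in\mathbb{N}^n$, $\mathrm{Gr}_e(M)$ is the quiver Grassmannian (the variety of subrepresentations of $M$ with dimension vector $e$) and $\chi$ is the Euler characteristic. With $x^{a}=x_1^{a_1}\cdots x_n^{a_n}$, the 2-cyclic Caldero–Chapoton map is $$CC(M)=\Big(\sum_{e\in\mathbb{N}^n}\chi(\mathrm{Gr}_e(M))\Big)x^{-g_M}.$$ $\mathcal{A}(\overline{\mathbb{A}_2}^{\emptyset})$ is the Paquette–Schiffler generalized cluster algebra of a disk with two marked points and one puncture of order $3$; it is the subalgebra of $\mathbb{Z}[x_1^{\pm1},x_2^{\pm1}]$ generated by its cluster variables $x_1,x_2,\frac{2x_2}{x_1},\frac{2x_1}{x_2},\frac{6}{x_1},\frac{6}{x_2}$, of which $x_1,x_2$ are the initial ones.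
   Formalization: The field K is assumed to have characteristic different from 3; in characteristic 3 both cyclic derivatives of the potential vanish, only the two simple modules are indecomposable τ-rigid, and the claimed bijection with four cluster variables fails. *)

theory Defs
  imports
    "Jordan_Normal_Form.VS_Connect"
    "HOL-Algebra.QuotRing"
    "HOL-Computational_Algebra.Polynomial"
    "HOL-Library.Poly_Mapping"
    "HOL-Library.Groups_Big_Fun"
    "HOL-Library.Function_Algebras"
begin

section \<open>Euler characteristics of varieties\<close>

text \<open>
  The field is an arbitrary algebraically closed field, so the Euler characteristic is the etale
  one: \<open>\<chi>(X) = \<Sum>\<^sub>p (-1)\<^sup>p dim H\<^sup>p(X, \<int>/l)\<close> for a prime \<open>l\<close> different from the
  characteristic. It does not depend on \<open>l\<close>, agrees with the l-adic Euler characteristic (with or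
  without compact supports), and over the complex numbers it is the topological one. For
  quasi-projective \<open>X\<close>, etale cohomology is Cech cohomology, i.e. the direct limit of the
  cohomologies of the Cech complexes of etale coverings (Artin). This is what is written out here,
  in terms of closed points: all schemes involved are etale over a reduced variety, hence reduced.
\<close>

text \<open>Polynomials in the variables \<open>'i\<close>; \<open>peval\<close> evaluates, \<open>pdiff i\<close> evaluates the formal
  partial derivative with respect to the variable \<open>i\<close>.\<close>

type_synonym ('i, 'k) mpoly = "('i \<Rightarrow>\<^sub>0 nat) \<Rightarrow>\<^sub>0 'k"

definition peval :: "('i, 'k::comm_ring_1) mpoly \<Rightarrow> ('i \<Rightarrow> 'k) \<Rightarrow> 'k" where
  "peval f x = (\<Sum>m\<in>Poly_Mapping.keys f. Poly_Mapping.lookup f m *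
     (\<Prod>j\<in>Poly_Mapping.keys m. x j ^ Poly_Mapping.lookup m j))"

definition pdiff :: "'i \<Rightarrow> ('i, 'k::comm_ring_1) mpoly \<Rightarrow> ('i \<Rightarrow> 'k) \<Rightarrow> 'k" where
  "pdiff i f x = (\<Sum>m\<in>Poly_Mapping.keys f. Poly_Mapping.lookup f m *
     (of_nat (Poly_Mapping.lookup m i) * x i ^ (Poly_Mapping.lookup m i - 1) *
      (\<Prod>j\<in>Poly_Mapping.keys m - {i}. x j ^ Poly_Mapping.lookup m j)))"

text \<open>A variety is presented by a finite affine open covering: \<open>coord A c\<close> embeds the open subset
  \<open>dom A c\<close> as a Zariski closed subset of an affine space with coordinates indexed by \<open>'d\<close>.\<close>

record ('x, 'c, 'd, 'k) atlas =
  charts :: "'c set"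
  dom :: "'c \<Rightarrow> 'x set"
  coord :: "'c \<Rightarrow> 'x \<Rightarrow> 'd \<Rightarrow> 'k"

definition points :: "('x, 'c, 'd, 'k) atlas \<Rightarrow> 'x set" where
  "points A = (\<Union>c\<in>charts A. dom A c)"

text \<open>A piece \<open>(c, m, f)\<close> stands for the closed subvariety of \<open>dom A c \<times> K\<^sup>m\<close> cut out by \<open>m\<close>
  polynomials \<open>f 0, \<dots>, f (m - 1)\<close> whose Jacobian determinant with respect to the \<open>m\<close> fibre
  coordinates vanishes nowhere on it. These are exactly the affine varieties etale over the affine
  variety \<open>dom A c\<close>. A finite list of pieces stands for the disjoint union, with points \<open>(k, x, t)\<close>;
  it is a covering if it maps onto \<open>points A\<close>. Such coverings are cofinal among all etale
  coverings.\<close>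

type_synonym ('c, 'd, 'k) piece = "'c \<times> nat \<times> (nat \<Rightarrow> ('d + nat, 'k) mpoly)"
type_synonym ('x, 'k) cpoint = "nat \<times> 'x \<times> (nat \<Rightarrow> 'k)"

definition total_space ::
  "('x, 'c, 'd, 'k::comm_ring_1) atlas \<Rightarrow> ('c, 'd, 'k) piece list \<Rightarrow> ('x, 'k) cpoint set" where
  "total_space A V = {(k, x, t). k < length V \<and> (case V ! k of (c, m, f) \<Rightarrow>
      x \<in> dom A c \<and> (\<forall>j\<ge>m. t j = 0) \<and> (\<forall>j<m. peval (f j) (case_sum (coord A c x) t) = 0))}"

definition etale_cover ::
  "('x, 'c, 'd, 'k::comm_ring_1) atlas \<Rightarrow> ('c, 'd, 'k) piece list \<Rightarrow> bool" where
  "etale_cover A V \<longleftrightarrow>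
     (\<forall>k<length V. fst (V ! k) \<in> charts A) \<and>
     (\<forall>(k, x, t)\<in>total_space A V. case V ! k of (c, m, f) \<Rightarrow>
        det (mat m m (\<lambda>(i, j). pdiff (Inr j) (f i) (case_sum (coord A c x) t))) \<noteq> 0) \<and>
     (\<forall>x\<in>points A. \<exists>k t. (k, x, t) \<in> total_space A V)"

text \<open>The \<open>(p+1)\<close>-fold fibre power of the covering over the variety.\<close>

definition fibre_power ::
  "('x, 'c, 'd, 'k::comm_ring_1) atlas \<Rightarrow> ('c, 'd, 'k) piece list \<Rightarrow> nat \<Rightarrow> ('x, 'k) cpoint list set" where
  "fibre_power A V p = {vs. length vs = Suc p \<and> set vs \<subseteq> total_space A V \<and>
      (\<forall>v\<in>set vs. \<forall>w\<in>set vs. fst (snd v) = fst (snd w))}"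

text \<open>Coordinates on a component (given by the list of piece indices) of a fibre power: those of
  the base point in the chart of the first piece, and the fibre coordinates of all factors.\<close>

definition power_coord ::
  "('x, 'c, 'd, 'k) atlas \<Rightarrow> ('c, 'd, 'k) piece list \<Rightarrow> ('x, 'k) cpoint list \<Rightarrow> 'd + nat \<times> nat \<Rightarrow> 'k" where
  "power_coord A V vs = case_sum
     (coord A (fst (V ! fst (hd vs))) (fst (snd (hd vs))))
     (\<lambda>(i, j). snd (snd (vs ! i)) j)"

text \<open>Sections of the constant sheaf \<open>\<int>/l\<close> are the functions to \<open>\<int>/l\<close> that are locally constant in
  the Zariski topology. They are represented by integer-valued functions, and everything is read
  modulo \<open>l\<close>.\<close>

definition cochain ::
  "nat \<Rightarrow> ('x, 'c, 'd, 'k::comm_ring_1) atlas \<Rightarrow> ('c, 'd, 'k) piece list \<Rightarrow> nat \<Rightarrow>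
   (('x, 'k) cpoint list \<Rightarrow> int) \<Rightarrow> bool" where
  "cochain l A V p z \<longleftrightarrow> (\<forall>vs\<in>fibre_power A V p. \<exists>F :: ('d + nat \<times> nat, 'k) mpoly.
      peval F (power_coord A V vs) \<noteq> 0 \<and>
      (\<forall>ws\<in>fibre_power A V p. map fst ws = map fst vs \<and> peval F (power_coord A V ws) \<noteq> 0 \<longrightarrow>
         z ws mod int l = z vs mod int l))"

definition cech_diff :: "('v list \<Rightarrow> int) \<Rightarrow> 'v list \<Rightarrow> int" where
  "cech_diff z vs = (\<Sum>i<length vs. (- 1) ^ i * z (take i vs @ drop (Suc i) vs))"

definition cocycle ::
  "nat \<Rightarrow> ('x, 'c, 'd, 'k::comm_ring_1) atlas \<Rightarrow> ('c, 'd, 'k) piece list \<Rightarrow> nat \<Rightarrow>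
   (('x, 'k) cpoint list \<Rightarrow> int) \<Rightarrow> bool" where
  "cocycle l A V p z \<longleftrightarrow> cochain l A V p z \<and>
     (\<forall>vs\<in>fibre_power A V (Suc p). cech_diff z vs mod int l = 0)"

definition coboundary ::
  "nat \<Rightarrow> ('x, 'c, 'd, 'k::comm_ring_1) atlas \<Rightarrow> ('c, 'd, 'k) piece list \<Rightarrow> nat \<Rightarrow>
   (('x, 'k) cpoint list \<Rightarrow> int) \<Rightarrow> bool" where
  "coboundary l A V p z \<longleftrightarrow> (case p of
      0 \<Rightarrow> \<forall>vs\<in>fibre_power A V 0. z vs mod int l = 0
    | Suc q \<Rightarrow> \<exists>y. cochain l A V q y \<and>
        (\<forall>vs\<in>fibre_power A V p. z vs mod int l = cech_diff y vs mod int l))"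

text \<open>\<open>refinement A W V \<rho>\<close>: \<open>\<rho>\<close> is a morphism of varieties over \<open>points A\<close> from \<open>W\<close> to \<open>V\<close> mapping
  each piece of \<open>W\<close> into a piece of \<open>V\<close>. Since the pieces are affine, the new fibre coordinates are
  polynomials \<open>g k j\<close>.\<close>

definition refinement ::
  "('x, 'c, 'd, 'k::comm_ring_1) atlas \<Rightarrow> ('c, 'd, 'k) piece list \<Rightarrow> ('c, 'd, 'k) piece list \<Rightarrow>
   (('x, 'k) cpoint \<Rightarrow> ('x, 'k) cpoint) \<Rightarrow> bool" where
  "refinement A W V \<rho> \<longleftrightarrow> \<rho> ` total_space A W \<subseteq> total_space A V \<and>
     (\<exists>(r :: nat \<Rightarrow> nat) (g :: nat \<Rightarrow> nat \<Rightarrow> ('d + nat, 'k) mpoly). \<forall>(k, x, t)\<in>total_space A W.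
        \<rho> (k, x, t) = (r k, x, \<lambda>j. peval (g k j) (case_sum (coord A (fst (W ! k)) x) t)))"

text \<open>The dimension over \<open>\<int>/l\<close> of the direct limit of the \<open>p\<close>-th Cech cohomology groups: the largest
  number of classes, all represented on a common covering, that are linearly independent in the
  limit.\<close>

definition etale_betti :: "nat \<Rightarrow> ('x, 'c, 'd, 'k::comm_ring_1) atlas \<Rightarrow> nat \<Rightarrow> nat" where
  "etale_betti l A p = Max {n. \<exists>V z. etale_cover A V \<and> (\<forall>i<n. cocycle l A V p (z i)) \<and>
     (\<forall>\<epsilon> :: nat \<Rightarrow> int. (\<exists>i<n. \<not> int l dvd \<epsilon> i) \<longrightarrow>
        (\<forall>W \<rho>. etale_cover A W \<and> refinement A W V \<rho> \<longrightarrow>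
           \<not> coboundary l A W p (\<lambda>ws. \<Sum>i<n. \<epsilon> i * z i (map \<rho> ws))))}"

definition euler_char :: "('x, 'c, 'd, 'k::comm_ring_1) atlas \<Rightarrow> int" where
  "euler_char A = (let l = (LEAST l. prime l \<and> (of_nat l :: 'k) \<noteq> 0) in
     Sum_any (\<lambda>p. (- 1) ^ p * int (etale_betti l A p)))"


section \<open>Quivers with potential and completed Jacobian algebras\<close>

text \<open>The vertices and arrows of a quiver are all elements of the finite types \<open>'v\<close> and \<open>'a\<close>.\<close>

record ('v, 'a) quiver =
  src :: "'a \<Rightarrow> 'v"
  tgt :: "'a \<Rightarrow> 'v"

text \<open>A path is a starting vertex with a list of arrows, written left to right.\<close>

type_synonym ('v, 'a) path = "'v \<times> 'a list"

fun is_path :: "('v, 'a) quiver \<Rightarrow> ('v, 'a) path \<Rightarrow> bool" where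
  "is_path Q (i, []) \<longleftrightarrow> True"
| "is_path Q (i, a # as) \<longleftrightarrow> src Q a = i \<and> is_path Q (tgt Q a, as)"

fun path_end :: "('v, 'a) quiver \<Rightarrow> ('v, 'a) path \<Rightarrow> 'v" where
  "path_end Q (i, []) = i"
| "path_end Q (i, a # as) = path_end Q (tgt Q a, as)"

text \<open>Elements of the completed path algebra are the formal (possibly infinite) linear combinations
  of paths.\<close>

type_synonym ('v, 'a, 'k) series = "('v, 'a) path \<Rightarrow> 'k"

definition path_elt :: "('v, 'a) path \<Rightarrow> ('v, 'a, 'k::zero_neq_one) series" where
  "path_elt p = (\<lambda>q. if q = p then 1 else 0)"

definition path_algebra :: "('v, 'a) quiver \<Rightarrow> ('v, 'a, 'k::field) series ring" where
  "path_algebra Q = \<lparr>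
     carrier = {f. \<forall>p. \<not> is_path Q p \<longrightarrow> f p = 0},
     mult = (\<lambda>f g (i, as). \<Sum>n\<le>length as.
       f (i, take n as) * g (path_end Q (i, take n as), drop n as)),
     one = (\<lambda>(i, as). if as = [] then 1 else 0),
     zero = (\<lambda>p. 0),
     add = (\<lambda>f g p. f p + g p)\<rparr>"

lemma is_path_split: "is_path Q (i, as @ bs) \<longleftrightarrow> is_path Q (i, as) \<and> is_path Q (path_end Q (i, as), bs)"
  by (induction as arbitrary: i) auto

lemma path_end_append: "path_end Q (i, as @ bs) = path_end Q (path_end Q (i, as), bs)"
  by (induction as arbitrary: i) auto

lemma ring_path_algebra: "ring (path_algebra Q :: ('v, 'a, 'k::field) series ring)"
proof (intro ringI abelian_groupI monoidI)
  let ?R = "path_algebra Q :: ('v, 'a, 'k::field) series ring"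
  fix f g h :: "('v, 'a, 'k) series"
  assume f: "f \<in> carrier ?R"
  show "\<exists>y\<in>carrier ?R. y \<oplus>\<^bsub>?R\<^esub> f = \<zero>\<^bsub>?R\<^esub>"
    using f by (intro bexI[of _ "\<lambda>p. - f p"]) (auto simp: path_algebra_def)
  have *: "(if n = m then x else 0) * (y::'k) = (if n = m then x * y else 0)" for n m :: nat and x y by simp
  show "\<one>\<^bsub>?R\<^esub> \<otimes>\<^bsub>?R\<^esub> f = f"
  proof (rule ext, clarify)
    fix i as
    have "(\<Sum>n\<le>length as. (if take n as = [] then 1 else 0) * f (path_end Q (i, take n as), drop n as))
       = (\<Sum>n\<le>length as. if n = 0 then f (i, as) else 0)"
      by (rule sum.cong) auto
    then show "(\<one>\<^bsub>?R\<^esub> \<otimes>\<^bsub>?R\<^esub> f) (i, as) = f (i, as)" by (simp add: path_algebra_def)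
  qed
  show "f \<otimes>\<^bsub>?R\<^esub> \<one>\<^bsub>?R\<^esub> = f"
  proof (rule ext, clarify)
    fix i as
    have "(\<Sum>n\<le>length as. f (i, take n as) * (if drop n as = [] then 1 else 0))
       = (\<Sum>n\<le>length as. if n = length as then f (i, as) else 0)"
      by (rule sum.cong) auto
    then show "(f \<otimes>\<^bsub>?R\<^esub> \<one>\<^bsub>?R\<^esub>) (i, as) = f (i, as)" by (simp add: path_algebra_def)
  qed
  assume g: "g \<in> carrier ?R"
  show "f \<otimes>\<^bsub>?R\<^esub> g \<in> carrier ?R"
  proof -
    have "(\<Sum>n\<le>length as. f (i, take n as) * g (path_end Q (i, take n as), drop n as)) = 0"
      if "\<not> is_path Q (i, as)" for i as
    proof (rule sum.neutral, clarify)
      fix n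
      have "\<not> is_path Q (i, take n as) \<or> \<not> is_path Q (path_end Q (i, take n as), drop n as)"
        using that is_path_split[of Q i "take n as" "drop n as"] by simp
      then show "f (i, take n as) * g (path_end Q (i, take n as), drop n as) = 0"
        using f g by (auto simp: path_algebra_def)
    qed
    then show ?thesis by (auto simp: path_algebra_def)
  qed
  assume h: "h \<in> carrier ?R"
  show "f \<otimes>\<^bsub>?R\<^esub> g \<otimes>\<^bsub>?R\<^esub> h = f \<otimes>\<^bsub>?R\<^esub> (g \<otimes>\<^bsub>?R\<^esub> h)"
  proof (rule ext, clarify)
    fix i as
    let ?F = "\<lambda>m n. f (i, take m as) * g (path_end Q (i, take m as), take (n - m) (drop m as))
       * h (path_end Q (i, take n as), drop n as)"
    have "(f \<otimes>\<^bsub>?R\<^esub> g \<otimes>\<^bsub>?R\<^esub> h) (i, as) = (\<Sum>n\<le>length as. \<Sum>m\<le>n. ?F m n)"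
      by (auto simp: path_algebra_def sum_distrib_right min_absorb2 take_take min_def drop_take intro!: sum.cong)
    also have "\<dots> = (\<Sum>m\<le>length as. \<Sum>n\<in>{m..length as}. ?F m n)"
      by (subst sum.nested_swap'[symmetric] | simp add: sum.Sigma)+
         (auto intro!: sum.reindex_bij_witness[of _ "\<lambda>(a,b). (b,a)" "\<lambda>(a,b). (b,a)"])
    also have "\<dots> = (\<Sum>m\<le>length as. \<Sum>n\<le>length as - m. ?F m (m + n))"
    proof (rule sum.cong[OF refl])
      fix m assume "m \<in> {..length as}"
      then show "(\<Sum>n\<in>{m..length as}. ?F m n) = (\<Sum>n\<le>length as - m. ?F m (m + n))"
        by (intro sum.reindex_bij_witness[of _ "\<lambda>n. m + n" "\<lambda>n. n - m"]) auto
    qed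
    also have "\<dots> = (f \<otimes>\<^bsub>?R\<^esub> (g \<otimes>\<^bsub>?R\<^esub> h)) (i, as)"
      by (auto simp: path_algebra_def sum_distrib_left take_add path_end_append mult.assoc drop_drop add.commute intro!: sum.cong)
    finally show "(f \<otimes>\<^bsub>?R\<^esub> g \<otimes>\<^bsub>?R\<^esub> h) (i, as) = (f \<otimes>\<^bsub>?R\<^esub> (g \<otimes>\<^bsub>?R\<^esub> h)) (i, as)" .
  qed
qed (auto simp: path_algebra_def add.assoc add.commute distrib_left distrib_right sum.distrib)

text \<open>Coefficient of \<open>q = v u\<close> in \<open>\<partial>\<^sub>a(W)\<close>: the sum of the coefficients in \<open>W\<close> of the cycles \<open>u a v\<close>, over
  all ways of cutting \<open>q\<close> into \<open>v u\<close>.\<close>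

definition cyclic_derivative ::
  "('v, 'a) quiver \<Rightarrow> 'a \<Rightarrow> ('v, 'a, 'k::field) series \<Rightarrow> ('v, 'a, 'k) series" where
  "cyclic_derivative Q a W = (\<lambda>(i, as). if is_path Q (i, as)
     then \<Sum>n\<le>length as. W (path_end Q (i, take n as), drop n as @ a # take n as) else 0)"

text \<open>Closure in the topology whose neighbourhoods of \<open>0\<close> are the powers of the arrow ideal; the
  \<open>n\<close>-th power consists of the series without terms of length less than \<open>n\<close>.\<close>

definition arrow_adic_closure ::
  "('v, 'a) quiver \<Rightarrow> ('v, 'a, 'k::field) series set \<Rightarrow> ('v, 'a, 'k) series set" where
  "arrow_adic_closure Q I = {f \<in> carrier (path_algebra Q).
     \<forall>n. \<exists>g\<in>I. \<forall>p. length (snd p) < n \<longrightarrow> f p = g p}"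

definition jacobian_ideal ::
  "('v, 'a) quiver \<Rightarrow> ('v, 'a, 'k::field) series \<Rightarrow> ('v, 'a, 'k) series set" where
  "jacobian_ideal Q W = arrow_adic_closure Q
     (Idl\<^bsub>path_algebra Q\<^esub> (range (\<lambda>a. cyclic_derivative Q a W)))"

definition jacobian_algebra ::
  "('v, 'a) quiver \<Rightarrow> ('v, 'a, 'k::field) series \<Rightarrow> ('v, 'a, 'k) series set ring" where
  "jacobian_algebra Q W = path_algebra Q Quot jacobian_ideal Q W"

definition jac_class ::
  "('v, 'a) quiver \<Rightarrow> ('v, 'a, 'k::field) series \<Rightarrow> ('v, 'a, 'k) series \<Rightarrow> ('v, 'a, 'k) series set" where
  "jac_class Q W f = jacobian_ideal Q W +>\<^bsub>path_algebra Q\<^esub> f"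

definition jac_scalar ::
  "('v, 'a) quiver \<Rightarrow> ('v, 'a, 'k::field) series \<Rightarrow> 'k \<Rightarrow> ('v, 'a, 'k) series set" where
  "jac_scalar Q W c = jac_class Q W (\<lambda>(i, as). if as = [] then c else 0)"

text \<open>The subspace \<open>e\<^sub>i \<Lambda> e\<^sub>j\<close>.\<close>

definition jac_hom ::
  "('v, 'a) quiver \<Rightarrow> ('v, 'a, 'k::field) series \<Rightarrow> 'v \<Rightarrow> 'v \<Rightarrow> ('v, 'a, 'k) series set set" where
  "jac_hom Q W i j =
     {jac_class Q W (path_elt (i, [])) \<otimes>\<^bsub>jacobian_algebra Q W\<^esub> x
        \<otimes>\<^bsub>jacobian_algebra Q W\<^esub> jac_class Q W (path_elt (j, [])) | x. x \<in> carrier (jacobian_algebra Q W)}"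


section \<open>Representations\<close>

text \<open>Up to isomorphism, the vector space at the vertex \<open>i\<close> is \<open>K\<^bsup>rdim M i\<^esup>\<close>, with matrices acting on
  column vectors.\<close>

record ('v, 'a, 'k) rep =
  rdim :: "'v \<Rightarrow> nat"
  rmap :: "'a \<Rightarrow> 'k mat"

definition is_rep :: "('v, 'a) quiver \<Rightarrow> ('v, 'a, 'k::field) rep \<Rightarrow> bool" where
  "is_rep Q M \<longleftrightarrow> (\<forall>a. rmap M a \<in> carrier_mat (rdim M (tgt Q a)) (rdim M (src Q a)))"

fun path_map :: "('v, 'a) quiver \<Rightarrow> ('v, 'a, 'k::field) rep \<Rightarrow> ('v, 'a) path \<Rightarrow> 'k mat" where
  "path_map Q M (i, []) = 1\<^sub>m (rdim M i)"
| "path_map Q M (i, a # as) = path_map Q M (tgt Q a, as) * rmap M a"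

text \<open>Finite-dimensional (right) modules over \<open>jacobian_algebra Q W\<close>. All sufficiently long paths act
  by zero on a finite-dimensional module over the completed path algebra, so a series acts through
  finitely many terms; the elements of the Jacobian ideal have to act by zero.\<close>

definition is_module ::
  "('v, 'a) quiver \<Rightarrow> ('v, 'a, 'k::field) series \<Rightarrow> ('v, 'a, 'k) rep \<Rightarrow> bool" where
  "is_module Q W M \<longleftrightarrow> is_rep Q M \<and> (\<exists>N.
     (\<forall>p. is_path Q p \<and> N \<le> length (snd p) \<longrightarrow>
        path_map Q M p = 0\<^sub>m (rdim M (path_end Q p)) (rdim M (fst p))) \<and>
     (\<forall>f\<in>jacobian_ideal Q W. \<forall>i j. \<forall>r<rdim M j. \<forall>c<rdim M i.
        (\<Sum>p | is_path Q p \<and> fst p = i \<and> path_end Q p = j \<and> length (snd p) < N.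
           f p * path_map Q M p $$ (r, c)) = 0))"

definition rep_hom ::
  "('v, 'a) quiver \<Rightarrow> ('v, 'a, 'k::field) rep \<Rightarrow> ('v, 'a, 'k) rep \<Rightarrow> ('v \<Rightarrow> 'k mat) set" where
  "rep_hom Q M N = {h. (\<forall>i. h i \<in> carrier_mat (rdim N i) (rdim M i)) \<and>
     (\<forall>a. h (tgt Q a) * rmap M a = rmap N a * h (src Q a))}"

definition rep_iso ::
  "('v, 'a) quiver \<Rightarrow> ('v, 'a, 'k::field) rep \<Rightarrow> ('v, 'a, 'k) rep \<Rightarrow> bool" where
  "rep_iso Q M N \<longleftrightarrow> (\<exists>h\<in>rep_hom Q M N. \<exists>h'\<in>rep_hom Q N M. \<forall>i.
     h' i * h i = 1\<^sub>m (rdim M i) \<and> h i * h' i = 1\<^sub>m (rdim N i))"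

definition zero_rep :: "('v, 'a, 'k::field) rep" where
  "zero_rep = \<lparr>rdim = (\<lambda>i. 0), rmap = (\<lambda>a. 0\<^sub>m 0 0)\<rparr>"

definition rep_sum ::
  "('v, 'a) quiver \<Rightarrow> ('v, 'a, 'k::field) rep \<Rightarrow> ('v, 'a, 'k) rep \<Rightarrow> ('v, 'a, 'k) rep" where
  "rep_sum Q M N = \<lparr>rdim = (\<lambda>i. rdim M i + rdim N i),
     rmap = (\<lambda>a. four_block_mat (rmap M a) (0\<^sub>m (rdim M (tgt Q a)) (rdim N (src Q a)))
       (0\<^sub>m (rdim N (tgt Q a)) (rdim M (src Q a))) (rmap N a))\<rparr>"

definition indecomposable ::
  "('v, 'a) quiver \<Rightarrow> ('v, 'a, 'k::field) series \<Rightarrow> ('v, 'a, 'k) rep \<Rightarrow> bool" where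
  "indecomposable Q W M \<longleftrightarrow> \<not> rep_iso Q M zero_rep \<and>
     (\<forall>N N'. is_module Q W N \<and> is_module Q W N' \<and> rep_iso Q M (rep_sum Q N N') \<longrightarrow>
        rep_iso Q N zero_rep \<or> rep_iso Q N' zero_rep)"

definition is_subrep ::
  "('v, 'a) quiver \<Rightarrow> ('v, 'a, 'k::field) rep \<Rightarrow> ('v \<Rightarrow> 'k vec set) \<Rightarrow> bool" where
  "is_subrep Q M U \<longleftrightarrow>
     (\<forall>i. VectorSpace.subspace class_ring (U i) (module_vec TYPE('k) (rdim M i))) \<and>
     (\<forall>a. \<forall>u\<in>U (src Q a). rmap M a *\<^sub>v u \<in> U (tgt Q a))"


section \<open>Quiver Grassmannians\<close>

text \<open>As a closed subvariety of a product of Grassmannians, covered by the standard charts: \<open>I\<close> selects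
  sets of \<open>e i\<close> coordinates, and the chart contains the \<open>U\<close> such that each \<open>U i\<close> projects isomorphically
  to the selected coordinates. Its coordinates are the entries of the basis of \<open>U i\<close> that
  is mapped to the standard basis.\<close>

definition quiver_grassmannian :: "('v, 'a) quiver \<Rightarrow> ('v, 'a, 'k::field) rep \<Rightarrow> ('v \<Rightarrow> nat) \<Rightarrow>
    ('v \<Rightarrow> 'k vec set, 'v \<Rightarrow> nat set, 'v \<times> nat \<times> nat, 'k) atlas" where
  "quiver_grassmannian Q M e = \<lparr>
     charts = {I. \<forall>i. I i \<subseteq> {..<rdim M i} \<and> card (I i) = e i},
     dom = (\<lambda>I. {U. is_subrep Q M U \<and>
       (\<forall>i. vectorspace.dim class_ring ((module_vec TYPE('k) (rdim M i))\<lparr>carrier := U i\<rparr>) = e i) \<and>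
       (\<forall>i. \<forall>y :: nat \<Rightarrow> 'k. \<exists>!u. u \<in> U i \<and> (\<forall>s\<in>I i. u $ s = y s))}),
     coord = (\<lambda>I U (i, r, s). if r \<in> I i \<and> s < rdim M i
       then (THE u. u \<in> U i \<and> (\<forall>s'\<in>I i. u $ s' = (if s' = r then 1 else 0))) $ s else 0)\<rparr>"


section \<open>Projective presentations, g-vectors and the Auslander--Reiten translation\<close>

text \<open>\<open>P\<^sub>i = e\<^sub>i \<Lambda>\<close> as a representation: \<open>\<phi> j\<close> identifies \<open>e\<^sub>i \<Lambda> e\<^sub>j\<close> with \<open>K\<^bsup>rdim P j\<^esup>\<close>.\<close>

definition is_projective_at :: "('v, 'a) quiver \<Rightarrow> ('v, 'a, 'k::field) series \<Rightarrow> 'v \<Rightarrow>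
    ('v, 'a, 'k) rep \<Rightarrow> ('v \<Rightarrow> ('v, 'a, 'k) series set \<Rightarrow> 'k vec) \<Rightarrow> bool" where
  "is_projective_at Q W i P \<phi> \<longleftrightarrow> is_rep Q P \<and>
     (\<forall>j. bij_betw (\<phi> j) (jac_hom Q W i j) (carrier_vec (rdim P j)) \<and>
        (\<forall>x\<in>jac_hom Q W i j. \<forall>y\<in>jac_hom Q W i j.
           \<phi> j (x \<oplus>\<^bsub>jacobian_algebra Q W\<^esub> y) = \<phi> j x + \<phi> j y) \<and>
        (\<forall>x\<in>jac_hom Q W i j. \<forall>c.
           \<phi> j (jac_scalar Q W c \<otimes>\<^bsub>jacobian_algebra Q W\<^esub> x) = c \<cdot>\<^sub>v \<phi> j x)) \<and>
     (\<forall>a. \<forall>x\<in>jac_hom Q W i (src Q a).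
        \<phi> (tgt Q a) (x \<otimes>\<^bsub>jacobian_algebra Q W\<^esub> jac_class Q W (path_elt (src Q a, [a])))
          = rmap P a *\<^sub>v \<phi> (src Q a) x)"

definition projective_data :: "('v, 'a) quiver \<Rightarrow> ('v, 'a, 'k::field) series \<Rightarrow> 'v \<Rightarrow>
    ('v, 'a, 'k) rep \<times> ('v \<Rightarrow> ('v, 'a, 'k) series set \<Rightarrow> 'k vec)" where
  "projective_data Q W i = (SOME (P, \<phi>). is_projective_at Q W i P \<phi>)"

definition proj :: "('v, 'a) quiver \<Rightarrow> ('v, 'a, 'k::field) series \<Rightarrow> 'v \<Rightarrow> ('v, 'a, 'k) rep" where
  "proj Q W i = fst (projective_data Q W i)"

definition proj_sum :: "('v::enum, 'a) quiver \<Rightarrow> ('v, 'a, 'k::field) series \<Rightarrow> ('v \<Rightarrow> nat) \<Rightarrow>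
    ('v, 'a, 'k) rep" where
  "proj_sum Q W b = foldr (rep_sum Q)
     (concat (map (\<lambda>i. replicate (b i) (proj Q W i)) Enum.enum)) zero_rep"

text \<open>Left multiplication by the arrow \<open>a\<close>, as a homomorphism \<open>P\<^bsub>t(a)\<^esub> \<rightarrow> P\<^bsub>s(a)\<^esub>\<close>.\<close>

definition arrow_lmult :: "('v, 'a) quiver \<Rightarrow> ('v, 'a, 'k::field) series \<Rightarrow> 'a \<Rightarrow> 'v \<Rightarrow> 'k mat" where
  "arrow_lmult Q W a = (THE h. h \<in> rep_hom Q (proj Q W (tgt Q a)) (proj Q W (src Q a)) \<and>
     (\<forall>j. \<forall>x\<in>jac_hom Q W (tgt Q a) j.
        h j *\<^sub>v snd (projective_data Q W (tgt Q a)) j x = snd (projective_data Q W (src Q a)) j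
          (jac_class Q W (path_elt (src Q a, [a])) \<otimes>\<^bsub>jacobian_algebra Q W\<^esub> x)))"

text \<open>\<open>h\<close> is an essential epimorphism from \<open>M\<close> onto the subrepresentation \<open>S\<close> of its codomain: no proper
  subrepresentation of \<open>M\<close> is mapped onto \<open>S\<close>.\<close>

definition essential_onto :: "('v, 'a) quiver \<Rightarrow> ('v, 'a, 'k::field) rep \<Rightarrow> ('v \<Rightarrow> 'k mat) \<Rightarrow>
    ('v \<Rightarrow> 'k vec set) \<Rightarrow> bool" where
  "essential_onto Q M h S \<longleftrightarrow> (\<forall>i. (*\<^sub>v) (h i) ` carrier_vec (rdim M i) = S i) \<and>
     (\<forall>U. is_subrep Q M U \<and> (\<forall>i. (*\<^sub>v) (h i) ` U i = S i) \<longrightarrow> (\<forall>i. U i = carrier_vec (rdim M i)))"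

text \<open>The minimal projective presentation \<open>\<Oplus> P\<^sub>i\<^bsup>b i\<^esup> \<rightarrow> \<Oplus> P\<^sub>i\<^bsup>a i\<^esup> \<rightarrow> M \<rightarrow> 0\<close> with maps \<open>f\<close> and \<open>g\<close>.\<close>

definition min_presentation :: "('v::enum, 'a) quiver \<Rightarrow> ('v, 'a, 'k::field) series \<Rightarrow>
    ('v, 'a, 'k) rep \<Rightarrow> ('v \<Rightarrow> nat) \<Rightarrow> ('v \<Rightarrow> nat) \<Rightarrow> ('v \<Rightarrow> 'k mat) \<Rightarrow> ('v \<Rightarrow> 'k mat) \<Rightarrow> bool" where
  "min_presentation Q W M a b f g \<longleftrightarrow>
     f \<in> rep_hom Q (proj_sum Q W b) (proj_sum Q W a) \<and> g \<in> rep_hom Q (proj_sum Q W a) M \<and>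
     essential_onto Q (proj_sum Q W a) g (\<lambda>i. carrier_vec (rdim M i)) \<and>
     essential_onto Q (proj_sum Q W b) f
       (\<lambda>i. {v \<in> carrier_vec (rdim (proj_sum Q W a) i). g i *\<^sub>v v = 0\<^sub>v (rdim M i)})"

definition g_vector :: "('v::enum, 'a) quiver \<Rightarrow> ('v, 'a, 'k::field) series \<Rightarrow>
    ('v, 'a, 'k) rep \<Rightarrow> 'v \<Rightarrow> int" where
  "g_vector Q W M = (THE d. \<exists>a b f g. min_presentation Q W M a b f g \<and>
     d = (\<lambda>i. int (a i) - int (b i)))"

text \<open>\<open>\<tau>M = D Tr M\<close>. For a minimal projective presentation with map \<open>f : P' \<rightarrow> P\<close>, the transpose
  \<open>Tr M\<close> is the cokernel of \<open>Hom(f,\<Lambda>) : Hom(P,\<Lambda>) \<rightarrow> Hom(P',\<Lambda>)\<close>, a left module whose part at the vertex \<open>j\<close>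
  is the cokernel of \<open>Hom(P, P\<^sub>j) \<rightarrow> Hom(P', P\<^sub>j)\<close> and on which arrows act by left
  multiplication. The following set is the linear dual of that cokernel, i.e. the space of
  functionals on \<open>Hom(P', P\<^sub>j)\<close> that vanish on the image of \<open>Hom(P, P\<^sub>j)\<close> (extended by \<open>0\<close>
  outside of \<open>Hom(P', P\<^sub>j)\<close>).\<close>

definition dual_transpose_space :: "('v::enum, 'a) quiver \<Rightarrow> ('v, 'a, 'k::field) series \<Rightarrow>
    ('v \<Rightarrow> nat) \<Rightarrow> ('v \<Rightarrow> nat) \<Rightarrow> ('v \<Rightarrow> 'k mat) \<Rightarrow> 'v \<Rightarrow> (('v \<Rightarrow> 'k mat) \<Rightarrow> 'k) set" where
  "dual_transpose_space Q W a b f j = {\<xi>.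
     (\<forall>h. h \<notin> rep_hom Q (proj_sum Q W b) (proj Q W j) \<longrightarrow> \<xi> h = 0) \<and>
     (\<forall>h\<in>rep_hom Q (proj_sum Q W b) (proj Q W j). \<forall>h'\<in>rep_hom Q (proj_sum Q W b) (proj Q W j).
        \<xi> (\<lambda>i. h i + h' i) = \<xi> h + \<xi> h') \<and>
     (\<forall>h\<in>rep_hom Q (proj_sum Q W b) (proj Q W j). \<forall>c. \<xi> (\<lambda>i. c \<cdot>\<^sub>m h i) = c * \<xi> h) \<and>
     (\<forall>h\<in>rep_hom Q (proj_sum Q W a) (proj Q W j). \<xi> (\<lambda>i. h i * f i) = 0)}"

definition is_ar_translate :: "('v::enum, 'a) quiver \<Rightarrow> ('v, 'a, 'k::field) series \<Rightarrow>
    ('v, 'a, 'k) rep \<Rightarrow> ('v, 'a, 'k) rep \<Rightarrow> bool" where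
  "is_ar_translate Q W M T \<longleftrightarrow> is_rep Q T \<and> (\<exists>a b f g \<psi>. min_presentation Q W M a b f g \<and>
     (\<forall>j. bij_betw (\<psi> j) (carrier_vec (rdim T j)) (dual_transpose_space Q W a b f j)) \<and>
     (\<forall>j. \<forall>v\<in>carrier_vec (rdim T j). \<forall>w\<in>carrier_vec (rdim T j). \<forall>h.
        \<psi> j (v + w) h = \<psi> j v h + \<psi> j w h) \<and>
     (\<forall>j. \<forall>v\<in>carrier_vec (rdim T j). \<forall>c h. \<psi> j (c \<cdot>\<^sub>v v) h = c * \<psi> j v h) \<and>
     (\<forall>x. \<forall>v\<in>carrier_vec (rdim T (src Q x)).
        \<forall>h\<in>rep_hom Q (proj_sum Q W b) (proj Q W (tgt Q x)).
          \<psi> (tgt Q x) (rmap T x *\<^sub>v v) h = \<psi> (src Q x) v (\<lambda>i. arrow_lmult Q W x i * h i)))"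

definition ar_translate :: "('v::enum, 'a) quiver \<Rightarrow> ('v, 'a, 'k::field) series \<Rightarrow>
    ('v, 'a, 'k) rep \<Rightarrow> ('v, 'a, 'k) rep" where
  "ar_translate Q W M = (SOME T. is_ar_translate Q W M T)"

definition tau_rigid :: "('v::enum, 'a) quiver \<Rightarrow> ('v, 'a, 'k::field) series \<Rightarrow>
    ('v, 'a, 'k) rep \<Rightarrow> bool" where
  "tau_rigid Q W M \<longleftrightarrow>
     rep_hom Q M (ar_translate Q W M) = {\<lambda>i. 0\<^sub>m (rdim (ar_translate Q W M) i) (rdim M i)}"


section \<open>The 2-cyclic Caldero--Chapoton map\<close>

text \<open>Laurent polynomials with integer coefficients in variables indexed by \<open>'v\<close>: the group ring of
  the group \<open>'v \<Rightarrow> int\<close> of exponent vectors.\<close>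

type_synonym 'v laurent = "('v \<Rightarrow> int) \<Rightarrow>\<^sub>0 int"

definition lmono :: "('v \<Rightarrow> int) \<Rightarrow> 'v laurent" where
  "lmono d = Poly_Mapping.single d 1"

definition CC :: "('v::enum, 'a) quiver \<Rightarrow> ('v, 'a, 'k::field) series \<Rightarrow> ('v, 'a, 'k) rep \<Rightarrow>
    'v laurent" where
  "CC Q W M = of_int (Sum_any (\<lambda>e. euler_char (quiver_grassmannian Q M e))) *
     lmono (\<lambda>i. - g_vector Q W M i)"


section \<open>The quiver with potential and the generalized cluster algebra\<close>

datatype vertex = V1 | V2
datatype arrow = A1 | B1

instantiation vertex :: enum
begin
definition "enum_vertex = [V1, V2]"
definition "enum_all_vertex P \<longleftrightarrow> P V1 \<and> P V2"
definition "enum_ex_vertex P \<longleftrightarrow> P V1 \<or> P V2"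
instance
proof
  show "(UNIV :: vertex set) = set Enum.enum"
    unfolding enum_vertex_def using vertex.exhaust by auto
  show "distinct (Enum.enum :: vertex list)"
    by (simp add: enum_vertex_def)
  show "Enum.enum_all P \<longleftrightarrow> Ball UNIV P" for P :: "vertex \<Rightarrow> bool"
    unfolding enum_all_vertex_def by (metis (full_types) UNIV_I vertex.exhaust)
  show "Enum.enum_ex P \<longleftrightarrow> Bex UNIV P" for P :: "vertex \<Rightarrow> bool"
    unfolding enum_ex_vertex_def by (metis (full_types) UNIV_I vertex.exhaust)
qed
end

definition A2bar :: "(vertex, arrow) quiver" where
  "A2bar = \<lparr>src = case_arrow V1 V2, tgt = case_arrow V2 V1\<rparr>"

definition A2bar_potential :: "(vertex, arrow, 'k::field) series" where
  "A2bar_potential = path_elt (V1, concat (replicate 3 [A1, B1]))"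

text \<open>In characteristic 3 the cyclic derivatives vanish, and the completed Jacobian algebra is the
  whole (infinite-dimensional) completed path algebra.\<close>

lemma cyclic_derivative_A2bar_A1:
  "cyclic_derivative A2bar A1 A2bar_potential =
     (\<lambda>p. if p = (V2, [B1,A1,B1,A1,B1]) then (3::'k::field) else 0)"
proof (rule ext, clarify)
  fix i as
  show "cyclic_derivative A2bar A1 A2bar_potential (i, as) = (if (i, as) = (V2, [B1,A1,B1,A1,B1]) then (3::'k::field) else 0)"
  proof (cases "length as = 5")
    case True
    then obtain a b c d e where "as = [a,b,c,d,e]" by (auto simp: numeral_eq_Suc length_Suc_conv)
    then show ?thesis
      by (cases i; cases a; cases b; cases c; cases d; cases e)
        (simp_all add: cyclic_derivative_def A2bar_potential_def A2bar_def path_elt_def numeral_eq_Suc atMost_Suc)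
  next
    case False
    then have "drop n as @ A1 # take n as \<noteq> concat (replicate 3 [A1,B1])" if "n \<le> length as" for n
      using that by (auto dest!: arg_cong[where f=length] simp: length_concat numeral_eq_Suc)
    with False show ?thesis by (auto simp: cyclic_derivative_def A2bar_potential_def path_elt_def)
  qed
qed

definition lvar :: "vertex \<Rightarrow> vertex laurent" where
  "lvar v = lmono (\<lambda>i. if i = v then 1 else 0)"

definition lvar_inv :: "vertex \<Rightarrow> vertex laurent" where
  "lvar_inv v = lmono (\<lambda>i. if i = v then - 1 else 0)"

inductive_set subring_generated :: "'r::ring_1 set \<Rightarrow> 'r set" for S where
  gen: "s \<in> S \<Longrightarrow> s \<in> subring_generated S"
| one: "1 \<in> subring_generated S"
| diff: "s \<in> subring_generated S \<Longrightarrow> t \<in> subring_generated S \<Longrightarrow> s - t \<in> subring_generated S"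
| mult: "s \<in> subring_generated S \<Longrightarrow> t \<in> subring_generated S \<Longrightarrow> s * t \<in> subring_generated S"

record 'r generalized_cluster_algebra =
  algebra_set :: "'r set"
  cluster_variables :: "'r set"
  initial_variables :: "'r set"

definition A2bar_cluster_variables :: "vertex laurent set" where
  "A2bar_cluster_variables = {lvar V1, lvar V2,
     2 * lvar V2 * lvar_inv V1, 2 * lvar V1 * lvar_inv V2, 6 * lvar_inv V1, 6 * lvar_inv V2}"

definition A2bar_cluster_algebra :: "vertex laurent generalized_cluster_algebra" where
  "A2bar_cluster_algebra = \<lparr>
     algebra_set = subring_generated A2bar_cluster_variables,
     cluster_variables = A2bar_cluster_variables,
     initial_variables = {lvar V1, lvar V2}\<rparr>"

definition indec_tau_rigid :: "(vertex, arrow, 'k::field) rep set" where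
  "indec_tau_rigid = {M. is_module A2bar A2bar_potential M \<and>
     indecomposable A2bar A2bar_potential M \<and> tau_rigid A2bar A2bar_potential M}"

definition indec_tau_rigid_iso ::
  "((vertex, arrow, 'k::field) rep \<times> (vertex, arrow, 'k) rep) set" where
  "indec_tau_rigid_iso =
     {(M, N). M \<in> indec_tau_rigid \<and> N \<in> indec_tau_rigid \<and> rep_iso A2bar M N}"

end

theory Submission
  imports Defs
begin

text \<open>
  Since \<open>3 \<noteq> 0\<close>, the Jacobian ideal consists of all series without terms of length below \<open>5\<close>, so \<open>\<Lambda>\<close> is
  the path algebra of the 2-cycle modulo the paths of length \<open>5\<close>, a self-injective Nakayama algebra. Its indecomposable
  modules are the uniserial modules \<open>uni i l\<close> with top at \<open>i\<close> and length \<open>l \<in> {1, \<dots>, 5}\<close>; those of length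
  \<open>5\<close> are the projectives \<open>P\<^sub>i\<close>. The submodules of \<open>uni i l\<close> form a chain with \<open>l + 1\<close> members of distinct
  dimension vectors, so every nonempty quiver Grassmannian is a point and the Euler characteristics add
  up to \<open>l + 1\<close>. For \<open>l < 5\<close> the minimal presentation is \<open>P\<^sub>k \<rightarrow> P\<^sub>i\<close>, where \<open>k\<close> is reached from \<open>i\<close> in
  \<open>l\<close> steps. The translate of \<open>uni i l\<close> is then uniserial of length \<open>l\<close> with top at the other vertex, and
  \<open>uni i l\<close> maps nontrivially to it unless \<open>l = 1\<close>. Hence the \<open>\<tau>\<close>-rigid ones are the two simple and the two
  projective modules, with values \<open>2 x\<^sub>k / x\<^sub>i\<close> and \<open>6 / x\<^sub>i\<close>.
\<close>

section \<open>Linear algebra\<close>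

text \<open>The factor 3 in both cyclic derivatives comes from the three occurrences of an arrow in
  the cycle: each leaves the same path of length 5. With 3 invertible, these paths themselves lie in
  the Jacobian ideal. The definitions choose the projectives and the translate by
  \<open>SOME\<close>, so the computations concern objects that are known only up to isomorphism.
  Each chosen projective is compared with the model \<open>uni i 5\<close> by inverse homomorphisms
  that respect coordinates, and the translate is accessible only through its bijection with
  functionals on Hom spaces. The proof never identifies the translate with a uniserial module. It is
  enough that it is zero for length 5, that it vanishes at the vertex \<open>i\<close> for length 1,
  and that for the other lengths it contains one suitable nonzero element at \<open>i\<close>. In
  the classification, an explicit retraction onto a longest uniserial submodule replaces the
  injectivity of the projectives. Idempotents serve both directions: those of \<open>uni i l\<close>
  are trivial, and so are those of an indecomposable module.\<close>

lemma subspace_vec_iff: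
  "VectorSpace.subspace class_ring U (module_vec TYPE('k::field) n) \<longleftrightarrow>
     U \<subseteq> carrier_vec n \<and> 0\<^sub>v n \<in> U \<and> (\<forall>u\<in>U. \<forall>v\<in>U. u + v \<in> U) \<and> (\<forall>c. \<forall>u\<in>U. c \<cdot>\<^sub>v u \<in> U)"
  unfolding VectorSpace.subspace_def submodule_def
  using vec_vs[of n, where 'a='k] vec_module[of n, where 'a='k]
  by (auto simp: module_vec_simps)

lemma mult_mat_vec_expand:
  fixes A :: "'k::field mat"
  assumes "A \<in> carrier_mat m n" "v \<in> carrier_vec n" "r < m"
  shows "(A *\<^sub>v v) $ r = (\<Sum>c<n. A $$ (r, c) * v $ c)"
  using assms by (auto simp: scalar_prod_def lessThan_atLeast0 intro!: sum.cong)

lemma mult_mat_unit_vec: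
  fixes A :: "'k::field mat"
  assumes "A \<in> carrier_mat m n" "c < n"
  shows "A *\<^sub>v unit_vec n c = col A c"
  using assms by (intro eq_vecI) (auto simp: mult_mat_vec_def)

lemma eq_mat_on_vecI:
  fixes A B :: "'k::field mat"
  assumes A: "A \<in> carrier_mat m n" and B: "B \<in> carrier_mat m n"
    and eq: "\<And>v. v \<in> carrier_vec n \<Longrightarrow> A *\<^sub>v v = B *\<^sub>v v"
  shows "A = B"
proof (rule eq_matI)
  fix i j assume ij: "i < dim_row B" "j < dim_col B"
  have "col A j = col B j"
    using eq[of "unit_vec n j"] mult_mat_unit_vec[OF A, of j] mult_mat_unit_vec[OF B, of j] ij B by simp
  then have "col A j $ i = col B j $ i" by simp
  then show "A $$ (i, j) = B $$ (i, j)" using A B ij by simp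
qed (use A B in auto)

text \<open>The images of the unit vectors are the columns. This turns abstract linear data, such as
  the coordinates of projectives and functionals on Hom spaces, into matrices.\<close>

lemma additive_homogeneous_mult_mat_vec:
  fixes f :: "'k::field vec \<Rightarrow> 'k vec"
  assumes closed: "\<And>v. v \<in> carrier_vec n \<Longrightarrow> f v \<in> carrier_vec m"
    and add: "\<And>v w. v \<in> carrier_vec n \<Longrightarrow> w \<in> carrier_vec n \<Longrightarrow> f (v + w) = f v + f w"
    and smult: "\<And>c v. v \<in> carrier_vec n \<Longrightarrow> f (c \<cdot>\<^sub>v v) = c \<cdot>\<^sub>v f v"
  obtains A where "A \<in> carrier_mat m n" "\<And>v. v \<in> carrier_vec n \<Longrightarrow> f v = A *\<^sub>v v"
proof
  define A where "A = mat m n (\<lambda>(r, c). f (unit_vec n c) $ r)"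
  show A: "A \<in> carrier_mat m n" by (simp add: A_def)
  fix v :: "'k vec" assume v: "v \<in> carrier_vec n"
  \<comment> \<open>Induction over the truncations of \<open>v\<close> to its first \<open>k\<close>
    coordinates replaces finite sums of vectors.\<close>
  define tr where "tr k = vec n (\<lambda>r. if r < k then v $ r else 0)" for k
  have tr [simp]: "tr k \<in> carrier_vec n" for k by (simp add: tr_def)
  have "f (tr k) = A *\<^sub>v tr k" if "k \<le> n" for k
    using that
  proof (induction k)
    case 0
    have "tr 0 = 0 \<cdot>\<^sub>v 0\<^sub>v n" by (auto simp: tr_def)
    then have "f (tr 0) = 0 \<cdot>\<^sub>v f (0\<^sub>v n)" using smult[of "0\<^sub>v n" 0] by simp
    also have "\<dots> = 0\<^sub>v m" using closed[of "0\<^sub>v n"] by auto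
    finally have "f (tr 0) = 0\<^sub>v m" .
    moreover have "tr 0 = 0\<^sub>v n" by (auto simp: tr_def)
    ultimately show ?case using A by auto
  next
    case (Suc k)
    have eq: "tr (Suc k) = tr k + v $ k \<cdot>\<^sub>v unit_vec n k"
      using Suc.prems by (intro eq_vecI) (auto simp: tr_def less_Suc_eq)
    have "f (unit_vec n k) = A *\<^sub>v unit_vec n k"
      using Suc.prems closed[of "unit_vec n k"] mult_mat_unit_vec[OF A, of k]
      by (auto simp: A_def)
    then show ?case
      using Suc A unfolding eq
      by (simp add: add smult mult_add_distrib_mat_vec[OF A] mult_mat_vec[OF A])
  qed
  moreover have "tr n = v" using v by (auto simp: tr_def)
  ultimately show "f v = A *\<^sub>v v" by (metis le_refl)
qed

text \<open>If \<open>n < m\<close>, padding both factors with zeros to square matrices keeps the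
  product equal to the identity but gives the first factor a zero column, against the
  multiplicativity of the determinant.\<close>

lemma right_inverse_dim_le:
  fixes A B :: "'k::field mat"
  assumes A: "A \<in> carrier_mat m n" and B: "B \<in> carrier_mat n m" and AB: "A * B = 1\<^sub>m m"
  shows "m \<le> n"
proof (rule ccontr)
  assume "\<not> m \<le> n"
  define A' where "A' = mat m m (\<lambda>(r, c). if c < n then A $$ (r, c) else 0)"
  define B' where "B' = mat m m (\<lambda>(r, c). if r < n then B $$ (r, c) else 0)"
  have "A' * B' = A * B"
  proof (rule eq_matI)
    fix i j assume "i < dim_row (A * B)" "j < dim_col (A * B)"
    then have ij: "i < m" "j < m" using A B by auto
    have "(A' * B') $$ (i, j) = (\<Sum>k<m. if k < n then A $$ (i, k) * B $$ (k, j) else 0)"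
      using ij by (auto simp: A'_def B'_def scalar_prod_def lessThan_atLeast0 intro!: sum.cong)
    also have "\<dots> = (\<Sum>k<n. A $$ (i, k) * B $$ (k, j))"
      using \<open>\<not> m \<le> n\<close> by (intro sum.mono_neutral_cong_right) auto
    also have "\<dots> = (A * B) $$ (i, j)"
      using ij A B by (auto simp: scalar_prod_def lessThan_atLeast0 intro!: sum.cong)
    finally show "(A' * B') $$ (i, j) = (A * B) $$ (i, j)" .
  qed (use A B in \<open>auto simp: A'_def B'_def\<close>)
  then have "det A' * det B' = 1"
    using AB det_mult[of A' m B'] by (simp add: A'_def B'_def)
  moreover have "col A' n = 0\<^sub>v m"
    using \<open>\<not> m \<le> n\<close> by (auto simp: A'_def)
  then have "det A' = 0"
    using \<open>\<not> m \<le> n\<close> laplace_expansion_column[of A' m n]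
    by (auto simp: A'_def intro!: sum.neutral)
  ultimately show False by simp
qed

text \<open>Preimages of the unit vectors are the columns of a right inverse.\<close>

lemma surj_mult_mat_vec_dim_le:
  fixes A :: "'k::field mat"
  assumes A: "A \<in> carrier_mat m n" and surj: "carrier_vec m \<subseteq> (*\<^sub>v) A ` carrier_vec n"
  shows "m \<le> n"
proof -
  have "\<exists>w\<in>carrier_vec n. A *\<^sub>v w = unit_vec m j" for j
    using subsetD[OF surj unit_vec_carrier[of m j]] by auto
  then obtain w where w: "\<And>j. w j \<in> carrier_vec n" "\<And>j. A *\<^sub>v w j = unit_vec m j" by metis
  define B where "B = mat n m (\<lambda>(r, c). w c $ r)"
  have B: "B \<in> carrier_mat n m" by (simp add: B_def)
  have "A * B = 1\<^sub>m m"
  proof (rule eq_matI)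
    fix i j assume ij: "i < dim_row (1\<^sub>m m)" "j < dim_col (1\<^sub>m m)"
    have "col B j = w j" using w(1)[of j] ij by (auto simp: B_def)
    then have "(A * B) $$ (i, j) = (A *\<^sub>v w j) $ i" using ij A B by simp
    then show "(A * B) $$ (i, j) = 1\<^sub>m m $$ (i, j)" using w(2)[of j] ij by auto
  qed (use A B in auto)
  then show ?thesis using right_inverse_dim_le[OF A B] by simp
qed

text \<open>The condition that a standard chart of \<open>quiver_grassmannian\<close> imposes at one
  vertex: restriction to the coordinates in \<open>I\<close> is a bijection from \<open>U\<close>
  onto all families of values.\<close>

definition chart :: "'k::field vec set \<Rightarrow> nat set \<Rightarrow> bool" where
  "chart U I \<longleftrightarrow> (\<forall>y :: nat \<Rightarrow> 'k. \<exists>!u. u \<in> U \<and> (\<forall>s\<in>I. u $ s = y s))"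

text \<open>If restriction to the coordinates in \<open>I\<close> is onto but kills \<open>u \<noteq> 0\<close>, then a coordinate \<open>s\<close>
  with \<open>u $ s \<noteq> 0\<close> can be added to \<open>I\<close>. So a maximal \<open>I\<close> works.\<close>

lemma subspace_chart:
  fixes U :: "'k::field vec set"
  assumes "VectorSpace.subspace class_ring U (module_vec TYPE('k) n)"
  obtains I where "I \<subseteq> {..<n}" "chart U I"
proof -
  have U: "U \<subseteq> carrier_vec n" "0\<^sub>v n \<in> U" "\<And>u v. u \<in> U \<Longrightarrow> v \<in> U \<Longrightarrow> u + v \<in> U"
    "\<And>c u. u \<in> U \<Longrightarrow> c \<cdot>\<^sub>v u \<in> U"
    using assms by (auto simp: subspace_vec_iff)
  define onto where "onto I \<longleftrightarrow> I \<subseteq> {..<n} \<and> (\<forall>y :: nat \<Rightarrow> 'k. \<exists>u\<in>U. \<forall>s\<in>I. u $ s = y s)" for I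
  have empty: "{} \<in> {I. onto I}" using U by (auto simp: onto_def)
  have "finite {I. onto I}"
    by (rule finite_subset[of _ "Pow {..<n}"]) (auto simp: onto_def)
  from finite_has_maximal2[OF this empty]
  obtain I where I: "onto I" and max: "\<And>J. onto J \<Longrightarrow> I \<subseteq> J \<Longrightarrow> I = J" by auto
  have inj: "u = 0\<^sub>v n" if u: "u \<in> U" "\<forall>s\<in>I. u $ s = 0" for u
  proof (rule ccontr)
    assume "u \<noteq> 0\<^sub>v n"
    then obtain s where s: "s < n" "u $ s \<noteq> 0" using u U(1) by (auto simp: vec_eq_iff)
    have "onto (insert s I)"
      unfolding onto_def
    proof safe
      fix y :: "nat \<Rightarrow> 'k"
      obtain v where v: "v \<in> U" "\<forall>t\<in>I. v $ t = y t" using I unfolding onto_def by blast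
      let ?w = "v + ((y s - v $ s) / u $ s) \<cdot>\<^sub>v u"
      have "u \<in> carrier_vec n" "v \<in> carrier_vec n" using u v U(1) by auto
      then have "?w $ t = y t" if "t \<in> insert s I" for t
        using that s v u I by (auto simp: onto_def subset_eq)
      moreover have "?w \<in> U" using u v U by auto
      ultimately show "\<exists>w\<in>U. \<forall>t\<in>insert s I. w $ t = y t" by blast
    qed (use s I in \<open>auto simp: onto_def\<close>)
    then have "s \<in> I" using max[of "insert s I"] by blast
    then show False using u s by auto
  qed
  have "\<exists>!u. u \<in> U \<and> (\<forall>s\<in>I. u $ s = y s)" for y :: "nat \<Rightarrow> 'k"
  proof -
    obtain u where u: "u \<in> U" "\<forall>s\<in>I. u $ s = y s" using I unfolding onto_def by blast
    have "v = u" if v: "v \<in> U" "\<forall>s\<in>I. v $ s = y s" for v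
    proof -
      have carr: "u \<in> carrier_vec n" "v \<in> carrier_vec n" using u v U(1) by auto
      have "v + (-1) \<cdot>\<^sub>v u = 0\<^sub>v n"
        using u v U carr I by (intro inj) (auto simp: onto_def subset_eq)
      then have "(v + (-1) \<cdot>\<^sub>v u) $ s = 0" if "s < n" for s using that by simp
      then show "v = u" using carr by (auto intro!: eq_vecI)
    qed
    then show ?thesis using u by blast
  qed
  then show thesis using that I by (auto simp: onto_def chart_def)
qed

lemma mult_mat_vec_in_subspace:
  fixes X :: "'k::field mat"
  assumes U: "VectorSpace.subspace class_ring U (module_vec TYPE('k) n)"
    and X: "X \<in> carrier_mat n k" and cols: "\<And>c. c < k \<Longrightarrow> col X c \<in> U" and y: "y \<in> carrier_vec k"
  shows "X *\<^sub>v y \<in> U"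
proof -
  have U: "U \<subseteq> carrier_vec n" "0\<^sub>v n \<in> U" "\<And>u v. u \<in> U \<Longrightarrow> v \<in> U \<Longrightarrow> u + v \<in> U"
    "\<And>c u. u \<in> U \<Longrightarrow> c \<cdot>\<^sub>v u \<in> U"
    using U by (auto simp: subspace_vec_iff)
  have "vec n (\<lambda>r. \<Sum>c<m. X $$ (r, c) * y $ c) \<in> U" if "m \<le> k" for m
    using that
  proof (induction m)
    case 0
    then show ?case using U(2) by (simp add: zero_vec_def)
  next
    case (Suc m)
    have "vec n (\<lambda>r. \<Sum>c<Suc m. X $$ (r, c) * y $ c) = vec n (\<lambda>r. \<Sum>c<m. X $$ (r, c) * y $ c) + y $ m \<cdot>\<^sub>v col X m"
      using Suc.prems X by (auto simp: algebra_simps)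
    then show ?case using Suc cols U by simp
  qed
  moreover have "X *\<^sub>v y = vec n (\<lambda>r. \<Sum>c<k. X $$ (r, c) * y $ c)"
    using X y by (intro eq_vecI) (auto simp: mult_mat_vec_expand[OF X y] simp del: index_mult_mat_vec)
  ultimately show ?thesis by simp
qed

text \<open>The columns of \<open>X\<close> are the basis of \<open>U\<close> that restricts to the
  standard basis on the coordinates in \<open>I\<close>, and \<open>R\<close> is the restriction to
  these coordinates. The pair serves for dimensions, for images of idempotents and for
  annihilators.\<close>

lemma chart_basis:
  fixes U :: "'k::field vec set"
  assumes U: "VectorSpace.subspace class_ring U (module_vec TYPE('k) n)"
    and I: "I \<subseteq> {..<n}" "chart U I"
  obtains X R where "X \<in> carrier_mat n (card I)" "R \<in> carrier_mat (card I) n" "R * X = 1\<^sub>m (card I)"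
    "(*\<^sub>v) X ` carrier_vec (card I) = U" "\<And>u. u \<in> U \<Longrightarrow> X *\<^sub>v (R *\<^sub>v u) = u"
proof -
  have Uc: "U \<subseteq> carrier_vec n" using U by (auto simp: subspace_vec_iff)
  let ?k = "card I"
  have "finite I" using I finite_subset by blast
  then obtain e where e: "bij_betw e {..<?k} I"
    using ex_bij_betw_nat_finite[of I] lessThan_atLeast0 by auto
  have e_lt: "e c < n" if "c < ?k" for c using that e I by (auto simp: bij_betw_def)
  define w where "w c = (THE u. u \<in> U \<and> (\<forall>s\<in>I. u $ s = (if s = e c then 1 else 0)))" for c
  have w: "w c \<in> U" "\<And>s. s \<in> I \<Longrightarrow> w c $ s = (if s = e c then 1 else 0)" for c
    using theI'[of "\<lambda>u. u \<in> U \<and> (\<forall>s\<in>I. u $ s = (if s = e c then 1 else 0))"] I(2)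
    unfolding chart_def w_def by auto
  define X where "X = mat n ?k (\<lambda>(r, c). w c $ r)"
  define R :: "'k mat" where "R = mat ?k n (\<lambda>(r, c). if c = e r then 1 else 0)"
  have X: "X \<in> carrier_mat n ?k" and R: "R \<in> carrier_mat ?k n" by (auto simp: X_def R_def)
  have colX: "col X c = w c" if "c < ?k" for c
    using w(1)[of c] Uc that by (intro eq_vecI) (auto simp: X_def)
  have R_app: "(R *\<^sub>v u) $ r = u $ e r" if "r < ?k" "u \<in> carrier_vec n" for r u
    using that e_lt[of r] unfolding mult_mat_vec_expand[OF R that(2,1)]
    by (simp add: R_def if_distrib[of "\<lambda>x. x * _"] cong: if_cong)
  have RX: "R * X = 1\<^sub>m ?k"
  proof (rule eq_matI)
    fix i j assume ij: "i < dim_row (1\<^sub>m ?k)" "j < dim_col (1\<^sub>m ?k)"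
    then have "(R * X) $$ (i, j) = (R *\<^sub>v w j) $ i" using X R colX by simp
    also have "\<dots> = w j $ e i" using ij w(1)[of j] Uc by (intro R_app) auto
    also have "\<dots> = 1\<^sub>m ?k $$ (i, j)" using ij w(2)[of "e i" j] bij_betwE[OF e] inj_on_eq_iff[OF bij_betw_imp_inj_on[OF e], of i j] by simp
    finally show "(R * X) $$ (i, j) = 1\<^sub>m ?k $$ (i, j)" .
  qed (use X R in auto)
  have into: "X *\<^sub>v y \<in> U" if "y \<in> carrier_vec ?k" for y
    using mult_mat_vec_in_subspace[OF U X _ that] colX w by auto
  \<comment> \<open>Both sides lie in \<open>U\<close>, so by uniqueness in \<open>chart\<close> it
    suffices to compare the coordinates in \<open>I\<close>.\<close>
  have XR: "X *\<^sub>v (R *\<^sub>v u) = u" if u: "u \<in> U" for u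
  proof -
    have uc: "u \<in> carrier_vec n" using u Uc by auto
    have "(X *\<^sub>v (R *\<^sub>v u)) $ s = u $ s" if "s \<in> I" for s
    proof -
      have "s \<in> e ` {..<?k}" using that bij_betw_imp_surj_on[OF e] by simp
      then obtain r where r: "r < ?k" "s = e r" by auto
      have "(X *\<^sub>v (R *\<^sub>v u)) $ s = (R *\<^sub>v (X *\<^sub>v (R *\<^sub>v u))) $ r"
        using r X R uc R_app[OF r(1), of "X *\<^sub>v (R *\<^sub>v u)"] by simp
      also have "R *\<^sub>v (X *\<^sub>v (R *\<^sub>v u)) = R *\<^sub>v u"
        using R uc by (simp add: assoc_mult_mat_vec[OF R X, symmetric] RX)
      finally show ?thesis using r R_app uc by simp
    qed
    moreover have "X *\<^sub>v (R *\<^sub>v u) \<in> U" using R uc by (intro into) simp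
    moreover have "\<exists>!v. v \<in> U \<and> (\<forall>s\<in>I. v $ s = u $ s)" using I(2) by (simp add: chart_def)
    ultimately show ?thesis using u by blast
  qed
  have "(*\<^sub>v) X ` carrier_vec ?k = U"
  proof (intro equalityI subsetI)
    fix u assume u: "u \<in> U"
    then have "R *\<^sub>v u \<in> carrier_vec ?k" using R Uc by auto
    then show "u \<in> (*\<^sub>v) X ` carrier_vec ?k" using XR[OF u] by (metis image_eqI)
  qed (use into in auto)
  then show thesis using that X R RX XR by blast
qed

text \<open>With a left inverse, \<open>X\<close> is a linear isomorphism from the coordinate space
  onto its image, so the dimension of the image is the number of columns.\<close>

lemma dim_image_left_invertible:
  fixes X :: "'k::field mat"
  assumes U: "VectorSpace.subspace class_ring U (module_vec TYPE('k) n)"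
    and X: "X \<in> carrier_mat n k" and R: "R \<in> carrier_mat k n" and RX: "R * X = 1\<^sub>m k"
    and im: "(*\<^sub>v) X ` carrier_vec k = U"
  shows "vectorspace.dim class_ring ((module_vec TYPE('k) n)\<lparr>carrier := U\<rparr>) = k"
proof -
  interpret V: vec_space "TYPE('k)" k .
  interpret W: vec_space "TYPE('k)" n .
  have vsU: "vectorspace class_ring ((module_vec TYPE('k) n)\<lparr>carrier := U\<rparr>)"
    using W.subspace_is_vs[OF U] by simp
  have "linear_map class_ring (module_vec TYPE('k) k) ((module_vec TYPE('k) n)\<lparr>carrier := U\<rparr>) ((*\<^sub>v) X)"
    unfolding linear_map_def mod_hom_def mod_hom_axioms_def
    using vsU V.vectorspace_axioms vec_module[of k, where 'a='k] vectorspace.axioms(1)[OF vsU] im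
    by (auto simp: LinearCombinations.module_hom_def module_vec_simps class_ring_simps
        mult_add_distrib_mat_vec[OF X] mult_mat_vec[OF X])
  moreover have "inj_on ((*\<^sub>v) X) (carrier_vec k)"
  proof (rule inj_on_inverseI[of _ "(*\<^sub>v) R"])
    fix y :: "'k vec" assume "y \<in> carrier_vec k"
    then show "R *\<^sub>v (X *\<^sub>v y) = y" by (simp add: assoc_mult_mat_vec[OF R X, symmetric] RX)
  qed
  ultimately show ?thesis
    using linear_map.dim_eq[OF _ V.fin_dim, of "(module_vec TYPE('k) n)\<lparr>carrier := U\<rparr>"] im V.dim_is_n
    by (auto simp: module_vec_simps)
qed

section \<open>Euler characteristics of points\<close>

lemma peval_single_0 [simp]: "peval (Poly_Mapping.single 0 c) x = c"
  by (cases "c = 0") (simp_all add: peval_def)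

lemma peval_1 [simp]: "peval 1 x = (1 :: 'k::comm_ring_1)"
  using peval_single_0[of 1 x] by simp

lemma alternating_sum: "(\<Sum>i<n. (- 1) ^ i) = (if even n then 0 else (1::int))"
  by (induction n) auto

text \<open>Deleting any entry of a constant list gives the same shorter list, so only the sum of
  the signs remains.\<close>

lemma cech_diff_replicate:
  "cech_diff z (replicate (Suc n) w) = (if even n then z (replicate n w) else 0)"
proof -
  have "take i (replicate (Suc n) w) @ drop (Suc i) (replicate (Suc n) w) = replicate n w" if "i < Suc n" for i
    using that by (simp add: replicate_add[symmetric] min_def del: replicate_Suc)
  then have "cech_diff z (replicate (Suc n) w) = (\<Sum>i<Suc n. (- 1) ^ i * z (replicate n w))"
    unfolding cech_diff_def by (intro sum.cong) (auto simp del: replicate_Suc)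
  also have "\<dots> = (\<Sum>i<Suc n. (- 1) ^ i) * z (replicate n w)" by (simp only: sum_distrib_right)
  finally show ?thesis by (simp only: alternating_sum) simp
qed

lemma fibre_power_singleton:
  assumes "total_space A V = {w}"
  shows "fibre_power A V p = {replicate (Suc p) w}"
proof -
  have "vs = replicate (Suc p) w" if "length vs = Suc p" "set vs \<subseteq> {w}" for vs
    using that replicate_eqI[of vs "Suc p" w] by auto
  then show ?thesis using assms by (auto simp: fibre_power_def)
qed

lemma replicate_in_fibre_power: "v \<in> total_space A V \<Longrightarrow> replicate (Suc p) v \<in> fibre_power A V p"
  by (auto simp: fibre_power_def)

lemma cochain_singleton:
  assumes "total_space A V = {w}"
  shows "cochain l A V p z"
  unfolding cochain_def fibre_power_singleton[OF assms] by (auto intro!: exI[of _ 1])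

lemma one_point_cover:
  fixes A :: "('x, 'c, 'd, 'k::field) atlas"
  assumes "points A = {x}"
  obtains W where "etale_cover A W" "total_space A W = {(0, x, \<lambda>_. 0)}"
proof -
  have "x \<in> points A" using assms by simp
  then obtain c where c: "c \<in> charts A" "x \<in> dom A c" by (auto simp: points_def)
  moreover have "dom A c \<subseteq> points A" using c(1) by (auto simp: points_def)
  ultimately have sub: "dom A c = {x}" using assms by auto
  \<comment> \<open>A piece without fibre coordinates is the chart itself; its Jacobian determinant
    is that of the empty matrix, which is 1.\<close>
  define W :: "('c, 'd, 'k) piece list" where "W = [(c, 0, \<lambda>_. 0)]"
  have "total_space A W = {(0, x, \<lambda>_. 0)}"
    using sub by (auto simp: total_space_def W_def)
  moreover have "etale_cover A W"
    using c assms \<open>total_space A W = _\<close> by (auto simp: etale_cover_def W_def det_dim_zero)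
  ultimately show thesis using that by blast
qed

lemma one_point_refinement:
  fixes A :: "('x, 'c, 'd, 'k::field) atlas"
  assumes pt: "points A = {x}" and V: "etale_cover A V"
  obtains W v where "etale_cover A W" "refinement A W V (\<lambda>_. v)" "total_space A W = {(0, x, \<lambda>_. 0)}"
    "v \<in> total_space A V"
proof -
  obtain k t where v: "(k, x, t) \<in> total_space A V"
    using V pt by (auto simp: etale_cover_def)
  obtain W where W: "etale_cover A W" "total_space A W = {(0, x, \<lambda>_. 0)}"
    using one_point_cover[OF pt] .
  \<comment> \<open>The map to the chosen point over \<open>x\<close> is constant, so its fibre
    coordinates are constant polynomials.\<close>
  have "refinement A W V (\<lambda>_. (k, x, t))"
    unfolding refinement_def W(2) using v
    by (auto intro!: exI[of _ "\<lambda>_. k"] exI[of _ "\<lambda>_ j. Poly_Mapping.single 0 (t j)"])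
  then show thesis using that W v by blast
qed

text \<open>The differential into an even positive degree is the identity, so everything there is a
  coboundary. The differential into an odd degree is 0, which is why vanishing is demanded in that
  case.\<close>

lemma one_point_coboundary:
  assumes W: "total_space A W = {w}" and p: "p > 0"
    and odd: "odd p \<Longrightarrow> z (replicate (Suc p) w) mod int l = 0"
  shows "coboundary l A W p z"
proof -
  obtain q where q: "p = Suc q" using p by (cases p) auto
  have "z (replicate (Suc p) w) mod int l = cech_diff (\<lambda>_. if odd p then 0 else z (replicate (Suc p) w)) (replicate (Suc p) w) mod int l"
    unfolding cech_diff_replicate using odd by auto
  then show ?thesis
    unfolding coboundary_def q fibre_power_singleton[OF W] using cochain_singleton[OF W, of l q]
    by (simp del: replicate_Suc) blast
qed

text \<open>The differential that leaves an odd degree is the identity on constant lists, so a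
  cocycle vanishes on them.\<close>

lemma one_point_cocycle_odd:
  assumes "cocycle l A V p z" "v \<in> total_space A V" "odd p"
  shows "z (replicate (Suc p) v) mod int l = 0"
proof -
  have "cech_diff z (replicate (Suc (Suc p)) v) mod int l = 0"
    using assms replicate_in_fibre_power[OF assms(2), of "Suc p"] by (auto simp: cocycle_def)
  then show ?thesis using assms(3) by (simp only: cech_diff_replicate) simp
qed

text \<open>Every covering of a point is refined by a section, over which the Cech complex is
  \<open>\<int>/l\<close> in each degree, with differentials alternately \<open>0\<close> and \<open>1\<close>.\<close>

lemma etale_betti_one_point:
  fixes A :: "('x, 'c, 'd, 'k::field) atlas"
  assumes pt: "points A = {x}" and l: "l > 1"
  shows "etale_betti l A p = (if p = 0 then 1 else 0)"
proof -
  let ?S = "{n. \<exists>V z. etale_cover A V \<and> (\<forall>i<n. cocycle l A V p (z i)) \<and>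
     (\<forall>\<epsilon> :: nat \<Rightarrow> int. (\<exists>i<n. \<not> int l dvd \<epsilon> i) \<longrightarrow>
        (\<forall>W \<rho>. etale_cover A W \<and> refinement A W V \<rho> \<longrightarrow>
           \<not> coboundary l A W p (\<lambda>ws. \<Sum>i<n. \<epsilon> i * z i (map \<rho> ws))))}"
  obtain W0 where W0: "etale_cover A W0" "total_space A W0 = {(0, x, \<lambda>_. 0)}"
    using one_point_cover[OF pt] .
  have l1: "\<not> int l dvd 1" using l by simp
  have zero: "0 \<in> ?S" using W0 by auto
  have "?S = (if p = 0 then {0, 1} else {0})"
  proof (cases "p = 0")
    case False
    have "n = 0" if n: "n \<in> ?S" for n
    proof (rule ccontr)
      assume "n \<noteq> 0"
      obtain V z where V: "etale_cover A V" and z: "\<forall>i<n. cocycle l A V p (z i)"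
        and indep: "\<And>\<epsilon> :: nat \<Rightarrow> int. \<And>W \<rho>. \<exists>i<n. \<not> int l dvd \<epsilon> i \<Longrightarrow> etale_cover A W \<Longrightarrow> refinement A W V \<rho> \<Longrightarrow>
           \<not> coboundary l A W p (\<lambda>ws. \<Sum>i<n. \<epsilon> i * z i (map \<rho> ws))"
        using n by blast
      obtain W v where W: "etale_cover A W" "refinement A W V (\<lambda>_. v)"
        "total_space A W = {(0, x, \<lambda>_. 0)}" "v \<in> total_space A V"
        using one_point_refinement[OF pt V] .
      \<comment> \<open>Over the section every cocycle of positive degree becomes a coboundary, so
        already the sum of the given classes dies there.\<close>
      have "coboundary l A W p (\<lambda>ws. \<Sum>i<n. 1 * z i (map (\<lambda>_. v) ws))"
      proof (rule one_point_coboundary[OF W(3)])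
        assume "odd p"
        have "int l dvd z i (replicate (Suc p) v)" if "i < n" for i
          using one_point_cocycle_odd[OF _ W(4) \<open>odd p\<close>] z that by (auto simp del: replicate_Suc)
        then have "int l dvd (\<Sum>i<n. 1 * z i (replicate (Suc p) v))"
          by (intro dvd_sum) (auto simp del: replicate_Suc)
        then show "(\<Sum>i<n. 1 * z i (map (\<lambda>_. v) (replicate (Suc p) (0, x, \<lambda>_. 0)))) mod int l = 0"
          by (simp only: map_replicate dvd_eq_mod_eq_0)
      qed (use False in simp)
      moreover have "\<exists>i<n. \<not> int l dvd 1" using l1 \<open>n \<noteq> 0\<close> by (intro exI[of _ 0]) auto
      ultimately show False using indep[of "\<lambda>_. 1", OF _ W(1,2)] by blast
    qed
    then show ?thesis using zero False by auto
  next
    case True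
    have le1: "n \<le> 1" if n: "n \<in> ?S" for n
    proof (rule ccontr)
      assume n2: "\<not> n \<le> 1"
      obtain V z where V: "etale_cover A V" and z: "\<forall>i<n. cocycle l A V p (z i)"
        and indep: "\<And>\<epsilon> :: nat \<Rightarrow> int. \<And>W \<rho>. \<exists>i<n. \<not> int l dvd \<epsilon> i \<Longrightarrow> etale_cover A W \<Longrightarrow> refinement A W V \<rho> \<Longrightarrow>
           \<not> coboundary l A W p (\<lambda>ws. \<Sum>i<n. \<epsilon> i * z i (map \<rho> ws))"
        using n by blast
      obtain W v where W: "etale_cover A W" "refinement A W V (\<lambda>_. v)"
        "total_space A W = {(0, x, \<lambda>_. 0)}" "v \<in> total_space A V"
        using one_point_refinement[OF pt V] .
      define c where "c i = z i [v]" for i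
      \<comment> \<open>A linear relation modulo \<open>l\<close> between the first two classes: if
        \<open>c 0\<close> is divisible by \<open>l\<close>, the first class is zero; otherwise the
        coefficients \<open>- c 1\<close> and \<open>c 0\<close> cancel.\<close>
      define \<epsilon> :: "nat \<Rightarrow> int" where "\<epsilon> = (if int l dvd c 0 then \<lambda>i. if i = 0 then 1 else 0
        else (\<lambda>i. if i = 0 then - c 1 else if i = 1 then c 0 else (0::int)))"
      have "(\<Sum>i<n. \<epsilon> i * c i) = (\<Sum>i\<in>{0, 1}. \<epsilon> i * c i)"
        using n2 by (intro sum.mono_neutral_right) (auto simp: \<epsilon>_def)
      then have "(\<Sum>i<n. \<epsilon> i * c i) mod int l = 0" by (auto simp: \<epsilon>_def)
      then have "coboundary l A W p (\<lambda>ws. \<Sum>i<n. \<epsilon> i * z i (map (\<lambda>_. v) ws))"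
        unfolding coboundary_def True fibre_power_singleton[OF W(3)] by (simp add: c_def)
      moreover have "\<exists>i<n. \<not> int l dvd \<epsilon> i"
        using l1 n2 by (intro exI[of _ "if int l dvd c 0 then 0 else 1"]) (auto simp: \<epsilon>_def)
      ultimately show False using indep[OF _ W(1,2)] by blast
    qed
    \<comment> \<open>The constant function 1 survives on every covering, because a degree 0
      coboundary is zero everywhere and a covering of a point has a point.\<close>
    have one: "1 \<in> ?S"
    proof -
      have "\<not> coboundary l A W 0 (\<lambda>ws. \<Sum>i<1. \<epsilon> i * 1)"
        if "\<exists>i<1. \<not> int l dvd \<epsilon> i" and W: "etale_cover A W" for \<epsilon> :: "nat \<Rightarrow> int" and W
      proof -
        obtain k t where "(k, x, t) \<in> total_space A W"
          using W pt by (auto simp: etale_cover_def)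
        then have "replicate (Suc 0) (k, x, t) \<in> fibre_power A W 0" by (rule replicate_in_fibre_power)
        then show ?thesis using that by (auto simp: coboundary_def dvd_eq_mod_eq_0)
      qed
      moreover have "cocycle l A W0 0 (\<lambda>_. 1)"
        using cech_diff_replicate[of "\<lambda>_. 1" "Suc 0" "(0::nat, x, \<lambda>_::nat. 0::'k)"]
        by (simp add: cocycle_def fibre_power_singleton[OF W0(2)] cochain_singleton[OF W0(2)] del: replicate_Suc)
      ultimately show ?thesis
        using W0(1) True by (intro CollectI exI[of _ W0] exI[of _ "\<lambda>_ _. 1"]) auto
    qed
    have "?S = {0, 1}"
    proof (intro equalityI subsetI)
      fix n assume "n \<in> ?S"
      from le1[OF this] show "n \<in> {0, 1}" by (cases n) auto
    next
      fix n assume "n \<in> {0, 1 :: nat}"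
      then consider "n = 0" | "n = 1" by blast
      then show "n \<in> ?S" by cases (use zero one in \<open>simp_all only:\<close>)
    qed
    then show ?thesis using True by simp
  qed
  then show ?thesis unfolding etale_betti_def by simp
qed

text \<open>Since 2 and 3 differ by 1, they cannot both vanish in a field. Thus the
  \<open>LEAST\<close> in \<open>euler_char\<close> is a genuine prime.\<close>

lemma prime_invertible_exists: "\<exists>l. prime l \<and> (of_nat l :: 'k::field) \<noteq> 0"
proof (cases "(of_nat 2 :: 'k) = 0")
  case True
  have "(of_nat (Suc 2) :: 'k) \<noteq> 0" unfolding of_nat_Suc True by simp
  moreover have "prime (Suc 2)" by simp
  ultimately show ?thesis by blast
qed (auto intro!: exI[of _ 2])

lemma euler_char_one_point:
  fixes A :: "('x, 'c, 'd, 'k::field) atlas"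
  assumes pt: "points A = {x}"
  shows "euler_char A = 1"
proof -
  let ?l = "LEAST l. prime l \<and> (of_nat l :: 'k) \<noteq> 0"
  have "?l > 1" using LeastI_ex[OF prime_invertible_exists[where 'k='k]] prime_gt_1_nat by blast
  note b = etale_betti_one_point[OF pt this]
  have "euler_char A = Sum_any (\<lambda>p::nat. (- 1) ^ p * int (if p = 0 then 1 else 0))"
    by (simp add: euler_char_def Let_def b)
  also have "\<dots> = (\<Sum>p\<in>{0}. (- 1) ^ p * int (if p = 0 then 1 else 0))"
    by (rule Sum_any.expand_superset) auto
  finally show ?thesis by simp
qed

lemma total_space_empty:
  assumes "points A = {}" "etale_cover A V"
  shows "total_space A V = {}"
  using assms by (force simp: etale_cover_def total_space_def points_def split: prod.splits)

text \<open>All fibre powers are empty, so every cochain is a coboundary on the covering itself and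
  no class is nonzero in the limit.\<close>

lemma euler_char_empty:
  fixes A :: "('x, 'c, 'd, 'k::field) atlas"
  assumes pt: "points A = {}"
  shows "euler_char A = 0"
proof -
  let ?l = "LEAST l. prime l \<and> (of_nat l :: 'k) \<noteq> 0"
  have "?l > 1" using LeastI_ex[OF prime_invertible_exists[where 'k='k]] prime_gt_1_nat by blast
  then have l1: "\<not> int ?l dvd 1" by simp
  have fp: "fibre_power A V p = {}" if "etale_cover A V" for V p
    using total_space_empty[OF pt that] by (auto simp: fibre_power_def)
  have cb: "coboundary l A V p z" if "etale_cover A V" for V l p z
    using that by (auto simp: coboundary_def cochain_def fp split: nat.splits)
  have ref: "refinement A V V (\<lambda>v. v)" if "etale_cover A V" for V
    using total_space_empty[OF pt that] by (simp add: refinement_def)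
  have "etale_betti ?l A p = 0" for p
  proof -
    \<comment> \<open>The empty list is a covering, so 0 belongs to the set whose maximum is taken;
      the maximum is over \<open>{0}\<close> and not over the empty set.\<close>
    have ec: "etale_cover A []" using pt by (auto simp: etale_cover_def total_space_def)
    have "{n. \<exists>V z. etale_cover A V \<and> (\<forall>i<n. cocycle ?l A V p (z i)) \<and>
     (\<forall>\<epsilon> :: nat \<Rightarrow> int. (\<exists>i<n. \<not> int ?l dvd \<epsilon> i) \<longrightarrow>
        (\<forall>W \<rho>. etale_cover A W \<and> refinement A W V \<rho> \<longrightarrow>
           \<not> coboundary ?l A W p (\<lambda>ws. \<Sum>i<n. \<epsilon> i * z i (map \<rho> ws))))} = {0}" (is "?S = _")
    proof (intro Set.set_eqI iffI)
      fix n assume "n \<in> ?S"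
      then obtain V z where V: "etale_cover A V" and indep: "\<And>\<epsilon> :: nat \<Rightarrow> int. \<And>W \<rho>. \<exists>i<n. \<not> int ?l dvd \<epsilon> i \<Longrightarrow> etale_cover A W \<Longrightarrow> refinement A W V \<rho> \<Longrightarrow>
           \<not> coboundary ?l A W p (\<lambda>ws. \<Sum>i<n. \<epsilon> i * z i (map \<rho> ws))"
        by blast
      show "n \<in> {0}"
      proof (rule ccontr)
        assume "n \<notin> {0}"
        then have "\<exists>i<n. \<not> int ?l dvd 1" using l1 by (intro exI[of _ 0]) auto
        then show False using indep[of "\<lambda>_. 1" V "\<lambda>v. v"] V ref[OF V] cb[OF V] by blast
      qed
    qed (use ec in auto)
    then show ?thesis unfolding etale_betti_def by simp
  qed
  then show ?thesis by (simp add: euler_char_def Let_def)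
qed

section \<open>The completed Jacobian algebra\<close>

primrec oth :: "vertex \<Rightarrow> vertex" where
  "oth V1 = V2"
| "oth V2 = V1"

primrec arr :: "vertex \<Rightarrow> arrow" where
  "arr V1 = A1"
| "arr V2 = B1"

definition vtx :: "vertex \<Rightarrow> nat \<Rightarrow> vertex" where
  "vtx i n = (if even n then i else oth i)"

text \<open>Exactly one arrow leaves each vertex, so \<open>alt i n\<close> is the only path of
  length \<open>n\<close> that starts at \<open>i\<close>, and \<open>vtx i n\<close> is its end. A
  series is therefore determined by its coefficients on these paths.\<close>

primrec alt :: "vertex \<Rightarrow> nat \<Rightarrow> arrow list" where
  "alt i 0 = []"
| "alt i (Suc n) = arr i # alt (oth i) n"

lemma oth_oth [simp]: "oth (oth i) = i"
  by (cases i) auto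

lemma oth_neq [simp]: "oth i \<noteq> i" "i \<noteq> oth i"
  by (cases i; simp)+

lemma oth_eq_iff [simp]: "oth i = oth j \<longleftrightarrow> i = j"
  by (cases i; cases j) auto

lemma neq_oth: "j \<noteq> i \<Longrightarrow> j = oth i"
  by (cases i; cases j) auto

lemma vertex_cases_oth [case_names same other]: "(j = i \<Longrightarrow> P) \<Longrightarrow> (j = oth i \<Longrightarrow> P) \<Longrightarrow> P"
  using neq_oth by blast

lemma src_arr [simp]: "src A2bar (arr i) = i" and tgt_arr [simp]: "tgt A2bar (arr i) = oth i"
  by (cases i; simp add: A2bar_def)+

lemma arrow_cases_arr [case_names arr]: "(\<And>i. a = arr i \<Longrightarrow> P) \<Longrightarrow> P"
  by (cases a) (metis arr.simps)+

lemma all_arrow_iff: "(\<forall>a. P a) \<longleftrightarrow> (\<forall>i. P (arr i))"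
  by (metis arrow_cases_arr)

lemma vtx_0 [simp]: "vtx i 0 = i" and vtx_Suc [simp]: "vtx i (Suc n) = oth (vtx i n)"
  and vtx_oth [simp]: "vtx (oth i) n = oth (vtx i n)" and vtx_vtx: "vtx (vtx i m) n = vtx i (m + n)"
  by (auto simp: vtx_def)

lemma vtx_5 [simp]: "vtx i 5 = oth i"
  by (simp add: vtx_def)

lemma length_alt [simp]: "length (alt i n) = n"
  by (induction n arbitrary: i) auto

lemma alt_add: "alt i (m + n) = alt i m @ alt (vtx i m) n"
  by (induction m arbitrary: i) auto

lemma take_alt [simp]: "m \<le> n \<Longrightarrow> take m (alt i n) = alt i m"
  using alt_add[of i m "n - m"] by simp

lemma drop_alt [simp]: "m \<le> n \<Longrightarrow> drop m (alt i n) = alt (vtx i m) (n - m)"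
  using alt_add[of i m "n - m"] by simp

lemma alt_eq_iff [simp]: "alt i m = alt i n \<longleftrightarrow> m = n"
  by (metis length_alt)

lemma is_path_A2bar: "is_path A2bar (i, as) \<longleftrightarrow> as = alt i (length as)"
proof (induction as arbitrary: i)
  case (Cons a as)
  have "src A2bar a = i \<longleftrightarrow> a = arr i" by (cases a rule: arrow_cases_arr) (auto dest: arg_cong[of _ _ "src A2bar"])
  then show ?case using Cons.IH[of "oth i"] by (cases "a = arr i") simp_all
qed simp

lemma is_path_alt [simp]: "is_path A2bar (i, alt i n)"
  by (simp add: is_path_A2bar)

lemma path_end_alt [simp]: "path_end A2bar (i, alt i n) = vtx i n"
  by (induction n arbitrary: i) auto

section \<open>Series, cyclic derivatives and the Jacobian ideal\<close>

abbreviation (input) "PA \<equiv> path_algebra A2bar"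
abbreviation (input) "pot \<equiv> A2bar_potential"

lemma carrier_PA: "f \<in> carrier PA \<longleftrightarrow> (\<forall>i as. as \<noteq> alt i (length as) \<longrightarrow> f (i, as) = 0)"
  by (auto simp: path_algebra_def is_path_A2bar)

lemma PA_ext:
  assumes "f \<in> carrier PA" "g \<in> carrier PA" "\<And>i n. f (i, alt i n) = g (i, alt i n)"
  shows "f = g"
proof (rule ext, clarify)
  fix i as
  show "f (i, as) = g (i, as)"
    using assms carrier_PA[of f] carrier_PA[of g] by (cases "as = alt i (length as)") metis+
qed

lemma mult_PA:
  "(f \<otimes>\<^bsub>PA\<^esub> g) (i, alt i n) = (\<Sum>m\<le>n. f (i, alt i m) * g (vtx i m, alt (vtx i m) (n - m)))"
  by (auto simp: path_algebra_def intro!: sum.cong)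

lemma add_PA: "(f \<oplus>\<^bsub>PA\<^esub> g) p = f p + g p" and zero_PA: "\<zero>\<^bsub>PA\<^esub> p = 0"
  by (simp_all add: path_algebra_def)

lemma a_inv_PA:
  fixes f :: "(vertex, arrow, 'k::field) series"
  assumes f: "f \<in> carrier PA"
  shows "\<ominus>\<^bsub>PA\<^esub> f = (\<lambda>p. - f p)"
proof -
  interpret ring "PA :: (vertex, arrow, 'k) series ring" by (rule ring_path_algebra)
  show ?thesis
    using f by (intro minus_equality) (auto simp: path_algebra_def)
qed

text \<open>Each arrow occurs three times in the cycle, and removing any occurrence leaves, after
  rotation, the same path of length 5. The three equal terms add up to the coefficient 3.\<close>

lemma cyclic_derivative_A2bar:
  "cyclic_derivative A2bar (arr i) pot = (\<lambda>p. if p = (oth i, alt (oth i) 5) then (3::'k::field) else 0)"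
proof (cases i)
  case V1
  then show ?thesis using cyclic_derivative_A2bar_A1[where 'k='k] by (simp add: numeral_eq_Suc)
next
  case V2
  have "cyclic_derivative A2bar B1 pot (j, as) = (if (j, as) = (V1, [A1, B1, A1, B1, A1]) then (3::'k) else 0)" for j as
  \<comment> \<open>Removing one arrow from the potential leaves five arrows. So lists of length 5
    are checked one by one, and for every other length a comparison of lengths suffices.\<close>
  proof (cases "length as = 5")
    case True
    then obtain a b c d e where "as = [a,b,c,d,e]" by (auto simp: numeral_eq_Suc length_Suc_conv)
    then show ?thesis
      by (cases j; cases a; cases b; cases c; cases d; cases e)
        (simp_all add: cyclic_derivative_def A2bar_potential_def A2bar_def path_elt_def numeral_eq_Suc atMost_Suc)
  next
    case False
    then have "drop n as @ B1 # take n as \<noteq> concat (replicate 3 [A1,B1])" if "n \<le> length as" for n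
      using that by (auto dest!: arg_cong[where f=length] simp: length_concat numeral_eq_Suc)
    with False show ?thesis by (auto simp: cyclic_derivative_def A2bar_potential_def path_elt_def)
  qed
  then show ?thesis using V2 by (auto simp: numeral_eq_Suc)
qed

text \<open>The fifth power of the arrow ideal of the completed path algebra.\<close>

definition high_order :: "(vertex, arrow, 'k::field) series set" where
  "high_order = {f \<in> carrier PA. \<forall>p. length (snd p) < 5 \<longrightarrow> f p = 0}"

lemma high_orderI:
  assumes "f \<in> carrier PA" "\<And>i n. n < 5 \<Longrightarrow> f (i, alt i n) = 0"
  shows "f \<in> high_order"
proof -
  have "f (i, as) = 0" if "length as < 5" for i as
    using that assms carrier_PA[of f] by (cases "as = alt i (length as)") metis+
  then show ?thesis using assms by (auto simp: high_order_def)
qed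

lemma ideal_high_order: "ideal high_order (PA :: (vertex, arrow, 'k::field) series ring)"
proof -
  interpret ring "PA :: (vertex, arrow, 'k) series ring" by (rule ring_path_algebra)
  have mult: "f \<otimes>\<^bsub>PA\<^esub> g \<in> high_order" if "f \<in> carrier PA" "g \<in> carrier PA" "f \<in> high_order \<or> g \<in> high_order"
    for f g :: "(vertex, arrow, 'k) series"
    using that by (intro high_orderI) (auto simp: mult_PA high_order_def)
  show ?thesis
  proof (rule idealI)
    show "subgroup high_order (add_monoid (PA :: (vertex, arrow, 'k) series ring))"
    proof (rule add.subgroupI)
      have "\<zero>\<^bsub>PA\<^esub> \<in> (high_order :: (vertex, arrow, 'k) series set)"
        by (rule high_orderI) (simp_all add: zero_PA)
      then show "(high_order :: (vertex, arrow, 'k) series set) \<noteq> {}" by blast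
      fix f :: "(vertex, arrow, 'k) series" assume f: "f \<in> high_order"
      then have "\<ominus>\<^bsub>PA\<^esub> f \<in> carrier PA" by (simp add: high_order_def)
      then show "\<ominus>\<^bsub>PA\<^esub> f \<in> high_order" using f by (simp add: high_order_def a_inv_PA)
      fix g :: "(vertex, arrow, 'k) series" assume "g \<in> high_order"
      then show "f \<oplus>\<^bsub>PA\<^esub> g \<in> high_order" using f by (simp add: high_order_def add_PA)
    qed (auto simp: high_order_def)
  qed (use mult in \<open>auto simp: high_order_def intro: ring_path_algebra\<close>)
qed

text \<open>The closure of the ideal adds nothing: a series without terms of length below \<open>5\<close> is
  divisible on the left by the two cyclic derivatives.\<close>

lemma jacobian_ideal_A2bar:
  assumes char3: "(3 :: 'k::field) \<noteq> 0"
  shows "jacobian_ideal A2bar (pot :: (vertex, arrow, 'k) series) = high_order"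
proof -
  interpret ring "PA :: (vertex, arrow, 'k) series ring" by (rule ring_path_algebra)
  define d :: "vertex \<Rightarrow> (vertex, arrow, 'k) series" where "d i = cyclic_derivative A2bar (arr (oth i)) pot" for i
  have d: "d i = (\<lambda>p. if p = (i, alt i 5) then 3 else 0)" for i
    unfolding d_def cyclic_derivative_A2bar by simp
  have d_high: "d i \<in> high_order" for i
    by (auto simp: d high_order_def carrier_PA)
  have range_d: "range (\<lambda>a. cyclic_derivative A2bar a (pot :: (vertex, arrow, 'k) series)) = range d"
  proof -
    have "cyclic_derivative A2bar a pot \<in> range d" for a
      by (cases a rule: arrow_cases_arr) (auto simp: d_def intro!: image_eqI[of _ _ "oth _"])
    then show ?thesis by (auto simp: d_def)
  qed
  let ?I = "Idl\<^bsub>PA\<^esub> (range d)"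
  have d_carr: "range d \<subseteq> carrier PA" using d_high by (auto simp: high_order_def)
  interpret I: ideal ?I "PA :: (vertex, arrow, 'k) series ring" by (rule genideal_ideal[OF d_carr])
  have sub: "?I \<subseteq> high_order"
    using d_high by (intro genideal_minimal ideal_high_order) auto
  have "f \<in> ?I" if f: "f \<in> high_order" for f
  proof -
    have fc: "f \<in> carrier PA" using f by (simp add: high_order_def)
    \<comment> \<open>Removing the first five arrows from the paths that start at \<open>i\<close>
      and dividing by 3 gives the cofactor of the derivative \<open>d i\<close>. Paths with
      different starting vertices do not interfere, so the two products add up to
      \<open>f\<close>.\<close>
    define g where "g i = (\<lambda>(j, bs). if j = oth i then f (i, alt i 5 @ bs) / 3 else 0)" for i
    have g: "g i \<in> carrier PA" for i
    proof -
      have "f (i, alt i 5 @ bs) = 0" if "bs \<noteq> alt (oth i) (length bs)" for bs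
        using fc that is_path_split[of A2bar i "alt i 5" bs] by (auto simp: path_algebra_def is_path_A2bar)
      then show ?thesis by (auto simp: carrier_PA g_def)
    qed
    have dg: "(d i \<otimes>\<^bsub>PA\<^esub> g i) (j, alt j n) = (if i = j then f (j, alt j n) else 0)" for i j n
    proof -
      have "(d i \<otimes>\<^bsub>PA\<^esub> g i) (j, alt j n) = (\<Sum>m\<le>n. if m = 5 then (if i = j then 3 * g i (oth j, alt (oth j) (n - 5)) else 0) else 0)"
        unfolding mult_PA by (rule sum.cong) (auto simp: d)
      also have "\<dots> = (if i = j then f (j, alt j n) else 0)"
        using f char3 alt_add[of j 5 "n - 5"] by (auto simp: g_def high_order_def)
      finally show ?thesis .
    qed
    have "f = d V1 \<otimes>\<^bsub>PA\<^esub> g V1 \<oplus>\<^bsub>PA\<^esub> d V2 \<otimes>\<^bsub>PA\<^esub> g V2"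
    proof (rule PA_ext)
      fix i n
      show "f (i, alt i n) = (d V1 \<otimes>\<^bsub>PA\<^esub> g V1 \<oplus>\<^bsub>PA\<^esub> d V2 \<otimes>\<^bsub>PA\<^esub> g V2) (i, alt i n)"
        unfolding add_PA dg by (cases i) auto
    qed (use fc g d_carr in \<open>auto simp: image_subset_iff\<close>)
    moreover have "d i \<in> ?I" for i using genideal_self[OF d_carr] by auto
    ultimately show ?thesis using g by (auto intro!: I.a_closed I.I_r_closed)
  qed
  then have Idl: "?I = high_order" using sub by auto
  \<comment> \<open>An approximation that agrees below length 5 already forces the coefficients in
    question to vanish.\<close>
  have "f \<in> high_order" if "f \<in> arrow_adic_closure A2bar high_order" for f
  proof -
    obtain g where "g \<in> high_order" "\<And>p. length (snd p) < 5 \<Longrightarrow> f p = g p" and fc: "f \<in> carrier PA"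
      using \<open>f \<in> _\<close> unfolding arrow_adic_closure_def by blast
    then show ?thesis by (auto simp: high_order_def)
  qed
  moreover have "high_order \<subseteq> arrow_adic_closure A2bar high_order"
    by (auto simp: arrow_adic_closure_def high_order_def)
  ultimately show ?thesis unfolding jacobian_ideal_def range_d Idl by auto
qed

section \<open>Modules as representations with vanishing paths of length 5\<close>

abbreviation pmat :: "(vertex, arrow, 'k::field) rep \<Rightarrow> vertex \<Rightarrow> nat \<Rightarrow> 'k mat" where
  "pmat M i n \<equiv> path_map A2bar M (i, alt i n)"

lemma is_rep_A2bar: "is_rep A2bar M \<longleftrightarrow> (\<forall>i. rmap M (arr i) \<in> carrier_mat (rdim M (oth i)) (rdim M i))"
  unfolding is_rep_def all_arrow_iff by simp

lemma rmap_arr_carrier: "is_rep A2bar M \<Longrightarrow> rmap M (arr i) \<in> carrier_mat (rdim M (oth i)) (rdim M i)"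
  by (simp add: is_rep_A2bar)

lemma pmat_carrier: "is_rep A2bar M \<Longrightarrow> pmat M i n \<in> carrier_mat (rdim M (vtx i n)) (rdim M i)"
proof (induction n arbitrary: i)
  case (Suc n)
  then show ?case using Suc.IH[of "oth i"] rmap_arr_carrier[of M i] by (auto intro!: mult_carrier_mat)
qed simp

lemma pmat_add:
  assumes M: "is_rep A2bar M"
  shows "pmat M i (m + n) = pmat M (vtx i m) n * pmat M i m"
proof (induction m arbitrary: i)
  case 0
  then show ?case using pmat_carrier[OF M, of i n] by simp
next
  case (Suc m)
  then show ?case
    using pmat_carrier[OF M, of "vtx (oth i) m" n] pmat_carrier[OF M, of "oth i" m] rmap_arr_carrier[OF M, of i]
    by simp
qed

lemma pmat_Suc:
  assumes M: "is_rep A2bar M"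
  shows "pmat M i (Suc n) = rmap M (arr (vtx i n)) * pmat M i n"
  using pmat_add[OF M, of i n 1] rmap_arr_carrier[OF M, of "vtx i n"] by (simp del: alt.simps) simp

text \<open>The ideal contains each path of length 5 as a series of its own, so such paths act by
  zero. Conversely, once they act by zero, so do all longer paths, and a series of
  \<open>high_order\<close> has no terms that could act.\<close>

lemma is_module_A2bar:
  assumes char3: "(3 :: 'k::field) \<noteq> 0"
  shows "is_module A2bar (pot :: (vertex, arrow, 'k) series) M \<longleftrightarrow>
    is_rep A2bar M \<and> (\<forall>i. pmat M i 5 = 0\<^sub>m (rdim M (oth i)) (rdim M i))"
proof (intro iffI conjI allI)
  assume "is_module A2bar (pot :: (vertex, arrow, 'k) series) M"
  then obtain N where M: "is_rep A2bar M"
    and N: "\<And>p. is_path A2bar p \<Longrightarrow> N \<le> length (snd p) \<Longrightarrow>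
        path_map A2bar M p = 0\<^sub>m (rdim M (path_end A2bar p)) (rdim M (fst p))"
    and rel: "\<And>f i j r c. (f :: (vertex, arrow, 'k) series) \<in> high_order \<Longrightarrow> r < rdim M j \<Longrightarrow> c < rdim M i \<Longrightarrow>
        (\<Sum>p | is_path A2bar p \<and> fst p = i \<and> path_end A2bar p = j \<and> length (snd p) < N.
           f p * path_map A2bar M p $$ (r, c)) = 0"
    unfolding is_module_def jacobian_ideal_A2bar[OF char3] by blast
  show "is_rep A2bar M" by (rule M)
  fix i
  show "pmat M i 5 = 0\<^sub>m (rdim M (oth i)) (rdim M i)"
  \<comment> \<open>\<open>N\<close> is the nilpotency bound provided by \<open>is_module\<close>.
    If it exceeds 5, the path of length 5 occurs in the sum and is isolated by the series with this
    single term.\<close>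
  proof (cases "N \<le> 5")
    case True
    then show ?thesis using N[of "(i, alt i 5)"] by simp
  next
    case False
    show ?thesis
    proof (rule eq_matI)
      fix r c assume rc: "r < dim_row (0\<^sub>m (rdim M (oth i)) (rdim M i))" "c < dim_col (0\<^sub>m (rdim M (oth i)) (rdim M i))"
      let ?S = "{p. is_path A2bar p \<and> fst p = i \<and> path_end A2bar p = oth i \<and> length (snd p) < N}"
      have "?S \<subseteq> (\<lambda>n. (i, alt i n)) ` {..<N}" by (auto simp: is_path_A2bar)
      then have fin: "finite ?S" using finite_subset by blast
      have "(path_elt (i, alt i 5) :: (vertex, arrow, 'k) series) \<in> high_order"
        by (auto simp: path_elt_def high_order_def carrier_PA)
      then have "0 = (\<Sum>p\<in>?S. path_elt (i, alt i 5) p * path_map A2bar M p $$ (r, c))"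
        using rel[of "path_elt (i, alt i 5)" r "oth i" c i] rc by simp
      also have "\<dots> = (\<Sum>p\<in>?S. if p = (i, alt i 5) then path_map A2bar M p $$ (r, c) else 0)"
        by (rule sum.cong) (auto simp: path_elt_def)
      also have "\<dots> = pmat M i 5 $$ (r, c)" using fin False by (simp add: sum.delta)
      finally show "pmat M i 5 $$ (r, c) = 0\<^sub>m (rdim M (oth i)) (rdim M i) $$ (r, c)" using rc by simp
    qed (use pmat_carrier[OF M, of i 5] in auto)
  qed
next
  assume M: "is_rep A2bar M \<and> (\<forall>i. pmat M i 5 = 0\<^sub>m (rdim M (oth i)) (rdim M i))"
  have "path_map A2bar M (i, as) = 0\<^sub>m (rdim M (path_end A2bar (i, as))) (rdim M i)"
    if p: "is_path A2bar (i, as)" "5 \<le> length as" for i as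
  proof -
    have "as = alt i (5 + (length as - 5))" using p by (simp add: is_path_A2bar)
    then obtain n where as: "as = alt i (5 + n)" by blast
    have "pmat M i (5 + n) = pmat M (vtx i 5) n * pmat M i 5" using M by (intro pmat_add) simp
    also have "\<dots> = 0\<^sub>m (rdim M (vtx i (5 + n))) (rdim M i)"
      using M pmat_carrier[of M "oth i" n] vtx_vtx[of i 5 n] by simp
    finally show ?thesis unfolding as by simp
  qed
  moreover have "(\<Sum>p | is_path A2bar p \<and> fst p = i \<and> path_end A2bar p = j \<and> length (snd p) < 5.
           f p * path_map A2bar M p $$ (r, c)) = 0" if "(f :: (vertex, arrow, 'k) series) \<in> high_order" for f i j r c
    using that by (intro sum.neutral) (auto simp: high_order_def)
  ultimately show "is_module A2bar (pot :: (vertex, arrow, 'k) series) M"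
    unfolding is_module_def jacobian_ideal_A2bar[OF char3] using M by (intro conjI exI[of _ 5]) auto
qed

section \<open>Homomorphisms of representations\<close>

lemma rep_hom_A2bar:
  "h \<in> rep_hom A2bar M N \<longleftrightarrow> (\<forall>i. h i \<in> carrier_mat (rdim N i) (rdim M i)) \<and>
     (\<forall>i. h (oth i) * rmap M (arr i) = rmap N (arr i) * h i)"
  unfolding rep_hom_def mem_Collect_eq all_arrow_iff by simp

lemma rep_hom_carrier: "h \<in> rep_hom Q M N \<Longrightarrow> h i \<in> carrier_mat (rdim N i) (rdim M i)"
  by (simp add: rep_hom_def)

lemma rep_hom_mult_vec_carrier:
  "h \<in> rep_hom Q M N \<Longrightarrow> v \<in> carrier_vec (rdim M i) \<Longrightarrow> h i *\<^sub>v v \<in> carrier_vec (rdim N i)"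
  by (rule mult_mat_vec_carrier[OF rep_hom_carrier])

lemma rep_hom_comp:
  assumes M: "is_rep Q M" and N: "is_rep Q N" and P: "is_rep Q P"
    and h: "h \<in> rep_hom Q M N" and k: "k \<in> rep_hom Q N P"
  shows "(\<lambda>i. k i * h i) \<in> rep_hom Q M P"
  unfolding rep_hom_def
proof (intro CollectI conjI allI)
  fix i show "k i * h i \<in> carrier_mat (rdim P i) (rdim M i)"
    using rep_hom_carrier[OF h, of i] rep_hom_carrier[OF k, of i] by simp
next
  fix a
  note c = rep_hom_carrier[OF h] rep_hom_carrier[OF k]
  have Ma: "rmap M a \<in> carrier_mat (rdim M (tgt Q a)) (rdim M (src Q a))"
    and Na: "rmap N a \<in> carrier_mat (rdim N (tgt Q a)) (rdim N (src Q a))"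
    and Pa: "rmap P a \<in> carrier_mat (rdim P (tgt Q a)) (rdim P (src Q a))"
    using M N P by (auto simp: is_rep_def)
  have ha: "h (tgt Q a) * rmap M a = rmap N a * h (src Q a)"
    and ka: "k (tgt Q a) * rmap N a = rmap P a * k (src Q a)" using h k by (auto simp: rep_hom_def)
  have "k (tgt Q a) * h (tgt Q a) * rmap M a = k (tgt Q a) * (rmap N a * h (src Q a))"
    using assoc_mult_mat[OF c(2,1) Ma] by (simp add: ha)
  also have "\<dots> = rmap P a * k (src Q a) * h (src Q a)"
    using assoc_mult_mat[OF c(2) Na c(1)] by (simp add: ka)
  also have "\<dots> = rmap P a * (k (src Q a) * h (src Q a))" using assoc_mult_mat[OF Pa c(2,1)] .
  finally show "k (tgt Q a) * h (tgt Q a) * rmap M a = rmap P a * (k (src Q a) * h (src Q a))" .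
qed

lemma rep_hom_id: "is_rep Q M \<Longrightarrow> (\<lambda>i. 1\<^sub>m (rdim M i)) \<in> rep_hom Q M M"
  unfolding rep_hom_def is_rep_def
proof (intro CollectI conjI allI)
  fix a assume "\<forall>a. rmap M a \<in> carrier_mat (rdim M (tgt Q a)) (rdim M (src Q a))"
  then have "rmap M a \<in> carrier_mat (rdim M (tgt Q a)) (rdim M (src Q a))" by simp
  from left_mult_one_mat[OF this] right_mult_one_mat[OF this]
  show "1\<^sub>m (rdim M (tgt Q a)) * rmap M a = rmap M a * 1\<^sub>m (rdim M (src Q a))" by simp
qed simp

lemma rep_hom_zero: "is_rep Q M \<Longrightarrow> is_rep Q N \<Longrightarrow> (\<lambda>i. 0\<^sub>m (rdim N i) (rdim M i)) \<in> rep_hom Q M N"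
  unfolding rep_hom_def is_rep_def
proof (intro CollectI conjI allI)
  fix a assume "\<forall>a. rmap M a \<in> carrier_mat (rdim M (tgt Q a)) (rdim M (src Q a))"
    and "\<forall>a. rmap N a \<in> carrier_mat (rdim N (tgt Q a)) (rdim N (src Q a))"
  then have "rmap M a \<in> carrier_mat (rdim M (tgt Q a)) (rdim M (src Q a))"
    and "rmap N a \<in> carrier_mat (rdim N (tgt Q a)) (rdim N (src Q a))" by simp_all
  from left_mult_zero_mat[OF this(1)] right_mult_zero_mat[OF this(2)]
  show "0\<^sub>m (rdim N (tgt Q a)) (rdim M (tgt Q a)) * rmap M a = rmap N a * 0\<^sub>m (rdim N (src Q a)) (rdim M (src Q a))" by simp
qed simp

lemma rep_iso_refl: "is_rep Q M \<Longrightarrow> rep_iso Q M M"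
proof -
  assume "is_rep Q M"
  then have "(\<lambda>i. 1\<^sub>m (rdim M i)) \<in> rep_hom Q M M" by (rule rep_hom_id)
  then show ?thesis unfolding rep_iso_def
    by (rule bexI[rotated], rule_tac bexI[rotated]) auto
qed

lemma rep_iso_sym: "rep_iso Q M N \<Longrightarrow> rep_iso Q N M"
proof -
  assume "rep_iso Q M N"
  then obtain h h' where "h \<in> rep_hom Q M N" "h' \<in> rep_hom Q N M"
    "\<forall>i. h' i * h i = 1\<^sub>m (rdim M i) \<and> h i * h' i = 1\<^sub>m (rdim N i)"
    unfolding rep_iso_def by (elim bexE)
  then show ?thesis unfolding rep_iso_def by (intro bexI[of _ h'] bexI[of _ h]) simp_all
qed

lemma mult_mat_cancel_mid:
  fixes A B C D :: "'k::field mat"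
  assumes "A \<in> carrier_mat n m" "B \<in> carrier_mat m p" "C \<in> carrier_mat p m" "D \<in> carrier_mat m n"
    and "B * C = 1\<^sub>m m"
  shows "A * B * (C * D) = A * D"
proof -
  have "A * B * (C * D) = A * (B * (C * D))" using assms by (intro assoc_mult_mat) auto
  also have "B * (C * D) = B * C * D" using assms by (intro assoc_mult_mat[symmetric]) auto
  finally show ?thesis using assms by simp
qed

lemma rep_iso_trans:
  assumes "is_rep Q M" "is_rep Q N" "is_rep Q P" "rep_iso Q M N" "rep_iso Q N P"
  shows "rep_iso Q M P"
proof -
  obtain h h' where h: "h \<in> rep_hom Q M N" "h' \<in> rep_hom Q N M"
    "\<And>i. h' i * h i = 1\<^sub>m (rdim M i)" "\<And>i. h i * h' i = 1\<^sub>m (rdim N i)"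
    using assms(4) by (auto simp: rep_iso_def)
  obtain k k' where k: "k \<in> rep_hom Q N P" "k' \<in> rep_hom Q P N"
    "\<And>i. k' i * k i = 1\<^sub>m (rdim N i)" "\<And>i. k i * k' i = 1\<^sub>m (rdim P i)"
    using assms(5) by (auto simp: rep_iso_def)
  have "h' i * k' i * (k i * h i) = h' i * h i" for i
    by (rule mult_mat_cancel_mid[OF rep_hom_carrier[OF h(2)] rep_hom_carrier[OF k(2)]
          rep_hom_carrier[OF k(1)] rep_hom_carrier[OF h(1)] k(3)])
  moreover have "k i * h i * (h' i * k' i) = k i * k' i" for i
    by (rule mult_mat_cancel_mid[OF rep_hom_carrier[OF k(1)] rep_hom_carrier[OF h(1)]
          rep_hom_carrier[OF h(2)] rep_hom_carrier[OF k(2)] h(4)])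
  ultimately have "\<forall>i. h' i * k' i * (k i * h i) = 1\<^sub>m (rdim M i) \<and> k i * h i * (h' i * k' i) = 1\<^sub>m (rdim P i)"
    by (simp only: h(3) k(4) simp_thms)
  then show ?thesis
    unfolding rep_iso_def
    by (intro bexI[OF _ rep_hom_comp[OF assms(1-3) h(1) k(1)]] bexI[OF _ rep_hom_comp[OF assms(3,2,1) k(2) h(2)]]) simp
qed

lemma rep_hom_pmat:
  assumes M: "is_rep A2bar M" and N: "is_rep A2bar N" and h: "h \<in> rep_hom A2bar M N"
  shows "h (vtx i n) * pmat M i n = pmat N i n * h i"
proof (induction n)
  case 0
  then show ?case using rep_hom_carrier[OF h, of i] by simp
next
  case (Suc n)
  let ?j = "vtx i n"
  note c = rep_hom_carrier[OF h] pmat_carrier[OF M, of i n] pmat_carrier[OF N, of i n]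
    rmap_arr_carrier[OF M, of ?j] rmap_arr_carrier[OF N, of ?j]
  have comm: "h (oth ?j) * rmap M (arr ?j) = rmap N (arr ?j) * h ?j" using h by (simp add: rep_hom_A2bar)
  have "h (oth ?j) * (rmap M (arr ?j) * pmat M i n) = h (oth ?j) * rmap M (arr ?j) * pmat M i n"
    using assoc_mult_mat[OF c(1) c(4) c(2)] by simp
  also have "\<dots> = rmap N (arr ?j) * (h ?j * pmat M i n)"
    unfolding comm using assoc_mult_mat[OF c(5) c(1) c(2)] .
  also have "\<dots> = rmap N (arr ?j) * pmat N i n * h i"
    unfolding Suc using assoc_mult_mat[OF c(5) c(3) c(1)] by simp
  finally show ?case by (simp only: pmat_Suc[OF M] pmat_Suc[OF N] vtx_Suc)
qed

lemma rep_hom_pmat_vec: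
  assumes M: "is_rep A2bar M" and N: "is_rep A2bar N" and h: "h \<in> rep_hom A2bar M N"
    and v: "v \<in> carrier_vec (rdim M i)"
  shows "h (vtx i n) *\<^sub>v (pmat M i n *\<^sub>v v) = pmat N i n *\<^sub>v (h i *\<^sub>v v)"
  using rep_hom_pmat[OF M N h, of i n] v
    assoc_mult_mat_vec[OF rep_hom_carrier[OF h] pmat_carrier[OF M] v, of n]
    assoc_mult_mat_vec[OF pmat_carrier[OF N] rep_hom_carrier[OF h] v, of n] by simp

lemma pmat_vec_add:
  assumes M: "is_rep A2bar M" and v: "v \<in> carrier_vec (rdim M i)"
  shows "pmat M i (m + n) *\<^sub>v v = pmat M (vtx i m) n *\<^sub>v (pmat M i m *\<^sub>v v)"
  using pmat_add[OF M, of i m n] assoc_mult_mat_vec[OF pmat_carrier[OF M] pmat_carrier[OF M] v, of m n] by simp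

lemma pmat_vec_Suc:
  assumes M: "is_rep A2bar M" and v: "v \<in> carrier_vec (rdim M i)"
  shows "pmat M i (Suc n) *\<^sub>v v = rmap M (arr (vtx i n)) *\<^sub>v (pmat M i n *\<^sub>v v)"
  using pmat_Suc[OF M, of i n] assoc_mult_mat_vec[OF rmap_arr_carrier[OF M] pmat_carrier[OF M] v, of n] by simp

lemma pmat_vec_carrier:
  "is_rep A2bar M \<Longrightarrow> v \<in> carrier_vec (rdim M i) \<Longrightarrow> pmat M i n *\<^sub>v v \<in> carrier_vec (rdim M (vtx i n))"
  by (rule mult_mat_vec_carrier[OF pmat_carrier])

lemma zero_mat_mult_vec [simp]: "v \<in> carrier_vec n \<Longrightarrow> 0\<^sub>m m n *\<^sub>v v = (0\<^sub>v m :: 'k::field vec)"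
  by auto

lemma mult_mat_zero_vec: "A \<in> carrier_mat m n \<Longrightarrow> A *\<^sub>v 0\<^sub>v n = (0\<^sub>v m :: 'k::field vec)"
  by auto

lemma pmat_vec_zero_mono:
  assumes M: "is_rep A2bar M" and v: "v \<in> carrier_vec (rdim M i)"
    and "pmat M i l *\<^sub>v v = 0\<^sub>v (rdim M (vtx i l))" "l \<le> m"
  shows "pmat M i m *\<^sub>v v = 0\<^sub>v (rdim M (vtx i m))"
  using pmat_vec_add[OF M v, of l "m - l"] assms mult_mat_zero_vec[OF pmat_carrier[OF M], of "vtx i l" "m - l"]
  by (simp add: vtx_vtx)

section \<open>Uniserial modules\<close>

text \<open>The length of the shortest path from \<open>i\<close> to \<open>j\<close>. The paths
  from \<open>i\<close> to \<open>j\<close> are those of length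
  \<open>2 * c + off i j\<close>.\<close>

definition off :: "vertex \<Rightarrow> vertex \<Rightarrow> nat" where
  "off i j = (if j = i then 0 else 1)"

text \<open>Counts the indices \<open>c\<close> with \<open>2 * c + off i j < l\<close>; see
  \<open>lt_udim\<close>, the form in which it is used.\<close>

definition udim :: "vertex \<Rightarrow> nat \<Rightarrow> vertex \<Rightarrow> nat" where
  "udim i l j = (l + 1 - off i j) div 2"

text \<open>The uniserial representation of length \<open>l\<close> with top at \<open>i\<close>. The basis vector with index \<open>c\<close> at
  the vertex \<open>j\<close> is the image of the generator under the path of length \<open>2 * c + off i j\<close>.\<close>

definition uni :: "vertex \<Rightarrow> nat \<Rightarrow> (vertex, arrow, 'k::field) rep" where
  "uni i l = \<lparr>rdim = udim i l, rmap = (\<lambda>a. mat (udim i l (tgt A2bar a)) (udim i l (src A2bar a))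
     (\<lambda>(r, c). if r = c + off i (src A2bar a) then 1 else 0))\<rparr>"

lemma off_oth: "off i (oth j) = 1 - off i j" and off_oth2: "off (oth i) j = 1 - off i j"
  and off_same [simp]: "off i i = 0" and off_le: "off i j \<le> 1"
  by (auto simp: off_def dest: neq_oth)

lemma off_0_or_1: "off i j = 0 \<or> off i j = 1" by (simp add: off_def)

lemma lt_udim: "c < udim i l j \<longleftrightarrow> 2 * c + off i j < l"
  using off_0_or_1[of i j] by (auto simp: udim_def)

lemma vtx_off [simp]: "vtx i (2 * c + off i j) = j" "vtx i (off i j) = j"
  by (auto simp: vtx_def off_def dest: neq_oth)

lemma rdim_uni [simp]: "rdim (uni i l) j = udim i l j"
  by (simp add: uni_def)

lemma rmap_uni: "rmap (uni i l) (arr j) = mat (udim i l (oth j)) (udim i l j) (\<lambda>(r, c). if r = c + off i j then 1 else 0)"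
  by (simp add: uni_def)

lemma is_rep_uni [simp]: "is_rep A2bar (uni i l)"
  by (simp add: is_rep_A2bar rmap_uni)

text \<open>An arrow raises the path length by 1. The index grows only when the arrow returns to the
  vertex \<open>i\<close>, that is, by \<open>off i j\<close>.\<close>

lemma rmap_uni_vec:
  assumes w: "w \<in> carrier_vec (udim i l j)" and r: "r < udim i l (oth j)"
  shows "(rmap (uni i l) (arr j) *\<^sub>v w) $ r = (if off i j \<le> r then w $ (r - off i j) else (0 :: 'k::field))"
proof -
  have "(rmap (uni i l) (arr j) *\<^sub>v w) $ r = (\<Sum>c<udim i l j. (if r = c + off i j then 1 else 0) * w $ c)"
    using mult_mat_vec_expand[OF rmap_arr_carrier[OF is_rep_uni, of i l j], of w r] w r
    by (simp add: rmap_uni)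
  also have "\<dots> = (\<Sum>c<udim i l j. if c = r - off i j then (if off i j \<le> r then w $ c else 0) else 0)"
    by (intro sum.cong) auto
  also have "\<dots> = (if off i j \<le> r then w $ (r - off i j) else 0)"
    using r off_0_or_1[of i j] unfolding lt_udim by (auto simp: lt_udim off_oth)
  finally show ?thesis .
qed

text \<open>In terms of path lengths, a path of length \<open>n\<close> shifts the basis by
  \<open>n\<close>. The difference below \<open>div\<close> is the length
  \<open>2 * c + off i j\<close> of the source vector, and halving it recovers \<open>c\<close>
  because \<open>off\<close> is at most 1.\<close>

lemma pmat_uni_vec:
  assumes w: "w \<in> carrier_vec (udim i l j)" and r: "r < udim i l (vtx j n)"
  shows "(pmat (uni i l) j n *\<^sub>v w) $ r =
    (if n \<le> 2 * r + off i (vtx j n) then w $ ((2 * r + off i (vtx j n) - n) div 2) else (0 :: 'k::field))"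
  using r
proof (induction n arbitrary: r)
  case 0
  then show ?case using w off_0_or_1[of i j] by auto
next
  case (Suc n)
  let ?j = "vtx j n"
  have c: "pmat (uni i l) j n *\<^sub>v w \<in> carrier_vec (udim i l ?j)"
    using pmat_vec_carrier[OF is_rep_uni, of w i l j n] w by simp
  have r: "r < udim i l (oth ?j)" using Suc.prems by simp
  have "(pmat (uni i l) j (Suc n) *\<^sub>v w) $ r = (if off i ?j \<le> r then (pmat (uni i l) j n *\<^sub>v w) $ (r - off i ?j) else 0)"
    using pmat_vec_Suc[OF is_rep_uni, of w i l j n] w rmap_uni_vec[OF c r] by simp
  also have "\<dots> = (if Suc n \<le> 2 * r + off i (oth ?j) then w $ ((2 * r + off i (oth ?j) - Suc n) div 2) else 0)"
  proof (cases "off i ?j \<le> r")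
    case True
    have "r - off i ?j < udim i l ?j" using r True off_0_or_1[of i ?j] by (auto simp: lt_udim off_oth)
    moreover have "2 * (r - off i ?j) + off i ?j = 2 * r + off i (oth ?j) - 1" "2 * r + off i (oth ?j) \<ge> 1"
      using True off_0_or_1[of i ?j] by (auto simp: off_oth)
    ultimately show ?thesis using Suc.IH[of "r - off i ?j"] True by (simp; linarith?)
  next
    case False
    then show ?thesis using off_0_or_1[of i ?j] by (auto simp: off_oth)
  qed
  finally show ?case by simp
qed

lemma pmat_uni_top:
  assumes "0 < l"
  shows "pmat (uni i l) i m *\<^sub>v unit_vec (udim i l i) 0 =
    (if m < l then unit_vec (udim i l (vtx i m)) (m div 2) else (0\<^sub>v (udim i l (vtx i m)) :: 'k::field vec))"
proof (rule eq_vecI)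
  fix r assume "r < dim_vec (if m < l then unit_vec (udim i l (vtx i m)) (m div 2) else (0\<^sub>v (udim i l (vtx i m)) :: 'k vec))"
  then have r: "r < udim i l (vtx i m)" by (simp split: if_splits)
  have m: "m div 2 * 2 + off i (vtx i m) = m"
    by (cases "even m") (auto simp: off_def vtx_def elim!: oddE)
  have "0 < udim i l i" using assms by (simp add: lt_udim)
  have "(pmat (uni i l) i m *\<^sub>v unit_vec (udim i l i) 0) $ r =
    (if m \<le> 2 * r + off i (vtx i m) then (unit_vec (udim i l i) 0 :: 'k vec) $ ((2 * r + off i (vtx i m) - m) div 2) else 0)"
    by (rule pmat_uni_vec) (use r in auto)
  also have "\<dots> = (if r = m div 2 then 1 else 0)"
  proof -
    have "(2 * r + off i (vtx i m) - m) div 2 < udim i l i"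
      using r by (auto simp: lt_udim)
    moreover have "m \<le> 2 * r + off i (vtx i m) \<and> (2 * r + off i (vtx i m) - m) div 2 = 0 \<longleftrightarrow> r = m div 2"
      using m by linarith
    ultimately show ?thesis by auto
  qed
  also have "\<dots> = (if m < l then unit_vec (udim i l (vtx i m)) (m div 2) else (0\<^sub>v (udim i l (vtx i m)) :: 'k vec)) $ r"
    using r m by (auto simp: lt_udim)
  finally show "(pmat (uni i l) i m *\<^sub>v unit_vec (udim i l i) 0) $ r =
    (if m < l then unit_vec (udim i l (vtx i m)) (m div 2) else (0\<^sub>v (udim i l (vtx i m)) :: 'k vec)) $ r" .
qed (use pmat_carrier[OF is_rep_uni, of i l i m] in auto)

text \<open>The candidate for the homomorphism from \<open>uni i l\<close> that sends the generator
  to \<open>v\<close>: each column is the image of \<open>v\<close> under the path that leads to the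
  corresponding basis vector. It commutes with the arrows once the path of length \<open>l\<close>
  kills \<open>v\<close>.\<close>

definition gen_hom :: "(vertex, arrow, 'k::field) rep \<Rightarrow> vertex \<Rightarrow> nat \<Rightarrow> 'k vec \<Rightarrow> vertex \<Rightarrow> 'k mat" where
  "gen_hom M i l v j = mat (rdim M j) (udim i l j) (\<lambda>(r, c). (pmat M i (2 * c + off i j) *\<^sub>v v) $ r)"

lemma vec_index_self: "u \<in> carrier_vec n \<Longrightarrow> vec n (\<lambda>r. u $ r) = u"
  by auto

lemma gen_hom_unit_vec:
  assumes M: "is_rep A2bar M" and v: "v \<in> carrier_vec (rdim M i)" and c: "c < udim i l j"
  shows "gen_hom M i l v j *\<^sub>v unit_vec (udim i l j) c = pmat M i (2 * c + off i j) *\<^sub>v v"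
proof -
  have "gen_hom M i l v j *\<^sub>v unit_vec (udim i l j) c = col (gen_hom M i l v j) c"
    using c by (intro mult_mat_unit_vec[of _ "rdim M j"]) (auto simp: gen_hom_def)
  also have "\<dots> = pmat M i (2 * c + off i j) *\<^sub>v v"
  proof -
    have "col (gen_hom M i l v j) c = vec (rdim M j) (\<lambda>r. (pmat M i (2 * c + off i j) *\<^sub>v v) $ r)"
      using c unfolding gen_hom_def by (intro eq_vecI) (simp_all del: index_mult_mat_vec)
    also have "\<dots> = pmat M i (2 * c + off i j) *\<^sub>v v"
      using pmat_vec_carrier[OF M v, of "2 * c + off i j"] by (intro vec_index_self) simp
    finally show ?thesis .
  qed
  finally show ?thesis .
qed

lemma gen_hom_hom:
  fixes M :: "(vertex, arrow, 'k::field) rep"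
  assumes M: "is_rep A2bar M" and v: "v \<in> carrier_vec (rdim M i)"
    and zero: "pmat M i l *\<^sub>v v = 0\<^sub>v (rdim M (vtx i l))"
  shows "gen_hom M i l v \<in> rep_hom A2bar (uni i l) M"
  unfolding rep_hom_A2bar
proof (intro conjI allI)
  fix j
  have g [simp]: "gen_hom M i l v k \<in> carrier_mat (rdim M k) (udim i l k)" for k by (simp add: gen_hom_def)
  show "gen_hom M i l v j \<in> carrier_mat (rdim M j) (rdim (uni i l) j)" by simp
  note Mc = rmap_arr_carrier[OF M, of j]
  show "gen_hom M i l v (oth j) * rmap (uni i l) (arr j) = rmap M (arr j) * gen_hom M i l v j"
  proof (rule mat_col_eqI)
    fix c assume "c < dim_col (rmap M (arr j) * gen_hom M i l v j)"
    then have c: "c < udim i l j" by (simp add: gen_hom_def)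
    have k: "2 * (c + off i j) + off i (oth j) = Suc (2 * c + off i j)"
      using off_0_or_1[of i j] by (auto simp: off_oth)
    have "col (rmap M (arr j) * gen_hom M i l v j) c = rmap M (arr j) *\<^sub>v (gen_hom M i l v j *\<^sub>v unit_vec (udim i l j) c)"
      using mult_mat_unit_vec[of "rmap M (arr j) * gen_hom M i l v j" "rdim M (oth j)" "udim i l j" c] c
        assoc_mult_mat_vec[OF Mc g unit_vec_carrier] mult_carrier_mat[OF Mc g] by simp
    also have "\<dots> = rmap M (arr j) *\<^sub>v (pmat M i (2 * c + off i j) *\<^sub>v v)"
      by (simp only: gen_hom_unit_vec[OF M v c])
    also have "\<dots> = pmat M i (Suc (2 * c + off i j)) *\<^sub>v v"
      using pmat_vec_Suc[OF M v, of "2 * c + off i j"] by simp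
    also have "\<dots> = gen_hom M i l v (oth j) *\<^sub>v col (rmap (uni i l) (arr j)) c"
    proof (cases "c + off i j < udim i l (oth j)")
      case True
      then have col: "col (rmap (uni i l) (arr j)) c = (unit_vec (udim i l (oth j)) (c + off i j) :: 'k vec)"
        using c by (intro eq_vecI) (auto simp: rmap_uni)
      show ?thesis unfolding col gen_hom_unit_vec[OF M v True] k ..
    next
      \<comment> \<open>No basis vector follows, so the extended path has length at least
        \<open>l\<close> and kills \<open>v\<close>.\<close>
      case False
      then have col: "col (rmap (uni i l) (arr j)) c = (0\<^sub>v (udim i l (oth j)) :: 'k vec)"
        using c by (intro eq_vecI) (auto simp: rmap_uni)
      have "l \<le> Suc (2 * c + off i j)" using False k by (simp add: lt_udim)
      from pmat_vec_zero_mono[OF M v zero this]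
      show ?thesis unfolding col mult_mat_zero_vec[OF g] by (simp only: vtx_Suc vtx_off)
    qed
    also have "\<dots> = col (gen_hom M i l v (oth j) * rmap (uni i l) (arr j)) c"
      using c by (intro col_mult2[symmetric, of _ "rdim M (oth j)" "udim i l (oth j)"  _ "udim i l j"]) (auto simp: rmap_uni)
    finally show "col (gen_hom M i l v (oth j) * rmap (uni i l) (arr j)) c = col (rmap M (arr j) * gen_hom M i l v j) c" by simp
  qed (use Mc in \<open>auto simp: gen_hom_def rmap_uni\<close>)
qed

text \<open>Every basis vector is a path applied to the generator, so the image of the generator
  determines the homomorphism.\<close>

lemma hom_uni_eq_gen_hom:
  assumes M: "is_rep A2bar M" and h: "h \<in> rep_hom A2bar (uni i l) M" and l: "0 < l"
  shows "h = gen_hom M i l (h i *\<^sub>v unit_vec (udim i l i) 0)"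
proof
  fix j
  let ?e = "unit_vec (udim i l i) 0" and ?v = "h i *\<^sub>v unit_vec (udim i l i) 0"
  have v: "?v \<in> carrier_vec (rdim M i)" using rep_hom_mult_vec_carrier[OF h, of ?e i] by simp
  have hj: "h j \<in> carrier_mat (rdim M j) (udim i l j)" using rep_hom_carrier[OF h, of j] by simp
  show "h j = gen_hom M i l ?v j"
  proof (rule mat_col_eqI)
    fix c assume "c < dim_col (gen_hom M i l ?v j)"
    then have c: "c < udim i l j" by (simp add: gen_hom_def)
    have "col (gen_hom M i l ?v j) c = pmat M i (2 * c + off i j) *\<^sub>v ?v"
      using gen_hom_unit_vec[OF M v c] c mult_mat_unit_vec[of "gen_hom M i l ?v j" "rdim M j" "udim i l j" c]
      by (simp add: gen_hom_def)
    also have "\<dots> = h j *\<^sub>v (pmat (uni i l) i (2 * c + off i j) *\<^sub>v ?e)"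
      using rep_hom_pmat_vec[OF is_rep_uni M h, of ?e i "2 * c + off i j"] by simp
    also have "pmat (uni i l) i (2 * c + off i j) *\<^sub>v ?e = unit_vec (udim i l j) c"
      using pmat_uni_top[OF l, of i "2 * c + off i j"] c off_0_or_1[of i j] by (auto simp: lt_udim)
    also have "h j *\<^sub>v unit_vec (udim i l j) c = col (h j) c"
      using mult_mat_unit_vec[OF hj c] .
    finally show "col (h j) c = col (gen_hom M i l ?v j) c" ..
  qed (use hj in \<open>auto simp: gen_hom_def\<close>)
qed

lemma hom_uni_ext:
  assumes "is_rep A2bar M" "h \<in> rep_hom A2bar (uni i l) M" "h' \<in> rep_hom A2bar (uni i l) M" "0 < l"
    and "h i *\<^sub>v unit_vec (udim i l i) 0 = h' i *\<^sub>v unit_vec (udim i l i) 0"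
  shows "h = h'"
proof -
  have "h = gen_hom M i l (h' i *\<^sub>v unit_vec (udim i l i) 0)"
    unfolding assms(5)[symmetric] by (rule hom_uni_eq_gen_hom[OF assms(1,2,4)])
  also have "\<dots> = h'" by (rule hom_uni_eq_gen_hom[OF assms(1,3,4), symmetric])
  finally show ?thesis .
qed

lemma gen_hom_top:
  assumes "is_rep A2bar M" "v \<in> carrier_vec (rdim M i)" "0 < l"
  shows "gen_hom M i l v i *\<^sub>v unit_vec (udim i l i) 0 = v"
  using gen_hom_unit_vec[OF assms(1,2), of 0 l i] assms by (simp add: lt_udim)

text \<open>Commutation with a single arrow, read off entrywise: an entry moves one step along the
  paths of both modules, and it is 0 where the target basis vector is not in the image of the arrow.
  Iteration yields the Toeplitz form of endomorphisms.\<close>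

lemma hom_uni_uni_entry:
  assumes h: "h \<in> rep_hom A2bar (uni i l) (uni i' l')"
    and r: "r < udim i' l' (oth j)" and c: "c + off i j < udim i l (oth j)"
  shows "h (oth j) $$ (r, c + off i j) = (if off i' j \<le> r then h j $$ (r - off i' j, c) else (0 :: 'k::field))"
proof -
  have c': "c < udim i l j" using c off_0_or_1[of i j] by (auto simp: lt_udim off_oth)
  have hc: "h k \<in> carrier_mat (udim i' l' k) (udim i l k)" for k using rep_hom_carrier[OF h, of k] by simp
  have colU: "col (rmap (uni i l) (arr j)) c = (unit_vec (udim i l (oth j)) (c + off i j) :: 'k vec)"
    using c c' by (intro eq_vecI) (auto simp: rmap_uni)
  have "col (h (oth j) * rmap (uni i l) (arr j)) c = h (oth j) *\<^sub>v unit_vec (udim i l (oth j)) (c + off i j)"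
    using col_mult2[OF hc rmap_arr_carrier[OF is_rep_uni, of i l j, simplified] c'] colU by simp
  also have "\<dots> = col (h (oth j)) (c + off i j)" using mult_mat_unit_vec[OF hc c] .
  finally have "col (h (oth j)) (c + off i j) $ r = col (rmap (uni i' l') (arr j) * h j) c $ r"
    using h by (simp add: rep_hom_A2bar)
  moreover have "col (rmap (uni i' l') (arr j) * h j) c = rmap (uni i' l') (arr j) *\<^sub>v col (h j) c"
    using col_mult2[OF rmap_arr_carrier[OF is_rep_uni, of i' l' j, simplified] hc c'] .
  moreover have "(rmap (uni i' l') (arr j) *\<^sub>v col (h j) c) $ r = (if off i' j \<le> r then col (h j) c $ (r - off i' j) else 0)"
    using hc[of j] r by (intro rmap_uni_vec) (auto intro: carrier_vecI)
  moreover have "r - off i' j < udim i' l' j" if "off i' j \<le> r"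
    using r that off_0_or_1[of i' j] by (auto simp: lt_udim off_oth)
  ultimately show ?thesis using hc[of j] hc[of "oth j"] r c c' by (auto split: if_splits)
qed

section \<open>Endomorphisms and direct summands\<close>

lemma rep_iso_zero_rep_iff:
  assumes N: "is_rep Q N"
  shows "rep_iso Q N zero_rep \<longleftrightarrow> (\<forall>i. rdim N i = 0)"
proof
  assume "rep_iso Q N zero_rep"
  then obtain h h' where h: "h \<in> rep_hom Q N zero_rep" "h' \<in> rep_hom Q zero_rep N" "\<And>i. h' i * h i = 1\<^sub>m (rdim N i)"
    unfolding rep_iso_def by auto
  have "rdim N i \<le> 0" for i
    using right_inverse_dim_le[of "h' i" "rdim N i" 0 "h i"] h rep_hom_carrier[OF h(1), of i] rep_hom_carrier[OF h(2), of i]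
    by (simp add: zero_rep_def)
  then show "\<forall>i. rdim N i = 0" by simp
next
  assume z: "\<forall>i. rdim N i = 0"
  have Z: "is_rep Q zero_rep" by (simp add: is_rep_def zero_rep_def)
  have "0\<^sub>m (rdim N i) 0 * 0\<^sub>m 0 (rdim N i) = 1\<^sub>m (rdim N i)" "0\<^sub>m 0 (rdim N i) * 0\<^sub>m (rdim N i) 0 = 1\<^sub>m 0" for i
    using z by (auto intro!: eq_matI)
  then show "rep_iso Q N zero_rep"
    unfolding rep_iso_def
    by (intro bexI[OF _ rep_hom_zero[OF N Z]] bexI[OF _ rep_hom_zero[OF Z N]]) (auto simp: zero_rep_def)
qed

lemma is_rep_rep_sum: "is_rep Q M \<Longrightarrow> is_rep Q N \<Longrightarrow> is_rep Q (rep_sum Q M N)"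
  by (auto simp: is_rep_def rep_sum_def)

lemma rdim_rep_sum [simp]: "rdim (rep_sum Q M N) i = rdim M i + rdim N i"
  by (simp add: rep_sum_def)

lemma mult_diag_block_mat:
  fixes A B C D :: "'k::field mat"
  assumes A: "A \<in> carrier_mat p q" and B: "B \<in> carrier_mat p' q'" and C: "C \<in> carrier_mat q r" and D: "D \<in> carrier_mat q' r'"
  shows "four_block_mat A (0\<^sub>m p q') (0\<^sub>m p' q) B * four_block_mat C (0\<^sub>m q r') (0\<^sub>m q' r) D =
    four_block_mat (A * C) (0\<^sub>m p r') (0\<^sub>m p' r) (B * D)"
proof -
  have "four_block_mat A (0\<^sub>m p q') (0\<^sub>m p' q) B * four_block_mat C (0\<^sub>m q r') (0\<^sub>m q' r) D =
    four_block_mat (A * C + 0\<^sub>m p q' * 0\<^sub>m q' r) (A * 0\<^sub>m q r' + 0\<^sub>m p q' * D)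
      (0\<^sub>m p' q * C + B * 0\<^sub>m q' r) (0\<^sub>m p' q * 0\<^sub>m q r' + B * D)"
    by (rule mult_four_block_mat[OF A _ _ B C _ _ D]) auto
  then show ?thesis
    using mult_carrier_mat[OF A C] mult_carrier_mat[OF B D]
    by (simp add: right_mult_zero_mat[OF A] right_mult_zero_mat[OF B] left_mult_zero_mat[OF C] left_mult_zero_mat[OF D])
qed

text \<open>Going from \<open>i\<close> to the other vertex and back shifts row and column index by
  one each. Only the second of the two arrows changes an index, since \<open>off\<close> is 0 at
  \<open>i\<close>.\<close>

lemma uni_end_toeplitz:
  fixes e :: "vertex \<Rightarrow> 'k::field mat"
  assumes e: "e \<in> rep_hom A2bar (uni i l) (uni i l)" and rc: "r < udim i l i" "c < udim i l i"
  shows "e i $$ (r, c) = (if c \<le> r then e i $$ (r - c, 0) else 0)"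
  using rc
proof (induction c arbitrary: r)
  case (Suc c)
  have c: "c < udim i l (oth i)" using Suc.prems by (auto simp: lt_udim off_oth)
  have "e i $$ (r, Suc c) = (if 1 \<le> r then e (oth i) $$ (r - 1, c) else 0)"
    using hom_uni_uni_entry[OF e, of r "oth i" c] Suc.prems by (simp add: off_oth)
  also have "\<dots> = (if 1 \<le> r then e i $$ (r - 1, c) else 0)"
  proof (cases "1 \<le> r")
    case True
    then have "r - 1 < udim i l (oth i)" using Suc.prems by (auto simp: lt_udim off_oth)
    then show ?thesis using hom_uni_uni_entry[OF e, of "r - 1" i c] c by simp
  qed simp
  also have "\<dots> = (if Suc c \<le> r then e i $$ (r - Suc c, 0) else 0)"
    using Suc.IH[of "r - 1"] Suc.prems by auto
  finally show ?case .
qed simp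

text \<open>The endomorphism ring of a uniserial module is local: an endomorphism is a polynomial in the
  shift by two, and an idempotent truncated polynomial is constant.\<close>

lemma uni_end_idempotent:
  fixes e :: "vertex \<Rightarrow> 'k::field mat"
  assumes e: "e \<in> rep_hom A2bar (uni i l) (uni i l)" and idem: "\<And>j. e j * e j = e j" and l: "0 < l"
  shows "e = (\<lambda>j. 0\<^sub>m (udim i l j) (udim i l j)) \<or> e = (\<lambda>j. 1\<^sub>m (udim i l j))"
proof -
  let ?n = "udim i l i"
  have n: "0 < ?n" using l by (simp add: lt_udim)
  have ei: "e i \<in> carrier_mat ?n ?n" using rep_hom_carrier[OF e, of i] by simp
  define k where "k r = e i $$ (r, 0)" for r
  \<comment> \<open>The first column of the square is the convolution of the first column with
    itself, as for truncated polynomials.\<close>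
  have conv: "(\<Sum>s<?n. (if s \<le> r then k (r - s) else 0) * k s) = k r" if "r < ?n" for r
  proof -
    have "(e i * e i) $$ (r, 0) = (\<Sum>s<?n. e i $$ (r, s) * e i $$ (s, 0))"
      using ei that n by (auto simp: scalar_prod_def lessThan_atLeast0 intro!: sum.cong)
    also have "\<dots> = (\<Sum>s<?n. (if s \<le> r then k (r - s) else 0) * k s)"
      using uni_end_toeplitz[OF e that] by (intro sum.cong) (auto simp: k_def)
    finally show ?thesis using idem[of i] by (simp add: k_def)
  qed
  have "(\<Sum>s<?n. (if s \<le> 0 then k (0 - s) else 0) * k s) = (\<Sum>s\<in>{0}. k 0 * k s)"
    using n by (intro sum.mono_neutral_cong_right) auto
  then have "k 0 * k 0 = k 0" using conv[OF n] by simp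
  then have k0: "k 0 = 0 \<or> k 0 = 1" by (metis mult_cancel_left1)
  have kr: "k r = 0" if "0 < r" "r < ?n" for r
    using that
  proof (induction r rule: less_induct)
    case (less r)
    have "(\<Sum>s<?n. (if s \<le> r then k (r - s) else 0) * k s) = (\<Sum>s\<in>{0, r}. k (r - s) * k s)"
      using less by (intro sum.mono_neutral_cong_right) auto
    then have eq: "k r * k 0 + k 0 * k r = k r" using conv[of r] less.prems by simp
    from k0 show ?case
    proof
      assume "k 0 = 1"
      then have "k r + k r = k r + 0" using eq by (simp only: mult_1_left mult_1_right add_0_right)
      then show ?thesis by (rule add_left_imp_eq)
    qed (use eq in simp)
  qed
  let ?u = "unit_vec ?n 0 :: 'k vec"
  have col: "e i *\<^sub>v ?u = k 0 \<cdot>\<^sub>v ?u"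
    using mult_mat_unit_vec[OF ei n] ei n kr by (intro eq_vecI) (auto simp: k_def)
  have U: "is_rep A2bar (uni i l :: (vertex, arrow, 'k) rep)" by simp
  from k0 show ?thesis
  proof
    assume "k 0 = 0"
    then have "e i *\<^sub>v ?u = 0\<^sub>m ?n ?n *\<^sub>v ?u" using col by auto
    then have "e = (\<lambda>j. 0\<^sub>m (udim i l j) (udim i l j))"
      using rep_hom_zero[OF U U] by (intro hom_uni_ext[OF U e _ l]) simp_all
    then show ?thesis by simp
  next
    assume "k 0 = 1"
    then have "e i *\<^sub>v ?u = 1\<^sub>m ?n *\<^sub>v ?u" using col by auto
    then have "e = (\<lambda>j. 1\<^sub>m (udim i l j))"
      using rep_hom_id[OF U] by (intro hom_uni_ext[OF U e _ l]) simp_all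
    then show ?thesis by simp
  qed
qed

text \<open>The projection onto one summand, carried over to \<open>uni i l\<close>, is an
  idempotent endomorphism, hence 0 or 1. Carried back, it says that one of the two summands is
  zero.\<close>

lemma indecomposable_uni:
  assumes l: "0 < l"
  shows "indecomposable A2bar W (uni i l :: (vertex, arrow, 'k::field) rep)"
  unfolding indecomposable_def
proof (intro conjI allI impI)
  have "udim i l i \<noteq> 0" using l lt_udim[of 0 i l i] by simp
  then show "\<not> rep_iso A2bar (uni i l :: (vertex, arrow, 'k) rep) zero_rep"
    by (auto simp: rep_iso_zero_rep_iff)
next
  fix N N' :: "(vertex, arrow, 'k) rep"
  assume "is_module A2bar W N \<and> is_module A2bar W N' \<and> rep_iso A2bar (uni i l) (rep_sum A2bar N N')"
  then have N: "is_rep A2bar N" and N': "is_rep A2bar N'" and iso: "rep_iso A2bar (uni i l) (rep_sum A2bar N N')"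
    by (auto simp: is_module_def)
  let ?S = "rep_sum A2bar N N'" and ?U = "uni i l :: (vertex, arrow, 'k) rep"
  have S: "is_rep A2bar ?S" by (rule is_rep_rep_sum[OF N N'])
  obtain h h' where h: "h \<in> rep_hom A2bar ?U ?S" and h': "h' \<in> rep_hom A2bar ?S ?U"
    and hh: "\<And>i. h i * h' i = 1\<^sub>m (rdim ?S i)"
    using iso unfolding rep_iso_def by auto
  note hc = rep_hom_carrier[OF h] and h'c = rep_hom_carrier[OF h']
  \<comment> \<open>The projection onto the first summand.\<close>
  define d where "d j = four_block_mat (1\<^sub>m (rdim N j)) (0\<^sub>m (rdim N j) (rdim N' j))
    (0\<^sub>m (rdim N' j) (rdim N j)) (0\<^sub>m (rdim N' j) (rdim N' j) :: 'k mat)" for j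
  have dc: "d j \<in> carrier_mat (rdim ?S j) (rdim ?S j)" for j by (simp add: d_def)
  have d: "d \<in> rep_hom A2bar ?S ?S"
    unfolding rep_hom_A2bar
  proof (intro conjI allI)
    fix j
    note c = rmap_arr_carrier[OF N, of j] rmap_arr_carrier[OF N', of j]
    show "d (oth j) * rmap ?S (arr j) = rmap ?S (arr j) * d j"
      unfolding d_def rep_sum_def rep.simps src_arr tgt_arr
        mult_diag_block_mat[OF one_carrier_mat zero_carrier_mat c] mult_diag_block_mat[OF c one_carrier_mat zero_carrier_mat]
      using c by (simp add: left_mult_zero_mat[OF c(2)] right_mult_zero_mat[OF c(2)])
  qed (rule dc)
  have dd: "d j * d j = d j" for j
    unfolding d_def by (subst mult_four_block_mat) auto
  define e where "e j = h' j * (d j * h j)" for j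
  have e: "e \<in> rep_hom A2bar ?U ?U"
    unfolding e_def by (rule rep_hom_comp[OF is_rep_uni S is_rep_uni rep_hom_comp[OF is_rep_uni S S h d] h'])
  have "e j * e j = e j" for j
  proof -
    have "e j * e j = h' j * d j * (h j * (h' j * (d j * h j)))"
      unfolding e_def using assoc_mult_mat[OF h'c dc hc, of j] assoc_mult_mat[OF mult_carrier_mat[OF h'c dc] hc mult_carrier_mat[OF h'c mult_carrier_mat[OF dc hc]], of j] by simp
    also have "h j * (h' j * (d j * h j)) = d j * h j"
      using assoc_mult_mat[OF hc h'c mult_carrier_mat[OF dc hc], of j] hh[of j] left_mult_one_mat[OF mult_carrier_mat[OF dc hc]] by simp
    also have "h' j * d j * (d j * h j) = h' j * (d j * (d j * h j))"
      by (rule assoc_mult_mat[OF h'c dc mult_carrier_mat[OF dc hc]])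
    also have "d j * (d j * h j) = d j * h j" using assoc_mult_mat[OF dc dc hc, of j] dd[of j] by simp
    finally show ?thesis by (simp add: e_def)
  qed
  from uni_end_idempotent[OF e this l]
  have "e = (\<lambda>j. 0\<^sub>m (udim i l j) (udim i l j)) \<or> e = (\<lambda>j. 1\<^sub>m (udim i l j))" .
  moreover have dj: "d j = h j * (e j * h' j)" for j
  proof -
    have "h j * (e j * h' j) = h j * (h' j * (d j * h j * h' j))"
      unfolding e_def using assoc_mult_mat[OF h'c mult_carrier_mat[OF dc hc] h'c, of j] by simp
    also have "\<dots> = d j * h j * h' j"
      using assoc_mult_mat[OF hc h'c mult_carrier_mat[OF mult_carrier_mat[OF dc hc] h'c], of j] hh[of j]
        left_mult_one_mat[OF mult_carrier_mat[OF mult_carrier_mat[OF dc hc] h'c], of j] by simp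
    also have "\<dots> = d j" using assoc_mult_mat[OF dc hc h'c, of j] hh[of j] right_mult_one_mat[OF dc, of j] by simp
    finally show ?thesis ..
  qed
  ultimately show "rep_iso A2bar N zero_rep \<or> rep_iso A2bar N' zero_rep"
  proof (elim disjE)
    assume "e = (\<lambda>j. 0\<^sub>m (udim i l j) (udim i l j))"
    then have d0: "d j = 0\<^sub>m (rdim ?S j) (rdim ?S j)" for j
      using dj[of j] left_mult_zero_mat[OF h'c, of "udim i l j" j] right_mult_zero_mat[OF hc, of j] by simp
    have "rdim N j = 0" for j
    proof (rule ccontr)
      assume "rdim N j \<noteq> 0"
      then have "d j $$ (0, 0) = 1" "(0\<^sub>m (rdim ?S j) (rdim ?S j) :: 'k mat) $$ (0, 0) = 0"
        by (simp_all add: d_def)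
      then show False unfolding d0[of j] by simp
    qed
    then show ?thesis using N by (simp add: rep_iso_zero_rep_iff)
  next
    assume "e = (\<lambda>j. 1\<^sub>m (udim i l j))"
    then have d1: "d j = 1\<^sub>m (rdim ?S j)" for j
      using dj[of j] left_mult_one_mat[OF h'c, of j] hh[of j] by simp
    have "rdim N' j = 0" for j
    proof (rule ccontr)
      assume "rdim N' j \<noteq> 0"
      then have "d j $$ (rdim N j, rdim N j) = 0" "(1\<^sub>m (rdim ?S j) :: 'k mat) $$ (rdim N j, rdim N j) = 1"
        by (simp_all add: d_def)
      then show False unfolding d1[of j] by simp
    qed
    then show ?thesis using N' by (simp add: rep_iso_zero_rep_iff)
  qed
qed

text \<open>Idempotents split: \<open>N\<close> is the image of \<open>e\<close>, \<open>X\<close>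
  its inclusion in coordinates of a basis of the image, and \<open>Y\<close> the corestriction of
  \<open>e\<close>.\<close>

lemma idempotent_image:
  fixes M :: "('v, 'a, 'k::field) rep"
  assumes M: "is_rep Q M" and e: "e \<in> rep_hom Q M M" and idem: "\<And>i. e i * e i = e i"
  obtains N X Y where "is_rep Q N" "X \<in> rep_hom Q N M" "Y \<in> rep_hom Q M N"
    "\<And>i. Y i * X i = 1\<^sub>m (rdim N i)" "\<And>i. X i * Y i = e i"
proof -
  note ec = rep_hom_carrier[OF e]
  have "\<exists>k X Y. X \<in> carrier_mat (rdim M i) k \<and> Y \<in> carrier_mat k (rdim M i) \<and> Y * X = 1\<^sub>m k \<and> X * Y = e i" for i
  proof -
    let ?n = "rdim M i" and ?U = "(*\<^sub>v) (e i) ` carrier_vec (rdim M i)"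
    have U: "VectorSpace.subspace class_ring ?U (module_vec TYPE('k) ?n)"
      unfolding subspace_vec_iff
    proof (intro conjI ballI allI)
      show "0\<^sub>v ?n \<in> ?U" using mult_mat_zero_vec[OF ec[of i]] by (intro image_eqI[of _ _ "0\<^sub>v ?n"]) auto
      show "?U \<subseteq> carrier_vec ?n" using ec[of i] by auto
      fix u assume "u \<in> ?U"
      then obtain x where x: "x \<in> carrier_vec ?n" "u = e i *\<^sub>v x" by auto
      show "c \<cdot>\<^sub>v u \<in> ?U" for c
        using x mult_mat_vec[OF ec[of i], of x c] by (intro image_eqI[of _ _ "c \<cdot>\<^sub>v x"]) auto
      fix v assume "v \<in> ?U"
      then obtain y where "y \<in> carrier_vec ?n" "v = e i *\<^sub>v y" by auto
      then show "u + v \<in> ?U"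
        using x mult_add_distrib_mat_vec[OF ec[of i], of x y] by (intro image_eqI[of _ _ "x + y"]) auto
    qed
    obtain I where I: "I \<subseteq> {..<?n}" "chart ?U I" using subspace_chart[OF U] .
    let ?k = "card I"
    obtain X R where X: "X \<in> carrier_mat ?n ?k" and R: "R \<in> carrier_mat ?k ?n" and RX: "R * X = 1\<^sub>m ?k"
      and im: "(*\<^sub>v) X ` carrier_vec ?k = ?U" and XR: "\<And>u. u \<in> ?U \<Longrightarrow> X *\<^sub>v (R *\<^sub>v u) = u"
      using chart_basis[OF U I] by blast
    have eX: "e i * X = X"
    proof (rule eq_mat_on_vecI[of _ ?n ?k])
      fix y :: "'k vec" assume y: "y \<in> carrier_vec ?k"
      then have "X *\<^sub>v y \<in> ?U" using im by blast
      then obtain x where x: "x \<in> carrier_vec ?n" "X *\<^sub>v y = e i *\<^sub>v x" by auto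
      then have "e i *\<^sub>v (X *\<^sub>v y) = X *\<^sub>v y"
        using assoc_mult_mat_vec[OF ec ec x(1)] idem[of i] by simp
      then show "(e i * X) *\<^sub>v y = X *\<^sub>v y" using assoc_mult_mat_vec[OF ec X y] by simp
    qed (use ec[of i] X in auto)
    have XRe: "X * (R * e i) = e i"
    proof (rule eq_mat_on_vecI[of _ ?n ?n])
      fix y :: "'k vec" assume y: "y \<in> carrier_vec ?n"
      have "(X * (R * e i)) *\<^sub>v y = X *\<^sub>v (R *\<^sub>v (e i *\<^sub>v y))"
        using assoc_mult_mat_vec[OF X mult_carrier_mat[OF R ec] y] assoc_mult_mat_vec[OF R ec y] by simp
      also have "\<dots> = e i *\<^sub>v y" using y by (intro XR) simp
      finally show "(X * (R * e i)) *\<^sub>v y = e i *\<^sub>v y" .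
    qed (use ec[of i] X R in auto)
    have "R * e i * X = 1\<^sub>m ?k" using assoc_mult_mat[OF R ec X] eX RX by simp
    then show ?thesis using X mult_carrier_mat[OF R ec[of i]] XRe by blast
  qed
  then obtain k X Y where XY: "\<And>i. X i \<in> carrier_mat (rdim M i) (k i)" "\<And>i. Y i \<in> carrier_mat (k i) (rdim M i)"
    "\<And>i. Y i * X i = 1\<^sub>m (k i)" "\<And>i. X i * Y i = e i" by metis
  \<comment> \<open>The arrows of the image are those of \<open>M\<close>, entered by
    \<open>X\<close> and left by \<open>Y\<close>. This respects composition because
    \<open>e\<close> commutes with the arrows.\<close>
  define N where "N = \<lparr>rdim = k, rmap = (\<lambda>a. Y (tgt Q a) * (rmap M a * X (src Q a)))\<rparr>"
  have Ma: "rmap M a \<in> carrier_mat (rdim M (tgt Q a)) (rdim M (src Q a))" for a using M by (simp add: is_rep_def)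
  have N: "is_rep Q N" using mult_carrier_mat[OF XY(2) mult_carrier_mat[OF Ma XY(1)]] by (simp add: is_rep_def N_def)
  have eXX: "e i * X i = X i" for i using assoc_mult_mat[OF XY(1,2,1), of i] XY(3)[of i] right_mult_one_mat[OF XY(1)] by (simp add: XY(4))
  have Ye: "Y i * e i = Y i" for i using assoc_mult_mat[OF XY(2,1,2), of i] XY(3)[of i] left_mult_one_mat[OF XY(2)] by (simp add: XY(4))
  have comm: "e (tgt Q a) * rmap M a = rmap M a * e (src Q a)" for a using e by (simp add: rep_hom_def)
  have XN: "X (tgt Q a) * (Y (tgt Q a) * (rmap M a * X (src Q a))) = rmap M a * X (src Q a)" for a
  proof -
    have "X (tgt Q a) * (Y (tgt Q a) * (rmap M a * X (src Q a))) = e (tgt Q a) * (rmap M a * X (src Q a))"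
      using assoc_mult_mat[OF XY(1,2) mult_carrier_mat[OF Ma XY(1)], of a] by (simp add: XY(4))
    also have "\<dots> = rmap M a * e (src Q a) * X (src Q a)"
      using assoc_mult_mat[OF ec Ma XY(1), of a] by (simp add: comm)
    also have "\<dots> = rmap M a * X (src Q a)"
      using assoc_mult_mat[OF Ma ec XY(1), of a] by (simp add: eXX)
    finally show ?thesis .
  qed
  have NY: "Y (tgt Q a) * (rmap M a * X (src Q a)) * Y (src Q a) = Y (tgt Q a) * rmap M a" for a
  proof -
    have "Y (tgt Q a) * (rmap M a * X (src Q a)) * Y (src Q a) = Y (tgt Q a) * (rmap M a * e (src Q a))"
      using assoc_mult_mat[OF XY(2) mult_carrier_mat[OF Ma XY(1)] XY(2), of a] assoc_mult_mat[OF Ma XY(1,2), of a]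
      by (simp add: XY(4))
    also have "\<dots> = Y (tgt Q a) * e (tgt Q a) * rmap M a"
      using assoc_mult_mat[OF XY(2) ec Ma, of a] by (simp add: comm)
    finally show ?thesis by (simp add: Ye)
  qed
  have "X \<in> rep_hom Q N M" using XY(1) XN by (simp add: rep_hom_def N_def)
  moreover have "Y \<in> rep_hom Q M N" using XY(2) NY by (simp add: rep_hom_def N_def)
  ultimately show thesis using that[OF N] XY by (simp add: N_def)
qed

lemma retract_pmat_zero:
  assumes M: "is_rep A2bar M" and N: "is_rep A2bar N" and X: "X \<in> rep_hom A2bar N M" and Y: "Y \<in> rep_hom A2bar M N"
    and YX: "\<And>i. Y i * X i = 1\<^sub>m (rdim N i)" and z: "pmat M i n = 0\<^sub>m (rdim M (vtx i n)) (rdim M i)"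
  shows "pmat N i n = 0\<^sub>m (rdim N (vtx i n)) (rdim N i)"
proof -
  note c = rep_hom_carrier[OF X] rep_hom_carrier[OF Y] pmat_carrier[OF N, of i n]
  have "pmat N i n = Y (vtx i n) * (X (vtx i n) * pmat N i n)"
    using assoc_mult_mat[OF c(2,1,3)] YX left_mult_one_mat[OF c(3)] by simp
  also have "\<dots> = Y (vtx i n) * 0\<^sub>m (rdim M (vtx i n)) (rdim N i)"
    using rep_hom_pmat[OF N M X, of i n] z left_mult_zero_mat[OF c(1)] by simp
  finally show ?thesis using right_mult_zero_mat[OF c(2)] by simp
qed

lemma is_module_retract:
  assumes char3: "(3 :: 'k::field) \<noteq> 0"
    and M: "is_module A2bar (pot :: (vertex, arrow, 'k) series) M" and N: "is_rep A2bar N"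
    and X: "X \<in> rep_hom A2bar N M" and Y: "Y \<in> rep_hom A2bar M N" and YX: "\<And>i. Y i * X i = 1\<^sub>m (rdim N i)"
  shows "is_module A2bar (pot :: (vertex, arrow, 'k) series) N"
  using M N retract_pmat_zero[OF _ N X Y YX, of _ 5] unfolding is_module_A2bar[OF char3] by simp

text \<open>\<open>M\<close> is the direct sum of the images of \<open>e\<close> and
  \<open>1 - e\<close>. Both are retracts of \<open>M\<close>, hence modules, so indecomposability
  makes one of them zero.\<close>

lemma indecomposable_idempotent:
  assumes char3: "(3 :: 'k::field) \<noteq> 0"
    and M: "is_module A2bar (pot :: (vertex, arrow, 'k) series) M"
    and ind: "indecomposable A2bar (pot :: (vertex, arrow, 'k) series) M"
    and e: "e \<in> rep_hom A2bar M M" and idem: "\<And>i. e i * e i = e i"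
  shows "(\<forall>i. e i = 0\<^sub>m (rdim M i) (rdim M i)) \<or> (\<forall>i. e i = 1\<^sub>m (rdim M i))"
proof -
  have Mr: "is_rep A2bar M" using M by (simp add: is_module_def)
  note ec = rep_hom_carrier[OF e]
  define e' where "e' i = 1\<^sub>m (rdim M i) - e i" for i
  have e'c: "e' i \<in> carrier_mat (rdim M i) (rdim M i)" for i unfolding e'_def by (rule minus_carrier_mat[OF ec])
  have e': "e' \<in> rep_hom A2bar M M"
    unfolding rep_hom_A2bar
  proof (intro conjI allI)
    fix i
    note Mc = rmap_arr_carrier[OF Mr, of i]
    have "e' (oth i) * rmap M (arr i) = rmap M (arr i) - e (oth i) * rmap M (arr i)"
      using minus_mult_distrib_mat[OF one_carrier_mat ec Mc] left_mult_one_mat[OF Mc] by (simp add: e'_def)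
    also have "\<dots> = rmap M (arr i) - rmap M (arr i) * e i" using e by (simp add: rep_hom_A2bar)
    also have "\<dots> = rmap M (arr i) * e' i"
      using mult_minus_distrib_mat[OF Mc one_carrier_mat ec] right_mult_one_mat[OF Mc] by (simp add: e'_def)
    finally show "e' (oth i) * rmap M (arr i) = rmap M (arr i) * e' i" .
  qed (rule e'c)
  have ee': "e i * e' i = 0\<^sub>m (rdim M i) (rdim M i)" and e'e: "e' i * e i = 0\<^sub>m (rdim M i) (rdim M i)" for i
    using mult_minus_distrib_mat[OF ec one_carrier_mat ec, of i] minus_mult_distrib_mat[OF one_carrier_mat ec ec, of i] idem[of i] ec[of i]
    by (simp_all add: e'_def minus_r_inv_mat)
  have idem': "e' i * e' i = e' i" for i
  proof -
    have "e' i * e' i = e' i - e i * e' i"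
      using minus_mult_distrib_mat[OF one_carrier_mat ec e'c, of i] left_mult_one_mat[OF e'c, of i] by (simp add: e'_def[of i])
    then show ?thesis using ee'[of i] e'c[of i] by (auto intro!: eq_matI)
  qed
  obtain N X Y where N: "is_rep A2bar N" and X: "X \<in> rep_hom A2bar N M" and Y: "Y \<in> rep_hom A2bar M N"
    and YX: "\<And>i. Y i * X i = 1\<^sub>m (rdim N i)" and XY: "\<And>i. X i * Y i = e i"
    using idempotent_image[OF Mr e idem] by blast
  obtain N' X' Y' where N': "is_rep A2bar N'" and X': "X' \<in> rep_hom A2bar N' M" and Y': "Y' \<in> rep_hom A2bar M N'"
    and YX': "\<And>i. Y' i * X' i = 1\<^sub>m (rdim N' i)" and XY': "\<And>i. X' i * Y' i = e' i"
    using idempotent_image[OF Mr e' idem'] by blast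
  note c = rep_hom_carrier[OF X] rep_hom_carrier[OF Y] rep_hom_carrier[OF X'] rep_hom_carrier[OF Y']
  \<comment> \<open>The mixed composites \<open>Y * X'\<close> and \<open>Y' * X\<close> vanish:
    framed by the splittings they are products of \<open>e\<close> and \<open>1 - e\<close>, and the
    outer factors cancel from the inside.\<close>
  have zero_mid: "A * B = 0\<^sub>m p q"
    if "A \<in> carrier_mat p n" "B \<in> carrier_mat n q" "C \<in> carrier_mat n p" "D \<in> carrier_mat q n"
      "A * C = 1\<^sub>m p" "D * B = 1\<^sub>m q" "C * A * (B * D) = 0\<^sub>m n n" for A B C D :: "'k mat" and p q n
  proof -
    have "A * (C * A * (B * D)) * B = A * B"
    proof -
      have "C * A * (B * D) = C * (A * B * D)"
        using assoc_mult_mat[OF that(3,1) mult_carrier_mat[OF that(2,4)]] assoc_mult_mat[OF that(1,2,4)] by simp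
      then have "A * (C * A * (B * D)) = A * B * D"
        using assoc_mult_mat[OF that(1,3) mult_carrier_mat[OF mult_carrier_mat[OF that(1,2)] that(4)]]
          left_mult_one_mat[OF mult_carrier_mat[OF mult_carrier_mat[OF that(1,2)] that(4)]] that(5) by simp
      then show ?thesis
        using assoc_mult_mat[OF mult_carrier_mat[OF that(1,2)] that(4,2)] right_mult_one_mat[OF mult_carrier_mat[OF that(1,2)]] that(6) by simp
    qed
    then show ?thesis using that right_mult_zero_mat[OF that(1), of n] left_mult_zero_mat[OF that(2), of p] by simp
  qed
  have YX'0: "Y i * X' i = 0\<^sub>m (rdim N i) (rdim N' i)" for i
    by (rule zero_mid[OF c(2) c(3) c(1) c(4) YX YX']) (simp add: XY XY' ee')
  have Y'X0: "Y' i * X i = 0\<^sub>m (rdim N' i) (rdim N i)" for i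
    by (rule zero_mid[OF c(4) c(1) c(3) c(2) YX' YX]) (simp add: XY XY' e'e)
  let ?S = "rep_sum A2bar N N'"
  \<comment> \<open>\<open>Y\<close> stacked on top of \<open>Y'\<close>, and below \<open>X\<close>
    next to \<open>X'\<close>. Blocks with zero columns or zero rows turn both into block
    matrices.\<close>
  define h where "h i = four_block_mat (Y i) (0\<^sub>m (rdim N i) 0) (Y' i) (0\<^sub>m (rdim N' i) 0)" for i
  define h' where "h' i = four_block_mat (X i) (X' i) (0\<^sub>m 0 (rdim N i)) (0\<^sub>m 0 (rdim N' i))" for i
  have hc: "h i \<in> carrier_mat (rdim ?S i) (rdim M i)" and h'c: "h' i \<in> carrier_mat (rdim M i) (rdim ?S i)" for i
    using c[of i] by (auto simp: h_def h'_def)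
  have hh': "h i * h' i = 1\<^sub>m (rdim ?S i)" for i
  proof -
    have "h i * h' i = four_block_mat (Y i * X i + 0\<^sub>m (rdim N i) 0 * 0\<^sub>m 0 (rdim N i)) (Y i * X' i + 0\<^sub>m (rdim N i) 0 * 0\<^sub>m 0 (rdim N' i))
       (Y' i * X i + 0\<^sub>m (rdim N' i) 0 * 0\<^sub>m 0 (rdim N i)) (Y' i * X' i + 0\<^sub>m (rdim N' i) 0 * 0\<^sub>m 0 (rdim N' i))"
      unfolding h_def h'_def by (rule mult_four_block_mat[OF c(2) _ c(4) _ c(1) c(3)]) auto
    also have "\<dots> = four_block_mat (1\<^sub>m (rdim N i)) (0\<^sub>m (rdim N i) (rdim N' i)) (0\<^sub>m (rdim N' i) (rdim N i)) (1\<^sub>m (rdim N' i))"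
      by (simp add: YX YX' YX'0 Y'X0)
    also have "\<dots> = 1\<^sub>m (rdim ?S i)" by (simp add: four_block_one_mat)
    finally show ?thesis .
  qed
  have h'h: "h' i * h i = 1\<^sub>m (rdim M i)" for i
  proof -
    have "h' i * h i = four_block_mat (X i * Y i + X' i * Y' i) (X i * 0\<^sub>m (rdim N i) 0 + X' i * 0\<^sub>m (rdim N' i) 0)
       (0\<^sub>m 0 (rdim N i) * Y i + 0\<^sub>m 0 (rdim N' i) * Y' i) (0\<^sub>m 0 (rdim N i) * 0\<^sub>m (rdim N i) 0 + 0\<^sub>m 0 (rdim N' i) * 0\<^sub>m (rdim N' i) 0)"
      unfolding h_def h'_def by (rule mult_four_block_mat[OF c(1) c(3) _ _ c(2) _ c(4)]) auto
    also have "X i * Y i + X' i * Y' i = 1\<^sub>m (rdim M i)"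
      using ec[of i] unfolding XY XY' e'_def by (intro eq_matI) auto
    finally show ?thesis using c[of i] by (auto intro!: eq_matI)
  qed
  have h: "h \<in> rep_hom A2bar M ?S"
    unfolding rep_hom_A2bar
  proof (intro conjI allI)
    fix i
    note nc = rmap_arr_carrier[OF N, of i] rmap_arr_carrier[OF N', of i] rmap_arr_carrier[OF Mr, of i]
    have "rmap ?S (arr i) * h i = four_block_mat (rmap N (arr i) * Y i + 0\<^sub>m (rdim N (oth i)) (rdim N' i) * Y' i)
       (rmap N (arr i) * 0\<^sub>m (rdim N i) 0 + 0\<^sub>m (rdim N (oth i)) (rdim N' i) * 0\<^sub>m (rdim N' i) 0)
       (0\<^sub>m (rdim N' (oth i)) (rdim N i) * Y i + rmap N' (arr i) * Y' i)
       (0\<^sub>m (rdim N' (oth i)) (rdim N i) * 0\<^sub>m (rdim N i) 0 + rmap N' (arr i) * 0\<^sub>m (rdim N' i) 0)"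
      unfolding h_def rep_sum_def rep.simps src_arr tgt_arr
      by (rule mult_four_block_mat[OF nc(1) _ _ nc(2) c(2) _ c(4)]) auto
    also have "\<dots> = four_block_mat (Y (oth i) * rmap M (arr i)) (0\<^sub>m (rdim N (oth i)) 0) (Y' (oth i) * rmap M (arr i)) (0\<^sub>m (rdim N' (oth i)) 0)"
    proof -
      have "Y (oth i) * rmap M (arr i) = rmap N (arr i) * Y i" "Y' (oth i) * rmap M (arr i) = rmap N' (arr i) * Y' i"
        using Y Y' by (simp_all add: rep_hom_A2bar)
      moreover have "rmap N (arr i) * Y i \<in> carrier_mat (rdim N (oth i)) (rdim M i)" "rmap N' (arr i) * Y' i \<in> carrier_mat (rdim N' (oth i)) (rdim M i)"
        using nc c[of i] by auto
      ultimately show ?thesis using nc c[of i]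
        by (simp add: left_mult_zero_mat[OF c(2)] left_mult_zero_mat[OF c(4)] right_mult_zero_mat[OF nc(1)] right_mult_zero_mat[OF nc(2)])
    qed
    also have "\<dots> = h (oth i) * rmap M (arr i)"
    proof (rule eq_mat_on_vecI[of _ "rdim ?S (oth i)" "rdim M i"])
      fix v :: "'k vec" assume v: "v \<in> carrier_vec (rdim M i)"
      have rows: "four_block_mat A (0\<^sub>m p 0) B (0\<^sub>m q 0) *\<^sub>v w = (A *\<^sub>v w) @\<^sub>v (B *\<^sub>v w)"
        if "A \<in> carrier_mat p n" "B \<in> carrier_mat q n" "w \<in> carrier_vec n" for A B :: "'k mat" and w p q n
        using that by (intro eq_vecI) (auto simp: scalar_prod_def intro!: sum.cong)
      show "four_block_mat (Y (oth i) * rmap M (arr i)) (0\<^sub>m (rdim N (oth i)) 0) (Y' (oth i) * rmap M (arr i)) (0\<^sub>m (rdim N' (oth i)) 0) *\<^sub>v v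
          = (h (oth i) * rmap M (arr i)) *\<^sub>v v"
        unfolding assoc_mult_mat_vec[OF hc nc(3) v] rows[OF mult_carrier_mat[OF c(2) nc(3)] mult_carrier_mat[OF c(4) nc(3)] v]
          assoc_mult_mat_vec[OF c(2) nc(3) v] assoc_mult_mat_vec[OF c(4) nc(3) v]
        unfolding h_def rows[OF c(2) c(4) mult_mat_vec_carrier[OF nc(3) v]] ..
    qed (use hc[of "oth i"] nc c[of "oth i"] in auto)
    finally show "h (oth i) * rmap M (arr i) = rmap ?S (arr i) * h i" ..
  qed (rule hc)
  \<comment> \<open>The inverse of a homomorphism is a homomorphism.\<close>
  have h': "h' \<in> rep_hom A2bar ?S M"
    unfolding rep_hom_A2bar
  proof (intro conjI allI)
    fix i
    note Sc = rmap_arr_carrier[OF is_rep_rep_sum[OF N N'], of i] and Mc = rmap_arr_carrier[OF Mr, of i]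
    have "h' (oth i) * rmap ?S (arr i) = h' (oth i) * (rmap ?S (arr i) * h i) * h' i"
      using assoc_mult_mat[OF Sc hc h'c] assoc_mult_mat[OF h'c mult_carrier_mat[OF Sc hc] h'c] hh'[of i] right_mult_one_mat[OF Sc] by simp
    also have "\<dots> = h' (oth i) * (h (oth i) * rmap M (arr i)) * h' i"
      using h by (simp add: rep_hom_A2bar)
    also have "\<dots> = rmap M (arr i) * h' i"
      using assoc_mult_mat[OF h'c hc Mc] h'h[of "oth i"] left_mult_one_mat[OF Mc] by simp
    finally show "h' (oth i) * rmap ?S (arr i) = rmap M (arr i) * h' i" .
  qed (rule h'c)
  have iso: "rep_iso A2bar M ?S"
    unfolding rep_iso_def using hh' h'h by (intro bexI[OF _ h] bexI[OF _ h']) simp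
  have "is_module A2bar (pot :: (vertex, arrow, 'k) series) N" "is_module A2bar (pot :: (vertex, arrow, 'k) series) N'"
    by (rule is_module_retract[OF char3 M N X Y YX] is_module_retract[OF char3 M N' X' Y' YX'])+
  then have "rep_iso A2bar N zero_rep \<or> rep_iso A2bar N' zero_rep"
    using ind iso unfolding indecomposable_def by simp
  then show ?thesis
  proof
    assume "rep_iso A2bar N zero_rep"
    then have "rdim N i = 0" for i using N by (simp add: rep_iso_zero_rep_iff)
    then have "e i = 0\<^sub>m (rdim M i) (rdim M i)" for i
      using c(1,2)[of i] unfolding XY[symmetric] by (auto intro!: eq_matI simp: scalar_prod_def)
    then show ?thesis by simp
  next
    assume "rep_iso A2bar N' zero_rep"
    then have "rdim N' i = 0" for i using N' by (simp add: rep_iso_zero_rep_iff)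
    then have e'0: "e' i = 0\<^sub>m (rdim M i) (rdim M i)" for i
      using c(3,4)[of i] unfolding XY'[symmetric] by (auto intro!: eq_matI simp: scalar_prod_def)
    have "e i = 1\<^sub>m (rdim M i)" for i
    proof (rule eq_matI)
      fix r c assume rc: "r < dim_row (1\<^sub>m (rdim M i))" "c < dim_col (1\<^sub>m (rdim M i))"
      then have "e' i $$ (r, c) = 1\<^sub>m (rdim M i) $$ (r, c) - e i $$ (r, c)" using ec[of i] by (simp add: e'_def)
      then show "e i $$ (r, c) = 1\<^sub>m (rdim M i) $$ (r, c)" using rc by (simp add: e'0)
    qed (use ec[of i] in auto)
    then show ?thesis by simp
  qed
qed

section \<open>Indecomposable modules\<close>

text \<open>Dual to \<open>gen_hom\<close>: a functional \<open>y\<close> at the vertex of the socle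
  induces a map to \<open>uni i l\<close>. The coordinate for path length \<open>m\<close> is the
  value of \<open>y\<close> after the remaining \<open>l - 1 - m\<close> steps, so the socle
  coordinate is \<open>y\<close> itself.\<close>

definition cogen_hom :: "(vertex, arrow, 'k::field) rep \<Rightarrow> vertex \<Rightarrow> nat \<Rightarrow> 'k vec \<Rightarrow> vertex \<Rightarrow> 'k mat" where
  "cogen_hom M i l y j = mat (udim i l j) (rdim M j) (\<lambda>(r, c). y \<bullet> col (pmat M j (l - 1 - (2 * r + off i j))) c)"

lemma scalar_prod_mult_mat_vec:
  fixes A :: "'k::field mat"
  assumes A: "A \<in> carrier_mat n m" and y: "y \<in> carrier_vec n" and w: "w \<in> carrier_vec m"
  shows "y \<bullet> (A *\<^sub>v w) = (\<Sum>c<m. (y \<bullet> col A c) * w $ c)"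
proof -
  have "y \<bullet> (A *\<^sub>v w) = (\<Sum>r<n. \<Sum>c<m. y $ r * (A $$ (r, c) * w $ c))"
    using A w mult_mat_vec_expand[OF A w] unfolding scalar_prod_def
    by (auto simp: lessThan_atLeast0 sum_distrib_left simp del: index_mult_mat_vec intro!: sum.cong)
  also have "\<dots> = (\<Sum>c<m. \<Sum>r<n. y $ r * (A $$ (r, c) * w $ c))" by (rule sum.swap)
  also have "\<dots> = (\<Sum>c<m. (y \<bullet> col A c) * w $ c)"
    using A by (auto simp: scalar_prod_def lessThan_atLeast0 sum_distrib_right mult.assoc intro!: sum.cong)
  finally show ?thesis .
qed

lemma cogen_hom_vec:
  assumes M: "is_rep A2bar M" and y: "y \<in> carrier_vec (rdim M (vtx i (l - 1)))"
    and w: "w \<in> carrier_vec (rdim M j)" and r: "r < udim i l j"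
  shows "(cogen_hom M i l y j *\<^sub>v w) $ r = y \<bullet> (pmat M j (l - 1 - (2 * r + off i j)) *\<^sub>v w)"
proof -
  let ?m = "2 * r + off i j"
  have "?m \<le> l - 1" using r by (simp add: lt_udim)
  then have "?m + (l - 1 - ?m) = l - 1" by simp
  then have "vtx j (l - 1 - ?m) = vtx i (l - 1)"
    using vtx_vtx[of i ?m "l - 1 - ?m"] by (simp only: vtx_off)
  then have c: "pmat M j (l - 1 - ?m) \<in> carrier_mat (rdim M (vtx i (l - 1))) (rdim M j)"
    using pmat_carrier[OF M, of j "l - 1 - ?m"] by simp
  show ?thesis
    unfolding scalar_prod_mult_mat_vec[OF c y w]
    using mult_mat_vec_expand[of "cogen_hom M i l y j" "udim i l j" "rdim M j" w r] w r
    by (simp add: cogen_hom_def del: index_mult_mat_vec)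
qed

lemma cogen_hom_hom:
  fixes M :: "(vertex, arrow, 'k::field) rep"
  assumes M: "is_rep A2bar M" and y: "y \<in> carrier_vec (rdim M (vtx i (l - 1)))"
    and zero: "\<And>j. pmat M j l = 0\<^sub>m (rdim M (vtx j l)) (rdim M j)" and l: "0 < l"
  shows "cogen_hom M i l y \<in> rep_hom A2bar M (uni i l)"
  unfolding rep_hom_A2bar
proof (intro conjI allI)
  fix j
  have g: "cogen_hom M i l y k \<in> carrier_mat (udim i l k) (rdim M k)" for k by (simp add: cogen_hom_def)
  then show "cogen_hom M i l y j \<in> carrier_mat (rdim (uni i l) j) (rdim M j)" by simp
  note Mc = rmap_arr_carrier[OF M, of j]
  have Uc: "(rmap (uni i l) (arr j) :: 'k mat) \<in> carrier_mat (udim i l (oth j)) (udim i l j)"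
    using rmap_arr_carrier[OF is_rep_uni, of i l j] by simp
  show "cogen_hom M i l y (oth j) * rmap M (arr j) = rmap (uni i l) (arr j) * cogen_hom M i l y j"
  proof (rule eq_mat_on_vecI[OF mult_carrier_mat[OF g Mc] mult_carrier_mat[OF Uc g]])
    fix w :: "'k vec" assume w: "w \<in> carrier_vec (rdim M j)"
    have Mw: "rmap M (arr j) *\<^sub>v w \<in> carrier_vec (rdim M (oth j))" using Mc w by simp
    have gw: "cogen_hom M i l y j *\<^sub>v w \<in> carrier_vec (udim i l j)" using g[of j] w by simp
    show "(cogen_hom M i l y (oth j) * rmap M (arr j)) *\<^sub>v w = (rmap (uni i l) (arr j) * cogen_hom M i l y j) *\<^sub>v w"
      unfolding assoc_mult_mat_vec[OF g Mc w] assoc_mult_mat_vec[OF Uc g w]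
    proof (rule eq_vecI)
      fix r assume "r < dim_vec (rmap (uni i l) (arr j) *\<^sub>v (cogen_hom M i l y j *\<^sub>v w))"
      then have r: "r < udim i l (oth j)" using Uc by simp
      let ?m = "2 * r + off i (oth j)"
      have m: "?m \<le> l - 1" using r by (simp add: lt_udim)
      have "pmat M j (Suc n) *\<^sub>v w = pmat M (oth j) n *\<^sub>v (rmap M (arr j) *\<^sub>v w)" for n
        using assoc_mult_mat_vec[OF pmat_carrier[OF M] Mc w, of n] by simp
      then have lhs: "(cogen_hom M i l y (oth j) *\<^sub>v (rmap M (arr j) *\<^sub>v w)) $ r = y \<bullet> (pmat M j (Suc (l - 1 - ?m)) *\<^sub>v w)"
        using cogen_hom_vec[OF M y Mw r] by (simp only:)
      show "(cogen_hom M i l y (oth j) *\<^sub>v (rmap M (arr j) *\<^sub>v w)) $ r = (rmap (uni i l) (arr j) *\<^sub>v (cogen_hom M i l y j *\<^sub>v w)) $ r"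
      proof (cases "off i j \<le> r")
        case True
        then have r': "r - off i j < udim i l j" and "l - 1 - (2 * (r - off i j) + off i j) = Suc (l - 1 - ?m)"
          using r m off_0_or_1[of i j] by (auto simp: lt_udim off_oth)
        then have "(cogen_hom M i l y j *\<^sub>v w) $ (r - off i j) = y \<bullet> (pmat M j (Suc (l - 1 - ?m)) *\<^sub>v w)"
          using cogen_hom_vec[OF M y w r'] by (simp only:)
        then show ?thesis unfolding lhs using rmap_uni_vec[OF gw r] True by simp
      next
        \<comment> \<open>This is the coordinate of the generator, which is in the image of no
          arrow. On the other side stands a path of length \<open>l\<close>, which is zero on
          \<open>M\<close>.\<close>
        case False
        then have "?m = 0" using off_0_or_1[of i j] by (auto simp: off_oth)
        then have s: "Suc (l - 1 - ?m) = l" using l by simp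
        have "j = oth i" using False by (intro neq_oth) (auto simp: off_def)
        then have "vtx j l = vtx i (l - 1)" using l by (cases l) simp_all
        then have "y \<bullet> (pmat M j l *\<^sub>v w) = 0" using y w by (simp add: zero)
        then show ?thesis unfolding lhs s using rmap_uni_vec[OF gw r] False by simp
      qed
    qed (use g[of "oth j"] Uc in simp)
  qed
qed

text \<open>A longest nonzero path starting at \<open>v\<close> generates a uniserial submodule \<open>uni i l\<close>, where \<open>l\<close> is the
  Loewy length. After a triangular change of \<open>v\<close>, a functional detecting its socle retracts
  \<open>M\<close> onto it.\<close>

lemma triangular_functional:
  fixes M :: "(vertex, arrow, 'k::field) rep"
  assumes M: "is_rep A2bar M" and y: "y \<in> carrier_vec (rdim M (vtx i (l - 1)))"
    and v0: "v0 \<in> carrier_vec (rdim M i)"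
    and zero: "\<And>j. pmat M j l = 0\<^sub>m (rdim M (vtx j l)) (rdim M j)" and l: "0 < l"
    and one: "y \<bullet> (pmat M i (l - 1) *\<^sub>v v0) = 1"
  shows "\<exists>v\<in>carrier_vec (rdim M i). y \<bullet> (pmat M i (l - 1) *\<^sub>v v) = 1 \<and>
    (\<forall>k. 0 < k \<and> k \<le> n \<and> 2 * k \<le> l - 1 \<longrightarrow> y \<bullet> (pmat M i (l - 1 - 2 * k) *\<^sub>v v) = 0)"
proof (induction n)
  case (Suc n)
  then obtain v where v: "v \<in> carrier_vec (rdim M i)" and v1: "y \<bullet> (pmat M i (l - 1) *\<^sub>v v) = 1"
    and vk: "\<And>k. 0 < k \<Longrightarrow> k \<le> n \<Longrightarrow> 2 * k \<le> l - 1 \<Longrightarrow> y \<bullet> (pmat M i (l - 1 - 2 * k) *\<^sub>v v) = 0"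
    by blast
  let ?b = "y \<bullet> (pmat M i (l - 1 - 2 * Suc n) *\<^sub>v v)" and ?t = "pmat M i (2 * Suc n) *\<^sub>v v"
  have ve: "vtx i (2 * k) = i" for k by (simp add: vtx_def)
  have t: "?t \<in> carrier_vec (rdim M i)" using pmat_vec_carrier[OF M v, of "2 * Suc n"] ve[of "Suc n"] by (simp only:)
  \<comment> \<open>Subtracting this multiple cancels the value for \<open>k = Suc n\<close>,
    because \<open>y\<close> is 1 on the longest path. For smaller \<open>k\<close>, and for the
    longest path itself, the correction involves paths of length at least \<open>l\<close>, which
    vanish.\<close>
  define v' where "v' = v + (- ?b) \<cdot>\<^sub>v ?t"
  have v': "v' \<in> carrier_vec (rdim M i)" using v t by (simp add: v'_def del: index_mult_mat_vec)
  have yv': "y \<bullet> (pmat M i m *\<^sub>v v') = y \<bullet> (pmat M i m *\<^sub>v v) - ?b * (y \<bullet> (pmat M i (2 * Suc n + m) *\<^sub>v v))"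
    if "vtx i m = vtx i (l - 1)" for m
  proof -
    have c: "pmat M i m \<in> carrier_mat (rdim M (vtx i (l - 1))) (rdim M i)" using pmat_carrier[OF M, of i m] that by simp
    have "pmat M i m *\<^sub>v v' = pmat M i m *\<^sub>v v + (- ?b) \<cdot>\<^sub>v (pmat M i m *\<^sub>v ?t)"
      unfolding v'_def using v t mult_add_distrib_mat_vec[OF c v, of "(- ?b) \<cdot>\<^sub>v ?t"] mult_mat_vec[OF c t] by simp
    moreover have "pmat M i (2 * Suc n + m) *\<^sub>v v = pmat M i m *\<^sub>v ?t"
      using pmat_vec_add[OF M v, of "2 * Suc n" m] ve[of "Suc n"] by (simp only:)
    moreover have "pmat M i m *\<^sub>v v \<in> carrier_vec (rdim M (vtx i (l - 1)))" "pmat M i m *\<^sub>v ?t \<in> carrier_vec (rdim M (vtx i (l - 1)))"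
      by (rule mult_mat_vec_carrier[OF c v] mult_mat_vec_carrier[OF c t])+
    ultimately show ?thesis
      using y scalar_prod_add_distrib[OF y, of "pmat M i m *\<^sub>v v" "(- ?b) \<cdot>\<^sub>v (pmat M i m *\<^sub>v ?t)"]
      by (simp del: index_mult_mat_vec path_map.simps alt.simps)
  qed
  have big: "y \<bullet> (pmat M i m *\<^sub>v v) = 0" if "l \<le> m" "vtx i m = vtx i (l - 1)" for m
  proof -
    have "pmat M i l *\<^sub>v v = 0\<^sub>v (rdim M (vtx i l))" using v by (simp add: zero)
    from pmat_vec_zero_mono[OF M v this that(1)] show ?thesis using y that(2) by simp
  qed
  have vm: "vtx i (l - 1 - 2 * k) = vtx i (l - 1)" if "2 * k \<le> l - 1" for k
    using that l by (auto simp: vtx_def)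
  have "y \<bullet> (pmat M i (l - 1) *\<^sub>v v') = 1"
    using yv'[of "l - 1"] big[of "2 * Suc n + (l - 1)"] v1 l by (simp add: vtx_def del: path_map.simps alt.simps)
  moreover have "y \<bullet> (pmat M i (l - 1 - 2 * k) *\<^sub>v v') = 0" if k: "0 < k" "k \<le> Suc n" "2 * k \<le> l - 1" for k
  proof (cases "k = Suc n")
    case True
    then have "2 * Suc n + (l - 1 - 2 * k) = l - 1" using k by simp
    then show ?thesis using yv'[OF vm[OF k(3)]] v1 True by (simp only:) simp
  next
    case False
    then have "l \<le> 2 * Suc n + (l - 1 - 2 * k)" "vtx i (2 * Suc n + (l - 1 - 2 * k)) = vtx i (l - 1)"
      using k l vm[OF k(3)] by (auto simp: vtx_def)
    from big[OF this] show ?thesis using yv'[OF vm[OF k(3)]] vk[of k] k False by simp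
  qed
  ultimately show ?case using v' by blast
qed (use v0 one in auto)

text \<open>The retraction yields an idempotent of \<open>M\<close> that factors through
  \<open>uni i l\<close>. It is not 0, so by indecomposability it is 1, and the inclusion of
  \<open>uni i l\<close> is an isomorphism.\<close>

lemma indecomposable_is_uni:
  fixes M :: "(vertex, arrow, 'k::field) rep"
  assumes char3: "(3 :: 'k) \<noteq> 0"
    and M: "is_module A2bar (pot :: (vertex, arrow, 'k) series) M"
    and ind: "indecomposable A2bar (pot :: (vertex, arrow, 'k) series) M"
  obtains i l where "0 < l" "l \<le> 5" "rep_iso A2bar (uni i l) M"
proof -
  have Mr: "is_rep A2bar M" and M5: "\<And>i. pmat M i 5 = 0\<^sub>m (rdim M (vtx i 5)) (rdim M i)"
    using M by (simp_all add: is_module_A2bar[OF char3])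
  define Z where "Z l \<longleftrightarrow> (\<forall>i. pmat M i l = 0\<^sub>m (rdim M (vtx i l)) (rdim M i))" for l
  \<comment> \<open>The Loewy length: all paths of length \<open>l\<close> vanish on
    \<open>M\<close>, but some path of length \<open>l - 1\<close> does not.\<close>
  define l where "l = (LEAST l. Z l)"
  have "Z 5" using M5 by (simp only: Z_def) simp
  then have Zl: "Z l" and l5: "l \<le> 5" unfolding l_def by (auto intro: LeastI Least_le)
  have l0: "0 < l"
  proof (rule ccontr)
    assume "\<not> 0 < l"
    then have z: "1\<^sub>m (rdim M i) = (0\<^sub>m (rdim M i) (rdim M i) :: 'k mat)" for i using Zl by (simp add: Z_def)
    have "rdim M i = 0" for i
    proof (rule ccontr)
      assume "rdim M i \<noteq> 0"
      then show False using arg_cong[OF z[of i], of "\<lambda>A. A $$ (0, 0)"] by simp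
    qed
    then show False using ind Mr by (simp add: indecomposable_def rep_iso_zero_rep_iff)
  qed
  have zero: "pmat M j l = 0\<^sub>m (rdim M (vtx j l)) (rdim M j)" for j using Zl by (simp add: Z_def)
  have "\<not> Z (l - 1)" unfolding l_def using l0 not_less_Least[of "l - 1" Z] by (simp add: l_def)
  then obtain i where i: "pmat M i (l - 1) \<noteq> 0\<^sub>m (rdim M (vtx i (l - 1))) (rdim M i)" by (auto simp: Z_def)
  note Pc = pmat_carrier[OF Mr, of i "l - 1"]
  have "\<exists>r<rdim M (vtx i (l - 1)). \<exists>c<rdim M i. pmat M i (l - 1) $$ (r, c) \<noteq> 0"
  proof (rule ccontr)
    assume "\<not> ?thesis"
    then have "pmat M i (l - 1) = 0\<^sub>m (rdim M (vtx i (l - 1))) (rdim M i)"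
      using Pc by (intro eq_matI) auto
    then show False using i by simp
  qed
  then obtain r c where rc: "r < rdim M (vtx i (l - 1))" "c < rdim M i" "pmat M i (l - 1) $$ (r, c) \<noteq> 0"
    by blast
  \<comment> \<open>The coordinate functional at a nonzero entry of the longest nonvanishing path,
    scaled to the value 1.\<close>
  define y where "y = (1 / pmat M i (l - 1) $$ (r, c)) \<cdot>\<^sub>v unit_vec (rdim M (vtx i (l - 1))) r"
  have y: "y \<in> carrier_vec (rdim M (vtx i (l - 1)))" by (simp add: y_def)
  have "y \<bullet> (pmat M i (l - 1) *\<^sub>v unit_vec (rdim M i) c) = 1"
    using mult_mat_unit_vec[OF Pc rc(2)] rc Pc by (simp add: y_def)
  from triangular_functional[OF Mr y unit_vec_carrier zero l0 this, of l]
  obtain v where v: "v \<in> carrier_vec (rdim M i)" and v1: "y \<bullet> (pmat M i (l - 1) *\<^sub>v v) = 1"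
    and vk: "\<And>k. 0 < k \<Longrightarrow> 2 * k \<le> l - 1 \<Longrightarrow> y \<bullet> (pmat M i (l - 1 - 2 * k) *\<^sub>v v) = 0"
    by auto
  have vz: "pmat M i l *\<^sub>v v = 0\<^sub>v (rdim M (vtx i l))" using v by (simp add: zero)
  let ?g = "gen_hom M i l v" and ?p = "cogen_hom M i l y"
  have g: "?g \<in> rep_hom A2bar (uni i l) M" by (rule gen_hom_hom[OF Mr v vz])
  have p: "?p \<in> rep_hom A2bar M (uni i l)" by (rule cogen_hom_hom[OF Mr y zero l0])
  have gc: "?g j \<in> carrier_mat (rdim M j) (udim i l j)" and pc: "?p j \<in> carrier_mat (udim i l j) (rdim M j)" for j
    by (simp_all add: gen_hom_def cogen_hom_def)
  \<comment> \<open>The entry \<open>(a, b)\<close> is \<open>y\<close> on the path of length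
    \<open>l - 1 + 2 * (b - a)\<close>, read as an integer. It is 0 above the Loewy bound, 1 for
    \<open>a = b\<close>, and 0 for shorter paths by the choice of \<open>v\<close>.\<close>
  have pg: "?p j * ?g j = 1\<^sub>m (udim i l j)" for j
  proof (rule eq_matI)
    fix a b assume "a < dim_row (1\<^sub>m (udim i l j))" "b < dim_col (1\<^sub>m (udim i l j))"
    then have ab: "a < udim i l j" "b < udim i l j" by auto
    let ?a = "2 * a + off i j" and ?b = "2 * b + off i j"
    have a: "?a \<le> l - 1" and b: "?b \<le> l - 1" using ab by (simp_all add: lt_udim)
    have "(?p j * ?g j) $$ (a, b) = ((?p j * ?g j) *\<^sub>v unit_vec (udim i l j) b) $ a"
      using mult_mat_unit_vec[OF mult_carrier_mat[OF pc gc] ab(2)] ab pc[of j] gc[of j] by simp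
    also have "\<dots> = (?p j *\<^sub>v (pmat M i ?b *\<^sub>v v)) $ a"
      using assoc_mult_mat_vec[OF pc gc unit_vec_carrier, of j b] gen_hom_unit_vec[OF Mr v ab(2)] by simp
    also have "\<dots> = y \<bullet> (pmat M j (l - 1 - ?a) *\<^sub>v (pmat M i ?b *\<^sub>v v))"
      using cogen_hom_vec[OF Mr y _ ab(1)] pmat_vec_carrier[OF Mr v, of ?b] by simp
    also have "pmat M j (l - 1 - ?a) *\<^sub>v (pmat M i ?b *\<^sub>v v) = pmat M i (?b + (l - 1 - ?a)) *\<^sub>v v"
      using pmat_vec_add[OF Mr v, of ?b "l - 1 - ?a"] by simp
    also have "y \<bullet> (pmat M i (?b + (l - 1 - ?a)) *\<^sub>v v) = (if a = b then 1 else 0)"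
    proof (cases a b rule: linorder_cases)
      case less
      then have "?b + (l - 1 - ?a) = 2 * (b - a) + (l - 1)" "l \<le> ?b + (l - 1 - ?a)" using a l0 by auto
      moreover have "vtx i (2 * (b - a) + (l - 1)) = vtx i (l - 1)" by (simp add: vtx_def)
      ultimately have "pmat M i (?b + (l - 1 - ?a)) *\<^sub>v v = 0\<^sub>v (rdim M (vtx i (l - 1)))"
        using pmat_vec_zero_mono[OF Mr v vz, of "?b + (l - 1 - ?a)"] by (simp only:)
      then show ?thesis using y less by simp
    next
      case equal
      then have "?b + (l - 1 - ?a) = l - 1" using a by simp
      then show ?thesis using v1 equal by (simp only:) simp
    next
      case greater
      have "?b + (l - 1 - ?a) = l - 1 - 2 * (a - b)" "2 * (a - b) \<le> l - 1" using greater a by auto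
      then show ?thesis using vk[of "a - b"] greater by (simp only:) simp
    qed
    finally show "(?p j * ?g j) $$ (a, b) = 1\<^sub>m (udim i l j) $$ (a, b)" using ab by simp
  qed (use gc[of j] pc[of j] in auto)
  have e: "(\<lambda>j. ?g j * ?p j) \<in> rep_hom A2bar M M" by (rule rep_hom_comp[OF Mr is_rep_uni Mr p g])
  have "?g j * ?p j * (?g j * ?p j) = ?g j * ?p j" for j by (rule mult_mat_cancel_mid[OF gc pc gc pc pg])
  from indecomposable_idempotent[OF char3 M ind e this]
  have "\<forall>j. ?g j * ?p j = 1\<^sub>m (rdim M j)"
  proof
    assume z: "\<forall>j. ?g j * ?p j = 0\<^sub>m (rdim M j) (rdim M j)"
    have "?p i * (?g i * ?p i) * ?g i = 1\<^sub>m (udim i l i)"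
      using assoc_mult_mat[OF pc gc pc, of i] assoc_mult_mat[OF mult_carrier_mat[OF pc gc] pc gc, of i] by (simp add: pg)
    then have "1\<^sub>m (udim i l i) = (0\<^sub>m (udim i l i) (udim i l i) :: 'k mat)"
      using z right_mult_zero_mat[OF pc, of i] left_mult_zero_mat[OF gc, of "udim i l i" i] by simp
    then have "(1\<^sub>m (udim i l i) :: 'k mat) $$ (0, 0) = 0\<^sub>m (udim i l i) (udim i l i) $$ (0, 0)" by simp
    moreover have "0 < udim i l i" using l0 by (simp add: lt_udim)
    ultimately show ?thesis by simp
  qed
  then have "rep_iso A2bar (uni i l) M"
    unfolding rep_iso_def using pg by (intro bexI[OF _ g] bexI[OF _ p]) simp
  then show thesis using that l0 l5 by blast
qed

section \<open>Submodules of uniserial modules\<close>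

lemma is_subrep_A2bar:
  "is_subrep A2bar M U \<longleftrightarrow>
     (\<forall>i. VectorSpace.subspace class_ring (U i) (module_vec TYPE('k::field) (rdim M i))) \<and>
     (\<forall>i. \<forall>u\<in>U i. rmap M (arr i) *\<^sub>v u \<in> U (oth i))"
  unfolding is_subrep_def all_arrow_iff by simp

lemma subrep_carrier: "is_subrep Q M U \<Longrightarrow> u \<in> U i \<Longrightarrow> u \<in> carrier_vec (rdim M i)"
  by (auto simp: is_subrep_def subspace_vec_iff)

lemma subrep_zero: "is_subrep Q M U \<Longrightarrow> 0\<^sub>v (rdim M i) \<in> U i"
  by (auto simp: is_subrep_def subspace_vec_iff)

lemma subrep_add: "is_subrep Q M U \<Longrightarrow> u \<in> U i \<Longrightarrow> v \<in> U i \<Longrightarrow> u + v \<in> U i"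
  by (auto simp: is_subrep_def subspace_vec_iff)

lemma subrep_smult: "is_subrep Q M U \<Longrightarrow> u \<in> U i \<Longrightarrow> c \<cdot>\<^sub>v u \<in> U i"
  by (auto simp: is_subrep_def subspace_vec_iff)

lemma subrep_pmat:
  assumes M: "is_rep A2bar M" and U: "is_subrep A2bar M U" and u: "u \<in> U i"
  shows "pmat M i n *\<^sub>v u \<in> U (vtx i n)"
proof (induction n)
  case 0
  then show ?case using u subrep_carrier[OF U u] by simp
next
  case (Suc n)
  then have "rmap M (arr (vtx i n)) *\<^sub>v (pmat M i n *\<^sub>v u) \<in> U (oth (vtx i n))"
    using U by (simp add: is_subrep_A2bar)
  then show ?case using pmat_vec_Suc[OF M subrep_carrier[OF U u], of n] by (simp only: vtx_Suc)
qed

lemma subrep_image: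
  fixes M N :: "('v, 'a, 'k::field) rep"
  assumes M: "is_rep Q M" and N: "is_rep Q N" and h: "h \<in> rep_hom Q M N" and U: "is_subrep Q M U"
  shows "is_subrep Q N (\<lambda>i. (*\<^sub>v) (h i) ` U i)"
  unfolding is_subrep_def
proof (intro conjI allI ballI)
  fix i
  note hc = rep_hom_carrier[OF h, of i]
  show "VectorSpace.subspace class_ring ((*\<^sub>v) (h i) ` U i) (module_vec TYPE('k) (rdim N i))"
    unfolding subspace_vec_iff
  proof (intro conjI ballI allI)
    show "(*\<^sub>v) (h i) ` U i \<subseteq> carrier_vec (rdim N i)"
      using hc subrep_carrier[OF U] by (auto intro: mult_mat_vec_carrier)
    show "0\<^sub>v (rdim N i) \<in> (*\<^sub>v) (h i) ` U i"
      using subrep_zero[OF U, of i] mult_mat_zero_vec[OF hc] by (metis image_eqI)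
    fix u assume "u \<in> (*\<^sub>v) (h i) ` U i"
    then obtain x where x: "x \<in> U i" "u = h i *\<^sub>v x" by auto
    show "c \<cdot>\<^sub>v u \<in> (*\<^sub>v) (h i) ` U i" for c
      using x subrep_smult[OF U x(1), of c] mult_mat_vec[OF hc subrep_carrier[OF U x(1)], of c] by (metis image_eqI)
    fix v assume "v \<in> (*\<^sub>v) (h i) ` U i"
    then obtain y where y: "y \<in> U i" "v = h i *\<^sub>v y" by auto
    show "u + v \<in> (*\<^sub>v) (h i) ` U i"
      using x y subrep_add[OF U x(1) y(1)] mult_add_distrib_mat_vec[OF hc subrep_carrier[OF U x(1)] subrep_carrier[OF U y(1)]]
      by (metis image_eqI)
  qed
next
  fix a u assume "u \<in> (*\<^sub>v) (h (src Q a)) ` U (src Q a)"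
  then obtain x where x: "x \<in> U (src Q a)" "u = h (src Q a) *\<^sub>v x" by auto
  have xc: "x \<in> carrier_vec (rdim M (src Q a))" using subrep_carrier[OF U x(1)] .
  have Ma: "rmap M a \<in> carrier_mat (rdim M (tgt Q a)) (rdim M (src Q a))"
    and Na: "rmap N a \<in> carrier_mat (rdim N (tgt Q a)) (rdim N (src Q a))" using M N by (auto simp: is_rep_def)
  have "rmap N a *\<^sub>v u = h (tgt Q a) *\<^sub>v (rmap M a *\<^sub>v x)"
    using assoc_mult_mat_vec[OF Na rep_hom_carrier[OF h] xc] assoc_mult_mat_vec[OF rep_hom_carrier[OF h] Ma xc] h x
    by (simp add: rep_hom_def)
  moreover have "rmap M a *\<^sub>v x \<in> U (tgt Q a)" using U x by (simp add: is_subrep_def)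
  ultimately show "rmap N a *\<^sub>v u \<in> (*\<^sub>v) (h (tgt Q a)) ` U (tgt Q a)" by simp
qed

lemma index_add_uminus_smult:
  assumes "w \<in> carrier_vec n" "t \<in> carrier_vec n" "r < n"
  shows "(w + (- a) \<cdot>\<^sub>v t) $ r = w $ r - (a :: 'k::field) * t $ r"
  using assms by simp

lemma vec_eq_add_uminus_smult:
  assumes "w \<in> carrier_vec n" "t \<in> carrier_vec n"
  shows "w = (w + (- a) \<cdot>\<^sub>v t) + (a :: 'k::field) \<cdot>\<^sub>v t"
  using assms by (intro eq_vecI) auto

text \<open>The vectors supported on path lengths at least \<open>m\<close>, that is, the
  \<open>m\<close>-th radical power of \<open>uni i l\<close>.\<close>

definition chain :: "vertex \<Rightarrow> nat \<Rightarrow> nat \<Rightarrow> vertex \<Rightarrow> 'k::field vec set" where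
  "chain i l m j = {w \<in> carrier_vec (udim i l j). \<forall>c<udim i l j. 2 * c + off i j < m \<longrightarrow> w $ c = 0}"

lemma chain_subrep: "is_subrep A2bar (uni i l :: (vertex, arrow, 'k::field) rep) (chain i l m)"
  unfolding is_subrep_A2bar
proof (intro conjI allI ballI)
  fix j
  show "VectorSpace.subspace class_ring (chain i l m j) (module_vec TYPE('k) (rdim (uni i l) j))"
    by (auto simp: subspace_vec_iff chain_def)
  fix w :: "'k vec" assume "w \<in> chain i l m j"
  then have w: "w \<in> carrier_vec (udim i l j)" and wz: "\<And>c. c < udim i l j \<Longrightarrow> 2 * c + off i j < m \<Longrightarrow> w $ c = 0"
    by (auto simp: chain_def)
  have "(rmap (uni i l) (arr j) *\<^sub>v w) $ r = 0" if r: "r < udim i l (oth j)" "2 * r + off i (oth j) < m" for r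
  proof -
    have "r - off i j < udim i l j \<and> 2 * (r - off i j) + off i j < m" if "off i j \<le> r"
      using r that off_0_or_1[of i j] by (auto simp: lt_udim off_oth)
    then show ?thesis using rmap_uni_vec[OF w r(1)] wz by auto
  qed
  moreover have "rmap (uni i l) (arr j) *\<^sub>v w \<in> carrier_vec (udim i l (oth j))"
    using rmap_arr_carrier[OF is_rep_uni, of i l j] w by (auto intro: mult_mat_vec_carrier)
  ultimately show "rmap (uni i l) (arr j) *\<^sub>v w \<in> chain i l m (oth j)" by (simp add: chain_def del: index_mult_mat_vec)
qed

text \<open>The submodule is determined by the least length of a path occurring in one of its elements.\<close>

lemma subrep_uni_chain:
  fixes V :: "vertex \<Rightarrow> 'k::field vec set"
  assumes V: "is_subrep A2bar (uni i l) V"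
  obtains m where "m \<le> l" "V = chain i l m"
proof -
  have Vc: "w \<in> carrier_vec (udim i l j)" if "w \<in> V j" for w j using subrep_carrier[OF V that] by simp
  define P where "P m \<longleftrightarrow> m = l \<or> (\<exists>j c. \<exists>w\<in>V j. c < udim i l j \<and> 2 * c + off i j = m \<and> w $ c \<noteq> 0)" for m
  define m where "m = (LEAST m. P m)"
  have Pm: "P m" and ml: "m \<le> l" unfolding m_def by (rule LeastI[of P l], simp add: P_def, rule Least_le, simp add: P_def)
  have sub: "V j \<subseteq> chain i l m j" for j
  proof
    fix w assume w: "w \<in> V j"
    have "w $ c = 0" if "c < udim i l j" "2 * c + off i j < m" for c
    proof (rule ccontr)
      assume "w $ c \<noteq> 0"
      then have "P (2 * c + off i j)" using w that by (auto simp: P_def)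
      then show False using not_less_Least[of "2 * c + off i j" P] that by (simp add: m_def)
    qed
    then show "w \<in> chain i l m j" using Vc[OF w] by (simp add: chain_def)
  qed
  \<comment> \<open>Descending induction on the least path length: one radical layer is added at a
    time, and each layer has dimension 1 at a single vertex.\<close>
  have sup: "chain i l (l - d) j \<subseteq> V j" if "d \<le> l - m" for d j
    using that
  proof (induction d arbitrary: j)
    case 0
    have "w = 0\<^sub>v (udim i l j)" if "w \<in> chain i l l j" for w :: "'k vec"
      using that by (intro eq_vecI) (auto simp: chain_def lt_udim)
    then show ?case using subrep_zero[OF V, of j] by auto
  next
    case (Suc d)
    let ?k = "l - Suc d"
    have k: "m \<le> ?k" "?k < l" "l - d = Suc ?k" using Suc.prems by auto
    then have "m < l" by simp
    then obtain j0 c0 w0 where w0: "w0 \<in> V j0" "c0 < udim i l j0" "2 * c0 + off i j0 = m" "w0 $ c0 \<noteq> 0"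
      using Pm by (auto simp: P_def)
    show ?case
    proof
      fix w :: "'k vec" assume w: "w \<in> chain i l ?k j"
      have wc: "w \<in> carrier_vec (udim i l j)" using w by (simp add: chain_def)
      show "w \<in> V j"
      proof (cases "\<exists>c. 2 * c + off i j = ?k")
        \<comment> \<open>The layer belongs to the other vertex, so at \<open>j\<close> the two
          chain members coincide.\<close>
        case False
        then have "w \<in> chain i l (Suc ?k) j" using w by (auto simp: chain_def less_Suc_eq)
        then show ?thesis using Suc.IH[of j] Suc.prems k by auto
      next
        case True
        then obtain c where c: "2 * c + off i j = ?k" by blast
        have cl: "c < udim i l j" using c k by (simp add: lt_udim)
        \<comment> \<open>The path moves the leading term of \<open>w0\<close> from length
          \<open>m\<close> to length \<open>?k\<close>.\<close>
        let ?t = "pmat (uni i l) j0 (?k - m) *\<^sub>v w0"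
        have "vtx i m = j0" using w0(3) by (metis vtx_off(1))
        moreover have "vtx i ?k = j" using c by (metis vtx_off(1))
        ultimately have vj: "vtx j0 (?k - m) = j" using vtx_vtx[of i m "?k - m"] k by simp
        have t: "?t \<in> V j" using subrep_pmat[OF is_rep_uni V w0(1), of "?k - m"] vj by simp
        have tc: "?t $ r = (if ?k - m \<le> 2 * r + off i j then w0 $ ((2 * r + off i j - (?k - m)) div 2) else 0)" if "r < udim i l j" for r
          using pmat_uni_vec[OF Vc[OF w0(1)], of r "?k - m"] that vj by simp
        have tcc: "?t $ c = w0 $ c0"
        proof -
          have "2 * c + off i j - (?k - m) = 2 * c0 + off i j0" using c w0(3) k by simp
          then have "(2 * c + off i j - (?k - m)) div 2 = c0" using off_0_or_1[of i j0] by auto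
          then show ?thesis using tc[OF cl] c k by simp
        qed
        \<comment> \<open>A shorter term of \<open>?t\<close> would come from a term of
          \<open>w0\<close> of length below \<open>m\<close>, and there is none.\<close>
        have tz: "?t $ r = 0" if r: "r < udim i l j" "2 * r + off i j < ?k" for r
        proof (cases "?k - m \<le> 2 * r + off i j")
          case True
          let ?x = "2 * r + off i j - (?k - m)"
          have "even (2 * c + off i j - (2 * r + off i j))" by simp
          have "?x < m" using True r k by simp
          moreover have "\<exists>q. ?x = 2 * q + off i j0"
          proof -
            have "r < c" using r c by simp
            then have "?x + 2 * (c - r) = 2 * c0 + off i j0" using True c w0(3) k r by simp
            moreover then have "c - r \<le> c0" using off_0_or_1[of i j0] by auto
            ultimately have "?x = 2 * (c0 - (c - r)) + off i j0" by simp
            then show ?thesis by blast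
          qed
          then obtain q where q: "?x = 2 * q + off i j0" by blast
          ultimately have "q < udim i l j0" "2 * q + off i j0 < m" using k by (simp_all add: lt_udim)
          then have "w0 $ q = 0" using sub[of j0] w0(1) by (auto simp: chain_def)
          moreover have "?x div 2 = q" using q off_0_or_1[of i j0] by auto
          ultimately show ?thesis using tc[OF r(1)] True by simp
        qed (use tc[OF r(1)] in simp)
        have tcar: "?t \<in> carrier_vec (udim i l j)" using Vc[OF t] .
        \<comment> \<open>Subtracting \<open>a\<close> times \<open>?t\<close> removes the leading
          term of \<open>w\<close>, so the difference falls under the induction hypothesis.\<close>
        define a where "a = w $ c / w0 $ c0"
        let ?u = "w + (- a) \<cdot>\<^sub>v ?t"
        have "?u \<in> chain i l (Suc ?k) j"
          unfolding chain_def
        proof (intro CollectI conjI allI impI)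
          show "?u \<in> carrier_vec (udim i l j)" using wc tcar by auto
          fix r assume r: "r < udim i l j" "2 * r + off i j < Suc ?k"
          have ur: "?u $ r = w $ r - a * ?t $ r" by (rule index_add_uminus_smult[OF wc tcar r(1)])
          show "?u $ r = 0"
          proof (cases "r = c")
            case True
            have "?u $ c = w $ c - a * w0 $ c0" using ur unfolding True tcc .
            then show ?thesis using w0(4) unfolding True a_def by simp
          next
            case False
            then have "2 * r + off i j < ?k" using r c by auto
            then have "w $ r = 0" "?t $ r = 0" using w tz[OF r(1)] r(1) by (auto simp: chain_def)
            then show ?thesis unfolding ur by (simp only: mult_zero_right diff_zero)
          qed
        qed
        then have u: "?u \<in> V j" using Suc.IH[of j] Suc.prems k by auto
        show ?thesis
          by (subst vec_eq_add_uminus_smult[OF wc tcar, of a]) (rule subrep_add[OF V u subrep_smult[OF V t]])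
      qed
    qed
  qed
  have "chain i l m j \<subseteq> V j" for j using sup[of "l - m" j] ml by simp
  then have "V = chain i l m" using sub by (intro ext) auto
  then show thesis using that ml by blast
qed

lemma udim_mono: "m \<le> l \<Longrightarrow> udim i m j \<le> udim i l j"
  by (simp add: udim_def div_le_mono)

lemma udim_sum: "udim i m i + udim i m (oth i) = m"
  by (simp add: udim_def off_def)

text \<open>At the vertex \<open>j\<close>, the basis vectors of path length below \<open>m\<close>
  are exactly the first \<open>udim i m j\<close>. So the standard inclusion and projection of the
  remaining coordinates serve as \<open>X\<close> and \<open>R\<close>.\<close>

lemma chain_basis:
  assumes m: "m \<le> l"
  obtains X R :: "'k::field mat" where "X \<in> carrier_mat (udim i l j) (udim i l j - udim i m j)"
    "R \<in> carrier_mat (udim i l j - udim i m j) (udim i l j)" "R * X = 1\<^sub>m (udim i l j - udim i m j)"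
    "(*\<^sub>v) X ` carrier_vec (udim i l j - udim i m j) = chain i l m j"
proof -
  let ?n = "udim i l j" and ?o = "udim i m j"
  let ?d = "?n - ?o"
  have o: "?o \<le> ?n" using udim_mono[OF m] .
  define X :: "'k mat" where "X = mat ?n ?d (\<lambda>(r, c). if r = c + ?o then 1 else 0)"
  define R :: "'k mat" where "R = mat ?d ?n (\<lambda>(r, c). if c = r + ?o then 1 else 0)"
  have X: "X \<in> carrier_mat ?n ?d" and R: "R \<in> carrier_mat ?d ?n" by (simp_all add: X_def R_def)
  have Xv: "(X *\<^sub>v y) $ r = (if ?o \<le> r then y $ (r - ?o) else 0)" if "y \<in> carrier_vec ?d" "r < ?n" for y r
  proof -
    have "(X *\<^sub>v y) $ r = (\<Sum>c<?d. if c = r - ?o then (if ?o \<le> r then y $ c else 0) else 0)"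
      unfolding mult_mat_vec_expand[OF X that] using that by (intro sum.cong) (auto simp: X_def)
    also have "\<dots> = (if ?o \<le> r then y $ (r - ?o) else 0)" using that by auto
    finally show ?thesis .
  qed
  have "R * X = 1\<^sub>m ?d"
  proof (rule eq_matI)
    fix r c assume rc: "r < dim_row (1\<^sub>m ?d)" "c < dim_col (1\<^sub>m ?d)"
    then have "(R * X) $$ (r, c) = (\<Sum>k<?n. R $$ (r, k) * X $$ (k, c))"
      using X R by (simp add: scalar_prod_def lessThan_atLeast0)
    also have "\<dots> = (\<Sum>k<?n. if k = r + ?o then (if r = c then 1 else 0) else 0)"
      using rc by (intro sum.cong) (auto simp: R_def X_def)
    also have "\<dots> = 1\<^sub>m ?d $$ (r, c)" using rc by auto
    finally show "(R * X) $$ (r, c) = 1\<^sub>m ?d $$ (r, c)" .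
  qed (use X R in auto)
  moreover have "(*\<^sub>v) X ` carrier_vec ?d = chain i l m j"
  proof (intro equalityI subsetI)
    fix w assume "w \<in> (*\<^sub>v) X ` carrier_vec ?d"
    then obtain y where y: "y \<in> carrier_vec ?d" "w = X *\<^sub>v y" by auto
    have "w $ c = 0" if c: "c < ?n" "2 * c + off i j < m" for c
    proof -
      have "c < ?o" using c by (simp add: lt_udim)
      then show ?thesis using Xv[OF y(1) c(1)] by (simp add: y(2))
    qed
    then show "w \<in> chain i l m j" using y X by (auto simp: chain_def)
  next
    fix w :: "'k vec" assume w: "w \<in> chain i l m j"
    have "w = X *\<^sub>v vec ?d (\<lambda>r. w $ (r + ?o))"
    proof (rule eq_vecI)
      fix r assume "r < dim_vec (X *\<^sub>v vec ?d (\<lambda>r. w $ (r + ?o)))"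
      then have r: "r < ?n" using X by simp
      have "w $ r = 0" if "r < ?o" using w r that by (simp add: chain_def lt_udim)
      then show "w $ r = (X *\<^sub>v vec ?d (\<lambda>r. w $ (r + ?o))) $ r" using Xv[OF _ r, of "vec ?d (\<lambda>r. w $ (r + ?o))"] r by auto
    qed (use w X in \<open>auto simp: chain_def\<close>)
    then show "w \<in> (*\<^sub>v) X ` carrier_vec ?d" by auto
  qed
  ultimately show thesis using that X R by blast
qed

text \<open>The standard charts cover the Grassmannian: every subspace is determined by suitable
  coordinates, and their number is its dimension.\<close>

lemma points_quiver_grassmannian:
  fixes M :: "('v, 'a, 'k::field) rep"
  shows "points (quiver_grassmannian Q M e) = {U. is_subrep Q M U \<and>
    (\<forall>i. vectorspace.dim class_ring ((module_vec TYPE('k) (rdim M i))\<lparr>carrier := U i\<rparr>) = e i)}"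
proof -
  have "\<exists>I. (\<forall>i. I i \<subseteq> {..<rdim M i} \<and> card (I i) = e i) \<and> (\<forall>i. chart (U i) (I i))"
    if U: "is_subrep Q M U"
      and d: "\<And>i. vectorspace.dim class_ring ((module_vec TYPE('k) (rdim M i))\<lparr>carrier := U i\<rparr>) = e i" for U
  proof -
    have "\<exists>J. J \<subseteq> {..<rdim M i} \<and> card J = e i \<and> chart (U i) J" for i
    proof -
      have Ui: "VectorSpace.subspace class_ring (U i) (module_vec TYPE('k) (rdim M i))"
        using U by (simp add: is_subrep_def)
      obtain J where J: "J \<subseteq> {..<rdim M i}" "chart (U i) J" using subspace_chart[OF Ui] .
      obtain X R where "X \<in> carrier_mat (rdim M i) (card J)" "R \<in> carrier_mat (card J) (rdim M i)"
        "R * X = 1\<^sub>m (card J)" "(*\<^sub>v) X ` carrier_vec (card J) = U i"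
        using chart_basis[OF Ui J] .
      from dim_image_left_invertible[OF Ui this] d[of i] J show ?thesis by auto
    qed
    then show ?thesis by metis
  qed
  note ex = this
  show ?thesis
  proof (intro equalityI subsetI)
    fix U assume "U \<in> {U. is_subrep Q M U \<and>
      (\<forall>i. vectorspace.dim class_ring ((module_vec TYPE('k) (rdim M i))\<lparr>carrier := U i\<rparr>) = e i)}"
    then have U: "is_subrep Q M U"
      and d: "\<And>i. vectorspace.dim class_ring ((module_vec TYPE('k) (rdim M i))\<lparr>carrier := U i\<rparr>) = e i" by auto
    obtain I where I: "\<forall>i. I i \<subseteq> {..<rdim M i} \<and> card (I i) = e i" "\<forall>i. chart (U i) (I i)"
      using ex[OF U d] by (elim exE conjE)
    have "I \<in> charts (quiver_grassmannian Q M e)" using I(1) by (simp add: quiver_grassmannian_def)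
    moreover have "U \<in> dom (quiver_grassmannian Q M e) I"
      using U d I(2) by (simp add: quiver_grassmannian_def chart_def)
    ultimately show "U \<in> points (quiver_grassmannian Q M e)" unfolding points_def by blast
  qed (auto simp: points_def quiver_grassmannian_def)
qed

text \<open>A representation isomorphic to \<open>uni i l\<close> has exactly \<open>l + 1\<close> subrepresentations, with distinct
  dimension vectors. So each quiver Grassmannian is a point or empty.\<close>

lemma sum_euler_char_uni:
  fixes M :: "(vertex, arrow, 'k::field) rep"
  assumes M: "is_rep A2bar M" and iso: "rep_iso A2bar (uni i l) M"
  shows "Sum_any (\<lambda>e. euler_char (quiver_grassmannian A2bar M e)) = int (Suc l)"
proof -
  obtain h h' where h: "h \<in> rep_hom A2bar (uni i l) M" and h': "h' \<in> rep_hom A2bar M (uni i l)"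
    and h'h: "\<And>j. h' j * h j = 1\<^sub>m (udim i l j)" and hh': "\<And>j. h j * h' j = 1\<^sub>m (rdim M j)"
    using iso unfolding rep_iso_def by auto
  have hc: "h j \<in> carrier_mat (rdim M j) (udim i l j)" and h'c: "h' j \<in> carrier_mat (udim i l j) (rdim M j)" for j
    using rep_hom_carrier[OF h, of j] rep_hom_carrier[OF h', of j] by simp_all
  define S :: "nat \<Rightarrow> vertex \<Rightarrow> 'k vec set" where "S m = (\<lambda>j. (*\<^sub>v) (h j) ` chain i l m j)" for m
  define dv where "dv m = (\<lambda>j. udim i l j - udim i m j)" for m
  have S: "is_subrep A2bar M (S m)" for m
    unfolding S_def by (rule subrep_image[OF is_rep_uni M h chain_subrep])
  have S_all: "\<exists>m\<le>l. U = S m" if U: "is_subrep A2bar M U" for U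
  proof -
    have "is_subrep A2bar (uni i l) (\<lambda>j. (*\<^sub>v) (h' j) ` U j)" by (rule subrep_image[OF M is_rep_uni h' U])
    then obtain m where m: "m \<le> l" "(\<lambda>j. (*\<^sub>v) (h' j) ` U j) = chain i l m" by (rule subrep_uni_chain)
    have "U j = S m j" for j
    proof -
      have "h j *\<^sub>v (h' j *\<^sub>v u) = u" if "u \<in> U j" for u
        using assoc_mult_mat_vec[OF hc h'c subrep_carrier[OF U that]] hh'[of j] subrep_carrier[OF U that] by simp
      then have "U j = (*\<^sub>v) (h j) ` ((*\<^sub>v) (h' j) ` U j)" by (force simp: image_image)
      then show ?thesis using fun_cong[OF m(2), of j] by (simp add: S_def)
    qed
    then show ?thesis using m(1) by blast
  qed
  have dim_S: "vectorspace.dim class_ring ((module_vec TYPE('k) (rdim M j))\<lparr>carrier := S m j\<rparr>) = dv m j"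
    if m: "m \<le> l" for m j
  proof -
    let ?d = "udim i l j - udim i m j"
    obtain X R :: "'k mat" where X: "X \<in> carrier_mat (udim i l j) ?d" and R: "R \<in> carrier_mat ?d (udim i l j)"
      and RX: "R * X = 1\<^sub>m ?d" and im: "(*\<^sub>v) X ` carrier_vec ?d = chain i l m j"
      using chain_basis[OF m] .
    have "R * h' j * (h j * X) = 1\<^sub>m ?d" using mult_mat_cancel_mid[OF R h'c hc X h'h] RX by simp
    moreover have "(*\<^sub>v) (h j * X) ` carrier_vec ?d = S m j"
      unfolding S_def im[symmetric] image_image
      by (rule image_cong) (auto simp: assoc_mult_mat_vec[OF hc X])
    moreover have "VectorSpace.subspace class_ring (S m j) (module_vec TYPE('k) (rdim M j))"
      using S[of m] by (simp add: is_subrep_def)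
    ultimately show ?thesis
      unfolding dv_def using dim_image_left_invertible mult_carrier_mat[OF hc X] mult_carrier_mat[OF R h'c] by blast
  qed
  \<comment> \<open>The dimension vector determines \<open>m\<close>, because the dimensions of
    \<open>uni i m\<close> at the two vertices add up to \<open>m\<close>.\<close>
  have dv_inj: "m = m'" if "m \<le> l" "m' \<le> l" "dv m = dv m'" for m m'
  proof -
    have eq: "udim i m j = udim i m' j" for j
      using fun_cong[OF that(3), of j] udim_mono[OF that(1), of i j] udim_mono[OF that(2), of i j] by (simp add: dv_def)
    show ?thesis using eq[of i] eq[of "oth i"] udim_sum[of i m] udim_sum[of i m'] by linarith
  qed
  have "euler_char (quiver_grassmannian A2bar M e) = (if e \<in> dv ` {..l} then 1 else 0)" for e
  proof (cases "e \<in> dv ` {..l}")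
    case True
    then obtain m where m: "m \<le> l" "e = dv m" by auto
    have "points (quiver_grassmannian A2bar M e) = {S m}"
      unfolding points_quiver_grassmannian
    proof (intro equalityI subsetI)
      fix U assume U: "U \<in> {U. is_subrep A2bar M U \<and>
        (\<forall>i. vectorspace.dim class_ring ((module_vec TYPE('k) (rdim M i))\<lparr>carrier := U i\<rparr>) = e i)}"
      then obtain m' where m': "m' \<le> l" "U = S m'" using S_all[of U] by auto
      then have "dv m' = dv m" using U m dim_S[OF m'(1)] by auto
      then show "U \<in> {S m}" using dv_inj m m' by auto
    qed (use S dim_S[OF m(1)] m in auto)
    then show ?thesis using True by (simp add: euler_char_one_point)
  next
    case False
    have "points (quiver_grassmannian A2bar M e) = {}"
    proof (rule ccontr)
      assume "points (quiver_grassmannian A2bar M e) \<noteq> {}"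
      then obtain U where U: "is_subrep A2bar M U"
        "\<And>i. vectorspace.dim class_ring ((module_vec TYPE('k) (rdim M i))\<lparr>carrier := U i\<rparr>) = e i"
        unfolding points_quiver_grassmannian by blast
      obtain m where m: "m \<le> l" "U = S m" using S_all[OF U(1)] by blast
      have "e = dv m" using U(2) dim_S[OF m(1)] m(2) by (intro ext) simp
      then show False using False m by blast
    qed
    then show ?thesis using False by (simp add: euler_char_empty)
  qed
  then have "Sum_any (\<lambda>e. euler_char (quiver_grassmannian A2bar M e)) = Sum_any (\<lambda>e. if e \<in> dv ` {..l} then 1 else 0)"
    by presburger
  also have "\<dots> = (\<Sum>e\<in>dv ` {..l}. if e \<in> dv ` {..l} then 1 else 0)"
    by (rule Sum_any.expand_superset) auto
  also have "\<dots> = int (card (dv ` {..l}))" by simp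
  also have "card (dv ` {..l}) = Suc l" using dv_inj by (subst card_image) (auto simp: inj_on_def)
  finally show ?thesis .
qed

section \<open>Series and their coordinates\<close>

abbreviation (input) "Jac \<equiv> jacobian_algebra A2bar A2bar_potential"
abbreviation (input) "cls \<equiv> jac_class A2bar A2bar_potential"

definition vertex_elt :: "vertex \<Rightarrow> (vertex, arrow, 'k::field) series" where
  "vertex_elt i = path_elt (i, [])"

definition arrow_elt :: "vertex \<Rightarrow> (vertex, arrow, 'k::field) series" where
  "arrow_elt i = path_elt (i, [arr i])"

text \<open>Canonical representatives for the classes in \<open>jac_hom A2bar pot i j\<close>:
  series supported on paths from \<open>i\<close> to \<open>j\<close>.\<close>

definition from_to :: "vertex \<Rightarrow> vertex \<Rightarrow> (vertex, arrow, 'k::field) series set" where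
  "from_to i j = {f \<in> carrier PA. \<forall>k n. f (k, alt k n) \<noteq> 0 \<longrightarrow> k = i \<and> vtx k n = j}"

lemma len_div_off: "2 * (n div 2) + off i (vtx i n) = n"
  by (cases "even n") (auto simp: off_def vtx_def elim!: oddE)

lemma vertex_elt_carrier [simp]: "vertex_elt i \<in> carrier PA"
  by (auto simp: carrier_PA vertex_elt_def path_elt_def)

lemma arrow_elt_carrier [simp]: "arrow_elt i \<in> carrier PA"
  by (auto simp: carrier_PA arrow_elt_def path_elt_def)

lemma const_carrier [simp]: "(\<lambda>(i, as). if as = [] then c else 0) \<in> carrier PA"
  by (auto simp: carrier_PA)

lemma alt_eq_Nil [simp]: "alt i n = [] \<longleftrightarrow> n = 0"
  by (cases n) auto

lemma alt_eq_singleton: "alt i m = [a] \<longleftrightarrow> m = 1 \<and> a = arr i"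
  by (cases m) auto

lemma vertex_elt_mult: "(vertex_elt i \<otimes>\<^bsub>PA\<^esub> f) (k, alt k n) = (if k = i then f (k, alt k n) else (0 :: 'k::field))"
proof -
  have "(vertex_elt i \<otimes>\<^bsub>PA\<^esub> f) (k, alt k n) = (\<Sum>m\<le>n. if m = 0 then (if k = i then f (k, alt k n) else 0) else 0)"
    unfolding mult_PA by (rule sum.cong) (auto simp: vertex_elt_def path_elt_def)
  then show ?thesis by simp
qed

lemma mult_vertex_elt: "(f \<otimes>\<^bsub>PA\<^esub> vertex_elt j) (k, alt k n) = (if vtx k n = j then f (k, alt k n) else (0 :: 'k::field))"
proof -
  have "(f \<otimes>\<^bsub>PA\<^esub> vertex_elt j) (k, alt k n) = (\<Sum>m\<le>n. if m = n then (if vtx k n = j then f (k, alt k n) else 0) else 0)"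
    unfolding mult_PA by (rule sum.cong) (auto simp: vertex_elt_def path_elt_def)
  then show ?thesis by simp
qed

lemma const_mult: "((\<lambda>(i, as). if as = [] then c else 0) \<otimes>\<^bsub>PA\<^esub> f) (k, alt k n) = (c :: 'k::field) * f (k, alt k n)"
proof -
  have "((\<lambda>(i, as). if as = [] then c else 0) \<otimes>\<^bsub>PA\<^esub> f) (k, alt k n) = (\<Sum>m\<le>n. if m = 0 then c * f (k, alt k n) else 0)"
    unfolding mult_PA by (rule sum.cong) auto
  then show ?thesis by simp
qed

lemma mult_arrow_elt: "(f \<otimes>\<^bsub>PA\<^esub> arrow_elt j) (k, alt k n) =
  (if 0 < n \<and> vtx k n = oth j then f (k, alt k (n - 1)) else (0 :: 'k::field))"
proof (cases n)
  case 0
  then show ?thesis using mult_PA[of f "arrow_elt j" k 0] by (simp add: arrow_elt_def path_elt_def)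
next
  case (Suc n')
  have eq: "alt (vtx k m) (n - m) = [arr j] \<and> vtx k m = j \<longleftrightarrow> m = n' \<and> vtx k n = oth j" if "m \<le> n" for m
  proof -
    have "n - m = 1 \<longleftrightarrow> m = n'" using that Suc by auto
    then show ?thesis unfolding alt_eq_singleton using Suc by auto
  qed
  have "(f \<otimes>\<^bsub>PA\<^esub> arrow_elt j) (k, alt k n) = (\<Sum>m\<le>n. if m = n' then (if vtx k n = oth j then f (k, alt k n') else 0) else 0)"
    unfolding mult_PA using eq by (intro sum.cong) (auto simp: arrow_elt_def path_elt_def)
  then show ?thesis using Suc by simp
qed

lemma arrow_elt_mult: "(arrow_elt j \<otimes>\<^bsub>PA\<^esub> f) (k, alt k n) =
  (if 0 < n \<and> k = j then f (oth k, alt (oth k) (n - 1)) else (0 :: 'k::field))"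
proof (cases n)
  case 0
  then show ?thesis using mult_PA[of "arrow_elt j" f k 0] by (simp add: arrow_elt_def path_elt_def)
next
  case (Suc n')
  have eq: "k = j \<and> alt k m = [arr j] \<longleftrightarrow> m = 1 \<and> k = j" for m
    by (auto simp: alt_eq_singleton)
  have "(arrow_elt j \<otimes>\<^bsub>PA\<^esub> f) (k, alt k n) = (\<Sum>m\<le>n. if m = 1 then (if k = j then f (oth k, alt (oth k) n') else 0) else 0)"
    unfolding mult_PA using eq Suc by (intro sum.cong) (auto simp: arrow_elt_def path_elt_def)
  then show ?thesis using Suc by simp
qed

text \<open>The index bound keeps path lengths below 5, where all representatives of a class agree.
  Hence the choice made by \<open>SOME\<close> does not matter; see
  \<open>std_coord_cls\<close>.\<close>

definition std_coord :: "vertex \<Rightarrow> vertex \<Rightarrow> (vertex, arrow, 'k::field) series set \<Rightarrow> 'k vec" where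
  "std_coord i j x = vec (udim i 5 j) (\<lambda>c. (SOME f. f \<in> x) (i, alt i (2 * c + off i j)))"

text \<open>Left multiplication by the arrow from \<open>s\<close>, in standard coordinates.\<close>

definition std_lmult :: "vertex \<Rightarrow> vertex \<Rightarrow> 'k::field mat" where
  "std_lmult s j = mat (udim s 5 j) (udim (oth s) 5 j) (\<lambda>(r, c). if r = c + off (oth s) j then 1 else 0)"

lemma std_lmult_carrier [simp]: "std_lmult s j \<in> carrier_mat (udim s 5 j) (udim (oth s) 5 j)"
  by (simp add: std_lmult_def)

text \<open>Prefixing an arrow raises the path length by 1, and the index of the basis vector at
  \<open>j\<close> grows exactly when \<open>j = s\<close>.\<close>

lemma std_lmult_vec:
  assumes w: "w \<in> carrier_vec (udim (oth s) 5 j)" and r: "r < udim s 5 j"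
  shows "(std_lmult s j *\<^sub>v w) $ r = (if off (oth s) j \<le> r then w $ (r - off (oth s) j) else (0 :: 'k::field))"
proof -
  have "r - off (oth s) j < udim (oth s) 5 j" if "off (oth s) j \<le> r"
    using r that off_0_or_1[of s j] by (auto simp: lt_udim off_oth2)
  moreover have "(std_lmult s j *\<^sub>v w) $ r = (\<Sum>c<udim (oth s) 5 j. if c = r - off (oth s) j then (if off (oth s) j \<le> r then w $ c else 0) else 0)"
    unfolding mult_mat_vec_expand[OF std_lmult_carrier w r] using r by (intro sum.cong) (auto simp: std_lmult_def)
  ultimately show ?thesis by auto
qed

text \<open>Left multiplication commutes with the right action of the arrows. In coordinates both
  are index shifts, by \<open>off (oth s)\<close> and by \<open>off\<close> of the respective
  top.\<close>

lemma std_lmult_hom: "(std_lmult s :: vertex \<Rightarrow> 'k::field mat) \<in> rep_hom A2bar (uni (oth s) 5) (uni s 5)"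
  unfolding rep_hom_A2bar
proof (intro conjI allI)
  fix j
  show "(std_lmult s j :: 'k mat) \<in> carrier_mat (rdim (uni s 5) j) (rdim (uni (oth s) 5) j)" by simp
  let ?A = "rmap (uni (oth s) 5) (arr j) :: 'k mat" and ?B = "rmap (uni s 5) (arr j) :: 'k mat"
  have A: "?A \<in> carrier_mat (udim (oth s) 5 (oth j)) (udim (oth s) 5 j)" and B: "?B \<in> carrier_mat (udim s 5 (oth j)) (udim s 5 j)"
    using rmap_arr_carrier[OF is_rep_uni, of "oth s" 5 j] rmap_arr_carrier[OF is_rep_uni, of s 5 j] by simp_all
  show "std_lmult s (oth j) * ?A = ?B * std_lmult s j"
  proof (rule eq_mat_on_vecI[OF mult_carrier_mat[OF std_lmult_carrier A] mult_carrier_mat[OF B std_lmult_carrier]])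
    fix w :: "'k vec" assume w: "w \<in> carrier_vec (udim (oth s) 5 j)"
    have Aw: "?A *\<^sub>v w \<in> carrier_vec (udim (oth s) 5 (oth j))" using A w by simp
    have lw: "std_lmult s j *\<^sub>v w \<in> carrier_vec (udim s 5 j)" using w by (rule mult_mat_vec_carrier[OF std_lmult_carrier])
    show "(std_lmult s (oth j) * ?A) *\<^sub>v w = (?B * std_lmult s j) *\<^sub>v w"
      unfolding assoc_mult_mat_vec[OF std_lmult_carrier A w] assoc_mult_mat_vec[OF B std_lmult_carrier w]
    proof (rule eq_vecI)
      fix r assume "r < dim_vec (?B *\<^sub>v (std_lmult s j *\<^sub>v w))"
      then have r: "r < udim s 5 (oth j)" using B by simp
      have "r - off s j < udim (oth s) 5 (oth j) \<and> r - off s j < udim s 5 j" if "off s j \<le> r"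
        using r that off_0_or_1[of s j] by (auto simp: lt_udim off_oth off_oth2)
      moreover have "off (oth s) (oth j) = off s j" using off_0_or_1[of s j] by (auto simp: off_oth off_oth2)
      ultimately show "(std_lmult s (oth j) *\<^sub>v (?A *\<^sub>v w)) $ r = (?B *\<^sub>v (std_lmult s j *\<^sub>v w)) $ r"
        using std_lmult_vec[OF Aw r] rmap_uni_vec[OF lw r] rmap_uni_vec[OF w, of "r - off s j"] std_lmult_vec[OF w, of "r - off s j"]
        by auto
    qed (use B in \<open>simp add: std_lmult_def\<close>)
  qed
qed

section \<open>Homomorphisms from uniserial modules\<close>

lemma full_subrep:
  fixes M :: "('v, 'a, 'k::field) rep"
  assumes "is_rep Q M"
  shows "is_subrep Q M (\<lambda>i. carrier_vec (rdim M i))"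
  using assms by (auto simp: is_subrep_def subspace_vec_iff is_rep_def intro: mult_mat_vec_carrier)

lemma zero_subrep:
  fixes M :: "('v, 'a, 'k::field) rep"
  assumes M: "is_rep Q M"
  shows "is_subrep Q M (\<lambda>i. {0\<^sub>v (rdim M i)})"
proof -
  have "rmap M a *\<^sub>v 0\<^sub>v (rdim M (src Q a)) = 0\<^sub>v (rdim M (tgt Q a))" for a
    using M by (intro mult_mat_zero_vec) (simp add: is_rep_def)
  then show ?thesis by (auto simp: is_subrep_def subspace_vec_iff)
qed

lemma preimage_subrep:
  fixes M N :: "('v, 'a, 'k::field) rep"
  assumes M: "is_rep Q M" and N: "is_rep Q N" and h: "h \<in> rep_hom Q M N" and V: "is_subrep Q N V"
  shows "is_subrep Q M (\<lambda>i. {w \<in> carrier_vec (rdim M i). h i *\<^sub>v w \<in> V i})"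
  unfolding is_subrep_def
proof (intro conjI allI ballI)
  fix i
  note hc = rep_hom_carrier[OF h, of i]
  show "VectorSpace.subspace class_ring {w \<in> carrier_vec (rdim M i). h i *\<^sub>v w \<in> V i} (module_vec TYPE('k) (rdim M i))"
    unfolding subspace_vec_iff using subrep_zero[OF V, of i] subrep_add[OF V] subrep_smult[OF V]
    by (auto simp: mult_mat_zero_vec[OF hc] mult_add_distrib_mat_vec[OF hc] mult_mat_vec[OF hc] simp del: index_mult_mat_vec)
next
  fix a w assume "w \<in> {w \<in> carrier_vec (rdim M (src Q a)). h (src Q a) *\<^sub>v w \<in> V (src Q a)}"
  then have w: "w \<in> carrier_vec (rdim M (src Q a))" "h (src Q a) *\<^sub>v w \<in> V (src Q a)" by auto
  have Ma: "rmap M a \<in> carrier_mat (rdim M (tgt Q a)) (rdim M (src Q a))"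
    and Na: "rmap N a \<in> carrier_mat (rdim N (tgt Q a)) (rdim N (src Q a))" using M N by (auto simp: is_rep_def)
  have "h (tgt Q a) *\<^sub>v (rmap M a *\<^sub>v w) = rmap N a *\<^sub>v (h (src Q a) *\<^sub>v w)"
    using assoc_mult_mat_vec[OF Na rep_hom_carrier[OF h] w(1)] assoc_mult_mat_vec[OF rep_hom_carrier[OF h] Ma w(1)] h
    by (simp add: rep_hom_def)
  then show "rmap M a *\<^sub>v w \<in> {w \<in> carrier_vec (rdim M (tgt Q a)). h (tgt Q a) *\<^sub>v w \<in> V (tgt Q a)}"
    using w V mult_mat_vec_carrier[OF Ma w(1)] by (simp add: is_subrep_def)
qed

lemma preimage_subrep_uni:
  assumes "is_rep A2bar X" "h \<in> rep_hom A2bar (uni i l) X" "is_subrep A2bar X V"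
  shows "is_subrep A2bar (uni i l) (\<lambda>j. {w \<in> carrier_vec (udim i l j). h j *\<^sub>v w \<in> V j})"
  using preimage_subrep[OF is_rep_uni assms] by simp

lemma add_uminus_smult_self: "x \<in> carrier_vec n \<Longrightarrow> x + (- 1) \<cdot>\<^sub>v x = (0\<^sub>v n :: 'k::field vec)"
  by auto

lemma chain_0: "chain i l 0 j = carrier_vec (udim i l j)"
  by (auto simp: chain_def)

lemma chain_full: "chain i l l j = {0\<^sub>v (udim i l j)}"
  by (auto simp: chain_def lt_udim)

text \<open>A submodule is a member of the chain, and only the full one contains a vector with
  nonzero coordinate at the generator.\<close>

lemma uni_generated:
  fixes V :: "vertex \<Rightarrow> 'k::field vec set"
  assumes V: "is_subrep A2bar (uni i l) V" and w: "w \<in> V i" "w $ 0 \<noteq> 0" and l: "0 < l"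
  shows "V j = carrier_vec (udim i l j)"
proof -
  obtain m where m: "m \<le> l" "V = chain i l m" using subrep_uni_chain[OF V] .
  have "0 < udim i l i" using l by (simp add: lt_udim)
  then have "m = 0" using w m(2) by (auto simp: chain_def)
  then show ?thesis using m(2) by (simp add: chain_0)
qed

lemma top_coord: "0 < l \<Longrightarrow> (unit_vec (udim i l i) 0 :: 'k::field vec) $ 0 = 1"
  using lt_udim[of 0 i l i] by simp

text \<open>The preimage of \<open>V\<close> is a subrepresentation that contains the generator,
  hence everything.\<close>

lemma hom_uni_image_subset:
  fixes X :: "(vertex, arrow, 'k::field) rep"
  assumes X: "is_rep A2bar X" and h: "h \<in> rep_hom A2bar (uni i l) X" and V: "is_subrep A2bar X V"
    and top: "h i *\<^sub>v unit_vec (udim i l i) 0 \<in> V i" and l: "0 < l" and w: "w \<in> carrier_vec (udim i l j)"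
  shows "h j *\<^sub>v w \<in> V j"
proof -
  have mem: "unit_vec (udim i l i) 0 \<in> {w \<in> carrier_vec (udim i l i). h i *\<^sub>v w \<in> V i}"
    using top by simp
  have d0: "(unit_vec (udim i l i) 0 :: 'k vec) $ 0 \<noteq> 0" using top_coord[OF l, of i, where 'k='k] by simp
  from uni_generated[OF preimage_subrep_uni[OF X h V] mem d0 l]
  have "{w \<in> carrier_vec (udim i l j). h j *\<^sub>v w \<in> V j} = carrier_vec (udim i l j)" by blast
  then show ?thesis using w by auto
qed

text \<open>A proper subrepresentation lies in the radical. So if it contains a preimage of the image of the
  generator, the kernel contains a generator.\<close>

lemma hom_uni_essential:
  fixes X :: "(vertex, arrow, 'k::field) rep"
  assumes X: "is_rep A2bar X" and h: "h \<in> rep_hom A2bar (uni i l) X" and V: "is_subrep A2bar (uni i l) V"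
    and nz: "h i *\<^sub>v unit_vec (udim i l i) 0 \<noteq> 0\<^sub>v (rdim X i)"
    and top: "h i *\<^sub>v unit_vec (udim i l i) 0 \<in> (*\<^sub>v) (h i) ` V i" and l: "0 < l"
  shows "V j = carrier_vec (udim i l j)"
proof -
  let ?e = "unit_vec (udim i l i) 0 :: 'k vec"
  obtain w where w: "w \<in> V i" "h i *\<^sub>v ?e = h i *\<^sub>v w" using top by auto
  have wc: "w \<in> carrier_vec (udim i l i)" using subrep_carrier[OF V w(1)] by simp
  have hc: "h i \<in> carrier_mat (rdim X i) (udim i l i)" using rep_hom_carrier[OF h, of i] by simp
  have "w $ 0 \<noteq> 0"
  proof
    assume w0: "w $ 0 = 0"
    \<comment> \<open>If \<open>w\<close> lay in the radical, this difference would be a generator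
      in the kernel, and the homomorphism would kill \<open>?e\<close>.\<close>
    let ?d = "?e + (- 1) \<cdot>\<^sub>v w"
    have hd: "h i *\<^sub>v ?d = h i *\<^sub>v ?e + (- 1) \<cdot>\<^sub>v (h i *\<^sub>v w)"
      using mult_add_distrib_mat_vec[OF hc, of ?e "(- 1) \<cdot>\<^sub>v w"] mult_mat_vec[OF hc wc, of "- 1"] wc by simp
    have "h i *\<^sub>v w \<in> carrier_vec (rdim X i)" by (rule mult_mat_vec_carrier[OF hc wc])
    then have "h i *\<^sub>v ?d = 0\<^sub>v (rdim X i)"
      unfolding hd w(2) by (rule add_uminus_smult_self)
    then have mem: "?d \<in> {w \<in> carrier_vec (udim i l i). h i *\<^sub>v w \<in> {0\<^sub>v (rdim X i)}}" using wc by simp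
    have "?d $ 0 = 1" using wc w0 l lt_udim[of 0 i l i] by simp
    then have d0: "?d $ 0 \<noteq> 0" by (simp only:) simp
    from uni_generated[OF preimage_subrep_uni[OF X h zero_subrep[OF X]] mem d0 l]
    have "{w \<in> carrier_vec (udim i l i). h i *\<^sub>v w \<in> {0\<^sub>v (rdim X i)}} = carrier_vec (udim i l i)" by blast
    then have "?e \<in> {w \<in> carrier_vec (udim i l i). h i *\<^sub>v w \<in> {0\<^sub>v (rdim X i)}}" by (simp only: unit_vec_carrier)
    then show False using nz by simp
  qed
  then show ?thesis using uni_generated[OF V w(1) _ l] by blast
qed

text \<open>For equal tops, homomorphisms do not lower path lengths, so the lowest coordinate of the
  image sees only the lowest coordinate of the argument.\<close>

lemma hom_uni_row0:
  assumes h: "h \<in> rep_hom A2bar (uni i l) (uni i l')" and c: "0 < c" "c < udim i l j" and r: "0 < udim i l' j"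
  shows "h j $$ (0, c) = (0 :: 'k::field)"
proof -
  have l': "0 < udim i l' i" using r by (simp add: lt_udim)
  have i0: "h i $$ (0, c) = 0" if "0 < c" "c < udim i l i" for c
    using hom_uni_uni_entry[OF h, of 0 "oth i" "c - 1"] l' that by (simp add: off_oth)
  show ?thesis
  proof (cases j i rule: vertex_cases_oth)
    case same
    then show ?thesis using i0 c by simp
  next
    case other
    then have "h j $$ (0, c) = h i $$ (0, c)" using hom_uni_uni_entry[OF h, of 0 i c] c r by simp
    moreover have "c < udim i l i" using c(2) other by (simp add: lt_udim)
    ultimately show ?thesis using i0 c by simp
  qed
qed

lemma hom_uni_coord0:
  assumes h: "h \<in> rep_hom A2bar (uni i l) (uni i l')" and w: "w \<in> carrier_vec (udim i l j)" and r: "0 < udim i l' j" "0 < udim i l j"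
  shows "(h j *\<^sub>v w) $ 0 = h j $$ (0, 0) * (w $ 0 :: 'k::field)"
proof -
  have hc: "h j \<in> carrier_mat (udim i l' j) (udim i l j)" using rep_hom_carrier[OF h, of j] by simp
  have "(h j *\<^sub>v w) $ 0 = (\<Sum>c<udim i l j. h j $$ (0, c) * w $ c)" by (rule mult_mat_vec_expand[OF hc w r(1)])
  also have "\<dots> = (\<Sum>c\<in>{0}. h j $$ (0, c) * w $ c)"
    using r hom_uni_row0[OF h] by (intro sum.mono_neutral_right) auto
  finally show ?thesis by simp
qed

lemma pmat_uni_zero: "l \<le> n \<Longrightarrow> pmat (uni i l :: (vertex, arrow, 'k::field) rep) j n = 0\<^sub>m (udim i l (vtx j n)) (udim i l j)"
proof (rule eq_mat_on_vecI)
  assume n: "l \<le> n"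
  show c: "pmat (uni i l :: (vertex, arrow, 'k) rep) j n \<in> carrier_mat (udim i l (vtx j n)) (udim i l j)"
    using pmat_carrier[OF is_rep_uni, of i l j n] by simp
  fix v :: "'k vec" assume v: "v \<in> carrier_vec (udim i l j)"
  show "pmat (uni i l) j n *\<^sub>v v = 0\<^sub>m (udim i l (vtx j n)) (udim i l j) *\<^sub>v v"
  proof (rule eq_vecI)
    fix r assume "r < dim_vec (0\<^sub>m (udim i l (vtx j n)) (udim i l j) *\<^sub>v v)"
    then have r: "r < udim i l (vtx j n)" by simp
    then have "\<not> n \<le> 2 * r + off i (vtx j n)" using n by (simp add: lt_udim)
    then show "(pmat (uni i l) j n *\<^sub>v v) $ r = (0\<^sub>m (udim i l (vtx j n)) (udim i l j) *\<^sub>v v) $ r"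
      using pmat_uni_vec[OF v r] v r by simp
  qed (use c in simp)
qed simp

text \<open>Test vectors that recover the index of a chain member: the basis vector here has path
  length \<open>q\<close>.\<close>

lemma unit_vec_in_chain:
  assumes q: "q < n"
  shows "unit_vec (udim i n (vtx i q)) (q div 2) \<in> (chain i n m (vtx i q) :: 'k::field vec set) \<longleftrightarrow> m \<le> q"
proof -
  have "q div 2 < udim i n (vtx i q)" using q len_div_off[of q i] by (simp add: lt_udim)
  then have "unit_vec (udim i n (vtx i q)) (q div 2) \<in> (chain i n m (vtx i q) :: 'k vec set) \<longleftrightarrow> \<not> 2 * (q div 2) + off i (vtx i q) < m"
    by (auto simp: chain_def)
  then show ?thesis unfolding len_div_off by (simp add: not_less)
qed

text \<open>The kernel is a member of the chain, so it suffices to test basis vectors. The one of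
  path length \<open>q\<close> goes to the path of length \<open>q\<close> applied to the image of
  the generator, which has a nonzero top coordinate and is therefore killed only from length
  \<open>l\<close> on.\<close>

lemma kernel_uni:
  fixes g :: "vertex \<Rightarrow> 'k::field mat"
  assumes g: "g \<in> rep_hom A2bar (uni i n) (uni i l)" and l: "0 < l" "l \<le> n"
    and onto: "carrier_vec (udim i l i) \<subseteq> (*\<^sub>v) (g i) ` carrier_vec (udim i n i)"
  shows "{w \<in> carrier_vec (udim i n j). g j *\<^sub>v w = 0\<^sub>v (udim i l j)} = chain i n l j"
proof -
  let ?e = "unit_vec (udim i n i) 0 :: 'k vec"
  let ?K = "\<lambda>j. {w \<in> carrier_vec (udim i n j). g j *\<^sub>v w \<in> {0\<^sub>v (udim i l j)}}"
  have pos: "0 < udim i l i" "0 < udim i n i" using l by (simp_all add: lt_udim)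
  have K: "is_subrep A2bar (uni i n) ?K" using preimage_subrep_uni[OF is_rep_uni g zero_subrep[OF is_rep_uni]] by simp
  obtain m where m: "m \<le> n" "?K = chain i n m" using subrep_uni_chain[OF K] .
  have kc: "g i *\<^sub>v ?e \<in> carrier_vec (udim i l i)" using rep_hom_mult_vec_carrier[OF g, of ?e i] by simp
  \<comment> \<open>A preimage of the generator of the target has image with top coordinate 1, and
    top coordinates are multiplied by a single matrix entry.\<close>
  have k0: "(g i *\<^sub>v ?e) $ 0 \<noteq> 0"
  proof -
    obtain w where w: "w \<in> carrier_vec (udim i n i)" "unit_vec (udim i l i) 0 = g i *\<^sub>v w"
      using onto unit_vec_carrier[of "udim i l i" 0] by blast
    have "g i $$ (0, 0) * w $ 0 = 1"
      unfolding hom_uni_coord0[OF g w(1) pos, symmetric] w(2)[symmetric] using pos by simp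
    then have "g i $$ (0, 0) \<noteq> 0" by auto
    then show ?thesis using hom_uni_coord0[OF g _ pos, of ?e] pos by simp
  qed
  have ex: "unit_vec (udim i n (vtx i q)) (q div 2) \<in> ?K (vtx i q) \<longleftrightarrow> l \<le> q" if q: "q < n" for q
  proof -
    let ?u = "unit_vec (udim i n (vtx i q)) (q div 2) :: 'k vec"
    have "g (vtx i q) *\<^sub>v ?u = pmat (uni i l) i q *\<^sub>v (g i *\<^sub>v ?e)"
    proof -
      have u: "pmat (uni i n) i q *\<^sub>v ?e = ?u" using pmat_uni_top[of n i q] q l by simp
      have "g (vtx i q) *\<^sub>v (pmat (uni i n) i q *\<^sub>v ?e) = pmat (uni i l) i q *\<^sub>v (g i *\<^sub>v ?e)"
        by (rule rep_hom_pmat_vec[OF is_rep_uni is_rep_uni g]) simp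
      then show ?thesis unfolding u .
    qed
    moreover have "pmat (uni i l) i q *\<^sub>v (g i *\<^sub>v ?e) = 0\<^sub>v (udim i l (vtx i q)) \<longleftrightarrow> l \<le> q"
    proof
      assume "l \<le> q"
      then show "pmat (uni i l) i q *\<^sub>v (g i *\<^sub>v ?e) = 0\<^sub>v (udim i l (vtx i q))" using kc by (simp only: pmat_uni_zero zero_mat_mult_vec)
    next
      assume z: "pmat (uni i l) i q *\<^sub>v (g i *\<^sub>v ?e) = 0\<^sub>v (udim i l (vtx i q))"
      show "l \<le> q"
      proof (rule ccontr)
        assume "\<not> l \<le> q"
        then have r: "q div 2 < udim i l (vtx i q)" using len_div_off[of q i] by (simp add: lt_udim)
        have "(pmat (uni i l) i q *\<^sub>v (g i *\<^sub>v ?e)) $ (q div 2) = (g i *\<^sub>v ?e) $ 0"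
          using pmat_uni_vec[OF kc r] len_div_off[of q i] by simp
        then show False using k0 r unfolding z by simp
      qed
    qed
    ultimately show ?thesis by simp
  qed
  have iff: "l \<le> q \<longleftrightarrow> m \<le> q" if "q < n" for q
    using ex[OF that] unit_vec_in_chain[OF that] fun_cong[OF m(2), of "vtx i q"] by blast
  have "m = l"
  proof (rule ccontr)
    assume "m \<noteq> l"
    then consider "m < l" | "l < m" by linarith
    then show False using iff[of m] iff[of l] l m by cases auto
  qed
  then show ?thesis using fun_cong[OF m(2), of j] by simp
qed

section \<open>Direct sums and cyclic submodules\<close>

lemma is_rep_zero_rep: "is_rep Q zero_rep"
  by (simp add: is_rep_def zero_rep_def)

text \<open>An equality and not only an isomorphism: it lets \<open>proj_sum\<close> with a single
  summand be rewritten to the projective itself.\<close>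

lemma rep_sum_zero_rep:
  fixes M :: "('v, 'a, 'k::field) rep"
  assumes M: "is_rep Q M"
  shows "rep_sum Q M zero_rep = M"
proof -
  have "four_block_mat (rmap M a) (0\<^sub>m (rdim M (tgt Q a)) 0) (0\<^sub>m 0 (rdim M (src Q a))) (0\<^sub>m 0 0) = rmap M a" for a
    using M by (intro eq_matI) (auto simp: is_rep_def)
  then show ?thesis by (simp add: rep_sum_def zero_rep_def)
qed

lemma pmat_rep_sum:
  fixes M N :: "(vertex, arrow, 'k::field) rep"
  assumes M: "is_rep A2bar M" and N: "is_rep A2bar N"
  shows "pmat (rep_sum A2bar M N) i n = four_block_mat (pmat M i n) (0\<^sub>m (rdim M (vtx i n)) (rdim N i))
    (0\<^sub>m (rdim N (vtx i n)) (rdim M i)) (pmat N i n)"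
proof (induction n)
  case (Suc n)
  have "rmap (rep_sum A2bar M N) (arr j) = four_block_mat (rmap M (arr j)) (0\<^sub>m (rdim M (oth j)) (rdim N j))
    (0\<^sub>m (rdim N (oth j)) (rdim M j)) (rmap N (arr j))" for j by (simp add: rep_sum_def)
  then show ?case
    unfolding pmat_Suc[OF is_rep_rep_sum[OF M N]] pmat_Suc[OF M] pmat_Suc[OF N] Suc vtx_Suc
    using mult_diag_block_mat[OF rmap_arr_carrier[OF M, of "vtx i n"] rmap_arr_carrier[OF N, of "vtx i n"]
        pmat_carrier[OF M, of i n] pmat_carrier[OF N, of i n]]
    by simp
qed simp

abbreviation (input) single_vertex :: "vertex \<Rightarrow> vertex \<Rightarrow> nat" where
  "single_vertex i \<equiv> (\<lambda>j. if j = i then 1 else 0)"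

text \<open>The \<open>l\<close>-th radical power of \<open>uni i 5\<close> is generated by the path
  of length \<open>l\<close>, which ends at \<open>vtx i l\<close>. This is the source of the second
  term in the minimal presentations.\<close>

lemma chain_cyclic:
  assumes l: "l < 5"
  obtains \<iota> :: "vertex \<Rightarrow> 'k::field mat" where "\<iota> \<in> rep_hom A2bar (uni (vtx i l) 5) (uni i 5)"
    "\<iota> (vtx i l) *\<^sub>v unit_vec (udim (vtx i l) 5 (vtx i l)) 0 = unit_vec (udim i 5 (vtx i l)) (l div 2)"
    "\<forall>j. (*\<^sub>v) (\<iota> j) ` carrier_vec (udim (vtx i l) 5 j) = chain i 5 l j"
proof -
  let ?k = "vtx i l"
  let ?u = "unit_vec (udim i 5 ?k) (l div 2) :: 'k vec" and ?U = "uni i 5 :: (vertex, arrow, 'k) rep"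
  let ?\<iota> = "gen_hom ?U ?k 5 ?u"
  have u: "?u \<in> carrier_vec (rdim ?U ?k)" by simp
  have h: "?\<iota> \<in> rep_hom A2bar (uni ?k 5) ?U"
    by (rule gen_hom_hom[OF is_rep_uni u]) (simp only: pmat_uni_zero[OF order_refl] rdim_uni zero_mat_mult_vec unit_vec_carrier)
  have top: "?\<iota> ?k *\<^sub>v unit_vec (udim ?k 5 ?k) 0 = ?u" by (rule gen_hom_top[OF is_rep_uni u]) simp
  have sub: "is_subrep A2bar ?U (\<lambda>j. (*\<^sub>v) (?\<iota> j) ` carrier_vec (udim ?k 5 j))"
    using subrep_image[OF is_rep_uni is_rep_uni h full_subrep[OF is_rep_uni]] by simp
  obtain m where m: "m \<le> 5" "(\<lambda>j. (*\<^sub>v) (?\<iota> j) ` carrier_vec (udim ?k 5 j)) = chain i 5 m"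
    using subrep_uni_chain[OF sub] .
  have "?u \<in> chain i 5 m ?k" using top fun_cong[OF m(2), of ?k] by (metis image_eqI unit_vec_carrier)
  then have "m \<le> l" using unit_vec_in_chain[OF l] by blast
  have memu: "?\<iota> ?k *\<^sub>v unit_vec (udim ?k 5 ?k) 0 \<in> chain i 5 l ?k"
    unfolding top by (rule iffD2[OF unit_vec_in_chain[OF l] order_refl])
  have into: "?\<iota> j *\<^sub>v w \<in> chain i 5 l j" if "w \<in> carrier_vec (udim ?k 5 j)" for w j
    by (rule hom_uni_image_subset[OF is_rep_uni h chain_subrep memu _ that]) simp
  \<comment> \<open>Otherwise the basis vector of path length \<open>m\<close> would lie in the
    image and hence in \<open>chain i 5 l\<close>.\<close>
  have "l \<le> m"
  proof (rule ccontr)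
    assume "\<not> l \<le> m"
    then have m5: "m < 5" using l by simp
    have "unit_vec (udim i 5 (vtx i m)) (m div 2) \<in> (chain i 5 m (vtx i m) :: 'k vec set)"
      using unit_vec_in_chain[OF m5] by blast
    then have "unit_vec (udim i 5 (vtx i m)) (m div 2) \<in> (*\<^sub>v) (?\<iota> (vtx i m)) ` carrier_vec (udim ?k 5 (vtx i m))"
      by (simp only: fun_cong[OF m(2), of "vtx i m"])
    then obtain w where "unit_vec (udim i 5 (vtx i m)) (m div 2) = ?\<iota> (vtx i m) *\<^sub>v w" "w \<in> carrier_vec (udim ?k 5 (vtx i m))"
      by (rule imageE)
    then have "unit_vec (udim i 5 (vtx i m)) (m div 2) \<in> (chain i 5 l (vtx i m) :: 'k vec set)"
      using into[of w "vtx i m"] by simp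
    then show False using unit_vec_in_chain[OF m5] \<open>\<not> l \<le> m\<close> by blast
  qed
  then have "m = l" using \<open>m \<le> l\<close> by simp
  from fun_cong[OF m(2)[unfolded this]]
  have "\<forall>j. (*\<^sub>v) (?\<iota> j) ` carrier_vec (udim ?k 5 j) = chain i 5 l j" by (intro allI)
  then show thesis by (rule that[OF h top])
qed

section \<open>Transport of presentations along isomorphisms\<close>

lemma essential_onto_iso:
  fixes M N P :: "('v, 'a, 'k::field) rep"
  assumes h: "h \<in> rep_hom Q M N" and h': "h' \<in> rep_hom Q N M" and h'h: "\<And>i. h' i * h i = 1\<^sub>m (rdim M i)"
    and hh': "\<And>i. h i * h' i = 1\<^sub>m (rdim N i)" and g: "g \<in> rep_hom Q P M"
    and ess: "essential_onto Q P g (\<lambda>i. carrier_vec (rdim M i))"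
  shows "essential_onto Q P (\<lambda>i. h i * g i) (\<lambda>i. carrier_vec (rdim N i))"
proof -
  note hc = rep_hom_carrier[OF h] and h'c = rep_hom_carrier[OF h'] and gc = rep_hom_carrier[OF g]
  have inv: "h' i *\<^sub>v (h i *\<^sub>v v) = v" if "v \<in> carrier_vec (rdim M i)" for i v
    using assoc_mult_mat_vec[OF h'c hc that] h'h[of i] that by simp
  have inv': "h i *\<^sub>v (h' i *\<^sub>v v) = v" if "v \<in> carrier_vec (rdim N i)" for i v
    using assoc_mult_mat_vec[OF hc h'c that] hh'[of i] that by simp
  have im: "(*\<^sub>v) (h i * g i) ` A = (*\<^sub>v) (h i) ` ((*\<^sub>v) (g i) ` A)" if "A \<subseteq> carrier_vec (rdim P i)" for A i
    unfolding image_image using that by (intro image_cong[OF refl] assoc_mult_mat_vec[OF hc gc]) auto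
  have h_onto: "(*\<^sub>v) (h i) ` carrier_vec (rdim M i) = carrier_vec (rdim N i)" for i
  proof (intro equalityI subsetI)
    fix v :: "'k vec" assume v: "v \<in> carrier_vec (rdim N i)"
    have "v = h i *\<^sub>v (h' i *\<^sub>v v)" using inv'[OF v] by simp
    then show "v \<in> (*\<^sub>v) (h i) ` carrier_vec (rdim M i)"
      by (rule image_eqI) (rule mult_mat_vec_carrier[OF h'c v])
  next
    fix v assume "v \<in> (*\<^sub>v) (h i) ` carrier_vec (rdim M i)"
    then show "v \<in> carrier_vec (rdim N i)" using mult_mat_vec_carrier[OF hc] by auto
  qed
  show ?thesis
    unfolding essential_onto_def
  proof (intro conjI allI impI)
    fix i
    show "(*\<^sub>v) (h i * g i) ` carrier_vec (rdim P i) = carrier_vec (rdim N i)"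
      using ess h_onto[of i] unfolding im[OF order_refl] essential_onto_def by simp
  next
    fix U i assume U: "is_subrep Q P U \<and> (\<forall>i. (*\<^sub>v) (h i * g i) ` U i = carrier_vec (rdim N i))"
    have "(*\<^sub>v) (g j) ` U j = carrier_vec (rdim M j)" for j
    proof -
      have Us: "is_subrep Q P U" using U by simp
      have Uc: "U j \<subseteq> carrier_vec (rdim P j)" using subrep_carrier[OF Us] by blast
      have gU: "(*\<^sub>v) (g j) ` U j \<subseteq> carrier_vec (rdim M j)"
        by (intro image_subsetI mult_mat_vec_carrier[OF gc] subrep_carrier[OF Us])
      have "v \<in> (*\<^sub>v) (g j) ` U j" if v: "v \<in> carrier_vec (rdim M j)" for v
      proof -
        have "h j *\<^sub>v v \<in> (*\<^sub>v) (h j) ` ((*\<^sub>v) (g j) ` U j)"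
          using mult_mat_vec_carrier[OF hc v] conjunct2[OF U, rule_format, of j] unfolding im[OF Uc, symmetric] by simp
        then obtain w where w: "w \<in> (*\<^sub>v) (g j) ` U j" "h j *\<^sub>v v = h j *\<^sub>v w" by blast
        then have "v = w" using inv[OF v] inv[of w j] gU by auto
        then show ?thesis using w(1) by simp
      qed
      then show ?thesis using gU by blast
    qed
    then show "U i = carrier_vec (rdim P i)" using ess conjunct1[OF U] unfolding essential_onto_def by simp
  qed
qed

text \<open>Only \<open>g\<close> changes, by composition with the isomorphism; its kernel stays the
  same. Keeping \<open>a\<close>, \<open>b\<close> and \<open>f\<close> makes g-vectors and
  translates of isomorphic modules literally equal.\<close>

lemma min_presentation_iso:
  fixes M N :: "('v::enum, 'a, 'k::field) rep"
  assumes M: "is_rep Q M" and N: "is_rep Q N" and iso: "rep_iso Q M N"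
    and P: "is_rep Q (proj_sum Q W a)"
    and pres: "min_presentation Q W M a b f g"
  shows "\<exists>g'. min_presentation Q W N a b f g'"
proof -
  obtain h h' where h: "h \<in> rep_hom Q M N" and h': "h' \<in> rep_hom Q N M"
    and h'h: "\<And>i. h' i * h i = 1\<^sub>m (rdim M i)" and hh': "\<And>i. h i * h' i = 1\<^sub>m (rdim N i)"
    using iso unfolding rep_iso_def by auto
  have g: "g \<in> rep_hom Q (proj_sum Q W a) M" using pres by (simp add: min_presentation_def)
  note hc = rep_hom_carrier[OF h] and h'c = rep_hom_carrier[OF h'] and gc = rep_hom_carrier[OF g]
  have "(h i * g i) *\<^sub>v v = 0\<^sub>v (rdim N i) \<longleftrightarrow> g i *\<^sub>v v = 0\<^sub>v (rdim M i)"
    if v: "v \<in> carrier_vec (rdim (proj_sum Q W a) i)" for i v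
  proof -
    have gv: "g i *\<^sub>v v \<in> carrier_vec (rdim M i)" by (rule mult_mat_vec_carrier[OF gc v])
    have "h' i *\<^sub>v (h i *\<^sub>v (g i *\<^sub>v v)) = g i *\<^sub>v v"
      using assoc_mult_mat_vec[OF h'c hc gv] h'h[of i] gv by simp
    then show ?thesis
      unfolding assoc_mult_mat_vec[OF hc gc v] using mult_mat_zero_vec[OF h'c, of i] mult_mat_zero_vec[OF hc, of i] by metis
  qed
  then have ker: "{v \<in> carrier_vec (rdim (proj_sum Q W a) i). (h i * g i) *\<^sub>v v = 0\<^sub>v (rdim N i)} =
    {v \<in> carrier_vec (rdim (proj_sum Q W a) i). g i *\<^sub>v v = 0\<^sub>v (rdim M i)}" for i by blast
  have "min_presentation Q W N a b f (\<lambda>i. h i * g i)"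
    unfolding min_presentation_def ker
    using pres essential_onto_iso[OF h h' h'h hh' g] rep_hom_comp[OF P M N g h] by (simp add: min_presentation_def)
  then show ?thesis by blast
qed

section \<open>Linear structure of Hom spaces and functionals\<close>

lemma rep_hom_add:
  fixes M N :: "('v, 'a, 'k::field) rep"
  assumes M: "is_rep Q M" and N: "is_rep Q N" and h: "h \<in> rep_hom Q M N" and h': "h' \<in> rep_hom Q M N"
  shows "(\<lambda>i. h i + h' i) \<in> rep_hom Q M N"
  unfolding rep_hom_def
proof (intro CollectI conjI allI)
  note hc = rep_hom_carrier[OF h] and h'c = rep_hom_carrier[OF h']
  show "h i + h' i \<in> carrier_mat (rdim N i) (rdim M i)" for i using hc[of i] h'c[of i] by simp
  fix a
  have Ma: "rmap M a \<in> carrier_mat (rdim M (tgt Q a)) (rdim M (src Q a))"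
    and Na: "rmap N a \<in> carrier_mat (rdim N (tgt Q a)) (rdim N (src Q a))" using M N by (auto simp: is_rep_def)
  have "h (tgt Q a) * rmap M a = rmap N a * h (src Q a)" "h' (tgt Q a) * rmap M a = rmap N a * h' (src Q a)"
    using h h' by (auto simp: rep_hom_def)
  then show "(h (tgt Q a) + h' (tgt Q a)) * rmap M a = rmap N a * (h (src Q a) + h' (src Q a))"
    by (simp only: add_mult_distrib_mat[OF hc h'c Ma] mult_add_distrib_mat[OF Na hc h'c])
qed

lemma rep_hom_smult:
  fixes M N :: "('v, 'a, 'k::field) rep"
  assumes M: "is_rep Q M" and N: "is_rep Q N" and h: "h \<in> rep_hom Q M N"
  shows "(\<lambda>i. c \<cdot>\<^sub>m h i) \<in> rep_hom Q M N"
  unfolding rep_hom_def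
proof (intro CollectI conjI allI)
  note hc = rep_hom_carrier[OF h]
  show "c \<cdot>\<^sub>m h i \<in> carrier_mat (rdim N i) (rdim M i)" for i using hc[of i] by simp
  fix a
  have Ma: "rmap M a \<in> carrier_mat (rdim M (tgt Q a)) (rdim M (src Q a))"
    and Na: "rmap N a \<in> carrier_mat (rdim N (tgt Q a)) (rdim N (src Q a))" using M N by (auto simp: is_rep_def)
  have "h (tgt Q a) * rmap M a = rmap N a * h (src Q a)" using h by (auto simp: rep_hom_def)
  then show "(c \<cdot>\<^sub>m h (tgt Q a)) * rmap M a = rmap N a * (c \<cdot>\<^sub>m h (src Q a))"
    by (simp only: mult_smult_assoc_mat[OF hc Ma] mult_smult_distrib[OF Na hc])
qed

lemma smult_mat_vec:
  "A \<in> carrier_mat n m \<Longrightarrow> v \<in> carrier_vec m \<Longrightarrow> (c \<cdot>\<^sub>m A) *\<^sub>v v = c \<cdot>\<^sub>v (A *\<^sub>v (v :: 'k::field vec))"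
  by (intro eq_vecI) (auto simp: scalar_prod_def sum_distrib_left mult.assoc)

lemma annihilator_subspace:
  fixes S :: "'k::field vec set"
  assumes S: "S \<subseteq> carrier_vec n"
  shows "VectorSpace.subspace class_ring {y \<in> carrier_vec n. \<forall>s\<in>S. y \<bullet> s = 0} (module_vec TYPE('k) n)"
  unfolding subspace_vec_iff
proof (intro conjI ballI allI)
  show "0\<^sub>v n \<in> {y \<in> carrier_vec n. \<forall>s\<in>S. y \<bullet> s = 0}" using S by auto
  fix u assume u: "u \<in> {y \<in> carrier_vec n. \<forall>s\<in>S. y \<bullet> s = 0}"
  show "c \<cdot>\<^sub>v u \<in> {y \<in> carrier_vec n. \<forall>s\<in>S. y \<bullet> s = 0}" for c
    using u S smult_scalar_prod_distrib[of u n _ c] by (auto simp: subset_eq)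
  fix v assume v: "v \<in> {y \<in> carrier_vec n. \<forall>s\<in>S. y \<bullet> s = 0}"
  have "(u + v) \<bullet> s = 0" if "s \<in> S" for s
    using add_scalar_prod_distrib[of u n v s] u v that S by auto
  then show "u + v \<in> {y \<in> carrier_vec n. \<forall>s\<in>S. y \<bullet> s = 0}" using u v by simp
qed auto

lemma eq_vec_scalar_prodI:
  fixes y y' :: "'k::field vec"
  assumes y: "y \<in> carrier_vec n" and y': "y' \<in> carrier_vec n"
    and eq: "\<And>w. w \<in> carrier_vec n \<Longrightarrow> y \<bullet> w = y' \<bullet> w"
  shows "y = y'"
proof (rule eq_vecI)
  fix r assume "r < dim_vec y'"
  then have "r < n" using y' by simp
  then show "y $ r = y' $ r" using eq[of "unit_vec n r"] y y' by simp
qed (use y y' in simp)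

lemma carrier_vec_singleton_dim:
  assumes "inj_on f (carrier_vec n :: 'k::field vec set)" "\<And>v. v \<in> carrier_vec n \<Longrightarrow> f v = c"
  shows "n = 0"
proof (rule ccontr)
  assume n: "n \<noteq> 0"
  have "unit_vec n 0 = (0\<^sub>v n :: 'k vec)" by (rule inj_onD[OF assms(1)]) (simp_all add: assms(2))
  then have "(unit_vec n 0 :: 'k vec) $ 0 = 0\<^sub>v n $ 0" by simp
  then show False using n by simp
qed

lemma is_ar_translateE:
  assumes "is_ar_translate Q W M T"
  obtains a b f g \<psi> where "is_rep Q T" "min_presentation Q W M a b f g"
    "\<forall>j. bij_betw (\<psi> j) (carrier_vec (rdim T j)) (dual_transpose_space Q W a b f j)"
    "\<forall>j. \<forall>v\<in>carrier_vec (rdim T j). \<forall>w\<in>carrier_vec (rdim T j). \<forall>h. \<psi> j (v + w) h = \<psi> j v h + \<psi> j w h"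
    "\<forall>j. \<forall>v\<in>carrier_vec (rdim T j). \<forall>c h. \<psi> j (c \<cdot>\<^sub>v v) h = c * \<psi> j v h"
    "\<forall>x. \<forall>v\<in>carrier_vec (rdim T (src Q x)). \<forall>h\<in>rep_hom Q (proj_sum Q W b) (proj Q W (tgt Q x)).
        \<psi> (tgt Q x) (rmap T x *\<^sub>v v) h = \<psi> (src Q x) v (\<lambda>i. arrow_lmult Q W x i * h i)"
  using assms unfolding is_ar_translate_def by (elim conjE exE) (rule that)

text \<open>Inverse isomorphisms between the projective chosen by \<open>SOME\<close> and the model
  \<open>uni i 5\<close>. The last two clauses, compatibility with coordinates, are what identifies
  \<open>arrow_lmult\<close> with \<open>std_lmult\<close>.\<close>

definition std_iso :: "vertex \<Rightarrow> (vertex \<Rightarrow> 'k::field mat) \<Rightarrow> (vertex \<Rightarrow> 'k mat) \<Rightarrow> bool" where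
  "std_iso i \<alpha> \<beta> \<longleftrightarrow> \<alpha> \<in> rep_hom A2bar (proj A2bar pot i) (uni i 5) \<and> \<beta> \<in> rep_hom A2bar (uni i 5) (proj A2bar pot i) \<and>
    (\<forall>j. \<beta> j * \<alpha> j = 1\<^sub>m (udim i 5 j)) \<and> (\<forall>j. \<alpha> j * \<beta> j = 1\<^sub>m (udim i 5 j)) \<and>
    (\<forall>j. \<forall>x\<in>jac_hom A2bar (pot :: (vertex, arrow, 'k) series) i j. \<alpha> j *\<^sub>v snd (projective_data A2bar pot i) j x = std_coord i j x) \<and>
    (\<forall>j. \<forall>x\<in>jac_hom A2bar (pot :: (vertex, arrow, 'k) series) i j. \<beta> j *\<^sub>v std_coord i j x = snd (projective_data A2bar pot i) j x)"

lemma rep_hom_zero_only: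
  assumes M: "is_rep Q M" and T: "is_rep Q T"
    and only: "\<And>h. h \<in> rep_hom Q M T \<Longrightarrow> h = (\<lambda>i. 0\<^sub>m (rdim T i) (rdim M i))"
  shows "rep_hom Q M T = {\<lambda>i. 0\<^sub>m (rdim T i) (rdim M i)}"
  using only rep_hom_zero[OF M T] by blast

section \<open>Quotients and Laurent monomials\<close>

text \<open>\<open>f\<close> is constant on each class, so the image of a class is a singleton and
  \<open>the_elem\<close> returns the common value.\<close>

lemma bij_betw_quotient_the_elem:
  assumes r: "equiv A r" and f: "f respects r"
    and inj: "\<And>x y. x \<in> A \<Longrightarrow> y \<in> A \<Longrightarrow> f x = f y \<Longrightarrow> (x, y) \<in> r"
  shows "bij_betw (\<lambda>C. the_elem (f ` C)) (A // r) (f ` A)"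
proof -
  have val: "the_elem (f ` (r `` {x})) = f x" if "x \<in> A" for x
  proof -
    have "f ` (r `` {x}) = (\<lambda>_. f x) ` (r `` {x})"
      by (rule image_cong[OF refl]) (rule congruentD[OF f, symmetric], simp only: Image_singleton_iff)
    then have "f ` (r `` {x}) = {f x}" unfolding image_constant[OF equiv_class_self[OF r that]] .
    then show ?thesis by (simp only: the_elem_eq)
  qed
  show ?thesis
    unfolding bij_betw_def
  proof
    show "inj_on (\<lambda>C. the_elem (f ` C)) (A // r)"
    proof (rule inj_onI)
      fix C D assume "C \<in> A // r" "D \<in> A // r" and eq: "the_elem (f ` C) = the_elem (f ` D)"
      then obtain x y where x: "x \<in> A" "C = r `` {x}" and y: "y \<in> A" "D = r `` {y}" by (elim quotientE)
      have "(x, y) \<in> r" using eq val[OF x(1)] val[OF y(1)] by (intro inj[OF x(1) y(1)]) (simp add: x(2) y(2))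
      then show "C = D" unfolding x(2) y(2) by (rule equiv_class_eq[OF r])
    qed
    show "(\<lambda>C. the_elem (f ` C)) ` (A // r) = f ` A"
    proof (intro equalityI subsetI)
      fix z assume "z \<in> (\<lambda>C. the_elem (f ` C)) ` (A // r)"
      then obtain x where "x \<in> A" "z = the_elem (f ` (r `` {x}))" by (elim imageE quotientE) blast
      then show "z \<in> f ` A" using val by blast
    next
      fix z assume "z \<in> f ` A"
      then obtain x where x: "x \<in> A" "z = f x" by blast
      then show "z \<in> (\<lambda>C. the_elem (f ` C)) ` (A // r)"
        using val[OF x(1)] by (intro image_eqI[of _ _ "r `` {x}"] quotientI) simp_all
    qed
  qed
qed

lemma single_eq_single_iff:
  "Poly_Mapping.single a c = Poly_Mapping.single b d \<longleftrightarrow> a = b \<and> c = d \<or> c = 0 \<and> d = (0 :: 'b::zero)"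
proof
  assume eq: "Poly_Mapping.single a c = Poly_Mapping.single b d"
  show "a = b \<and> c = d \<or> c = 0 \<and> d = 0"
    using arg_cong[OF eq, of "\<lambda>p. Poly_Mapping.lookup p a"] arg_cong[OF eq, of "\<lambda>p. Poly_Mapping.lookup p b"]
    by (auto simp: lookup_single when_def split: if_splits)
qed auto

text \<open>The expected value of \<open>CC\<close> at \<open>uni i l\<close>: the coefficient
  counts submodules, and the exponent is the negative g-vector, without contribution of a second
  term when the module is projective.\<close>

definition cc_value :: "vertex \<Rightarrow> nat \<Rightarrow> vertex laurent" where
  "cc_value i l = Poly_Mapping.single
     (\<lambda>j. int (if l \<noteq> 5 \<and> j = vtx i l then 1 else 0) - int (if j = i then 1 else 0)) (int (Suc l))"

lemma vertex_fun_eq_iff: "f = g \<longleftrightarrow> f V1 = g V1 \<and> f V2 = g V2"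
  by (metis ext vertex.exhaust)

text \<open>The coefficient, 2 or 6, gives the length, and the vertex with exponent -1 gives the
  top.\<close>

lemma cc_value_inj:
  assumes "cc_value i l = cc_value i' l'" "l \<in> {1, 5}" "l' \<in> {1, 5}"
  shows "i = i' \<and> l = l'"
  using assms by (cases i; cases i') (auto simp: cc_value_def single_eq_single_iff vertex_fun_eq_iff vtx_def)

lemma numeral_mult_single:
  "numeral n * Poly_Mapping.single (a :: 'a::monoid_add) (b :: int) = Poly_Mapping.single a (numeral n * b)"
  by (simp add: single_numeral[symmetric] mult_single del: single_numeral)

lemma cc_value_cluster:
  "cc_value V1 1 = 2 * lvar V2 * lvar_inv V1" "cc_value V2 1 = 2 * lvar V1 * lvar_inv V2"
  "cc_value i 5 = 6 * lvar_inv i"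
  by (auto simp: cc_value_def lvar_def lvar_inv_def lmono_def numeral_mult_single mult_single single_eq_single_iff
      vertex_fun_eq_iff vtx_def plus_fun_def)

lemma lvar_neq_cc_value: "l \<in> {1, 5} \<Longrightarrow> lvar v \<noteq> cc_value i l"
  by (auto simp: cc_value_def lvar_def lmono_def single_eq_single_iff)

lemma noninitial_cluster_variables:
  "cluster_variables A2bar_cluster_algebra - initial_variables A2bar_cluster_algebra =
    {2 * lvar V2 * lvar_inv V1, 2 * lvar V1 * lvar_inv V2, 6 * lvar_inv V1, 6 * lvar_inv V2}"
  using lvar_neq_cc_value[of 1] lvar_neq_cc_value[of 5]
  unfolding A2bar_cluster_algebra_def A2bar_cluster_variables_def cc_value_cluster[symmetric] by auto

section \<open>Indecomposable projective modules\<close>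

context
  assumes char3: "(3 :: 'k::field) \<noteq> 0"
begin

abbreviation (input) "\<W> \<equiv> A2bar_potential :: (vertex, arrow, 'k) series"
abbreviation (input) "Proj i \<equiv> proj A2bar \<W> i"
abbreviation (input) "ProjSum b \<equiv> proj_sum A2bar \<W> b"
abbreviation (input) "crd i \<equiv> snd (projective_data A2bar \<W> i)"
abbreviation (input) "lm s \<equiv> arrow_lmult A2bar \<W> (arr s)"

section \<open>The Jacobian algebra in coordinates\<close>

lemma cls_eq_set:
  assumes f: "f \<in> carrier (PA :: (vertex, arrow, 'k) series ring)"
  shows "cls f = {h \<in> carrier PA. \<forall>i. \<forall>n<5. h (i, alt i n) = f (i, alt i n)}"
proof (intro equalityI subsetI)
  fix h assume "h \<in> cls f"
  then obtain g where "g \<in> high_order" "h = g \<oplus>\<^bsub>PA\<^esub> f"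
    unfolding jac_class_def jacobian_ideal_A2bar[OF char3] by (auto simp: a_r_coset_def')
  then show "h \<in> {h \<in> carrier PA. \<forall>i. \<forall>n<5. h (i, alt i n) = f (i, alt i n)}"
    using f by (auto simp: high_order_def add_PA carrier_PA)
next
  fix h assume h: "h \<in> {h \<in> carrier PA. \<forall>i. \<forall>n<5. h (i, alt i n) = f (i, alt i n)}"
  have "(\<lambda>p. h p - f p) \<in> high_order"
    using h f by (intro high_orderI) (auto simp: carrier_PA)
  moreover have "h = (\<lambda>p. h p - f p) \<oplus>\<^bsub>PA\<^esub> f" by (auto simp: add_PA)
  ultimately show "h \<in> cls f"
    unfolding jac_class_def jacobian_ideal_A2bar[OF char3] by (auto simp: a_r_coset_def')
qed

lemma cls_eq_iff:
  assumes "f \<in> carrier (PA :: (vertex, arrow, 'k) series ring)" "g \<in> carrier PA"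
  shows "cls f = cls g \<longleftrightarrow> (\<forall>i. \<forall>n<5. f (i, alt i n) = g (i, alt i n))"
  using assms by (auto simp: cls_eq_set)

lemma carrier_Jac: "carrier (Jac :: (vertex, arrow, 'k) series set ring) = cls ` carrier PA"
  by (auto simp: jacobian_algebra_def FactRing_def A_RCOSETS_def' jac_class_def)

lemma cls_mult:
  assumes "f \<in> carrier (PA :: (vertex, arrow, 'k) series ring)" "g \<in> carrier PA"
  shows "cls f \<otimes>\<^bsub>Jac\<^esub> cls g = cls (f \<otimes>\<^bsub>PA\<^esub> g)"
  using ideal.rcoset_mult_add[OF ideal_high_order assms]
  by (simp add: jacobian_algebra_def FactRing_def jac_class_def jacobian_ideal_A2bar[OF char3])

lemma cls_add:
  assumes "f \<in> carrier (PA :: (vertex, arrow, 'k) series ring)" "g \<in> carrier PA"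
  shows "cls f \<oplus>\<^bsub>Jac\<^esub> cls g = cls (f \<oplus>\<^bsub>PA\<^esub> g)"
  using abelian_subgroup.a_rcos_sum[OF abelian_subgroupI3[OF ideal.axioms(1)[OF ideal_high_order] ring.is_abelian_group[OF ring_path_algebra]] assms]
  by (simp add: jacobian_algebra_def FactRing_def jac_class_def jacobian_ideal_A2bar[OF char3])

lemma PA_mult_closed: "f \<in> carrier (PA :: (vertex, arrow, 'k) series ring) \<Longrightarrow> g \<in> carrier PA \<Longrightarrow> f \<otimes>\<^bsub>PA\<^esub> g \<in> carrier PA"
  using ring.ring_simprules(5)[OF ring_path_algebra] .

lemma PA_add_closed: "f \<in> carrier (PA :: (vertex, arrow, 'k) series ring) \<Longrightarrow> g \<in> carrier PA \<Longrightarrow> f \<oplus>\<^bsub>PA\<^esub> g \<in> carrier PA"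
  using ring.ring_simprules(1)[OF ring_path_algebra] .

text \<open>Multiplying by the two vertex idempotents deletes every path that does not run from
  \<open>i\<close> to \<open>j\<close> and changes nothing else.\<close>

lemma jac_hom_A2bar: "jac_hom A2bar \<W> i j = cls ` (from_to i j :: (vertex, arrow, 'k) series set)"
proof -
  have eq: "cls (vertex_elt i) \<otimes>\<^bsub>Jac\<^esub> cls f \<otimes>\<^bsub>Jac\<^esub> cls (vertex_elt j) = cls (vertex_elt i \<otimes>\<^bsub>PA\<^esub> f \<otimes>\<^bsub>PA\<^esub> vertex_elt j)"
    if "f \<in> carrier (PA :: (vertex, arrow, 'k) series ring)" for f
    using that by (simp add: cls_mult PA_mult_closed)
  have mem: "vertex_elt i \<otimes>\<^bsub>PA\<^esub> f \<otimes>\<^bsub>PA\<^esub> vertex_elt j \<in> from_to i j"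
    if "f \<in> carrier (PA :: (vertex, arrow, 'k) series ring)" for f
    using that by (auto simp: from_to_def PA_mult_closed vertex_elt_mult mult_vertex_elt split: if_splits)
  have fix_: "vertex_elt i \<otimes>\<^bsub>PA\<^esub> f \<otimes>\<^bsub>PA\<^esub> vertex_elt j = f" if f: "f \<in> from_to i j" for f :: "(vertex, arrow, 'k) series"
  proof (rule PA_ext)
    show "vertex_elt i \<otimes>\<^bsub>PA\<^esub> f \<otimes>\<^bsub>PA\<^esub> vertex_elt j \<in> carrier PA" "f \<in> carrier PA"
      using f by (simp_all add: from_to_def PA_mult_closed)
    show "(vertex_elt i \<otimes>\<^bsub>PA\<^esub> f \<otimes>\<^bsub>PA\<^esub> vertex_elt j) (k, alt k n) = f (k, alt k n)" for k n
      using f by (auto simp: from_to_def vertex_elt_mult mult_vertex_elt)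
  qed
  show ?thesis
    unfolding jac_hom_def carrier_Jac vertex_elt_def[symmetric]
  proof (intro equalityI subsetI)
    fix x assume "x \<in> {cls (vertex_elt i) \<otimes>\<^bsub>Jac\<^esub> x \<otimes>\<^bsub>Jac\<^esub> cls (vertex_elt j) |x. x \<in> cls ` carrier (PA :: (vertex, arrow, 'k) series ring)}"
    then obtain f where "f \<in> carrier (PA :: (vertex, arrow, 'k) series ring)" "x = cls (vertex_elt i) \<otimes>\<^bsub>Jac\<^esub> cls f \<otimes>\<^bsub>Jac\<^esub> cls (vertex_elt j)"
      by blast
    then show "x \<in> cls ` from_to i j" using eq mem by auto
  next
    fix x assume "x \<in> cls ` (from_to i j :: (vertex, arrow, 'k) series set)"
    then obtain f where f: "f \<in> from_to i j" "x = cls f" by blast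
    then have fc: "f \<in> carrier PA" by (simp add: from_to_def)
    have "x = cls (vertex_elt i) \<otimes>\<^bsub>Jac\<^esub> cls f \<otimes>\<^bsub>Jac\<^esub> cls (vertex_elt j)" using eq[OF fc] fix_[OF f(1)] f(2) by simp
    then show "x \<in> {cls (vertex_elt i) \<otimes>\<^bsub>Jac\<^esub> x \<otimes>\<^bsub>Jac\<^esub> cls (vertex_elt j) |x. x \<in> cls ` carrier (PA :: (vertex, arrow, 'k) series ring)}"
      using fc by blast
  qed
qed

lemma from_to_carrier: "f \<in> from_to i j \<Longrightarrow> f \<in> carrier (PA :: (vertex, arrow, 'k) series ring)"
  by (simp add: from_to_def)

lemma from_to_add: "f \<in> from_to i j \<Longrightarrow> g \<in> from_to i j \<Longrightarrow> f \<oplus>\<^bsub>PA\<^esub> g \<in> (from_to i j :: (vertex, arrow, 'k) series set)"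
  unfolding from_to_def
proof (elim CollectE conjE, intro CollectI conjI allI impI)
  fix k n
  assume f: "f \<in> carrier (PA :: (vertex, arrow, 'k) series ring)" "\<forall>k n. f (k, alt k n) \<noteq> 0 \<longrightarrow> k = i \<and> vtx k n = j"
    and g: "g \<in> carrier PA" "\<forall>k n. g (k, alt k n) \<noteq> 0 \<longrightarrow> k = i \<and> vtx k n = j"
  show "f \<oplus>\<^bsub>PA\<^esub> g \<in> carrier PA" using f g by (simp add: PA_add_closed)
  assume "(f \<oplus>\<^bsub>PA\<^esub> g) (k, alt k n) \<noteq> 0"
  then have "f (k, alt k n) \<noteq> 0 \<or> g (k, alt k n) \<noteq> 0" by (auto simp: add_PA)
  then show "k = i" "vtx k n = j" using f(2) g(2) by blast+
qed

lemma from_to_const: "f \<in> from_to i j \<Longrightarrow> (\<lambda>(i, as). if as = [] then c else 0) \<otimes>\<^bsub>PA\<^esub> f \<in> (from_to i j :: (vertex, arrow, 'k) series set)"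
  by (auto simp: from_to_def PA_mult_closed const_mult)

lemma from_to_mult_arrow: "f \<in> from_to i j \<Longrightarrow> f \<otimes>\<^bsub>PA\<^esub> arrow_elt j \<in> (from_to i (oth j) :: (vertex, arrow, 'k) series set)"
  by (auto simp: from_to_def PA_mult_closed mult_arrow_elt split: if_splits)

lemma from_to_arrow_mult: "f \<in> from_to (oth s) j \<Longrightarrow> arrow_elt s \<otimes>\<^bsub>PA\<^esub> f \<in> (from_to s j :: (vertex, arrow, 'k) series set)"
proof -
  assume f: "f \<in> from_to (oth s) j"
  have "vtx s n = j" if "0 < n" "f (oth s, alt (oth s) (n - 1)) \<noteq> 0" for n
  proof -
    have "f (oth s, alt (oth s) (n - 1)) \<noteq> 0 \<longrightarrow> oth s = oth s \<and> vtx (oth s) (n - 1) = j"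
      using f unfolding from_to_def by blast
    then have "vtx (oth s) (n - 1) = j" using that(2) by (elim impE conjE)
    then show ?thesis using that(1) by (cases n) simp_all
  qed
  note v = this
  show ?thesis
    unfolding from_to_def
  proof (intro CollectI conjI allI impI)
    show "arrow_elt s \<otimes>\<^bsub>PA\<^esub> f \<in> carrier PA" using f by (simp add: from_to_def PA_mult_closed)
    fix k n assume "(arrow_elt s \<otimes>\<^bsub>PA\<^esub> f) (k, alt k n) \<noteq> 0"
    then have "0 < n" "k = s" "f (oth s, alt (oth s) (n - 1)) \<noteq> 0" unfolding arrow_elt_mult by (auto split: if_splits)
    then show "k = s" "vtx k n = j" using v[of n] by simp_all
  qed
qed

lemma jac_hom_add: "x \<in> jac_hom A2bar \<W> i j \<Longrightarrow> y \<in> jac_hom A2bar \<W> i j \<Longrightarrow>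
    x \<oplus>\<^bsub>Jac\<^esub> y \<in> (jac_hom A2bar \<W> i j :: (vertex, arrow, 'k) series set set)"
  unfolding jac_hom_A2bar by (auto simp: cls_add from_to_carrier from_to_add)

lemma jac_hom_scalar: "x \<in> jac_hom A2bar \<W> i j \<Longrightarrow>
    jac_scalar A2bar \<W> c \<otimes>\<^bsub>Jac\<^esub> x \<in> (jac_hom A2bar \<W> i j :: (vertex, arrow, 'k) series set set)"
  unfolding jac_hom_A2bar jac_scalar_def by (auto simp: cls_mult from_to_carrier from_to_const)

lemma jac_hom_mult_arrow: "x \<in> jac_hom A2bar \<W> i j \<Longrightarrow>
    x \<otimes>\<^bsub>Jac\<^esub> cls (arrow_elt j) \<in> (jac_hom A2bar \<W> i (oth j) :: (vertex, arrow, 'k) series set set)"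
  unfolding jac_hom_A2bar by (auto simp: cls_mult from_to_carrier from_to_mult_arrow)

lemma jac_hom_arrow_mult: "x \<in> jac_hom A2bar \<W> (oth s) j \<Longrightarrow>
    cls (arrow_elt s) \<otimes>\<^bsub>Jac\<^esub> x \<in> (jac_hom A2bar \<W> s j :: (vertex, arrow, 'k) series set set)"
  unfolding jac_hom_A2bar by (auto simp: cls_mult from_to_carrier from_to_arrow_mult)

lemma std_coord_cls:
  assumes f: "f \<in> carrier (PA :: (vertex, arrow, 'k) series ring)"
  shows "std_coord i j (cls f) = vec (udim i 5 j) (\<lambda>c. f (i, alt i (2 * c + off i j)))"
proof -
  have "f \<in> cls f" using f by (simp add: cls_eq_set)
  then have "(SOME g. g \<in> cls f) \<in> cls f" by (rule someI[of "\<lambda>g. g \<in> cls f"])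
  then have "(SOME g. g \<in> cls f) (i, alt i n) = f (i, alt i n)" if "n < 5" for n
    using that f by (simp add: cls_eq_set)
  then show ?thesis unfolding std_coord_def by (intro eq_vecI) (simp_all add: lt_udim)
qed

text \<open>A class is determined by its coefficients below length 5, and the paths from
  \<open>i\<close> to \<open>j\<close> of such length correspond to the indices below
  \<open>udim i 5 j\<close>.\<close>

lemma std_coord_bij: "bij_betw (std_coord i j) (jac_hom A2bar \<W> i j) (carrier_vec (udim i 5 j) :: 'k vec set)"
  unfolding bij_betw_def
proof (intro conjI)
  show "inj_on (std_coord i j :: _ \<Rightarrow> 'k vec) (jac_hom A2bar \<W> i j)"
  proof (rule inj_onI)
    fix x y :: "(vertex, arrow, 'k) series set"
    assume "x \<in> jac_hom A2bar \<W> i j" "y \<in> jac_hom A2bar \<W> i j" and eq: "std_coord i j x = std_coord i j y"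
    then obtain f g where f: "f \<in> from_to i j" "x = cls f" and g: "g \<in> from_to i j" "y = cls g"
      unfolding jac_hom_A2bar by blast
    note fc = from_to_carrier[OF f(1)] and gc = from_to_carrier[OF g(1)]
    have "f (k, alt k n) = g (k, alt k n)" if n: "n < 5" for k n
    proof (cases "k = i \<and> vtx k n = j")
      case True
      from True have ki: "k = i" by (rule conjunct1)
      from True have "vtx k n = j" by (rule conjunct2)
      then have "vtx i n = j" unfolding ki .
      then have len: "2 * (n div 2) + off i j = n" using len_div_off[of n i] by (simp only:)
      then have c: "n div 2 < udim i 5 j" using n by (simp add: lt_udim)
      have "std_coord i j x $ (n div 2) = f (i, alt i n)" "std_coord i j y $ (n div 2) = g (i, alt i n)"
        using c len by (simp_all add: f(2) g(2) std_coord_cls[OF fc] std_coord_cls[OF gc])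
      then show ?thesis using eq unfolding ki by simp
    next
      case False
      then have "f (k, alt k n) = 0" "g (k, alt k n) = 0" using f(1) g(1) unfolding from_to_def by blast+
      then show ?thesis by simp
    qed
    then show "x = y" using f(2) g(2) cls_eq_iff[OF fc gc] by simp
  qed
  show "std_coord i j ` jac_hom A2bar \<W> i j = (carrier_vec (udim i 5 j) :: 'k vec set)"
  proof (intro equalityI subsetI)
    fix y :: "'k vec" assume y: "y \<in> carrier_vec (udim i 5 j)"
    define f :: "(vertex, arrow, 'k) series" where
      "f = (\<lambda>(k, as). if k = i \<and> as = alt i (length as) \<and> vtx i (length as) = j \<and> length as < 5 then y $ (length as div 2) else 0)"
    have f: "f \<in> from_to i j" by (auto simp: from_to_def f_def carrier_PA)
    have "std_coord i j (cls f) = y"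
      unfolding std_coord_cls[OF from_to_carrier[OF f]]
    proof (rule eq_vecI)
      fix c assume "c < dim_vec y"
      then have c: "c < udim i 5 j" using y by simp
      have "(2 * c + off i j) div 2 = c" using off_0_or_1[of i j] by auto
      then show "vec (udim i 5 j) (\<lambda>c. f (i, alt i (2 * c + off i j))) $ c = y $ c"
        using c by (simp add: f_def lt_udim)
    qed (use y in simp)
    then show "y \<in> std_coord i j ` jac_hom A2bar \<W> i j" using f unfolding jac_hom_A2bar by blast
  qed (auto simp: std_coord_def)
qed

text \<open>Provides the witness for the \<open>SOME\<close> in \<open>projective_data\<close>.
  Appending an arrow to a path and the arrow of \<open>uni i 5\<close> are the same index
  shift.\<close>

lemma is_projective_uni: "is_projective_at A2bar \<W> i (uni i 5) (std_coord i)"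
  unfolding is_projective_at_def
proof (intro conjI allI ballI)
  fix j
  show "bij_betw (std_coord i j) (jac_hom A2bar \<W> i j) (carrier_vec (rdim (uni i 5 :: (vertex, arrow, 'k) rep) j) :: 'k vec set)"
    using std_coord_bij by simp
  fix x :: "(vertex, arrow, 'k) series set" assume "x \<in> jac_hom A2bar \<W> i j"
  then obtain f where f: "f \<in> from_to i j" "x = cls f" unfolding jac_hom_A2bar by blast
  note fc = from_to_carrier[OF f(1)]
  show "std_coord i j (jac_scalar A2bar \<W> c \<otimes>\<^bsub>Jac\<^esub> x) = c \<cdot>\<^sub>v std_coord i j x" for c
    unfolding f(2) jac_scalar_def cls_mult[OF const_carrier fc] std_coord_cls[OF fc] std_coord_cls[OF PA_mult_closed[OF const_carrier fc]] const_mult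
    by auto
  fix y :: "(vertex, arrow, 'k) series set" assume "y \<in> jac_hom A2bar \<W> i j"
  then obtain g where g: "g \<in> from_to i j" "y = cls g" unfolding jac_hom_A2bar by blast
  note gc = from_to_carrier[OF g(1)]
  show "std_coord i j (x \<oplus>\<^bsub>Jac\<^esub> y) = std_coord i j x + std_coord i j y"
    unfolding f(2) g(2) cls_add[OF fc gc] std_coord_cls[OF fc] std_coord_cls[OF gc] std_coord_cls[OF PA_add_closed[OF fc gc]] add_PA
    by auto
next
  fix a and x :: "(vertex, arrow, 'k) series set"
  assume x: "x \<in> jac_hom A2bar \<W> i (src A2bar a)"
  obtain j where a: "a = arr j" by (cases a rule: arrow_cases_arr)
  obtain f where f: "f \<in> from_to i j" "x = cls f" using x unfolding a jac_hom_A2bar src_arr by blast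
  note fc = from_to_carrier[OF f(1)]
  let ?v = "vec (udim i 5 j) (\<lambda>c. f (i, alt i (2 * c + off i j)))"
  have "std_coord i (oth j) (cls f \<otimes>\<^bsub>Jac\<^esub> cls (arrow_elt j)) = rmap (uni i 5) (arr j) *\<^sub>v std_coord i j (cls f)"
    unfolding cls_mult[OF fc arrow_elt_carrier] std_coord_cls[OF fc] std_coord_cls[OF PA_mult_closed[OF fc arrow_elt_carrier]] mult_arrow_elt
  proof (rule eq_vecI)
    fix r assume "r < dim_vec (rmap (uni i 5) (arr j) *\<^sub>v ?v)"
    then have r: "r < udim i 5 (oth j)" using rmap_arr_carrier[OF is_rep_uni, of i 5 j] by (simp add: rmap_uni)
    have "r - off i j < udim i 5 j" if "off i j \<le> r" using r that off_0_or_1[of i j] by (auto simp: lt_udim off_oth)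
    moreover have "0 < 2 * r + off i (oth j) \<longleftrightarrow> off i j \<le> r" using off_0_or_1[of i j] by (auto simp: off_oth)
    moreover have "2 * (r - off i j) + off i j = 2 * r + off i (oth j) - 1" if "off i j \<le> r"
      using that off_0_or_1[of i j] by (auto simp: off_oth)
    ultimately show "vec (udim i 5 (oth j)) (\<lambda>c. if 0 < 2 * c + off i (oth j) \<and> vtx i (2 * c + off i (oth j)) = oth j
        then f (i, alt i (2 * c + off i (oth j) - 1)) else 0) $ r = (rmap (uni i 5) (arr j) *\<^sub>v ?v) $ r"
      using rmap_uni_vec[of ?v i 5 j r] r by auto
  qed (simp add: rmap_uni)
  then show "std_coord i (tgt A2bar a) (x \<otimes>\<^bsub>Jac\<^esub> cls (path_elt (src A2bar a, [a]))) = rmap (uni i 5) a *\<^sub>v std_coord i (src A2bar a) x"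
    unfolding a f(2) src_arr tgt_arr arrow_elt_def .
qed simp

text \<open>One coordinate map is inverted and the other applied. The result is additive and
  homogeneous, hence a matrix, and both coordinate systems describe the same right action.\<close>

lemma projective_hom:
  fixes P P' :: "(vertex, arrow, 'k) rep"
  assumes P: "is_projective_at A2bar \<W> i P \<phi>"
    and P': "is_projective_at A2bar \<W> i P' \<phi>'"
  obtains h where "h \<in> rep_hom A2bar P P'" "\<And>j x. x \<in> jac_hom A2bar \<W> i j \<Longrightarrow> h j *\<^sub>v \<phi> j x = \<phi>' j x"
proof -
  have bij: "bij_betw (\<phi> j) (jac_hom A2bar \<W> i j) (carrier_vec (rdim P j))"
    and bij': "bij_betw (\<phi>' j) (jac_hom A2bar \<W> i j) (carrier_vec (rdim P' j))" for j
    using P P' by (auto simp: is_projective_at_def)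
  have mem: "\<phi> j x \<in> carrier_vec (rdim P j)" "\<phi>' j x \<in> carrier_vec (rdim P' j)" if "x \<in> jac_hom A2bar \<W> i j" for j x
    using that bij[of j] bij'[of j] by (auto simp: bij_betw_def)
  have "\<exists>A. A \<in> carrier_mat (rdim P' j) (rdim P j) \<and> (\<forall>x\<in>jac_hom A2bar \<W> i j. A *\<^sub>v \<phi> j x = \<phi>' j x)" for j
  proof -
    define iv where "iv = inv_into (jac_hom A2bar \<W> i j) (\<phi> j)"
    have iv: "iv v \<in> jac_hom A2bar \<W> i j" "\<phi> j (iv v) = v" if "v \<in> carrier_vec (rdim P j)" for v
      using that bij_betw_imp_surj_on[OF bij[of j]] inv_into_into[of v "\<phi> j" "jac_hom A2bar \<W> i j"] f_inv_into_f[of v "\<phi> j" "jac_hom A2bar \<W> i j"]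
      by (simp_all add: iv_def)
    have iv_eq: "iv (\<phi> j x) = x" if "x \<in> jac_hom A2bar \<W> i j" for x
      using that bij_betw_inv_into_left[OF bij[of j]] by (simp add: iv_def)
    obtain A where A: "A \<in> carrier_mat (rdim P' j) (rdim P j)" "\<And>v. v \<in> carrier_vec (rdim P j) \<Longrightarrow> \<phi>' j (iv v) = A *\<^sub>v v"
    proof (rule additive_homogeneous_mult_mat_vec[of "rdim P j" "\<lambda>v. \<phi>' j (iv v)" "rdim P' j"])
      fix v :: "'k vec" assume v: "v \<in> carrier_vec (rdim P j)"
      show "\<phi>' j (iv v) \<in> carrier_vec (rdim P' j)" using iv[OF v] mem by auto
      show "\<phi>' j (iv (c \<cdot>\<^sub>v v)) = c \<cdot>\<^sub>v \<phi>' j (iv v)" for c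
      proof -
        have "\<phi> j (jac_scalar A2bar \<W> c \<otimes>\<^bsub>Jac\<^esub> iv v) = c \<cdot>\<^sub>v v"
          using P iv[OF v] by (auto simp: is_projective_at_def)
        then have "iv (c \<cdot>\<^sub>v v) = jac_scalar A2bar \<W> c \<otimes>\<^bsub>Jac\<^esub> iv v"
          using iv_eq[OF jac_hom_scalar[OF iv(1)[OF v], of c]] by simp
        then show ?thesis using P' iv(1)[OF v] by (auto simp: is_projective_at_def)
      qed
      fix w :: "'k vec" assume w: "w \<in> carrier_vec (rdim P j)"
      have "\<phi> j (iv v \<oplus>\<^bsub>Jac\<^esub> iv w) = v + w"
        using P iv[OF v] iv[OF w] by (auto simp: is_projective_at_def)
      then have "iv (v + w) = iv v \<oplus>\<^bsub>Jac\<^esub> iv w"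
        using iv_eq[OF jac_hom_add[OF iv(1)[OF v] iv(1)[OF w]]] by simp
      then show "\<phi>' j (iv (v + w)) = \<phi>' j (iv v) + \<phi>' j (iv w)"
        using P' iv(1)[OF v] iv(1)[OF w] by (auto simp: is_projective_at_def)
    qed blast
    then show ?thesis using mem(1) iv_eq by (intro exI[of _ A]) (auto simp flip: A(2))
  qed
  then obtain h where h: "\<And>j. h j \<in> carrier_mat (rdim P' j) (rdim P j)"
    "\<And>j x. x \<in> jac_hom A2bar \<W> i j \<Longrightarrow> h j *\<^sub>v \<phi> j x = \<phi>' j x" by metis
  have Pr: "is_rep A2bar P" and P'r: "is_rep A2bar P'" using P P' by (simp_all add: is_projective_at_def)
  have "h \<in> rep_hom A2bar P P'"
    unfolding rep_hom_A2bar
  proof (intro conjI allI)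
    fix j
    note Pc = rmap_arr_carrier[OF Pr, of j] and P'c = rmap_arr_carrier[OF P'r, of j]
    show "h (oth j) * rmap P (arr j) = rmap P' (arr j) * h j"
    proof (rule eq_mat_on_vecI[OF mult_carrier_mat[OF h(1) Pc] mult_carrier_mat[OF P'c h(1)]])
      fix v :: "'k vec" assume v: "v \<in> carrier_vec (rdim P j)"
      then obtain x where x: "x \<in> jac_hom A2bar \<W> i j" "v = \<phi> j x"
        using bij_betw_imp_surj_on[OF bij[of j]] by blast
      have ax: "\<phi> (oth j) (x \<otimes>\<^bsub>Jac\<^esub> cls (arrow_elt j)) = rmap P (arr j) *\<^sub>v v"
        "\<phi>' (oth j) (x \<otimes>\<^bsub>Jac\<^esub> cls (arrow_elt j)) = rmap P' (arr j) *\<^sub>v \<phi>' j x"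
        using P P' x unfolding is_projective_at_def all_arrow_iff by (simp_all add: arrow_elt_def)
      have "h (oth j) *\<^sub>v (rmap P (arr j) *\<^sub>v v) = \<phi>' (oth j) (x \<otimes>\<^bsub>Jac\<^esub> cls (arrow_elt j))"
        unfolding ax(1)[symmetric] by (rule h(2)[OF jac_hom_mult_arrow[OF x(1)]])
      also have "\<dots> = rmap P' (arr j) *\<^sub>v (h j *\<^sub>v v)" unfolding ax(2) using h(2)[OF x(1)] x(2) by simp
      finally show "(h (oth j) * rmap P (arr j)) *\<^sub>v v = (rmap P' (arr j) * h j) *\<^sub>v v"
        using assoc_mult_mat_vec[OF h(1) Pc v] assoc_mult_mat_vec[OF P'c h(1) v] by simp
    qed
  qed (rule h(1))
  then show thesis using that h(2) by blast
qed


lemma is_projective_proj: "is_projective_at A2bar \<W> i (Proj i) (crd i)"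
proof -
  have "case projective_data A2bar \<W> i of (P, \<phi>) \<Rightarrow> is_projective_at A2bar \<W> i P \<phi>"
    unfolding projective_data_def
    by (rule someI[of _ "(uni i 5, std_coord i)"]) (simp add: is_projective_uni)
  then show ?thesis by (simp add: proj_def case_prod_beta)
qed

lemma is_rep_proj: "is_rep A2bar (Proj i)"
  using is_projective_proj[of i] by (simp add: is_projective_at_def)

lemma proj_iso_uni:
  obtains \<alpha> \<beta> where "\<alpha> \<in> rep_hom A2bar (Proj i) (uni i 5)" "\<beta> \<in> rep_hom A2bar (uni i 5) (Proj i)"
    "\<And>j. \<beta> j * \<alpha> j = 1\<^sub>m (rdim (Proj i) j)" "\<And>j. \<alpha> j * \<beta> j = 1\<^sub>m (udim i 5 j)"
    "\<And>j x. x \<in> jac_hom A2bar \<W> i j \<Longrightarrow> \<alpha> j *\<^sub>v crd i j x = std_coord i j x"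
    "\<And>j x. x \<in> jac_hom A2bar \<W> i j \<Longrightarrow> \<beta> j *\<^sub>v std_coord i j x = crd i j x"
proof -
  obtain \<alpha> where a: "\<alpha> \<in> rep_hom A2bar (Proj i) (uni i 5)"
    "\<And>j x. x \<in> jac_hom A2bar \<W> i j \<Longrightarrow> \<alpha> j *\<^sub>v crd i j x = std_coord i j x"
    using projective_hom[OF is_projective_proj is_projective_uni] by blast
  obtain \<beta> where b: "\<beta> \<in> rep_hom A2bar (uni i 5) (Proj i)"
    "\<And>j x. x \<in> jac_hom A2bar \<W> i j \<Longrightarrow> \<beta> j *\<^sub>v std_coord i j x = crd i j x"
    using projective_hom[OF is_projective_uni is_projective_proj] by blast
  have ac: "\<alpha> j \<in> carrier_mat (udim i 5 j) (rdim (Proj i) j)" and bc: "\<beta> j \<in> carrier_mat (rdim (Proj i) j) (udim i 5 j)" for j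
    using rep_hom_carrier[OF a(1), of j] rep_hom_carrier[OF b(1), of j] by simp_all
  have "\<beta> j * \<alpha> j = 1\<^sub>m (rdim (Proj i) j)" for j
  proof (rule eq_mat_on_vecI[OF mult_carrier_mat[OF bc ac] one_carrier_mat])
    fix v :: "'k vec" assume v: "v \<in> carrier_vec (rdim (Proj i) j)"
    have "bij_betw (crd i j) (jac_hom A2bar \<W> i j) (carrier_vec (rdim (Proj i) j))"
      using is_projective_proj[of i] by (simp add: is_projective_at_def)
    then obtain x where x: "x \<in> jac_hom A2bar \<W> i j" "v = crd i j x"
      using bij_betw_imp_surj_on v by blast
    then show "(\<beta> j * \<alpha> j) *\<^sub>v v = 1\<^sub>m (rdim (Proj i) j) *\<^sub>v v"
      using a(2)[OF x(1)] b(2)[OF x(1)] assoc_mult_mat_vec[OF bc ac v] v by simp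
  qed
  moreover have "\<alpha> j * \<beta> j = 1\<^sub>m (udim i 5 j)" for j
  proof (rule eq_mat_on_vecI[OF mult_carrier_mat[OF ac bc] one_carrier_mat])
    fix v :: "'k vec" assume v: "v \<in> carrier_vec (udim i 5 j)"
    then obtain x where x: "x \<in> jac_hom A2bar \<W> i j" "v = std_coord i j x"
      using bij_betw_imp_surj_on[OF std_coord_bij] by blast
    then show "(\<alpha> j * \<beta> j) *\<^sub>v v = 1\<^sub>m (udim i 5 j) *\<^sub>v v"
      using a(2)[OF x(1)] b(2)[OF x(1)] assoc_mult_mat_vec[OF ac bc v] v by simp
  qed
  ultimately show thesis using that a b by blast
qed

lemma std_lmult_coord:
  assumes x: "x \<in> jac_hom A2bar \<W> (oth s) j"
  shows "std_lmult s j *\<^sub>v std_coord (oth s) j x = (std_coord s j (cls (arrow_elt s) \<otimes>\<^bsub>Jac\<^esub> x) :: 'k vec)"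
proof -
  obtain f where f: "f \<in> from_to (oth s) j" "x = cls f" using x unfolding jac_hom_A2bar by blast
  note fc = from_to_carrier[OF f(1)]
  let ?v = "vec (udim (oth s) 5 j) (\<lambda>c. f (oth s, alt (oth s) (2 * c + off (oth s) j)))"
  show ?thesis
    unfolding f(2) cls_mult[OF arrow_elt_carrier fc] std_coord_cls[OF fc] std_coord_cls[OF PA_mult_closed[OF arrow_elt_carrier fc]] arrow_elt_mult
  proof (rule eq_vecI)
    fix r assume "r < dim_vec (vec (udim s 5 j) (\<lambda>c. if 0 < 2 * c + off s j \<and> s = s then f (oth s, alt (oth s) (2 * c + off s j - 1)) else 0))"
    then have r: "r < udim s 5 j" by simp
    have "r - off (oth s) j < udim (oth s) 5 j" if "off (oth s) j \<le> r" using r that off_0_or_1[of s j] by (auto simp: lt_udim off_oth2)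
    moreover have "0 < 2 * r + off s j \<longleftrightarrow> off (oth s) j \<le> r" using off_0_or_1[of s j] by (auto simp: off_oth2)
    moreover have "2 * (r - off (oth s) j) + off (oth s) j = 2 * r + off s j - 1" if "off (oth s) j \<le> r"
      using that off_0_or_1[of s j] by (auto simp: off_oth2)
    ultimately show "(std_lmult s j *\<^sub>v ?v) $ r = vec (udim s 5 j) (\<lambda>c. if 0 < 2 * c + off s j \<and> s = s then f (oth s, alt (oth s) (2 * c + off s j - 1)) else 0) $ r"
      using std_lmult_vec[of ?v s j r] r by auto
  qed (simp add: std_lmult_def)
qed

text \<open>Conjugating \<open>std_lmult\<close> to the chosen projectives gives a homomorphism with
  the property in \<open>THE\<close>. It is the only one, since the coordinates exhaust the space at
  each vertex.\<close>

lemma arrow_lmult_eq: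
  assumes \<alpha>: "\<alpha> \<in> rep_hom A2bar (Proj (oth s)) (uni (oth s) 5)"
    "\<And>j x. x \<in> jac_hom A2bar \<W> (oth s) j \<Longrightarrow> \<alpha> j *\<^sub>v crd (oth s) j x = std_coord (oth s) j x"
    and \<beta>: "\<beta> \<in> rep_hom A2bar (uni s 5) (Proj s)"
    "\<And>j x. x \<in> jac_hom A2bar \<W> s j \<Longrightarrow> \<beta> j *\<^sub>v std_coord s j x = crd s j x"
  shows "arrow_lmult A2bar \<W> (arr s) = (\<lambda>j. \<beta> j * (std_lmult s j * \<alpha> j))"
    and "(\<lambda>j. \<beta> j * (std_lmult s j * \<alpha> j)) \<in> rep_hom A2bar (Proj (oth s)) (Proj s)"
proof -
  let ?h = "\<lambda>j. \<beta> j * (std_lmult s j * \<alpha> j)"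
  have bij: "bij_betw (crd (oth s) j) (jac_hom A2bar \<W> (oth s) j) (carrier_vec (rdim (Proj (oth s)) j))" for j
    using is_projective_proj[of "oth s"] by (simp add: is_projective_at_def)
  have ac: "\<alpha> j \<in> carrier_mat (udim (oth s) 5 j) (rdim (Proj (oth s)) j)" and bc: "\<beta> j \<in> carrier_mat (rdim (Proj s) j) (udim s 5 j)" for j
    using rep_hom_carrier[OF \<alpha>(1), of j] rep_hom_carrier[OF \<beta>(1), of j] by simp_all
  show h: "?h \<in> rep_hom A2bar (Proj (oth s)) (Proj s)"
    by (rule rep_hom_comp[OF is_rep_proj is_rep_uni is_rep_proj rep_hom_comp[OF is_rep_proj is_rep_uni is_rep_uni \<alpha>(1) std_lmult_hom] \<beta>(1)])
  have hx: "?h j *\<^sub>v crd (oth s) j x = crd s j (cls (arrow_elt s) \<otimes>\<^bsub>Jac\<^esub> x)" if x: "x \<in> jac_hom A2bar \<W> (oth s) j" for j x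
  proof -
    have v: "crd (oth s) j x \<in> carrier_vec (rdim (Proj (oth s)) j)" using bij[of j] x by (auto simp: bij_betw_def)
    have "?h j *\<^sub>v crd (oth s) j x = \<beta> j *\<^sub>v (std_lmult s j *\<^sub>v (\<alpha> j *\<^sub>v crd (oth s) j x))"
      using assoc_mult_mat_vec[OF bc mult_carrier_mat[OF std_lmult_carrier ac] v] assoc_mult_mat_vec[OF std_lmult_carrier ac v] by simp
    also have "\<dots> = crd s j (cls (arrow_elt s) \<otimes>\<^bsub>Jac\<^esub> x)"
      unfolding \<alpha>(2)[OF x] std_lmult_coord[OF x] by (rule \<beta>(2)[OF jac_hom_arrow_mult[OF x]])
    finally show ?thesis .
  qed
  show "arrow_lmult A2bar \<W> (arr s) = ?h"
    unfolding arrow_lmult_def src_arr tgt_arr arrow_elt_def[symmetric]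
  proof (rule the_equality)
    show "?h \<in> rep_hom A2bar (Proj (oth s)) (Proj s) \<and> (\<forall>j. \<forall>x\<in>jac_hom A2bar \<W> (oth s) j.
        ?h j *\<^sub>v crd (oth s) j x = crd s j (cls (arrow_elt s) \<otimes>\<^bsub>Jac\<^esub> x))"
      using h hx by blast
    fix h' assume h': "h' \<in> rep_hom A2bar (Proj (oth s)) (Proj s) \<and> (\<forall>j. \<forall>x\<in>jac_hom A2bar \<W> (oth s) j.
        h' j *\<^sub>v crd (oth s) j x = crd s j (cls (arrow_elt s) \<otimes>\<^bsub>Jac\<^esub> x))"
    show "h' = ?h"
    proof
      fix j
      show "h' j = ?h j"
      proof (rule eq_mat_on_vecI[OF rep_hom_carrier[OF conjunct1[OF h']] rep_hom_carrier[OF h]])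
        fix v :: "'k vec" assume "v \<in> carrier_vec (rdim (Proj (oth s)) j)"
        then obtain x where x: "x \<in> jac_hom A2bar \<W> (oth s) j" "v = crd (oth s) j x"
          using bij_betw_imp_surj_on[OF bij[of j]] by blast
        then show "h' j *\<^sub>v v = ?h j *\<^sub>v v" using hx[OF x(1)] h' by simp
      qed
    qed
  qed
qed

lemma is_module_uni: "l \<le> 5 \<Longrightarrow> is_module A2bar \<W> (uni i l)"
  by (simp add: is_module_A2bar[OF char3] pmat_uni_zero)

lemma proj_iso:
  obtains \<alpha> \<beta> where "\<alpha> \<in> rep_hom A2bar (Proj i) (uni i 5)" "\<beta> \<in> rep_hom A2bar (uni i 5) (Proj i)"
    "\<forall>j. \<beta> j * \<alpha> j = 1\<^sub>m (rdim (Proj i) j)" "\<forall>j. \<alpha> j * \<beta> j = 1\<^sub>m (udim i 5 j)"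
proof (rule proj_iso_uni[of i])
  fix \<alpha> \<beta>
  assume "\<alpha> \<in> rep_hom A2bar (Proj i) (uni i 5)" "\<beta> \<in> rep_hom A2bar (uni i 5) (Proj i)"
    "\<And>j. \<beta> j * \<alpha> j = 1\<^sub>m (rdim (Proj i) j)" "\<And>j. \<alpha> j * \<beta> j = 1\<^sub>m (udim i 5 j)"
  then show thesis by (intro that[of \<alpha> \<beta>] allI)
qed

lemma rdim_proj: "rdim (Proj i) j = udim i 5 j"
proof -
  obtain \<alpha> \<beta> where ab: "\<alpha> \<in> rep_hom A2bar (Proj i) (uni i 5)" "\<beta> \<in> rep_hom A2bar (uni i 5) (Proj i)"
    "\<forall>j. \<beta> j * \<alpha> j = 1\<^sub>m (rdim (Proj i) j)" "\<forall>j. \<alpha> j * \<beta> j = 1\<^sub>m (udim i 5 j)"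
    using proj_iso[of i] .
  have "\<alpha> j \<in> carrier_mat (udim i 5 j) (rdim (Proj i) j)" "\<beta> j \<in> carrier_mat (rdim (Proj i) j) (udim i 5 j)"
    using rep_hom_carrier[OF ab(1), of j] rep_hom_carrier[OF ab(2), of j] by simp_all
  then show ?thesis
    using right_inverse_dim_le[OF _ _ ab(3)[rule_format, of j]] right_inverse_dim_le[OF _ _ ab(4)[rule_format, of j]] by (intro le_antisym)
qed

lemma pmat_proj: "pmat (Proj i) j 5 = 0\<^sub>m (rdim (Proj i) (vtx j 5)) (rdim (Proj i) j)"
proof -
  obtain \<alpha> \<beta> where ab: "\<alpha> \<in> rep_hom A2bar (Proj i) (uni i 5)" "\<beta> \<in> rep_hom A2bar (uni i 5) (Proj i)"
    "\<forall>j. \<beta> j * \<alpha> j = 1\<^sub>m (rdim (Proj i) j)" "\<forall>j. \<alpha> j * \<beta> j = 1\<^sub>m (udim i 5 j)"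
    using proj_iso[of i] .
  show ?thesis
    using pmat_uni_zero[of 5 5 i j] by (intro retract_pmat_zero[OF is_rep_uni is_rep_proj ab(1,2) ab(3)[rule_format]]) simp
qed

section \<open>Sums of projectives and essential covers\<close>

lemma proj_sum_unit: "ProjSum (\<lambda>j. if j = i then 1 else 0) = Proj i"
  by (cases i) (simp_all add: proj_sum_def enum_vertex_def rep_sum_zero_rep is_rep_proj)

lemma proj_sum_zero: "ProjSum (\<lambda>_. 0) = zero_rep"
  by (simp add: proj_sum_def enum_vertex_def)

lemma foldr_rep_sum:
  assumes "\<forall>M\<in>set Ms. is_rep A2bar M \<and> (\<forall>j. pmat M j 5 = 0\<^sub>m (rdim M (vtx j 5)) (rdim M j))"
  shows "is_rep A2bar (foldr (rep_sum A2bar) Ms zero_rep) \<and>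
    (\<forall>j. pmat (foldr (rep_sum A2bar) Ms zero_rep) j 5 =
      (0\<^sub>m (rdim (foldr (rep_sum A2bar) Ms zero_rep) (vtx j 5)) (rdim (foldr (rep_sum A2bar) Ms zero_rep) j) :: 'k mat)) \<and>
    rdim (foldr (rep_sum A2bar) Ms zero_rep) j = (\<Sum>M\<leftarrow>Ms. rdim M j)"
  using assms
proof (induction Ms)
  case Nil
  have "pmat (zero_rep :: (vertex, arrow, 'k) rep) j 5 = 0\<^sub>m (rdim (zero_rep :: (vertex, arrow, 'k) rep) (vtx j 5)) (rdim (zero_rep :: (vertex, arrow, 'k) rep) j)" for j
    using pmat_carrier[OF is_rep_zero_rep, of j 5] by (intro eq_matI) (auto simp: zero_rep_def)
  then show ?case by (simp add: is_rep_zero_rep) (simp add: zero_rep_def)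
next
  case (Cons M Ms)
  then show ?case by (simp add: is_rep_rep_sum pmat_rep_sum del: vtx_5)
qed

lemma set_proj_sum_list: "M \<in> set (concat (map (\<lambda>i. replicate (b i) (Proj i)) Enum.enum)) \<Longrightarrow>
  is_rep A2bar M \<and> (\<forall>j. pmat M j 5 = 0\<^sub>m (rdim M (vtx j 5)) (rdim M j))"
  by (auto simp: is_rep_proj pmat_proj simp del: vtx_5)

lemma is_rep_proj_sum: "is_rep A2bar (ProjSum b)"
  and pmat_proj_sum: "pmat (ProjSum b) j 5 = 0\<^sub>m (rdim (ProjSum b) (vtx j 5)) (rdim (ProjSum b) j)"
  and rdim_proj_sum: "rdim (ProjSum b) j = b V1 * udim V1 5 j + b V2 * udim V2 5 j"
proof -
  have "\<forall>M\<in>set (concat (map (\<lambda>i. replicate (b i) (Proj i)) Enum.enum)).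
      is_rep A2bar M \<and> (\<forall>j. pmat M j 5 = 0\<^sub>m (rdim M (vtx j 5)) (rdim M j))"
    using set_proj_sum_list by (intro ballI)
  note F = foldr_rep_sum[OF this, folded proj_sum_def]
  show "is_rep A2bar (ProjSum b)" "pmat (ProjSum b) j 5 = 0\<^sub>m (rdim (ProjSum b) (vtx j 5)) (rdim (ProjSum b) j)"
    using F by blast+
  show "rdim (ProjSum b) j = b V1 * udim V1 5 j + b V2 * udim V2 5 j"
    using F[of j] by (simp add: enum_vertex_def rdim_proj sum_list_replicate)
qed

text \<open>The projectives have dimension vectors (3, 2) and (2, 3). A nonzero sum bounded by one
  of these has total dimension at most 5, so it has one summand, and comparison at a vertex decides
  which.\<close>

lemma proj_sum_dim_le_unit:
  assumes le: "\<And>j. rdim (ProjSum b) j \<le> udim i 5 j" and nz: "rdim (ProjSum b) i \<noteq> 0"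
  shows "b = (\<lambda>j. if j = i then 1 else 0)"
proof -
  have u: "udim V1 5 V1 = 3" "udim V1 5 V2 = 2" "udim V2 5 V1 = 2" "udim V2 5 V2 = 3"
    by (simp_all add: udim_def off_def)
  have "b V1 * 3 + b V2 * 2 \<le> udim i 5 V1" "b V1 * 2 + b V2 * 3 \<le> udim i 5 V2"
    using le[of V1] le[of V2] by (simp_all add: rdim_proj_sum u)
  moreover have "b V1 \<noteq> 0 \<or> b V2 \<noteq> 0" using nz by (auto simp: rdim_proj_sum)
  ultimately have "b V1 = (if V1 = i then 1 else 0) \<and> b V2 = (if V2 = i then 1 else 0)"
    by (cases i) (simp_all add: u; linarith)+
  then show ?thesis by (metis vertex.exhaust)
qed

text \<open>An essential cover of a nonzero cyclic subrepresentation \<open>S\<close> is generated by one preimage of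
  the generator of \<open>S\<close>, so it is no larger than one indecomposable projective.\<close>

lemma cyclic_cover:
  fixes X :: "(vertex, arrow, 'k) rep"
  assumes X: "is_rep A2bar X" and \<gamma>: "\<gamma> \<in> rep_hom A2bar (uni i 5) X"
    and nz: "\<gamma> i *\<^sub>v unit_vec (udim i 5 i) 0 \<noteq> 0\<^sub>v (rdim X i)"
    and h: "h \<in> rep_hom A2bar (ProjSum b) X"
    and ess: "essential_onto A2bar (ProjSum b) h (\<lambda>j. (*\<^sub>v) (\<gamma> j) ` carrier_vec (udim i 5 j))"
  shows "b = (\<lambda>j. if j = i then 1 else 0)"
proof -
  let ?e = "unit_vec (udim i 5 i) 0 :: 'k vec" and ?P = "ProjSum b"
  note P = is_rep_proj_sum[of b]
  have im: "(*\<^sub>v) (h j) ` carrier_vec (rdim ?P j) = (*\<^sub>v) (\<gamma> j) ` carrier_vec (udim i 5 j)" for j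
    using ess by (simp add: essential_onto_def)
  have "\<gamma> i *\<^sub>v ?e \<in> (*\<^sub>v) (h i) ` carrier_vec (rdim ?P i)" unfolding im by simp
  then obtain u where u: "u \<in> carrier_vec (rdim ?P i)" "\<gamma> i *\<^sub>v ?e = h i *\<^sub>v u" by blast
  have dim_nz: "rdim ?P i \<noteq> 0"
  proof
    assume z: "rdim ?P i = 0"
    then have "u = 0\<^sub>v (rdim ?P i)" using u(1) by (intro eq_vecI) auto
    then show False using nz u(2) mult_mat_zero_vec[OF rep_hom_carrier[OF h, of i]] by simp
  qed
  have uz: "pmat ?P i 5 *\<^sub>v u = 0\<^sub>v (rdim ?P (vtx i 5))"
    unfolding pmat_proj_sum by (rule zero_mat_mult_vec[OF u(1)])
  \<comment> \<open>The lift of \<open>\<gamma>\<close> through \<open>h\<close>: the generator goes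
    to the chosen preimage \<open>u\<close>, which is allowed because paths of length 5 vanish on
    projectives.\<close>
  let ?k = "gen_hom ?P i 5 u"
  have k: "?k \<in> rep_hom A2bar (uni i 5) ?P" by (rule gen_hom_hom[OF P u(1) uz])
  have kc: "?k j \<in> carrier_mat (rdim ?P j) (udim i 5 j)" for j by (simp add: gen_hom_def)
  have "(\<lambda>j. h j * ?k j) = \<gamma>"
  proof (rule hom_uni_ext[OF X rep_hom_comp[OF is_rep_uni P X k h] \<gamma>])
    show "h i * ?k i *\<^sub>v ?e = \<gamma> i *\<^sub>v ?e"
      using assoc_mult_mat_vec[OF rep_hom_carrier[OF h] kc unit_vec_carrier] gen_hom_top[OF P u(1), of 5] u(2) by simp
  qed simp
  then have hk: "h j * ?k j = \<gamma> j" for j by metis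
  \<comment> \<open>The image of the lift already maps onto the cyclic subrepresentation, so by
    essentiality it is everything.\<close>
  let ?V = "\<lambda>j. (*\<^sub>v) (?k j) ` carrier_vec (udim i 5 j)"
  have V: "is_subrep A2bar ?P ?V" using subrep_image[OF is_rep_uni P k full_subrep[OF is_rep_uni]] by simp
  have "(*\<^sub>v) (h j) ` ?V j = (*\<^sub>v) (\<gamma> j) ` carrier_vec (udim i 5 j)" for j
    unfolding image_image
    by (rule image_cong[OF refl]) (simp only: hk[symmetric] assoc_mult_mat_vec[OF rep_hom_carrier[OF h] kc])
  then have "?V j = carrier_vec (rdim ?P j)" for j using ess V unfolding essential_onto_def by blast
  then have "rdim ?P j \<le> udim i 5 j" for j
    by (intro surj_mult_mat_vec_dim_le[OF kc]) blast
  then show ?thesis using proj_sum_dim_le_unit dim_nz by blast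
qed

lemma zero_cover:
  fixes X :: "(vertex, arrow, 'k) rep"
  assumes h: "h \<in> rep_hom A2bar (ProjSum b) X"
    and ess: "essential_onto A2bar (ProjSum b) h (\<lambda>j. {0\<^sub>v (rdim X j)})"
  shows "b = (\<lambda>_. 0)"
proof -
  let ?P = "ProjSum b"
  have "(*\<^sub>v) (h j) ` {0\<^sub>v (rdim ?P j)} = {0\<^sub>v (rdim X j)}" for j
    using mult_mat_zero_vec[OF rep_hom_carrier[OF h, of j]] by simp
  then have full: "{0\<^sub>v (rdim ?P j)} = (carrier_vec (rdim ?P j) :: 'k vec set)" for j
    using ess zero_subrep[OF is_rep_proj_sum, of b] unfolding essential_onto_def by blast
  have "rdim ?P j = 0" for j
  proof (rule ccontr)
    assume nz: "rdim ?P j \<noteq> 0"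
    have "unit_vec (rdim ?P j) 0 \<in> {0\<^sub>v (rdim ?P j) :: 'k vec}" unfolding full by simp
    then show False using nz arg_cong[of "unit_vec (rdim ?P j) 0" "0\<^sub>v (rdim ?P j) :: 'k vec" "\<lambda>v. v $ 0"] by simp
  qed
  moreover have "udim V1 5 V1 = 3" "udim V2 5 V2 = 3" by (simp_all add: udim_def)
  ultimately have "b V1 = 0" "b V2 = 0" using rdim_proj_sum[of b V1] rdim_proj_sum[of b V2] by auto
  then show ?thesis by (metis vertex.exhaust)
qed

section \<open>Minimal projective presentations\<close>

lemma min_presentation_iso_ex:
  assumes M: "is_rep A2bar M" and N: "is_rep A2bar N" and iso: "rep_iso A2bar M N"
  shows "(\<exists>g. min_presentation A2bar \<W> M a b f g) \<longleftrightarrow>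
    (\<exists>g. min_presentation A2bar \<W> N a b f g)"
  using min_presentation_iso[OF M N iso is_rep_proj_sum]
    min_presentation_iso[OF N M rep_iso_sym[OF iso] is_rep_proj_sum] by blast

lemma g_vector_iso:
  assumes "is_rep A2bar M" "is_rep A2bar N" "rep_iso A2bar M N"
  shows "g_vector A2bar \<W> M = g_vector A2bar \<W> N"
proof -
  have "(\<exists>a b f g. min_presentation A2bar \<W> M a b f g \<and> d = (\<lambda>i. int (a i) - int (b i))) \<longleftrightarrow>
    (\<exists>a b f g. min_presentation A2bar \<W> N a b f g \<and> d = (\<lambda>i. int (a i) - int (b i)))" for d
    using min_presentation_iso_ex[OF assms] by blast
  then show ?thesis unfolding g_vector_def by presburger
qed

text \<open>A module enters \<open>is_ar_translate\<close> only through the existence of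
  \<open>g\<close>. Isomorphic modules thus have the same translates, and \<open>SOME\<close> picks
  the same one.\<close>

lemma ar_translate_iso:
  assumes "is_rep A2bar M" "is_rep A2bar N" "rep_iso A2bar M N"
  shows "ar_translate A2bar \<W> M = ar_translate A2bar \<W> N"
proof -
  have ex: "(\<exists>a b f g \<psi>. A a b f g \<and> C a b f \<psi>) \<longleftrightarrow> (\<exists>a b f g \<psi>. B a b f g \<and> C a b f \<psi>)"
    if "\<And>a b f. (\<exists>g. A a b f g) \<longleftrightarrow> (\<exists>g. B a b f g)"
    for A B :: "(vertex \<Rightarrow> nat) \<Rightarrow> (vertex \<Rightarrow> nat) \<Rightarrow> (vertex \<Rightarrow> 'k mat) \<Rightarrow> (vertex \<Rightarrow> 'k mat) \<Rightarrow> bool"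
      and C :: "_ \<Rightarrow> _ \<Rightarrow> _ \<Rightarrow> (vertex \<Rightarrow> 'k vec \<Rightarrow> (vertex \<Rightarrow> 'k mat) \<Rightarrow> 'k) \<Rightarrow> bool"
    using that by blast
  have "is_ar_translate A2bar \<W> M T \<longleftrightarrow> is_ar_translate A2bar \<W> N T" for T
    unfolding is_ar_translate_def by (intro conj_cong refl ex) (rule min_presentation_iso_ex[OF assms])
  then show ?thesis unfolding ar_translate_def by presburger
qed

text \<open>The chosen projective inherits from \<open>uni i 5\<close> that proper
  subrepresentations lie in the radical, so a homomorphism that does not kill the generator is
  essential onto its image.\<close>

lemma essential_onto_proj:
  fixes X :: "(vertex, arrow, 'k) rep"
  assumes X: "is_rep A2bar X" and h: "h \<in> rep_hom A2bar (uni i 5) X"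
    and nz: "h i *\<^sub>v unit_vec (udim i 5 i) 0 \<noteq> 0\<^sub>v (rdim X i)"
    and \<alpha>: "\<alpha> \<in> rep_hom A2bar (Proj i) (uni i 5)" and \<beta>: "\<beta> \<in> rep_hom A2bar (uni i 5) (Proj i)"
    and \<beta>\<alpha>: "\<forall>j. \<beta> j * \<alpha> j = 1\<^sub>m (rdim (Proj i) j)" and \<alpha>\<beta>: "\<forall>j. \<alpha> j * \<beta> j = 1\<^sub>m (udim i 5 j)"
  shows "essential_onto A2bar (Proj i) (\<lambda>j. h j * \<alpha> j) (\<lambda>j. (*\<^sub>v) (h j) ` carrier_vec (udim i 5 j))"
proof -
  have ac: "\<alpha> j \<in> carrier_mat (udim i 5 j) (rdim (Proj i) j)" and bc: "\<beta> j \<in> carrier_mat (rdim (Proj i) j) (udim i 5 j)"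
    and hc: "h j \<in> carrier_mat (rdim X j) (udim i 5 j)" for j
    using rep_hom_carrier[OF \<alpha>, of j] rep_hom_carrier[OF \<beta>, of j] rep_hom_carrier[OF h, of j] by simp_all
  have ba: "\<beta> j *\<^sub>v (\<alpha> j *\<^sub>v v) = v" if "v \<in> carrier_vec (rdim (Proj i) j)" for j v
    using assoc_mult_mat_vec[OF bc ac that] \<beta>\<alpha> that by simp
  have ab: "\<alpha> j *\<^sub>v (\<beta> j *\<^sub>v v) = v" if "v \<in> carrier_vec (udim i 5 j)" for j v
    using assoc_mult_mat_vec[OF ac bc that] \<alpha>\<beta> that by simp
  have im: "(*\<^sub>v) (h j * \<alpha> j) ` A = (*\<^sub>v) (h j) ` ((*\<^sub>v) (\<alpha> j) ` A)" if "A \<subseteq> carrier_vec (rdim (Proj i) j)" for A j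
    unfolding image_image using that by (intro image_cong[OF refl] assoc_mult_mat_vec[OF hc ac]) auto
  have a_onto: "(*\<^sub>v) (\<alpha> j) ` carrier_vec (rdim (Proj i) j) = carrier_vec (udim i 5 j)" for j
  proof (intro equalityI subsetI)
    fix v :: "'k vec" assume v: "v \<in> carrier_vec (udim i 5 j)"
    have "v = \<alpha> j *\<^sub>v (\<beta> j *\<^sub>v v)" using ab[OF v] by simp
    then show "v \<in> (*\<^sub>v) (\<alpha> j) ` carrier_vec (rdim (Proj i) j)"
      by (rule image_eqI) (rule mult_mat_vec_carrier[OF bc v])
  next
    fix v assume "v \<in> (*\<^sub>v) (\<alpha> j) ` carrier_vec (rdim (Proj i) j)"
    then show "v \<in> carrier_vec (udim i 5 j)" using mult_mat_vec_carrier[OF ac] by auto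
  qed
  show ?thesis
    unfolding essential_onto_def
  proof (intro conjI allI impI)
    show "(*\<^sub>v) (h j * \<alpha> j) ` carrier_vec (rdim (Proj i) j) = (*\<^sub>v) (h j) ` carrier_vec (udim i 5 j)" for j
      unfolding im[OF order_refl] a_onto ..
    fix U j assume U: "is_subrep A2bar (Proj i) U \<and> (\<forall>j. (*\<^sub>v) (h j * \<alpha> j) ` U j = (*\<^sub>v) (h j) ` carrier_vec (udim i 5 j))"
    then have Us: "is_subrep A2bar (Proj i) U" by simp
    have Uc: "U j \<subseteq> carrier_vec (rdim (Proj i) j)" for j using subrep_carrier[OF Us] by blast
    have V: "is_subrep A2bar (uni i 5) (\<lambda>j. (*\<^sub>v) (\<alpha> j) ` U j)"
      by (rule subrep_image[OF is_rep_proj is_rep_uni \<alpha> Us])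
    have "h i *\<^sub>v unit_vec (udim i 5 i) 0 \<in> (*\<^sub>v) (h i) ` ((*\<^sub>v) (\<alpha> i) ` U i)"
      unfolding im[OF Uc, symmetric] using U by simp
    from hom_uni_essential[OF X h V nz this]
    have full: "(*\<^sub>v) (\<alpha> j) ` U j = carrier_vec (udim i 5 j)" by simp
    have "v \<in> U j" if v: "v \<in> carrier_vec (rdim (Proj i) j)" for v
    proof -
      have "\<alpha> j *\<^sub>v v \<in> (*\<^sub>v) (\<alpha> j) ` U j" unfolding full by (rule mult_mat_vec_carrier[OF ac v])
      then obtain u where u: "u \<in> U j" "\<alpha> j *\<^sub>v v = \<alpha> j *\<^sub>v u" by blast
      then have "v = u" using ba[OF v] ba[of u j] Uc[of j] by auto
      then show ?thesis using u(1) by simp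
    qed
    then show "U j = carrier_vec (rdim (Proj i) j)" using Uc by blast
  qed
qed

lemma kernel_proj:
  assumes g: "g \<in> rep_hom A2bar (Proj i) (uni i l)" and l: "0 < l" "l \<le> 5"
    and onto: "\<And>j. (*\<^sub>v) (g j) ` carrier_vec (rdim (Proj i) j) = carrier_vec (udim i l j)"
    and \<alpha>: "\<alpha> \<in> rep_hom A2bar (Proj i) (uni i 5)" and \<beta>: "\<beta> \<in> rep_hom A2bar (uni i 5) (Proj i)"
    and \<beta>\<alpha>: "\<forall>j. \<beta> j * \<alpha> j = 1\<^sub>m (rdim (Proj i) j)"
  shows "{v \<in> carrier_vec (rdim (Proj i) j). g j *\<^sub>v v = 0\<^sub>v (udim i l j)} = (*\<^sub>v) (\<beta> j) ` chain i 5 l j"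
proof -
  have ac: "\<alpha> j \<in> carrier_mat (udim i 5 j) (rdim (Proj i) j)" and bc: "\<beta> j \<in> carrier_mat (rdim (Proj i) j) (udim i 5 j)"
    and gc: "g j \<in> carrier_mat (udim i l j) (rdim (Proj i) j)" for j
    using rep_hom_carrier[OF \<alpha>, of j] rep_hom_carrier[OF \<beta>, of j] rep_hom_carrier[OF g, of j] by simp_all
  have ba: "\<beta> j *\<^sub>v (\<alpha> j *\<^sub>v v) = v" if "v \<in> carrier_vec (rdim (Proj i) j)" for j v
    using assoc_mult_mat_vec[OF bc ac that] \<beta>\<alpha> that by simp
  have gb: "(\<lambda>j. g j * \<beta> j) \<in> rep_hom A2bar (uni i 5) (uni i l)"
    by (rule rep_hom_comp[OF is_rep_uni is_rep_proj is_rep_uni \<beta> g])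
  have gbv: "(g j * \<beta> j) *\<^sub>v w = g j *\<^sub>v (\<beta> j *\<^sub>v w)" if "w \<in> carrier_vec (udim i 5 j)" for j w
    using assoc_mult_mat_vec[OF gc bc that] .
  have "carrier_vec (udim i l i) \<subseteq> (*\<^sub>v) (g i * \<beta> i) ` carrier_vec (udim i 5 i)"
  proof
    fix w :: "'k vec" assume "w \<in> carrier_vec (udim i l i)"
    then obtain v where v: "v \<in> carrier_vec (rdim (Proj i) i)" "w = g i *\<^sub>v v" using onto[of i] by blast
    have av: "\<alpha> i *\<^sub>v v \<in> carrier_vec (udim i 5 i)" by (rule mult_mat_vec_carrier[OF ac v(1)])
    have "w = (g i * \<beta> i) *\<^sub>v (\<alpha> i *\<^sub>v v)" using gbv[OF av] ba[OF v(1)] v(2) by simp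
    then show "w \<in> (*\<^sub>v) (g i * \<beta> i) ` carrier_vec (udim i 5 i)" using av by blast
  qed
  from kernel_uni[OF gb l this, of j]
  have ker: "chain i 5 l j = {w \<in> carrier_vec (udim i 5 j). (g j * \<beta> j) *\<^sub>v w = 0\<^sub>v (udim i l j)}" ..
  show ?thesis
  proof (intro equalityI subsetI)
    fix v assume v: "v \<in> {v \<in> carrier_vec (rdim (Proj i) j). g j *\<^sub>v v = 0\<^sub>v (udim i l j)}"
    then have vc: "v \<in> carrier_vec (rdim (Proj i) j)" by simp
    have av: "\<alpha> j *\<^sub>v v \<in> carrier_vec (udim i 5 j)" by (rule mult_mat_vec_carrier[OF ac vc])
    have "\<alpha> j *\<^sub>v v \<in> chain i 5 l j" unfolding ker using av gbv[OF av] ba[OF vc] v by simp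
    then show "v \<in> (*\<^sub>v) (\<beta> j) ` chain i 5 l j" using ba[OF vc] by (metis image_eqI)
  next
    fix v assume "v \<in> (*\<^sub>v) (\<beta> j) ` chain i 5 l j"
    then obtain w where w: "w \<in> carrier_vec (udim i 5 j)" "(g j * \<beta> j) *\<^sub>v w = 0\<^sub>v (udim i l j)" "v = \<beta> j *\<^sub>v w"
      unfolding ker by blast
    have "v \<in> carrier_vec (rdim (Proj i) j)" unfolding w(3) by (rule mult_mat_vec_carrier[OF bc w(1)])
    moreover have "g j *\<^sub>v v = 0\<^sub>v (udim i l j)" using gbv[OF w(1)] w(2,3) by simp
    ultimately show "v \<in> {v \<in> carrier_vec (rdim (Proj i) j). g j *\<^sub>v v = 0\<^sub>v (udim i l j)}" by simp
  qed
qed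

lemma uni_cover:
  assumes l: "0 < l" "l \<le> 5"
  obtains \<pi> :: "vertex \<Rightarrow> 'k mat" where "\<pi> \<in> rep_hom A2bar (uni i 5) (uni i l)"
    "\<pi> i *\<^sub>v unit_vec (udim i 5 i) 0 = unit_vec (udim i l i) 0"
    "\<forall>j. (*\<^sub>v) (\<pi> j) ` carrier_vec (udim i 5 j) = carrier_vec (udim i l j)"
proof -
  let ?U = "uni i l :: (vertex, arrow, 'k) rep" and ?e = "unit_vec (udim i l i) 0 :: 'k vec"
  let ?\<pi> = "gen_hom ?U i 5 ?e"
  have e: "?e \<in> carrier_vec (rdim ?U i)" by simp
  have h: "?\<pi> \<in> rep_hom A2bar (uni i 5) ?U"
    by (rule gen_hom_hom[OF is_rep_uni e]) (simp only: pmat_uni_zero[OF l(2)] rdim_uni zero_mat_mult_vec unit_vec_carrier)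
  have top: "?\<pi> i *\<^sub>v unit_vec (udim i 5 i) 0 = ?e" by (rule gen_hom_top[OF is_rep_uni e]) simp
  have sub: "is_subrep A2bar ?U (\<lambda>j. (*\<^sub>v) (?\<pi> j) ` carrier_vec (udim i 5 j))"
    using subrep_image[OF is_rep_uni is_rep_uni h full_subrep[OF is_rep_uni]] by simp
  have mem: "?e \<in> (*\<^sub>v) (?\<pi> i) ` carrier_vec (udim i 5 i)" using top by (metis image_eqI unit_vec_carrier)
  have e0: "?e $ 0 \<noteq> 0" using top_coord[OF l(1), of i, where 'k='k] by simp
  have "\<forall>j. (*\<^sub>v) (?\<pi> j) ` carrier_vec (udim i 5 j) = carrier_vec (udim i l j)"
    using uni_generated[OF sub mem e0 l(1)] by (intro allI)
  then show thesis using that h top by blast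
qed

lemma unit_vec_neq_zero: "c < n \<Longrightarrow> (unit_vec n c :: 'k vec) \<noteq> 0\<^sub>v n"
  using arg_cong[of "unit_vec n c" "0\<^sub>v n :: 'k vec" "\<lambda>v. v $ c"] by auto

lemma mult_inj_neq_zero:
  assumes "A \<in> carrier_mat n m" "B \<in> carrier_mat m n" "B * A = 1\<^sub>m m" "v \<in> carrier_vec m" "v \<noteq> (0\<^sub>v m :: 'k vec)"
  shows "A *\<^sub>v v \<noteq> 0\<^sub>v n"
proof
  assume "A *\<^sub>v v = 0\<^sub>v n"
  then have "B *\<^sub>v (A *\<^sub>v v) = 0\<^sub>v m" using mult_mat_zero_vec[OF assms(2)] by simp
  then show False using assoc_mult_mat_vec[OF assms(2,1,4)] assms by simp
qed

text \<open>The composite of the inclusion of the cyclic radical power into \<open>uni i 5\<close>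
  with \<open>\<beta>\<close>. Injectivity of \<open>\<beta>\<close> keeps the image of the
  generator nonzero.\<close>

lemma kernel_cover:
  assumes l: "l < 5"
    and \<alpha>: "\<alpha> \<in> rep_hom A2bar (Proj i) (uni i 5)" and \<beta>: "\<beta> \<in> rep_hom A2bar (uni i 5) (Proj i)"
    and \<alpha>\<beta>: "\<forall>j. \<alpha> j * \<beta> j = 1\<^sub>m (udim i 5 j)"
  obtains \<gamma> where "\<gamma> \<in> rep_hom A2bar (uni (vtx i l) 5) (Proj i)"
    "\<gamma> (vtx i l) *\<^sub>v unit_vec (udim (vtx i l) 5 (vtx i l)) 0 \<noteq> 0\<^sub>v (rdim (Proj i) (vtx i l))"
    "\<forall>j. (*\<^sub>v) (\<gamma> j) ` carrier_vec (udim (vtx i l) 5 j) = (*\<^sub>v) (\<beta> j) ` chain i 5 l j"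
proof -
  let ?k = "vtx i l"
  have ac: "\<alpha> j \<in> carrier_mat (udim i 5 j) (rdim (Proj i) j)" and bc: "\<beta> j \<in> carrier_mat (rdim (Proj i) j) (udim i 5 j)" for j
    using rep_hom_carrier[OF \<alpha>, of j] rep_hom_carrier[OF \<beta>, of j] by simp_all
  obtain \<iota> :: "vertex \<Rightarrow> 'k mat" where \<iota>: "\<iota> \<in> rep_hom A2bar (uni ?k 5) (uni i 5)"
    and top: "\<iota> ?k *\<^sub>v unit_vec (udim ?k 5 ?k) 0 = unit_vec (udim i 5 ?k) (l div 2)"
    and im: "\<forall>j. (*\<^sub>v) (\<iota> j) ` carrier_vec (udim ?k 5 j) = chain i 5 l j"
    using chain_cyclic[OF l, of i] .
  have ic: "\<iota> j \<in> carrier_mat (udim i 5 j) (udim ?k 5 j)" for j using rep_hom_carrier[OF \<iota>, of j] by simp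
  have g: "(\<lambda>j. \<beta> j * \<iota> j) \<in> rep_hom A2bar (uni ?k 5) (Proj i)"
    by (rule rep_hom_comp[OF is_rep_uni is_rep_uni is_rep_proj \<iota> \<beta>])
  have v: "\<beta> j * \<iota> j *\<^sub>v w = \<beta> j *\<^sub>v (\<iota> j *\<^sub>v w)" if "w \<in> carrier_vec (udim ?k 5 j)" for j w
    by (rule assoc_mult_mat_vec[OF bc ic that])
  have "l div 2 < udim i 5 ?k" using l len_div_off[of l i] by (simp add: lt_udim)
  then have "\<beta> ?k *\<^sub>v unit_vec (udim i 5 ?k) (l div 2) \<noteq> 0\<^sub>v (rdim (Proj i) ?k)"
    using \<alpha>\<beta> by (intro mult_inj_neq_zero[OF bc ac] unit_vec_neq_zero) simp_all
  then have nz: "\<beta> ?k * \<iota> ?k *\<^sub>v unit_vec (udim ?k 5 ?k) 0 \<noteq> 0\<^sub>v (rdim (Proj i) ?k)"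
    by (simp only: v[OF unit_vec_carrier] top not_False_eq_True)
  have "(*\<^sub>v) (\<beta> j * \<iota> j) ` carrier_vec (udim ?k 5 j) = (*\<^sub>v) (\<beta> j) ` chain i 5 l j" for j
  proof -
    have "(*\<^sub>v) (\<beta> j * \<iota> j) ` carrier_vec (udim ?k 5 j) = (*\<^sub>v) (\<beta> j) ` ((*\<^sub>v) (\<iota> j) ` carrier_vec (udim ?k 5 j))"
      unfolding image_image by (intro image_cong[OF refl] v)
    then show ?thesis using im by simp
  qed
  then show thesis using that[OF g nz] by blast
qed

lemma kernel_trivial:
  assumes \<beta>: "\<beta> \<in> rep_hom A2bar (uni i 5) (Proj i)"
  shows "(*\<^sub>v) (\<beta> j) ` chain i 5 5 j = {0\<^sub>v (rdim (Proj i) j)}"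
  using mult_mat_zero_vec[OF rep_hom_carrier[OF \<beta>, of j]] by (simp add: chain_full)

text \<open>Two uses of \<open>cyclic_cover\<close>: the image of \<open>g\<close> is generated by
  the top of \<open>uni i l\<close>, which gives \<open>a\<close>, and the image of \<open>f\<close>
  is the kernel, a cyclic radical power, which gives \<open>b\<close>. For \<open>l = 5\<close> the
  kernel is zero.\<close>

lemma min_presentation_uni_unique:
  assumes l: "0 < l" "l \<le> 5" and pres: "min_presentation A2bar \<W> (uni i l) a b f g"
  shows "a = single_vertex i \<and> b = (if l = 5 then (\<lambda>_. 0) else single_vertex (vtx i l))"
proof -
  have f: "f \<in> rep_hom A2bar (ProjSum b) (ProjSum a)" and g: "g \<in> rep_hom A2bar (ProjSum a) (uni i l)"
    and essg: "essential_onto A2bar (ProjSum a) g (\<lambda>j. carrier_vec (udim i l j))"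
    and essf: "essential_onto A2bar (ProjSum b) f (\<lambda>j. {v \<in> carrier_vec (rdim (ProjSum a) j). g j *\<^sub>v v = 0\<^sub>v (udim i l j)})"
    using pres by (auto simp: min_presentation_def)
  obtain \<pi> :: "vertex \<Rightarrow> 'k mat" where \<pi>: "\<pi> \<in> rep_hom A2bar (uni i 5) (uni i l)"
    and top: "\<pi> i *\<^sub>v unit_vec (udim i 5 i) 0 = unit_vec (udim i l i) 0"
    and im: "\<forall>j. (*\<^sub>v) (\<pi> j) ` carrier_vec (udim i 5 j) = carrier_vec (udim i l j)"
    using uni_cover[OF l, of i] .
  have "0 < udim i l i" using l by (simp add: lt_udim)
  then have nz: "\<pi> i *\<^sub>v unit_vec (udim i 5 i) 0 \<noteq> 0\<^sub>v (rdim (uni i l :: (vertex, arrow, 'k) rep) i)"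
    unfolding top rdim_uni by (rule unit_vec_neq_zero)
  have a: "a = single_vertex i"
    using im essg by (intro cyclic_cover[OF is_rep_uni \<pi> nz g]) simp
  have Pa: "ProjSum a = Proj i" unfolding a by (rule proj_sum_unit)
  obtain \<alpha> \<beta> where \<alpha>: "\<alpha> \<in> rep_hom A2bar (Proj i) (uni i 5)" and \<beta>: "\<beta> \<in> rep_hom A2bar (uni i 5) (Proj i)"
    and \<beta>\<alpha>: "\<forall>j. \<beta> j * \<alpha> j = 1\<^sub>m (rdim (Proj i) j)" and \<alpha>\<beta>: "\<forall>j. \<alpha> j * \<beta> j = 1\<^sub>m (udim i 5 j)"
    using proj_iso[of i] .
  have onto: "(*\<^sub>v) (g j) ` carrier_vec (rdim (Proj i) j) = carrier_vec (udim i l j)" for j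
    using essg unfolding Pa essential_onto_def by blast
  note ker = kernel_proj[OF g[unfolded Pa] l onto \<alpha> \<beta> \<beta>\<alpha>]
  have essf': "essential_onto A2bar (ProjSum b) f (\<lambda>j. (*\<^sub>v) (\<beta> j) ` chain i 5 l j)"
    using essf unfolding Pa ker .
  have f': "f \<in> rep_hom A2bar (ProjSum b) (Proj i)" using f unfolding Pa .
  have "b = (if l = 5 then (\<lambda>_. 0) else single_vertex (vtx i l))"
  proof (cases "l = 5")
    case True
    have "b = (\<lambda>_. 0)" using essf' unfolding True kernel_trivial[OF \<beta>] by (rule zero_cover[OF f'])
    then show ?thesis using True by simp
  next
    case False
    then have l5: "l < 5" using l by simp
    obtain \<gamma> where \<gamma>: "\<gamma> \<in> rep_hom A2bar (uni (vtx i l) 5) (Proj i)"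
      "\<gamma> (vtx i l) *\<^sub>v unit_vec (udim (vtx i l) 5 (vtx i l)) 0 \<noteq> 0\<^sub>v (rdim (Proj i) (vtx i l))"
      "\<forall>j. (*\<^sub>v) (\<gamma> j) ` carrier_vec (udim (vtx i l) 5 j) = (*\<^sub>v) (\<beta> j) ` chain i 5 l j"
      using kernel_cover[OF l5 \<alpha> \<beta> \<alpha>\<beta>] .
    have "b = single_vertex (vtx i l)"
      using \<gamma>(3) essf' by (intro cyclic_cover[OF is_rep_proj \<gamma>(1,2) f']) simp
    then show ?thesis using False by simp
  qed
  then show ?thesis using a by blast
qed

lemma min_presentation_uni_exists:
  assumes l: "0 < l" "l \<le> 5"
  shows "\<exists>f g. min_presentation A2bar \<W> (uni i l) (single_vertex i)
    (if l = 5 then (\<lambda>_. 0) else single_vertex (vtx i l)) f g"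
proof -
  obtain \<pi> :: "vertex \<Rightarrow> 'k mat" where \<pi>: "\<pi> \<in> rep_hom A2bar (uni i 5) (uni i l)"
    and top: "\<pi> i *\<^sub>v unit_vec (udim i 5 i) 0 = unit_vec (udim i l i) 0"
    and im: "\<forall>j. (*\<^sub>v) (\<pi> j) ` carrier_vec (udim i 5 j) = carrier_vec (udim i l j)"
    using uni_cover[OF l, of i] .
  have "0 < udim i l i" using l by (simp add: lt_udim)
  then have nz: "\<pi> i *\<^sub>v unit_vec (udim i 5 i) 0 \<noteq> 0\<^sub>v (rdim (uni i l :: (vertex, arrow, 'k) rep) i)"
    unfolding top rdim_uni by (rule unit_vec_neq_zero)
  obtain \<alpha> \<beta> where \<alpha>: "\<alpha> \<in> rep_hom A2bar (Proj i) (uni i 5)" and \<beta>: "\<beta> \<in> rep_hom A2bar (uni i 5) (Proj i)"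
    and \<beta>\<alpha>: "\<forall>j. \<beta> j * \<alpha> j = 1\<^sub>m (rdim (Proj i) j)" and \<alpha>\<beta>: "\<forall>j. \<alpha> j * \<beta> j = 1\<^sub>m (udim i 5 j)"
    using proj_iso[of i] .
  define g where "g = (\<lambda>j. \<pi> j * \<alpha> j)"
  have g: "g \<in> rep_hom A2bar (Proj i) (uni i l)"
    unfolding g_def by (rule rep_hom_comp[OF is_rep_proj is_rep_uni is_rep_uni \<alpha> \<pi>])
  have essg: "essential_onto A2bar (Proj i) g (\<lambda>j. carrier_vec (udim i l j))"
    using essential_onto_proj[OF is_rep_uni \<pi> nz \<alpha> \<beta> \<beta>\<alpha> \<alpha>\<beta>] im by (simp add: g_def)
  have onto: "(*\<^sub>v) (g j) ` carrier_vec (rdim (Proj i) j) = carrier_vec (udim i l j)" for j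
    using essg unfolding essential_onto_def by blast
  note ker = kernel_proj[OF g l onto \<alpha> \<beta> \<beta>\<alpha>]
  have "\<exists>f. f \<in> rep_hom A2bar (ProjSum (if l = 5 then (\<lambda>_. 0) else single_vertex (vtx i l))) (Proj i) \<and>
    essential_onto A2bar (ProjSum (if l = 5 then (\<lambda>_. 0) else single_vertex (vtx i l))) f (\<lambda>j. (*\<^sub>v) (\<beta> j) ` chain i 5 l j)"
  proof (cases "l = 5")
    case True
    \<comment> \<open>The module is projective, so the zero representation covers the
      kernel.\<close>
    let ?f = "\<lambda>j. 0\<^sub>m (rdim (Proj i) j) (rdim (zero_rep :: (vertex, arrow, 'k) rep) j) :: 'k mat"
    have "?f \<in> rep_hom A2bar zero_rep (Proj i)" by (rule rep_hom_zero[OF is_rep_zero_rep is_rep_proj])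
    moreover have "essential_onto A2bar zero_rep ?f (\<lambda>j. {0\<^sub>v (rdim (Proj i) j)})"
    proof -
      have c0: "v = 0\<^sub>v 0" if "v \<in> carrier_vec 0" for v :: "'k vec" using that by auto
      have "?f j *\<^sub>v v = 0\<^sub>v (rdim (Proj i) j)" if "v \<in> carrier_vec (rdim (zero_rep :: (vertex, arrow, 'k) rep) j)" for j v
        using that by (rule zero_mat_mult_vec)
      then have "(*\<^sub>v) (?f j) ` carrier_vec (rdim (zero_rep :: (vertex, arrow, 'k) rep) j) = {0\<^sub>v (rdim (Proj i) j)}" for j
        using zero_carrier_vec[of "rdim (zero_rep :: (vertex, arrow, 'k) rep) j"] by (metis (no_types, lifting) image_cong image_constant_conv empty_iff)
      moreover have "U j = carrier_vec (rdim (zero_rep :: (vertex, arrow, 'k) rep) j)"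
        if U: "is_subrep A2bar (zero_rep :: (vertex, arrow, 'k) rep) U" for U j
        using subrep_zero[OF U, of j] subrep_carrier[OF U, of _ j] c0 by (auto simp: zero_rep_def)
      ultimately show ?thesis unfolding essential_onto_def by blast
    qed
    ultimately show ?thesis using True kernel_trivial[OF \<beta>] by (auto simp: proj_sum_zero)
  next
    case False
    then have l5: "l < 5" using l by simp
    let ?k = "vtx i l"
    obtain \<gamma> where \<gamma>: "\<gamma> \<in> rep_hom A2bar (uni ?k 5) (Proj i)"
      "\<gamma> ?k *\<^sub>v unit_vec (udim ?k 5 ?k) 0 \<noteq> 0\<^sub>v (rdim (Proj i) ?k)"
      "\<forall>j. (*\<^sub>v) (\<gamma> j) ` carrier_vec (udim ?k 5 j) = (*\<^sub>v) (\<beta> j) ` chain i 5 l j"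
      using kernel_cover[OF l5 \<alpha> \<beta> \<alpha>\<beta>] .
    obtain \<alpha>' \<beta>' where \<alpha>': "\<alpha>' \<in> rep_hom A2bar (Proj ?k) (uni ?k 5)" and \<beta>': "\<beta>' \<in> rep_hom A2bar (uni ?k 5) (Proj ?k)"
      and iso': "\<forall>j. \<beta>' j * \<alpha>' j = 1\<^sub>m (rdim (Proj ?k) j)" "\<forall>j. \<alpha>' j * \<beta>' j = 1\<^sub>m (udim ?k 5 j)"
      using proj_iso[of ?k] .
    have "(\<lambda>j. \<gamma> j * \<alpha>' j) \<in> rep_hom A2bar (Proj ?k) (Proj i)"
      by (rule rep_hom_comp[OF is_rep_proj is_rep_uni is_rep_proj \<alpha>' \<gamma>(1)])
    moreover have "essential_onto A2bar (Proj ?k) (\<lambda>j. \<gamma> j * \<alpha>' j) (\<lambda>j. (*\<^sub>v) (\<beta> j) ` chain i 5 l j)"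
      using essential_onto_proj[OF is_rep_proj \<gamma>(1,2) \<alpha>' \<beta>' iso'] \<gamma>(3) by simp
    ultimately have "\<exists>f. f \<in> rep_hom A2bar (Proj ?k) (Proj i) \<and> essential_onto A2bar (Proj ?k) f (\<lambda>j. (*\<^sub>v) (\<beta> j) ` chain i 5 l j)" by blast
    then show ?thesis unfolding if_not_P[OF False] proj_sum_unit .
  qed
  then obtain f where "f \<in> rep_hom A2bar (ProjSum (if l = 5 then (\<lambda>_. 0) else single_vertex (vtx i l))) (Proj i)"
    "essential_onto A2bar (ProjSum (if l = 5 then (\<lambda>_. 0) else single_vertex (vtx i l))) f (\<lambda>j. (*\<^sub>v) (\<beta> j) ` chain i 5 l j)" by blast
  then have "min_presentation A2bar \<W> (uni i l) (single_vertex i)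
    (if l = 5 then (\<lambda>_. 0) else single_vertex (vtx i l)) f g"
    unfolding min_presentation_def proj_sum_unit rdim_uni ker using g essg by blast
  then show ?thesis by blast
qed

lemma g_vector_uni:
  assumes l: "0 < l" "l \<le> 5"
  shows "g_vector A2bar \<W> (uni i l) =
    (\<lambda>j. int (single_vertex i j) - int ((if l = 5 then (\<lambda>_. 0) else single_vertex (vtx i l)) j))"
  unfolding g_vector_def
proof (rule the_equality)
  show "\<exists>a b f g. min_presentation A2bar \<W> (uni i l) a b f g \<and>
    (\<lambda>j. int (single_vertex i j) - int ((if l = 5 then (\<lambda>_. 0) else single_vertex (vtx i l)) j)) = (\<lambda>i. int (a i) - int (b i))"
    using min_presentation_uni_exists[OF l, of i] by blast
  fix d assume "\<exists>a b f g. min_presentation A2bar \<W> (uni i l) a b f g \<and> d = (\<lambda>i. int (a i) - int (b i))"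
  then obtain a b f g where "min_presentation A2bar \<W> (uni i l) a b f g" "d = (\<lambda>i. int (a i) - int (b i))"
    by blast
  then show "d = (\<lambda>j. int (single_vertex i j) - int ((if l = 5 then (\<lambda>_. 0) else single_vertex (vtx i l)) j))"
    using min_presentation_uni_unique[OF l, of i a b f g] by simp
qed

section \<open>The Auslander--Reiten translation\<close>

lemma std_iso_exists: "\<exists>(\<alpha> :: vertex \<Rightarrow> 'k mat) \<beta>. std_iso i \<alpha> \<beta>"
proof (rule proj_iso_uni[of i])
  fix \<alpha> \<beta>
  assume "\<alpha> \<in> rep_hom A2bar (Proj i) (uni i 5)" "\<beta> \<in> rep_hom A2bar (uni i 5) (Proj i)"
    "\<And>j. \<beta> j * \<alpha> j = 1\<^sub>m (rdim (Proj i) j)" "\<And>j. \<alpha> j * \<beta> j = 1\<^sub>m (udim i 5 j)"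
    "\<And>j x. x \<in> jac_hom A2bar \<W> i j \<Longrightarrow> \<alpha> j *\<^sub>v snd (projective_data A2bar \<W> i) j x = std_coord i j x"
    "\<And>j x. x \<in> jac_hom A2bar \<W> i j \<Longrightarrow> \<beta> j *\<^sub>v std_coord i j x = snd (projective_data A2bar \<W> i) j x"
  then have "std_iso i \<alpha> \<beta>" unfolding std_iso_def rdim_proj by (intro conjI allI ballI)
  then show ?thesis by (intro exI)
qed

lemma std_isoD:
  assumes "std_iso i \<alpha> (\<beta> :: vertex \<Rightarrow> 'k mat)"
  shows "\<alpha> \<in> rep_hom A2bar (Proj i) (uni i 5)" "\<beta> \<in> rep_hom A2bar (uni i 5) (Proj i)"
    "\<alpha> j \<in> carrier_mat (udim i 5 j) (udim i 5 j)" "\<beta> j \<in> carrier_mat (udim i 5 j) (udim i 5 j)"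
    "v \<in> carrier_vec (udim i 5 j) \<Longrightarrow> \<beta> j *\<^sub>v (\<alpha> j *\<^sub>v v) = v"
    "v \<in> carrier_vec (udim i 5 j) \<Longrightarrow> \<alpha> j *\<^sub>v (\<beta> j *\<^sub>v v) = v"
proof -
  show a: "\<alpha> \<in> rep_hom A2bar (Proj i) (uni i 5)" and b: "\<beta> \<in> rep_hom A2bar (uni i 5) (Proj i)"
    using assms by (simp_all add: std_iso_def)
  show ac: "\<alpha> j \<in> carrier_mat (udim i 5 j) (udim i 5 j)" and bc: "\<beta> j \<in> carrier_mat (udim i 5 j) (udim i 5 j)"
    using rep_hom_carrier[OF a, of j] rep_hom_carrier[OF b, of j] by (simp_all add: rdim_proj)
  show "\<beta> j *\<^sub>v (\<alpha> j *\<^sub>v v) = v" "\<alpha> j *\<^sub>v (\<beta> j *\<^sub>v v) = v" if v: "v \<in> carrier_vec (udim i 5 j)"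
  proof -
    have "\<beta> j * \<alpha> j = 1\<^sub>m (udim i 5 j)" "\<alpha> j * \<beta> j = 1\<^sub>m (udim i 5 j)" using assms by (simp_all add: std_iso_def)
    then show "\<beta> j *\<^sub>v (\<alpha> j *\<^sub>v v) = v" "\<alpha> j *\<^sub>v (\<beta> j *\<^sub>v v) = v"
      unfolding assoc_mult_mat_vec[OF bc ac v, symmetric] assoc_mult_mat_vec[OF ac bc v, symmetric] using v by simp_all
  qed
qed

lemma lm_hom: "lm s \<in> rep_hom A2bar (Proj (oth s)) (Proj s)"
proof -
  obtain \<alpha> \<beta> :: "vertex \<Rightarrow> 'k mat" where a: "std_iso (oth s) \<alpha> \<beta>" using std_iso_exists by blast
  obtain \<alpha>' \<beta>' :: "vertex \<Rightarrow> 'k mat" where b: "std_iso s \<alpha>' \<beta>'" using std_iso_exists by blast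
  have h: "\<alpha> j *\<^sub>v snd (projective_data A2bar \<W> (oth s)) j x = std_coord (oth s) j x" if "x \<in> jac_hom A2bar \<W> (oth s) j" for j x
    using a that by (simp add: std_iso_def)
  have h': "\<beta>' j *\<^sub>v std_coord s j x = snd (projective_data A2bar \<W> s) j x" if "x \<in> jac_hom A2bar \<W> s j" for j x
    using b that by (simp add: std_iso_def)
  have eq: "lm s = (\<lambda>j. \<beta>' j * (std_lmult s j * \<alpha> j))"
    by (rule arrow_lmult_eq(1)[OF std_isoD(1)[OF a] h std_isoD(2)[OF b] h'])
  show ?thesis
    by (subst eq) (rule arrow_lmult_eq(2)[OF std_isoD(1)[OF a] h std_isoD(2)[OF b] h'])
qed

lemma lm_std:
  assumes a: "std_iso (oth s) \<alpha> (\<beta> :: vertex \<Rightarrow> 'k mat)" and b: "std_iso s \<alpha>' \<beta>'" and v: "v \<in> carrier_vec (udim (oth s) 5 j)"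
  shows "\<alpha>' j *\<^sub>v (lm s j *\<^sub>v v) = std_lmult s j *\<^sub>v (\<alpha> j *\<^sub>v v)"
proof -
  have h: "\<alpha> j *\<^sub>v snd (projective_data A2bar \<W> (oth s)) j x = std_coord (oth s) j x" if "x \<in> jac_hom A2bar \<W> (oth s) j" for j x
    using a that by (simp add: std_iso_def)
  have h': "\<beta>' j *\<^sub>v std_coord s j x = snd (projective_data A2bar \<W> s) j x" if "x \<in> jac_hom A2bar \<W> s j" for j x
    using b that by (simp add: std_iso_def)
  have eq: "lm s = (\<lambda>j. \<beta>' j * (std_lmult s j * \<alpha> j))"
    by (rule arrow_lmult_eq(1)[OF std_isoD(1)[OF a] h std_isoD(2)[OF b] h'])
  have av: "\<alpha> j *\<^sub>v v \<in> carrier_vec (udim (oth s) 5 j)" by (rule mult_mat_vec_carrier[OF std_isoD(3)[OF a] v])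
  have "lm s j *\<^sub>v v = \<beta>' j *\<^sub>v (std_lmult s j *\<^sub>v (\<alpha> j *\<^sub>v v))"
    unfolding eq using assoc_mult_mat_vec[OF std_isoD(4)[OF b] mult_carrier_mat[OF std_lmult_carrier std_isoD(3)[OF a]] v]
      assoc_mult_mat_vec[OF std_lmult_carrier std_isoD(3)[OF a] v] by simp
  then show ?thesis using std_isoD(6)[OF b mult_mat_vec_carrier[OF std_lmult_carrier av]] by simp
qed

text \<open>By the Yoneda lemma, a homomorphism from \<open>P\<^sub>k\<close> amounts to its value at the generator.\<close>

lemma proj_hom_ex:
  assumes iso: "std_iso k \<alpha> (\<beta> :: vertex \<Rightarrow> 'k mat)" and X: "is_rep A2bar X"
    and X5: "pmat X k 5 = 0\<^sub>m (rdim X (vtx k 5)) (rdim X k)" and w: "w \<in> carrier_vec (rdim X k)"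
  shows "\<exists>h\<in>rep_hom A2bar (Proj k) X. h k *\<^sub>v (\<beta> k *\<^sub>v unit_vec (udim k 5 k) 0) = w"
proof -
  have "pmat X k 5 *\<^sub>v w = 0\<^sub>v (rdim X (vtx k 5))" unfolding X5 by (rule zero_mat_mult_vec[OF w])
  from gen_hom_hom[OF X w this] have g: "gen_hom X k 5 w \<in> rep_hom A2bar (uni k 5) X" .
  have gc: "gen_hom X k 5 w k \<in> carrier_mat (rdim X k) (udim k 5 k)" by (simp add: gen_hom_def)
  have u: "\<beta> k *\<^sub>v unit_vec (udim k 5 k) 0 \<in> carrier_vec (udim k 5 k)"
    by (rule mult_mat_vec_carrier[OF std_isoD(4)[OF iso] unit_vec_carrier])
  have "(gen_hom X k 5 w k * \<alpha> k) *\<^sub>v (\<beta> k *\<^sub>v unit_vec (udim k 5 k) 0) = w"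
    using assoc_mult_mat_vec[OF gc std_isoD(3)[OF iso] u] std_isoD(6)[OF iso unit_vec_carrier] gen_hom_top[OF X w, of 5] by simp
  then show ?thesis
    using rep_hom_comp[OF is_rep_proj is_rep_uni X std_isoD(1)[OF iso] g] by (intro bexI)
qed

lemma proj_hom_unique:
  assumes iso: "std_iso k \<alpha> (\<beta> :: vertex \<Rightarrow> 'k mat)" and X: "is_rep A2bar X"
    and h: "h \<in> rep_hom A2bar (Proj k) X" and h': "h' \<in> rep_hom A2bar (Proj k) X"
    and eq: "h k *\<^sub>v (\<beta> k *\<^sub>v unit_vec (udim k 5 k) 0) = h' k *\<^sub>v (\<beta> k *\<^sub>v unit_vec (udim k 5 k) 0)"
  shows "h = h'"
proof -
  have hc: "h j \<in> carrier_mat (rdim X j) (udim k 5 j)" and h'c: "h' j \<in> carrier_mat (rdim X j) (udim k 5 j)" for j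
    using rep_hom_carrier[OF h, of j] rep_hom_carrier[OF h', of j] by (simp_all add: rdim_proj)
  note bc = std_isoD(4)[OF iso] and ac = std_isoD(3)[OF iso]
  have "(\<lambda>j. h j * \<beta> j) = (\<lambda>j. h' j * \<beta> j)"
  proof (rule hom_uni_ext[OF X])
    show "(\<lambda>j. h j * \<beta> j) \<in> rep_hom A2bar (uni k 5) X" "(\<lambda>j. h' j * \<beta> j) \<in> rep_hom A2bar (uni k 5) X"
      using rep_hom_comp[OF is_rep_uni is_rep_proj X std_isoD(2)[OF iso]] h h' by simp_all
    show "h k * \<beta> k *\<^sub>v unit_vec (udim k 5 k) 0 = h' k * \<beta> k *\<^sub>v unit_vec (udim k 5 k) 0"
      using eq unfolding assoc_mult_mat_vec[OF hc bc unit_vec_carrier] assoc_mult_mat_vec[OF h'c bc unit_vec_carrier] .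
  qed simp
  then have hb: "h j * \<beta> j = h' j * \<beta> j" for j by (rule fun_cong)
  have "h j = h' j" for j
  proof (rule eq_mat_on_vecI[OF hc h'c])
    fix v :: "'k vec" assume v: "v \<in> carrier_vec (udim k 5 j)"
    have av: "\<alpha> j *\<^sub>v v \<in> carrier_vec (udim k 5 j)" by (rule mult_mat_vec_carrier[OF ac v])
    have "(h j * \<beta> j) *\<^sub>v (\<alpha> j *\<^sub>v v) = (h' j * \<beta> j) *\<^sub>v (\<alpha> j *\<^sub>v v)" unfolding hb ..
    then show "h j *\<^sub>v v = h' j *\<^sub>v v"
      unfolding assoc_mult_mat_vec[OF hc bc av] assoc_mult_mat_vec[OF h'c bc av] std_isoD(5)[OF iso v] .
  qed
  then show ?thesis by (rule ext)
qed

lemma pmat_proj': "pmat (Proj i) k 5 = 0\<^sub>m (rdim (Proj i) (vtx k 5)) (rdim (Proj i) k)"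
  by (rule pmat_proj)

text \<open>A functional on \<open>Hom(P\<^sub>k, P\<^sub>j)\<close> is a row vector, by evaluation at the generator of \<open>P\<^sub>k\<close>. In these terms
  the arrows act on \<open>D Tr\<close> by the transposes of left multiplication.\<close>

lemma ar_translate_exists_single:
  assumes pres: "min_presentation A2bar \<W> M a (single_vertex k) f g"
  shows "\<exists>T. is_ar_translate A2bar \<W> M T"
proof -
  let ?b = "single_vertex k" and ?A = "ProjSum a"
  have Pb: "ProjSum ?b = Proj k" by (rule proj_sum_unit)
  have f: "f \<in> rep_hom A2bar (Proj k) ?A" using pres unfolding min_presentation_def Pb by simp
  note Ar = is_rep_proj_sum[of a] and Pr = is_rep_proj
  obtain \<alpha> \<beta> :: "vertex \<Rightarrow> 'k mat" where iso: "std_iso k \<alpha> \<beta>" using std_iso_exists by blast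
  define u where "u = \<beta> k *\<^sub>v unit_vec (udim k 5 k) 0"
  define n where "n j = udim j 5 k" for j
  have rd: "rdim (Proj j) k = n j" for j unfolding n_def by (rule rdim_proj)
  have u: "u \<in> carrier_vec (n k)" unfolding u_def n_def by (rule mult_mat_vec_carrier[OF std_isoD(4)[OF iso] unit_vec_carrier])
  have hk: "h k \<in> carrier_mat (n j) (n k)" if "h \<in> rep_hom A2bar (Proj k) (Proj j)" for h j
    using rep_hom_carrier[OF that, of k] by (simp add: rd)
  have hak: "h k \<in> carrier_mat (n j) (rdim ?A k)" if "h \<in> rep_hom A2bar ?A (Proj j)" for h j
    using rep_hom_carrier[OF that, of k] by (simp add: rd)
  have fk: "f k \<in> carrier_mat (rdim ?A k) (n k)" using rep_hom_carrier[OF f, of k] by (simp add: rd)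
  have fu: "f k *\<^sub>v u \<in> carrier_vec (rdim ?A k)" by (rule mult_mat_vec_carrier[OF fk u])
  have hu: "h k *\<^sub>v u \<in> carrier_vec (n j)" if "h \<in> rep_hom A2bar (Proj k) (Proj j)" for h j
    by (rule mult_mat_vec_carrier[OF hk[OF that] u])
  have comp_f: "(\<lambda>i. h i * f i) \<in> rep_hom A2bar (Proj k) (Proj j)" if "h \<in> rep_hom A2bar ?A (Proj j)" for h j
    by (rule rep_hom_comp[OF Pr Ar Pr f that])
  \<comment> \<open>The values at the generator of those homomorphisms that factor through
    \<open>f\<close>.\<close>
  define S where "S j = {h k *\<^sub>v (f k *\<^sub>v u) | h. h \<in> rep_hom A2bar ?A (Proj j)}" for j
  have Sc: "S j \<subseteq> carrier_vec (n j)" for j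
    unfolding S_def using mult_mat_vec_carrier[OF hak fu] by blast
  \<comment> \<open>Row vectors that vanish on these values: the functionals in
    \<open>dual_transpose_space\<close>, evaluated at the generator.\<close>
  define Y where "Y j = {y \<in> carrier_vec (n j). \<forall>s\<in>S j. y \<bullet> s = 0}" for j
  have Ysub: "VectorSpace.subspace class_ring (Y j) (module_vec TYPE('k) (n j))" for j
    unfolding Y_def by (rule annihilator_subspace[OF Sc])
  have "\<exists>d X R. X \<in> carrier_mat (n j) d \<and> R \<in> carrier_mat d (n j) \<and> R * X = 1\<^sub>m d \<and>
    (*\<^sub>v) X ` carrier_vec d = Y j \<and> (\<forall>y\<in>Y j. X *\<^sub>v (R *\<^sub>v y) = y)" for j
  proof -
    obtain I where I: "I \<subseteq> {..<n j}" "chart (Y j) I" using subspace_chart[OF Ysub] .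
    show ?thesis by (rule chart_basis[OF Ysub I]) blast
  qed
  then obtain d X R where X: "\<And>j. X j \<in> carrier_mat (n j) (d j)" and R: "\<And>j. R j \<in> carrier_mat (d j) (n j)"
    and RX: "\<And>j. R j * X j = 1\<^sub>m (d j)" and im: "\<And>j. (*\<^sub>v) (X j) ` carrier_vec (d j) = Y j"
    and XR: "\<And>j y. y \<in> Y j \<Longrightarrow> X j *\<^sub>v (R j *\<^sub>v y) = y" by metis
  have XY: "X j *\<^sub>v v \<in> Y j" if "v \<in> carrier_vec (d j)" for j v using im[of j] that by blast
  have Xc: "X j *\<^sub>v v \<in> carrier_vec (n j)" if "v \<in> carrier_vec (d j)" for j v
    by (rule mult_mat_vec_carrier[OF X that])
  have lmc: "lm s k \<in> carrier_mat (n s) (n (oth s))" for s using rep_hom_carrier[OF lm_hom, of s k] by (simp add: rd)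
  \<comment> \<open>The space at \<open>j\<close> is \<open>Y j\<close> in coordinates of its basis
    \<open>X j\<close>; arrows act by the transpose of left multiplication, converted back to
    coordinates by \<open>R\<close>.\<close>
  define T :: "(vertex, arrow, 'k) rep" where
    "T = \<lparr>rdim = d, rmap = (\<lambda>x. R (tgt A2bar x) * ((lm (src A2bar x) k)\<^sup>T * X (src A2bar x)))\<rparr>"
  have lmt: "(lm s k)\<^sup>T \<in> carrier_mat (n (oth s)) (n s)" for s using lmc[of s] by simp
  have Tr: "is_rep A2bar T"
    unfolding is_rep_A2bar T_def using mult_carrier_mat[OF R mult_carrier_mat[OF lmt X]] by simp
  define \<psi> where "\<psi> j v = (\<lambda>h. if h \<in> rep_hom A2bar (Proj k) (Proj j) then (X j *\<^sub>v v) \<bullet> (h k *\<^sub>v u) else 0)" for j v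
  have D: "dual_transpose_space A2bar \<W> a ?b f j = {\<xi>.
     (\<forall>h. h \<notin> rep_hom A2bar (Proj k) (Proj j) \<longrightarrow> \<xi> h = 0) \<and>
     (\<forall>h\<in>rep_hom A2bar (Proj k) (Proj j). \<forall>h'\<in>rep_hom A2bar (Proj k) (Proj j). \<xi> (\<lambda>i. h i + h' i) = \<xi> h + \<xi> h') \<and>
     (\<forall>h\<in>rep_hom A2bar (Proj k) (Proj j). \<forall>c. \<xi> (\<lambda>i. c \<cdot>\<^sub>m h i) = c * \<xi> h) \<and>
     (\<forall>h\<in>rep_hom A2bar ?A (Proj j). \<xi> (\<lambda>i. h i * f i) = 0)}" for j
    unfolding dual_transpose_space_def Pb ..
  have \<psi>D: "\<psi> j v \<in> dual_transpose_space A2bar \<W> a ?b f j" if v: "v \<in> carrier_vec (d j)" for j v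
    unfolding D
  proof (intro CollectI conjI allI ballI impI)
    show "\<psi> j v h = 0" if "h \<notin> rep_hom A2bar (Proj k) (Proj j)" for h using that by (simp add: \<psi>_def)
    show "\<psi> j v (\<lambda>i. h i + h' i) = \<psi> j v h + \<psi> j v h'"
      if h: "h \<in> rep_hom A2bar (Proj k) (Proj j)" and h': "h' \<in> rep_hom A2bar (Proj k) (Proj j)" for h h'
      using rep_hom_add[OF Pr Pr h h'] h h' scalar_prod_add_distrib[OF Xc[OF v] hu[OF h] hu[OF h']]
        add_mult_distrib_mat_vec[OF hk[OF h] hk[OF h'] u] by (simp add: \<psi>_def)
    show "\<psi> j v (\<lambda>i. c \<cdot>\<^sub>m h i) = c * \<psi> j v h" if h: "h \<in> rep_hom A2bar (Proj k) (Proj j)" for h c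
      using rep_hom_smult[OF Pr Pr h, of c] h scalar_prod_smult_distrib[OF Xc[OF v] hu[OF h], of c]
        smult_mat_vec[OF hk[OF h] u, of c] by (simp add: \<psi>_def)
    show "\<psi> j v (\<lambda>i. h i * f i) = 0" if h: "h \<in> rep_hom A2bar ?A (Proj j)" for h
    proof -
      have "h k *\<^sub>v (f k *\<^sub>v u) \<in> S j" using h by (auto simp: S_def)
      then have "(X j *\<^sub>v v) \<bullet> (h k *\<^sub>v (f k *\<^sub>v u)) = 0" using XY[OF v] unfolding Y_def by blast
      then show ?thesis using comp_f[OF h] assoc_mult_mat_vec[OF hak[OF h] fk u] by (simp add: \<psi>_def)
    qed
  qed
  have ex: "\<exists>h\<in>rep_hom A2bar (Proj k) (Proj j). h k *\<^sub>v u = w" if "w \<in> carrier_vec (n j)" for j w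
    unfolding u_def by (rule proj_hom_ex[OF iso Pr pmat_proj']) (simp add: rd that)
  have uniq: "h = h'" if "h \<in> rep_hom A2bar (Proj k) (Proj j)" "h' \<in> rep_hom A2bar (Proj k) (Proj j)" "h k *\<^sub>v u = h' k *\<^sub>v u" for h h' j
    using that(3) unfolding u_def by (rule proj_hom_unique[OF iso Pr that(1,2)])
  have bij: "bij_betw (\<psi> j) (carrier_vec (d j)) (dual_transpose_space A2bar \<W> a ?b f j)" for j
    unfolding bij_betw_def
  proof (intro conjI equalityI subsetI)
    show "inj_on (\<psi> j) (carrier_vec (d j))"
    proof (rule inj_onI)
      fix v v' assume v: "v \<in> carrier_vec (d j)" and v': "v' \<in> carrier_vec (d j)" and eq: "\<psi> j v = \<psi> j v'"
      have "X j *\<^sub>v v = X j *\<^sub>v v'"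
      proof (rule eq_vec_scalar_prodI[OF Xc[OF v] Xc[OF v']])
        fix w :: "'k vec" assume "w \<in> carrier_vec (n j)"
        from ex[OF this] obtain h where "h \<in> rep_hom A2bar (Proj k) (Proj j)" "h k *\<^sub>v u = w" by (rule bexE)
        then show "(X j *\<^sub>v v) \<bullet> w = (X j *\<^sub>v v') \<bullet> w" using fun_cong[OF eq, of h] by (simp add: \<psi>_def)
      qed
      then have "R j *\<^sub>v (X j *\<^sub>v v) = R j *\<^sub>v (X j *\<^sub>v v')" by simp
      then show "v = v'"
        unfolding assoc_mult_mat_vec[OF R X v, symmetric] assoc_mult_mat_vec[OF R X v', symmetric] RX using v v' by simp
    qed
    show "\<xi> \<in> dual_transpose_space A2bar \<W> a ?b f j" if "\<xi> \<in> \<psi> j ` carrier_vec (d j)" for \<xi>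
      using that \<psi>D by blast
    fix \<xi> assume "\<xi> \<in> dual_transpose_space A2bar \<W> a ?b f j"
    then have x0: "\<And>h. h \<notin> rep_hom A2bar (Proj k) (Proj j) \<Longrightarrow> \<xi> h = 0"
      and xadd: "\<And>h h'. h \<in> rep_hom A2bar (Proj k) (Proj j) \<Longrightarrow> h' \<in> rep_hom A2bar (Proj k) (Proj j) \<Longrightarrow> \<xi> (\<lambda>i. h i + h' i) = \<xi> h + \<xi> h'"
      and xsm: "\<And>h c. h \<in> rep_hom A2bar (Proj k) (Proj j) \<Longrightarrow> \<xi> (\<lambda>i. c \<cdot>\<^sub>m h i) = c * \<xi> h"
      and xf: "\<And>h. h \<in> rep_hom A2bar ?A (Proj j) \<Longrightarrow> \<xi> (\<lambda>i. h i * f i) = 0"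
      unfolding D by blast+
    have "\<forall>w. \<exists>h. w \<in> carrier_vec (n j) \<longrightarrow> h \<in> rep_hom A2bar (Proj k) (Proj j) \<and> h k *\<^sub>v u = w" using ex by blast
    then obtain H where H: "\<And>w. w \<in> carrier_vec (n j) \<Longrightarrow> H w \<in> rep_hom A2bar (Proj k) (Proj j) \<and> H w k *\<^sub>v u = w" by metis
    \<comment> \<open>Homomorphisms are determined by their value at the generator, so
      \<open>H\<close> is linear. The functional composed with it is a matrix with one row, which
      becomes \<open>y\<close>.\<close>
    obtain B where B: "B \<in> carrier_mat 1 (n j)" "\<And>w. w \<in> carrier_vec (n j) \<Longrightarrow> vec 1 (\<lambda>_. \<xi> (H w)) = B *\<^sub>v w"
    proof (rule additive_homogeneous_mult_mat_vec[of "n j" "\<lambda>w. vec 1 (\<lambda>_. \<xi> (H w))" 1])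
      fix v :: "'k vec" assume v: "v \<in> carrier_vec (n j)"
      note Hv = conjunct1[OF H[OF v]] conjunct2[OF H[OF v]]
      show "vec 1 (\<lambda>_. \<xi> (H (c \<cdot>\<^sub>v v))) = c \<cdot>\<^sub>v vec 1 (\<lambda>_. \<xi> (H v))" for c
      proof -
        have cv: "c \<cdot>\<^sub>v v \<in> carrier_vec (n j)" using v by simp
        have "H (c \<cdot>\<^sub>v v) = (\<lambda>i. c \<cdot>\<^sub>m H v i)"
          using smult_mat_vec[OF hk[OF Hv(1)] u, of c] Hv(2) conjunct2[OF H[OF cv]]
          by (intro uniq[OF conjunct1[OF H[OF cv]] rep_hom_smult[OF Pr Pr Hv(1)]]) simp
        then show ?thesis using xsm[OF Hv(1), of c] by auto
      qed
      fix w :: "'k vec" assume w: "w \<in> carrier_vec (n j)"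
      note Hw = conjunct1[OF H[OF w]] conjunct2[OF H[OF w]]
      have vw: "v + w \<in> carrier_vec (n j)" using v w by simp
      have "H (v + w) = (\<lambda>i. H v i + H w i)"
        using add_mult_distrib_mat_vec[OF hk[OF Hv(1)] hk[OF Hw(1)] u] Hv(2) Hw(2) conjunct2[OF H[OF vw]]
        by (intro uniq[OF conjunct1[OF H[OF vw]] rep_hom_add[OF Pr Pr Hv(1) Hw(1)]]) simp
      then show "vec 1 (\<lambda>_. \<xi> (H (v + w))) = vec 1 (\<lambda>_. \<xi> (H v)) + vec 1 (\<lambda>_. \<xi> (H w))"
        using xadd[OF Hv(1) Hw(1)] by auto
    qed auto
    define y where "y = row B 0"
    have y: "y \<in> carrier_vec (n j)" unfolding y_def using B(1) by (intro carrier_vecI) simp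
    have \<xi>: "\<xi> h = y \<bullet> (h k *\<^sub>v u)" if h: "h \<in> rep_hom A2bar (Proj k) (Proj j)" for h
    proof -
      have "H (h k *\<^sub>v u) = h" using H[OF hu[OF h]] by (intro uniq[OF _ h]) auto
      then have "\<xi> h = vec 1 (\<lambda>_. \<xi> (H (h k *\<^sub>v u))) $ 0" by simp
      also have "\<dots> = (B *\<^sub>v (h k *\<^sub>v u)) $ 0" unfolding B(2)[OF hu[OF h]] ..
      also have "\<dots> = y \<bullet> (h k *\<^sub>v u)" unfolding y_def using B(1) by (intro index_mult_mat_vec) simp
      finally show ?thesis .
    qed
    have "y \<bullet> s = 0" if "s \<in> S j" for s
    proof -
      obtain h where h: "h \<in> rep_hom A2bar ?A (Proj j)" "s = h k *\<^sub>v (f k *\<^sub>v u)" using \<open>s \<in> S j\<close> unfolding S_def by blast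
      show ?thesis using xf[OF h(1)] \<xi>[OF comp_f[OF h(1)]] assoc_mult_mat_vec[OF hak[OF h(1)] fk u] h(2) by simp
    qed
    then have "y \<in> Y j" using y by (simp add: Y_def)
    then obtain v where v: "v \<in> carrier_vec (d j)" "y = X j *\<^sub>v v" using im[of j] by blast
    have "\<xi> = \<psi> j v"
    proof
      show "\<xi> h = \<psi> j v h" for h
        using \<xi>[of h] x0[of h] v(2) by (simp add: \<psi>_def)
    qed
    then show "\<xi> \<in> \<psi> j ` carrier_vec (d j)" using v(1) by blast
  qed
  have act: "\<psi> (oth s) (rmap T (arr s) *\<^sub>v v) h = \<psi> s v (\<lambda>i. lm s i * h i)"
    if v: "v \<in> carrier_vec (d s)" and h: "h \<in> rep_hom A2bar (Proj k) (Proj (oth s))" for s v h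
  proof -
    let ?y = "X s *\<^sub>v v" and ?y' = "(lm s k)\<^sup>T *\<^sub>v (X s *\<^sub>v v)"
    have y: "?y \<in> carrier_vec (n s)" by (rule Xc[OF v])
    have y'c: "?y' \<in> carrier_vec (n (oth s))" by (rule mult_mat_vec_carrier[OF lmt y])
    have pair: "?y' \<bullet> w = ?y \<bullet> (lm s k *\<^sub>v w)" if "w \<in> carrier_vec (n (oth s))" for w
      by (rule transpose_vec_mult_scalar[OF lmc that y])
    \<comment> \<open>Composing with left multiplication again gives a homomorphism through
      \<open>f\<close>, so the transpose maps annihilators to annihilators and stays in the span of
      \<open>X (oth s)\<close>.\<close>
    have "?y' \<bullet> w = 0" if "w \<in> S (oth s)" for w
    proof -
      obtain h' where h': "h' \<in> rep_hom A2bar ?A (Proj (oth s))" "w = h' k *\<^sub>v (f k *\<^sub>v u)" using \<open>w \<in> S (oth s)\<close> unfolding S_def by blast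
      have wc: "w \<in> carrier_vec (n (oth s))" using Sc that by blast
      have "(\<lambda>i. lm s i * h' i) \<in> rep_hom A2bar ?A (Proj s)" by (rule rep_hom_comp[OF Ar Pr Pr h'(1) lm_hom])
      then have "(lm s k * h' k) *\<^sub>v (f k *\<^sub>v u) \<in> S s" unfolding S_def by (intro CollectI exI[of _ "\<lambda>i. lm s i * h' i"]) simp
      then have "lm s k *\<^sub>v w \<in> S s" unfolding h'(2) assoc_mult_mat_vec[OF lmc hak[OF h'(1)] fu] .
      then have "?y \<bullet> (lm s k *\<^sub>v w) = 0" using XY[OF v] unfolding Y_def by blast
      then show ?thesis using pair[OF wc] by simp
    qed
    then have y'Y: "?y' \<in> Y (oth s)" using y'c by (simp add: Y_def)
    have "rmap T (arr s) *\<^sub>v v = R (oth s) *\<^sub>v ?y'"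
      unfolding T_def using assoc_mult_mat_vec[OF R mult_carrier_mat[OF lmt X] v] assoc_mult_mat_vec[OF lmt X v] by simp
    then have "X (oth s) *\<^sub>v (rmap T (arr s) *\<^sub>v v) = ?y'" using XR[OF y'Y] by simp
    then have "\<psi> (oth s) (rmap T (arr s) *\<^sub>v v) h = ?y' \<bullet> (h k *\<^sub>v u)" using h by (simp add: \<psi>_def)
    also have "\<dots> = ?y \<bullet> ((lm s k * h k) *\<^sub>v u)"
      unfolding pair[OF hu[OF h]] assoc_mult_mat_vec[OF lmc hk[OF h] u] ..
    also have "\<dots> = \<psi> s v (\<lambda>i. lm s i * h i)"
      using rep_hom_comp[OF Pr Pr Pr h lm_hom] by (simp add: \<psi>_def)
    finally show ?thesis .
  qed
  have dT: "rdim T = d" by (simp add: T_def)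
  have Tadd: "\<psi> j (v + w) h = \<psi> j v h + \<psi> j w h" if v: "v \<in> carrier_vec (d j)" and w: "w \<in> carrier_vec (d j)" for j v w h
    using mult_add_distrib_mat_vec[OF X v w] add_scalar_prod_distrib[OF Xc[OF v] Xc[OF w] hu] by (simp add: \<psi>_def)
  have Tsm: "\<psi> j (c \<cdot>\<^sub>v v) h = c * \<psi> j v h" if v: "v \<in> carrier_vec (d j)" for j v c h
    using mult_mat_vec[OF X v, of c] smult_scalar_prod_distrib[OF Xc[OF v] hu, of _ c] by (simp add: \<psi>_def)
  have "is_ar_translate A2bar \<W> M T"
    unfolding is_ar_translate_def dT all_arrow_iff src_arr tgt_arr
    using Tr pres bij Tadd Tsm act
    by (intro conjI exI[of _ a] exI[of _ ?b] exI[of _ f] exI[of _ g] exI[of _ \<psi>]) (simp_all add: Pb)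
  then show ?thesis by blast
qed

text \<open>Homomorphisms from the zero representation have matrices without columns. Hence
  \<open>h + h = h\<close>, and additivity forces the value 0.\<close>

lemma dual_transpose_zero:
  "dual_transpose_space A2bar \<W> a (\<lambda>_. 0) f j = {\<lambda>_. 0}"
proof (intro equalityI subsetI)
  fix \<xi> assume x: "\<xi> \<in> dual_transpose_space A2bar \<W> a (\<lambda>_. 0) f j"
  have "\<xi> h = 0" for h
  proof (cases "h \<in> rep_hom A2bar zero_rep (Proj j)")
    case True
    have "h i + h i = h i" for i using rep_hom_carrier[OF True, of i] by (intro eq_matI) (auto simp: zero_rep_def)
    then have "\<xi> h = \<xi> h + \<xi> h" using x True unfolding dual_transpose_space_def proj_sum_zero by force
    then show ?thesis by (simp only: add_cancel_right_right)
  next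
    case False
    then show ?thesis using x unfolding dual_transpose_space_def proj_sum_zero by blast
  qed
  then show "\<xi> \<in> {\<lambda>_. 0}" by auto
qed (auto simp: dual_transpose_space_def)

text \<open>Existence of some translate justifies the \<open>SOME\<close>. In the projective case
  the zero representation is one.\<close>

lemma ar_translate_uni:
  assumes l: "0 < l" "l \<le> 5"
  shows "is_ar_translate A2bar \<W> (uni i l) (ar_translate A2bar \<W> (uni i l))"
proof -
  obtain f g where pres: "min_presentation A2bar \<W> (uni i l) (single_vertex i)
    (if l = 5 then (\<lambda>_. 0) else single_vertex (vtx i l)) f g"
    using min_presentation_uni_exists[OF l, of i] by blast
  have "\<exists>T. is_ar_translate A2bar \<W> (uni i l) T"
  proof (cases "l = 5")
    case False
    then show ?thesis using ar_translate_exists_single[of "uni i l" "single_vertex i" "vtx i l" f g] pres by simp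
  next
    case True
    have pres0: "min_presentation A2bar \<W> (uni i l) (single_vertex i) (\<lambda>_. 0) f g"
      using pres unfolding if_P[OF True] .
    have "(\<lambda>v (h :: vertex \<Rightarrow> 'k mat). 0 :: 'k) ` (carrier_vec 0 :: 'k vec set) = {\<lambda>_. 0}"
      using zero_carrier_vec[of 0, where 'a='k] by blast
    then have bij: "bij_betw (\<lambda>v (h :: vertex \<Rightarrow> 'k mat). 0) (carrier_vec 0 :: 'k vec set) {\<lambda>_. 0 :: 'k}"
      by (auto simp: bij_betw_def inj_on_def)
    have d0: "rdim (zero_rep :: (vertex, arrow, 'k) rep) j = 0" for j by (simp add: zero_rep_def)
    have "is_ar_translate A2bar \<W> (uni i l) zero_rep"
      unfolding is_ar_translate_def d0
      using pres0 is_rep_zero_rep[of A2bar, where 'c='k] bij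
      by (intro conjI exI[of _ "single_vertex i"] exI[of _ "\<lambda>_. 0 :: nat"] exI[of _ f] exI[of _ g] exI[of _ "\<lambda>j v h. 0"])
        (simp_all add: dual_transpose_zero)
    then show ?thesis by blast
  qed
  then show ?thesis unfolding ar_translate_def by (rule someI_ex)
qed

section \<open>Deciding tau-rigidity\<close>

lemma tau_rigid_uni_5: "tau_rigid A2bar \<W> (uni i 5)"
proof -
  let ?T = "ar_translate A2bar \<W> (uni i 5)"
  have T: "is_ar_translate A2bar \<W> (uni i 5) ?T" by (rule ar_translate_uni) simp_all
  then have Tr: "is_rep A2bar ?T" by (simp add: is_ar_translate_def)
  from T obtain a b f g \<psi> where pres: "min_presentation A2bar \<W> (uni i 5) a b f g"
    and bij: "\<forall>j. bij_betw (\<psi> j) (carrier_vec (rdim ?T j) :: 'k vec set) (dual_transpose_space A2bar \<W> a b f j)"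
    by (rule is_ar_translateE) (rule that)
  have b: "b = (\<lambda>_. 0)" using min_presentation_uni_unique[OF _ _ pres] by simp
  have z: "rdim ?T j = 0" for j
    using bij[rule_format, of j] unfolding b dual_transpose_zero
    by (intro carrier_vec_singleton_dim[of "\<psi> j" _ "\<lambda>_. 0"]) (auto simp: bij_betw_def)
  show ?thesis
    unfolding tau_rigid_def
  proof (rule rep_hom_zero_only[OF is_rep_uni Tr])
    fix h assume h: "h \<in> rep_hom A2bar (uni i 5) ?T"
    show "h = (\<lambda>j. 0\<^sub>m (rdim ?T j) (rdim (uni i 5 :: (vertex, arrow, 'k) rep) j))"
    proof
      fix j show "h j = 0\<^sub>m (rdim ?T j) (rdim (uni i 5 :: (vertex, arrow, 'k) rep) j)"
        using rep_hom_carrier[OF h, of j] z[of j] by (intro eq_matI) auto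
    qed
  qed
qed


lemma dual_transpose_spaceD:
  assumes "\<xi> \<in> dual_transpose_space A2bar \<W> a b f j"
  shows "h \<notin> rep_hom A2bar (ProjSum b) (Proj j) \<Longrightarrow> \<xi> h = 0"
    and "h' \<in> rep_hom A2bar (ProjSum a) (Proj j) \<Longrightarrow> \<xi> (\<lambda>i. h' i * f i) = 0"
  using assms unfolding dual_transpose_space_def by blast+

text \<open>For a simple module, all of \<open>Hom(P', P\<^sub>i)\<close> factors through the presentation map \<open>f\<close>.\<close>

lemma dual_transpose_uni_1:
  assumes pres: "min_presentation A2bar \<W> (uni i 1) (single_vertex i) (single_vertex (oth i)) f g"
  shows "dual_transpose_space A2bar \<W> (single_vertex i) (single_vertex (oth i)) f i \<subseteq> {\<lambda>_. 0}"
proof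
  let ?k = "oth i"
  note Pa = proj_sum_unit[of i] and Pb = proj_sum_unit[of ?k]
  note Pr = is_rep_proj and rd = rdim_proj
  have f: "f \<in> rep_hom A2bar (Proj ?k) (Proj i)" and g: "g \<in> rep_hom A2bar (Proj i) (uni i 1)"
    and essf: "essential_onto A2bar (Proj ?k) f (\<lambda>j. {v \<in> carrier_vec (udim i 5 j). g j *\<^sub>v v = 0\<^sub>v (udim i 1 j)})"
    using pres unfolding min_presentation_def Pa Pb by (simp_all add: rd)
  obtain \<alpha> \<beta> :: "vertex \<Rightarrow> 'k mat" where iso: "std_iso i \<alpha> \<beta>" using std_iso_exists by blast
  obtain \<alpha>' \<beta>' :: "vertex \<Rightarrow> 'k mat" where iso': "std_iso ?k \<alpha>' \<beta>'" using std_iso_exists by blast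
  note ac = std_isoD(3)[OF iso] and bc = std_isoD(4)[OF iso] and b'c = std_isoD(4)[OF iso']
  have fc: "f j \<in> carrier_mat (udim i 5 j) (udim ?k 5 j)" for j using rep_hom_carrier[OF f, of j] by (simp add: rd)
  have gc: "g j \<in> carrier_mat (udim i 1 j) (udim i 5 j)" for j using rep_hom_carrier[OF g, of j] by (simp add: rd)
  have u2: "udim i 5 ?k = 2" "udim i 5 i = 3" "udim i 1 ?k = 0" by (simp_all add: udim_def off_def)
  \<comment> \<open>The simple module is zero at \<open>?k\<close>, so the kernel is everything
    there and \<open>f\<close> is onto at this vertex.\<close>
  have ker: "g ?k *\<^sub>v v = 0\<^sub>v (udim i 1 ?k)" if "v \<in> carrier_vec (udim i 5 ?k)" for v
    using mult_mat_vec_carrier[OF gc[of ?k] that] by (intro eq_vecI) (auto simp only: u2(3) carrier_vecD index_zero_vec less_zeroE)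
  have f_onto: "(*\<^sub>v) (f ?k) ` carrier_vec (udim ?k 5 ?k) = carrier_vec (udim i 5 ?k)"
    using essf ker unfolding essential_onto_def rd by auto
  \<comment> \<open>The presentation map in standard coordinates.\<close>
  let ?F = "\<lambda>j. \<alpha> j * (f j * \<beta>' j)"
  have F: "?F \<in> rep_hom A2bar (uni ?k 5) (uni i 5)"
    by (rule rep_hom_comp[OF is_rep_uni Pr is_rep_uni rep_hom_comp[OF is_rep_uni Pr Pr std_isoD(2)[OF iso'] f] std_isoD(1)[OF iso]])
  have Fv: "?F j *\<^sub>v v = \<alpha> j *\<^sub>v (f j *\<^sub>v (\<beta>' j *\<^sub>v v))" if "v \<in> carrier_vec (udim ?k 5 j)" for j v
    using assoc_mult_mat_vec[OF ac mult_carrier_mat[OF fc b'c] that] assoc_mult_mat_vec[OF fc b'c that] by simp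
  have Fc: "?F ?k \<in> carrier_mat (udim i 5 ?k) (udim ?k 5 ?k)" using rep_hom_carrier[OF F, of ?k] by simp
  \<comment> \<open>The entry equals the one in row 0 and column \<open>c - 1\<close> at the vertex
    \<open>i\<close>. That entry vanishes, because its column is in the image of an arrow while the
    generator of the target is not.\<close>
  have row0: "?F ?k $$ (0, c) = 0" if c: "0 < c" "c < udim ?k 5 ?k" for c
  proof -
    have c1: "c - 1 < udim ?k 5 i" using c by (simp add: lt_udim off_def)
    have "?F ?k $$ (0, c - 1 + off ?k i) = (if off i i \<le> 0 then ?F i $$ (0 - off i i, c - 1) else 0)"
      by (rule hom_uni_uni_entry[OF F, of 0 i "c - 1"]) (use c in \<open>simp_all add: u2 off_def\<close>)
    moreover have "?F (oth ?k) $$ (0, c - 1 + off ?k ?k) = (if off i ?k \<le> 0 then ?F ?k $$ (0 - off i ?k, c - 1) else 0)"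
      by (rule hom_uni_uni_entry[OF F, of 0 ?k "c - 1"]) (use c1 in \<open>simp_all add: u2\<close>)
    ultimately show ?thesis using c by (simp add: off_def)
  qed
  let ?e = "unit_vec (udim ?k 5 ?k) 0 :: 'k vec" and ?z = "?F ?k *\<^sub>v unit_vec (udim ?k 5 ?k) 0"
  have k0: "0 < udim ?k 5 ?k" by (simp add: lt_udim)
  have zc: "?z \<in> carrier_vec (udim i 5 ?k)" by (rule mult_mat_vec_carrier[OF Fc unit_vec_carrier])
  have z0: "?z $ 0 = ?F ?k $$ (0, 0)"
    unfolding mult_mat_unit_vec[OF Fc k0]  by (rule index_col) (simp_all only: carrier_matD[OF Fc] k0 u2(1))
  \<comment> \<open>Otherwise the whole first row would vanish, although \<open>f\<close> is onto at
    this vertex.\<close>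
  have z_nz: "?z $ 0 \<noteq> 0"
  proof
    assume z: "?z $ 0 = 0"
    have "\<beta> ?k *\<^sub>v unit_vec (udim i 5 ?k) 0 \<in> (*\<^sub>v) (f ?k) ` carrier_vec (udim ?k 5 ?k)"
      unfolding f_onto by (rule mult_mat_vec_carrier[OF bc unit_vec_carrier])
    then obtain w where w: "w \<in> carrier_vec (udim ?k 5 ?k)" "\<beta> ?k *\<^sub>v unit_vec (udim i 5 ?k) 0 = f ?k *\<^sub>v w" by blast
    have aw: "\<alpha>' ?k *\<^sub>v w \<in> carrier_vec (udim ?k 5 ?k)" by (rule mult_mat_vec_carrier[OF std_isoD(3)[OF iso'] w(1)])
    have "?F ?k *\<^sub>v (\<alpha>' ?k *\<^sub>v w) = unit_vec (udim i 5 ?k) 0"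
      unfolding Fv[OF aw] std_isoD(5)[OF iso' w(1)] w(2)[symmetric] by (rule std_isoD(6)[OF iso unit_vec_carrier])
    then have "(?F ?k *\<^sub>v (\<alpha>' ?k *\<^sub>v w)) $ 0 = 1" by (simp add: u2)
    moreover have "(?F ?k *\<^sub>v (\<alpha>' ?k *\<^sub>v w)) $ 0 = (\<Sum>c<udim ?k 5 ?k. ?F ?k $$ (0, c) * (\<alpha>' ?k *\<^sub>v w) $ c)"
      by (rule mult_mat_vec_expand[OF Fc aw]) (simp add: u2)
    moreover have "(\<Sum>c<udim ?k 5 ?k. ?F ?k $$ (0, c) * (\<alpha>' ?k *\<^sub>v w) $ c) = 0"
    proof (rule sum.neutral, rule ballI)
      fix c assume "c \<in> {..<udim ?k 5 ?k}"
      then have "?F ?k $$ (0, c) = 0" using row0[of c] z z0 by (cases "c = 0") auto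
      then show "?F ?k $$ (0, c) * (\<alpha>' ?k *\<^sub>v w) $ c = 0" by (simp only: mult_zero_left)
    qed
    ultimately show False by simp
  qed
  fix \<xi> assume \<xi>: "\<xi> \<in> dual_transpose_space A2bar \<W> (single_vertex i) (single_vertex ?k) f i"
  have "\<xi> h = 0" for h
  proof (cases "h \<in> rep_hom A2bar (Proj ?k) (Proj i)")
    case False
    then show ?thesis using dual_transpose_spaceD(1)[OF \<xi>, of h] unfolding Pb by blast
  next
    case h: True
    have hc: "h j \<in> carrier_mat (udim i 5 j) (udim ?k 5 j)" for j using rep_hom_carrier[OF h, of j] by (simp add: rd)
    let ?u = "\<beta>' ?k *\<^sub>v ?e"
    have u: "?u \<in> carrier_vec (udim ?k 5 ?k)" by (rule mult_mat_vec_carrier[OF b'c unit_vec_carrier])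
    define p where "p = \<alpha> ?k *\<^sub>v (h ?k *\<^sub>v ?u)"
    have hu: "h ?k *\<^sub>v ?u \<in> carrier_vec (udim i 5 ?k)" by (rule mult_mat_vec_carrier[OF hc u])
    have pc: "p \<in> carrier_vec (udim i 5 ?k)" unfolding p_def by (rule mult_mat_vec_carrier[OF ac hu])
    \<comment> \<open>At \<open>?k\<close> an endomorphism of \<open>uni i 5\<close> is a lower
      triangular Toeplitz matrix of size 2 with entries \<open>x\<close> and \<open>y\<close>. These
      values solve \<open>x * z0 = p0\<close> and \<open>y * z0 + x * z1 = p1\<close>.\<close>
    define x where "x = p $ 0 / ?z $ 0"
    define y where "y = (p $ 1 - x * ?z $ 1) / ?z $ 0"
    \<comment> \<open>The coordinate of path length 4 is set to 0; after another arrow it has length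
      5 and does not reach \<open>?k\<close>.\<close>
    define v where "v = vec (udim i 5 i) (\<lambda>r. if r = 0 then x else if r = 1 then y else 0)"
    let ?U = "uni i 5 :: (vertex, arrow, 'k) rep"
    let ?E = "gen_hom ?U i 5 v"
    have v: "v \<in> carrier_vec (rdim ?U i)" by (simp add: v_def)
    have v': "v \<in> carrier_vec (udim i 5 i)" by (simp add: v_def)
    have E: "?E \<in> rep_hom A2bar ?U ?U"
      by (rule gen_hom_hom[OF is_rep_uni v]) (simp only: pmat_uni_zero[OF order_refl] rdim_uni zero_mat_mult_vec[OF v'])
    have Ec: "?E j \<in> carrier_mat (udim i 5 j) (udim i 5 j)" for j by (simp add: gen_hom_def)
    have Eent: "?E ?k $$ (r, c) = (if c \<le> r then v $ (r - c) else 0)" if "r < 2" "c < 2" for r c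
    proof -
      have "vtx i (2 * c + 1) = ?k" by (simp add: vtx_def)
      then have "(pmat ?U i (2 * c + 1) *\<^sub>v v) $ r = (if 2 * c + 1 \<le> 2 * r + off i ?k then v $ ((2 * r + off i ?k - (2 * c + 1)) div 2) else 0)"
        using pmat_uni_vec[OF v', of r "2 * c + 1"] that by (simp only: u2)
      moreover have "(2 * r + off i ?k - (2 * c + 1)) div 2 = r - c" by (simp add: off_def)
      ultimately show ?thesis using that by (simp add: gen_hom_def u2 off_def del: index_mult_mat_vec)
    qed
    have "?E ?k *\<^sub>v ?z = p"
    proof (rule eq_vecI)
      fix r assume "r < dim_vec p"
      then have r: "r < 2" using pc by (simp add: u2)
      have "(?E ?k *\<^sub>v ?z) $ r = (\<Sum>c<udim i 5 ?k. ?E ?k $$ (r, c) * ?z $ c)"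
        by (rule mult_mat_vec_expand[OF Ec zc]) (simp add: u2 r)
      also have "\<dots> = ?E ?k $$ (r, 0) * ?z $ 0 + ?E ?k $$ (r, 1) * ?z $ 1"
        unfolding u2 by (simp only: numeral_2_eq_2 sum.lessThan_Suc lessThan_0 sum.empty add_0 One_nat_def)
      also have "\<dots> = p $ r"
      proof (cases "r = 0")
        case True
        then show ?thesis using Eent[of 0 0] Eent[of 0 1] z_nz by (simp add: v_def x_def u2 del: index_mult_mat_vec)
      next
        case False
        then have "r = 1" using r by simp
        then show ?thesis using Eent[of 1 0] Eent[of 1 1] z_nz by (simp add: v_def y_def u2 del: index_mult_mat_vec)
      qed
      finally show "(?E ?k *\<^sub>v ?z) $ r = p $ r" .
    qed (use Ec[of ?k] pc in simp)
    note Ez = this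
    let ?h' = "\<lambda>j. \<beta> j * (?E j * \<alpha> j)"
    have h': "?h' \<in> rep_hom A2bar (Proj i) (Proj i)"
      by (rule rep_hom_comp[OF Pr is_rep_uni Pr rep_hom_comp[OF Pr is_rep_uni is_rep_uni std_isoD(1)[OF iso] E] std_isoD(2)[OF iso]])
    have h'c: "?h' ?k \<in> carrier_mat (udim i 5 ?k) (udim i 5 ?k)" using mult_carrier_mat[OF bc mult_carrier_mat[OF Ec ac]] .
    have fu: "f ?k *\<^sub>v ?u \<in> carrier_vec (udim i 5 ?k)" by (rule mult_mat_vec_carrier[OF fc u])
    \<comment> \<open>Both sides agree at the generator of the chosen projective, which
      suffices.\<close>
    have "h = (\<lambda>j. ?h' j * f j)"
    proof (rule proj_hom_unique[OF iso' Pr h rep_hom_comp[OF Pr Pr Pr f h']])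
      have "(?h' ?k * f ?k) *\<^sub>v ?u = ?h' ?k *\<^sub>v (f ?k *\<^sub>v ?u)" by (rule assoc_mult_mat_vec[OF h'c fc u])
      also have "\<dots> = \<beta> ?k *\<^sub>v (?E ?k *\<^sub>v (\<alpha> ?k *\<^sub>v (f ?k *\<^sub>v ?u)))"
        using assoc_mult_mat_vec[OF bc mult_carrier_mat[OF Ec ac] fu] assoc_mult_mat_vec[OF Ec ac fu] by simp
      also have "\<dots> = \<beta> ?k *\<^sub>v (\<alpha> ?k *\<^sub>v (h ?k *\<^sub>v ?u))"
        unfolding Fv[OF unit_vec_carrier, symmetric] Ez p_def ..
      also have "\<dots> = h ?k *\<^sub>v ?u" by (rule std_isoD(5)[OF iso hu])
      finally show "h ?k *\<^sub>v ?u = (?h' ?k * f ?k) *\<^sub>v ?u" ..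
    qed
    then show ?thesis using dual_transpose_spaceD(2)[OF \<xi>, of ?h'] h' unfolding Pa by simp
  qed
  then show "\<xi> \<in> {\<lambda>_. 0}" by auto
qed

text \<open>Only the vertex \<open>i\<close> matters: the translate vanishes there, so the generator
  of the simple module has no nonzero image.\<close>

lemma tau_rigid_uni_1: "tau_rigid A2bar \<W> (uni i 1)"
proof -
  let ?T = "ar_translate A2bar \<W> (uni i 1)"
  have T: "is_ar_translate A2bar \<W> (uni i 1) ?T" by (rule ar_translate_uni) simp_all
  then have Tr: "is_rep A2bar ?T" by (simp add: is_ar_translate_def)
  from T obtain a b f g \<psi> where pres: "min_presentation A2bar \<W> (uni i 1) a b f g"
    and bij: "\<forall>j. bij_betw (\<psi> j) (carrier_vec (rdim ?T j) :: 'k vec set) (dual_transpose_space A2bar \<W> a b f j)"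
    by (rule is_ar_translateE) (rule that)
  have ab: "a = single_vertex i" "b = single_vertex (oth i)"
    using min_presentation_uni_unique[OF _ _ pres] by (simp_all add: vtx_def)
  have sub: "dual_transpose_space A2bar \<W> a b f i \<subseteq> {\<lambda>_. 0}"
    using dual_transpose_uni_1[of i f g] pres unfolding ab by simp
  have z: "rdim ?T i = 0"
  proof (rule carrier_vec_singleton_dim[of "\<psi> i" _ "\<lambda>_. 0"])
    show "inj_on (\<psi> i) (carrier_vec (rdim ?T i))" using bij by (simp add: bij_betw_def)
    show "\<psi> i v = (\<lambda>_. 0)" if "v \<in> carrier_vec (rdim ?T i)" for v
      using bij_betwE[OF bij[rule_format, of i]] that sub by auto
  qed
  show ?thesis
    unfolding tau_rigid_def
  proof (rule rep_hom_zero_only[OF is_rep_uni Tr])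
    fix h assume h: "h \<in> rep_hom A2bar (uni i 1) ?T"
    have c: "w = 0\<^sub>v 0" if "w \<in> carrier_vec (rdim ?T i)" for w :: "'k vec" using that z by auto
    have zh: "(\<lambda>j. 0\<^sub>m (rdim ?T j) (rdim (uni i 1 :: (vertex, arrow, 'k) rep) j)) \<in> rep_hom A2bar (uni i 1) ?T"
      by (rule rep_hom_zero[OF is_rep_uni Tr])
    show "h = (\<lambda>j. 0\<^sub>m (rdim ?T j) (rdim (uni i 1 :: (vertex, arrow, 'k) rep) j))"
    proof (rule hom_uni_ext[OF Tr h zh])
      have "h i *\<^sub>v unit_vec (udim i 1 i) 0 \<in> carrier_vec (rdim ?T i)"
        using rep_hom_mult_vec_carrier[OF h, of "unit_vec (udim i 1 i) 0" i] by simp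
      moreover have "0\<^sub>m (rdim ?T i) (rdim (uni i 1 :: (vertex, arrow, 'k) rep) i) *\<^sub>v unit_vec (udim i 1 i) 0 \<in> carrier_vec (rdim ?T i)"
        by (rule mult_mat_vec_carrier[OF zero_carrier_mat]) simp
      ultimately show "h i *\<^sub>v unit_vec (udim i 1 i) 0 = 0\<^sub>m (rdim ?T i) (rdim (uni i 1 :: (vertex, arrow, 'k) rep) i) *\<^sub>v unit_vec (udim i 1 i) 0"
        using c by metis
    qed simp
  qed
qed

text \<open>In the remaining cases the functional that reads off the coefficient of the shortest path in
  \<open>e\<^sub>i \<Lambda> e\<^sub>k\<close> is an element of \<open>\<tau>M\<close> at \<open>i\<close>, killed by paths of length two. It is the image of the
  generator under a nonzero homomorphism \<open>M \<rightarrow> \<tau>M\<close>.\<close>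

lemma not_tau_rigid_uni:
  assumes l: "2 \<le> l" "l < 5"
  shows "\<not> tau_rigid A2bar \<W> (uni i l)"
proof -
  let ?T = "ar_translate A2bar \<W> (uni i l)" and ?k = "vtx i l"
  have l0: "0 < l" "l \<le> 5" using l by simp_all
  have T: "is_ar_translate A2bar \<W> (uni i l) ?T" by (rule ar_translate_uni[OF l0])
  then have Tr: "is_rep A2bar ?T" by (simp add: is_ar_translate_def)
  from T obtain a b f g \<psi> where pres: "min_presentation A2bar \<W> (uni i l) a b f g"
    and bij: "\<forall>j. bij_betw (\<psi> j) (carrier_vec (rdim ?T j) :: 'k vec set) (dual_transpose_space A2bar \<W> a b f j)"
    and \<psi>smult: "\<forall>j. \<forall>v\<in>carrier_vec (rdim ?T j). \<forall>c h. \<psi> j (c \<cdot>\<^sub>v v) h = c * \<psi> j v h"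
    and act: "\<forall>x. \<forall>v\<in>carrier_vec (rdim ?T (src A2bar x)). \<forall>h\<in>rep_hom A2bar (ProjSum b) (Proj (tgt A2bar x)).
        \<psi> (tgt A2bar x) (rmap ?T x *\<^sub>v v) h = \<psi> (src A2bar x) v (\<lambda>i. arrow_lmult A2bar \<W> x i * h i)"
    by (rule is_ar_translateE) (rule that)
  have ab: "a = single_vertex i" "b = single_vertex ?k"
    using min_presentation_uni_unique[OF l0 pres] l by simp_all
  have Pa: "ProjSum a = Proj i" and Pb: "ProjSum b = Proj ?k" unfolding ab by (rule proj_sum_unit)+
  note Pr = is_rep_proj and rd = rdim_proj
  have f: "f \<in> rep_hom A2bar (Proj ?k) (Proj i)" and g: "g \<in> rep_hom A2bar (Proj i) (uni i l)"
    and essg: "essential_onto A2bar (Proj i) g (\<lambda>j. carrier_vec (udim i l j))"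
    and essf: "essential_onto A2bar (Proj ?k) f (\<lambda>j. {v \<in> carrier_vec (rdim (Proj i) j). g j *\<^sub>v v = 0\<^sub>v (udim i l j)})"
    using pres unfolding min_presentation_def Pa Pb by simp_all
  obtain \<alpha> \<beta> :: "vertex \<Rightarrow> 'k mat" where iso: "std_iso i \<alpha> \<beta>" using std_iso_exists by blast
  obtain \<alpha>' \<beta>' :: "vertex \<Rightarrow> 'k mat" where iso': "std_iso ?k \<alpha>' \<beta>'" using std_iso_exists by blast
  obtain \<alpha>'' \<beta>'' :: "vertex \<Rightarrow> 'k mat" where iso'': "std_iso (oth i) \<alpha>'' \<beta>''" using std_iso_exists by blast
  note ac = std_isoD(3)[OF iso]
  let ?u = "\<beta>' ?k *\<^sub>v unit_vec (udim ?k 5 ?k) 0"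
  have u: "?u \<in> carrier_vec (udim ?k 5 ?k)" by (rule mult_mat_vec_carrier[OF std_isoD(4)[OF iso'] unit_vec_carrier])
  have hk: "h ?k \<in> carrier_mat (udim j 5 ?k) (udim ?k 5 ?k)" if "h \<in> rep_hom A2bar (Proj ?k) (Proj j)" for h j
    using rep_hom_carrier[OF that, of ?k] by (simp add: rd)
  have hu: "h ?k *\<^sub>v ?u \<in> carrier_vec (udim j 5 ?k)" if "h \<in> rep_hom A2bar (Proj ?k) (Proj j)" for h j
    by (rule mult_mat_vec_carrier[OF hk[OF that] u])
  define \<xi> where "\<xi> h = (if h \<in> rep_hom A2bar (Proj ?k) (Proj i) then (\<alpha> ?k *\<^sub>v (h ?k *\<^sub>v ?u)) $ 0 else 0)" for h
  have uk: "0 < udim i 5 ?k" "0 < udim ?k 5 ?k" using off_le[of i ?k] by (simp_all add: lt_udim)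
  have ah: "\<alpha> ?k *\<^sub>v (h ?k *\<^sub>v ?u) \<in> carrier_vec (udim i 5 ?k)" if "h \<in> rep_hom A2bar (Proj ?k) (Proj i)" for h
    by (rule mult_mat_vec_carrier[OF ac hu[OF that]])
  have \<xi>D: "\<xi> \<in> dual_transpose_space A2bar \<W> a b f i"
    unfolding dual_transpose_space_def Pa Pb
  proof (intro CollectI conjI allI ballI impI)
    show "\<xi> h = 0" if "h \<notin> rep_hom A2bar (Proj ?k) (Proj i)" for h using that by (simp add: \<xi>_def)
    show "\<xi> (\<lambda>i. h i + h' i) = \<xi> h + \<xi> h'"
      if h: "h \<in> rep_hom A2bar (Proj ?k) (Proj i)" and h': "h' \<in> rep_hom A2bar (Proj ?k) (Proj i)" for h h'
    proof -
      have "\<alpha> ?k *\<^sub>v ((h ?k + h' ?k) *\<^sub>v ?u) = \<alpha> ?k *\<^sub>v (h ?k *\<^sub>v ?u) + \<alpha> ?k *\<^sub>v (h' ?k *\<^sub>v ?u)"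
        unfolding add_mult_distrib_mat_vec[OF hk[OF h] hk[OF h'] u] by (rule mult_add_distrib_mat_vec[OF ac hu[OF h] hu[OF h']])
      then have "(\<alpha> ?k *\<^sub>v ((h ?k + h' ?k) *\<^sub>v ?u)) $ 0 = (\<alpha> ?k *\<^sub>v (h ?k *\<^sub>v ?u)) $ 0 + (\<alpha> ?k *\<^sub>v (h' ?k *\<^sub>v ?u)) $ 0"
        using index_add_vec(1)[of 0 "\<alpha> ?k *\<^sub>v (h' ?k *\<^sub>v ?u)"] carrier_vecD[OF ah[OF h']] uk(1) by (simp only:)
      then show ?thesis using rep_hom_add[OF Pr Pr h h'] h h' by (simp only: \<xi>_def if_True)
    qed
    show "\<xi> (\<lambda>i. c \<cdot>\<^sub>m h i) = c * \<xi> h" if h: "h \<in> rep_hom A2bar (Proj ?k) (Proj i)" for h c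
    proof -
      have "\<alpha> ?k *\<^sub>v ((c \<cdot>\<^sub>m h ?k) *\<^sub>v ?u) = c \<cdot>\<^sub>v (\<alpha> ?k *\<^sub>v (h ?k *\<^sub>v ?u))"
        unfolding smult_mat_vec[OF hk[OF h] u] by (rule mult_mat_vec[OF ac hu[OF h]])
      then have "(\<alpha> ?k *\<^sub>v ((c \<cdot>\<^sub>m h ?k) *\<^sub>v ?u)) $ 0 = c * (\<alpha> ?k *\<^sub>v (h ?k *\<^sub>v ?u)) $ 0"
        using index_smult_vec(1)[of 0 "\<alpha> ?k *\<^sub>v (h ?k *\<^sub>v ?u)" c] carrier_vecD[OF ah[OF h]] uk(1) by (simp only:)
      then show ?thesis using rep_hom_smult[OF Pr Pr h, of c] h by (simp only: \<xi>_def if_True)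
    qed
    \<comment> \<open>The image of \<open>f\<close> lies in the radical power
      \<open>chain i 5 l\<close>. Since \<open>l\<close> is at least 2, the coefficient of the
      shortest path, of length at most 1, vanishes there, and endomorphisms preserve this.\<close>
    show "\<xi> (\<lambda>i. h i * f i) = 0" if h: "h \<in> rep_hom A2bar (Proj i) (Proj i)" for h
    proof -
      have hc: "h ?k \<in> carrier_mat (udim i 5 ?k) (udim i 5 ?k)" using rep_hom_carrier[OF h, of ?k] by (simp add: rd)
      have onto: "(*\<^sub>v) (g j) ` carrier_vec (rdim (Proj i) j) = carrier_vec (udim i l j)" for j
        using essg unfolding essential_onto_def by blast
      have ba: "\<forall>j. \<beta> j * \<alpha> j = 1\<^sub>m (rdim (Proj i) j)" using iso by (simp add: std_iso_def rd)
      have "f ?k *\<^sub>v ?u \<in> (*\<^sub>v) (f ?k) ` carrier_vec (rdim (Proj ?k) ?k)" using u by (simp add: rd)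
      then have "f ?k *\<^sub>v ?u \<in> (*\<^sub>v) (\<beta> ?k) ` chain i 5 l ?k"
        using essf unfolding essential_onto_def kernel_proj[OF g l0 onto std_isoD(1,2)[OF iso] ba] by blast
      then obtain w where w: "w \<in> chain i 5 l ?k" "f ?k *\<^sub>v ?u = \<beta> ?k *\<^sub>v w" by blast
      have wc: "w \<in> carrier_vec (udim i 5 ?k)" using w(1) by (simp add: chain_def)
      have w0: "w $ 0 = 0" using w(1) uk(1) l off_le[of i ?k] by (simp add: chain_def)
      let ?H = "\<lambda>j. \<alpha> j * (h j * \<beta> j)"
      have H: "?H \<in> rep_hom A2bar (uni i 5) (uni i 5)"
        by (rule rep_hom_comp[OF is_rep_uni Pr is_rep_uni rep_hom_comp[OF is_rep_uni Pr Pr std_isoD(2)[OF iso] h] std_isoD(1)[OF iso]])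
      have "?H ?k *\<^sub>v w = \<alpha> ?k *\<^sub>v (h ?k *\<^sub>v (f ?k *\<^sub>v ?u))"
        using assoc_mult_mat_vec[OF ac mult_carrier_mat[OF hc std_isoD(4)[OF iso]] wc] assoc_mult_mat_vec[OF hc std_isoD(4)[OF iso] wc] w(2) by simp
      moreover have "(?H ?k *\<^sub>v w) $ 0 = 0" using hom_uni_coord0[OF H wc uk(1) uk(1)] w0 by simp
      moreover have "(h ?k * f ?k) *\<^sub>v ?u = h ?k *\<^sub>v (f ?k *\<^sub>v ?u)" by (rule assoc_mult_mat_vec[OF hc hk[OF f] u])
      ultimately show ?thesis using rep_hom_comp[OF Pr Pr Pr f h] by (simp add: \<xi>_def del: index_mult_mat_vec)
    qed
  qed
  then have "\<xi> \<in> \<psi> i ` carrier_vec (rdim ?T i)" unfolding bij_betw_imp_surj_on[OF bij[rule_format, of i]] .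
  then obtain t where t: "t \<in> carrier_vec (rdim ?T i)" "\<psi> i t = \<xi>" by (rule imageE) (rule that, assumption, rule sym)
  have \<psi>0: "\<psi> j (0\<^sub>v (rdim ?T j)) = (\<lambda>_. 0)" for j
  proof
    fix h
    have "0 \<cdot>\<^sub>v 0\<^sub>v (rdim ?T j) = (0\<^sub>v (rdim ?T j) :: 'k vec)" by (intro eq_vecI) simp_all
    then show "\<psi> j (0\<^sub>v (rdim ?T j)) h = 0" using \<psi>smult[rule_format, of "0\<^sub>v (rdim ?T j)" j 0 h] by simp
  qed
  \<comment> \<open>Some homomorphism sends the generator to the shortest path, and the functional
    takes the value 1 on it.\<close>
  have t_nz: "t \<noteq> 0\<^sub>v (rdim ?T i)"
  proof
    assume "t = 0\<^sub>v (rdim ?T i)"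
    then have z: "\<xi> = (\<lambda>_. 0)" using t(2) \<psi>0 by simp
    have bu: "\<beta> ?k *\<^sub>v unit_vec (udim i 5 ?k) 0 \<in> carrier_vec (udim i 5 ?k)"
      by (rule mult_mat_vec_carrier[OF std_isoD(4)[OF iso] unit_vec_carrier])
    have "\<exists>h\<in>rep_hom A2bar (Proj ?k) (Proj i). h ?k *\<^sub>v ?u = \<beta> ?k *\<^sub>v unit_vec (udim i 5 ?k) 0"
      by (rule proj_hom_ex[OF iso' Pr pmat_proj']) (simp only: rd bu)
    then obtain h where h: "h \<in> rep_hom A2bar (Proj ?k) (Proj i)" "h ?k *\<^sub>v ?u = \<beta> ?k *\<^sub>v unit_vec (udim i 5 ?k) 0" by (rule bexE)
    have "\<xi> h = 1" using h(1) uk by (simp add: \<xi>_def h(2) std_isoD(6)[OF iso unit_vec_carrier] del: index_mult_mat_vec)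
    then show False using z by simp
  qed
  have act': "\<psi> (oth s) (rmap ?T (arr s) *\<^sub>v v) h = \<psi> s v (\<lambda>j. lm s j * h j)"
    if "v \<in> carrier_vec (rdim ?T s)" "h \<in> rep_hom A2bar (Proj ?k) (Proj (oth s))" for s v h
    using act[rule_format, of v "arr s" h] that unfolding Pb by simp
  have Tt: "rmap ?T (arr i) *\<^sub>v t \<in> carrier_vec (rdim ?T (oth i))" by (rule mult_mat_vec_carrier[OF rmap_arr_carrier[OF Tr] t(1)])
  \<comment> \<open>Two arrows acting on the translate correspond to two left multiplications inside
    the functional. These raise path lengths by 2, so the coefficient of the shortest path becomes
    0.\<close>
  let ?t2 = "rmap ?T (arr (oth i)) *\<^sub>v (rmap ?T (arr i) *\<^sub>v t)"
  have t2c: "?t2 \<in> carrier_vec (rdim ?T i)" using mult_mat_vec_carrier[OF rmap_arr_carrier[OF Tr, of "oth i"] Tt] by simp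
  have lm1: "lm (oth i) \<in> rep_hom A2bar (Proj i) (Proj (oth i))" using lm_hom[of "oth i"] by simp
  have "\<psi> i ?t2 h = 0" for h
  proof (cases "h \<in> rep_hom A2bar (Proj ?k) (Proj i)")
    case False
    have "\<psi> i ?t2 \<in> dual_transpose_space A2bar \<W> a b f i"
      by (rule bij_betwE[OF bij[rule_format, of i], rule_format, OF t2c])
    from dual_transpose_spaceD(1)[OF this, of h] False show ?thesis unfolding Pb by blast
  next
    case h: True
    have h1: "(\<lambda>j. lm (oth i) j * h j) \<in> rep_hom A2bar (Proj ?k) (Proj (oth i))" by (rule rep_hom_comp[OF Pr Pr Pr h lm1])
    have h2: "(\<lambda>j. lm i j * (lm (oth i) j * h j)) \<in> rep_hom A2bar (Proj ?k) (Proj i)" by (rule rep_hom_comp[OF Pr Pr Pr h1 lm_hom])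
    have "\<psi> i ?t2 h = \<psi> (oth i) (rmap ?T (arr i) *\<^sub>v t) (\<lambda>j. lm (oth i) j * h j)"
      using act'[OF Tt, of h] h by simp
    also have "\<dots> = \<xi> (\<lambda>j. lm i j * (lm (oth i) j * h j))" using act'[OF t(1) h1] t(2) by simp
    also have "\<dots> = (\<alpha> ?k *\<^sub>v ((lm i ?k * (lm (oth i) ?k * h ?k)) *\<^sub>v ?u)) $ 0" using h2 by (simp add: \<xi>_def)
    also have "(lm i ?k * (lm (oth i) ?k * h ?k)) *\<^sub>v ?u = lm i ?k *\<^sub>v (lm (oth i) ?k *\<^sub>v (h ?k *\<^sub>v ?u))"
    proof -
      have c1: "lm i ?k \<in> carrier_mat (udim i 5 ?k) (udim (oth i) 5 ?k)" using rep_hom_carrier[OF lm_hom[of i], of ?k] by (simp add: rd)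
      have c2: "lm (oth i) ?k \<in> carrier_mat (udim (oth i) 5 ?k) (udim i 5 ?k)" using rep_hom_carrier[OF lm1, of ?k] by (simp add: rd)
      show ?thesis using assoc_mult_mat_vec[OF c1 mult_carrier_mat[OF c2 hk[OF h]] u] assoc_mult_mat_vec[OF c2 hk[OF h] u] by simp
    qed
    also have "\<alpha> ?k *\<^sub>v (lm i ?k *\<^sub>v (lm (oth i) ?k *\<^sub>v (h ?k *\<^sub>v ?u))) = std_lmult i ?k *\<^sub>v (std_lmult (oth i) ?k *\<^sub>v (\<alpha> ?k *\<^sub>v (h ?k *\<^sub>v ?u)))"
    proof -
      have c2: "lm (oth i) ?k \<in> carrier_mat (udim (oth i) 5 ?k) (udim i 5 ?k)" using rep_hom_carrier[OF lm1, of ?k] by (simp add: rd)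
      have iso_oo: "std_iso (oth (oth i)) \<alpha> \<beta>" using iso by simp
      have huo: "h ?k *\<^sub>v ?u \<in> carrier_vec (udim (oth (oth i)) 5 ?k)" using hu[OF h] by simp
      show ?thesis
        unfolding lm_std[OF iso'' iso mult_mat_vec_carrier[OF c2 hu[OF h]]] lm_std[OF iso_oo iso'' huo] ..
    qed
    also have "\<dots> $ 0 = 0"
    proof -
      let ?w = "\<alpha> ?k *\<^sub>v (h ?k *\<^sub>v ?u)"
      have w: "?w \<in> carrier_vec (udim (oth (oth i)) 5 ?k)" using ah[OF h] by simp
      have w1: "std_lmult (oth i) ?k *\<^sub>v ?w \<in> carrier_vec (udim (oth i) 5 ?k)" by (rule mult_mat_vec_carrier[OF std_lmult_carrier w])
      show ?thesis
      proof (cases "off (oth i) ?k \<le> 0")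
        case True
        then have off0: "off (oth i) ?k = 0" and off1: "\<not> off (oth (oth i)) ?k \<le> 0" using off_0_or_1[of i ?k] by (auto simp: off_oth2)
        have "0 < udim (oth i) 5 ?k" using off0 by (simp add: lt_udim)
        then have "(std_lmult (oth i) ?k *\<^sub>v ?w) $ 0 = 0" using std_lmult_vec[OF w, of 0] off1 by simp
        then show ?thesis using std_lmult_vec[OF w1 uk(1)] off0 by simp
      next
        case False
        then show ?thesis using std_lmult_vec[OF w1 uk(1)] by simp
      qed
    qed
    finally show ?thesis .
  qed
  then have "\<psi> i ?t2 = \<psi> i (0\<^sub>v (rdim ?T i))" using \<psi>0 by auto
  then have t2: "?t2 = 0\<^sub>v (rdim ?T i)"
    by (rule inj_onD[OF bij_betw_imp_inj_on[OF bij[rule_format, of i]] _ t2c]) simp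
  have "pmat ?T i 2 *\<^sub>v t = ?t2"
    using pmat_vec_Suc[OF Tr t(1), of 1] pmat_vec_Suc[OF Tr t(1), of 0] t(1) by (simp add: numeral_2_eq_2)
  then have "pmat ?T i 2 *\<^sub>v t = 0\<^sub>v (rdim ?T (vtx i 2))" using t2 by (simp add: vtx_def)
  \<comment> \<open>Since \<open>l\<close> is at least 2, the path of length \<open>l\<close> kills
    \<open>t\<close> too, so \<open>t\<close> may be the image of the generator.\<close>
  from pmat_vec_zero_mono[OF Tr t(1) this l(1)]
  have h: "gen_hom ?T i l t \<in> rep_hom A2bar (uni i l) ?T" by (rule gen_hom_hom[OF Tr t(1)])
  have ht: "gen_hom ?T i l t i *\<^sub>v unit_vec (udim i l i) 0 = t" by (rule gen_hom_top[OF Tr t(1) l0(1)])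
  show ?thesis
  proof
    assume "tau_rigid A2bar \<W> (uni i l)"
    then have "gen_hom ?T i l t = (\<lambda>j. 0\<^sub>m (rdim ?T j) (rdim (uni i l :: (vertex, arrow, 'k) rep) j))"
      using h unfolding tau_rigid_def by simp
    then have "t = 0\<^sub>m (rdim ?T i) (udim i l i) *\<^sub>v unit_vec (udim i l i) 0" using ht by simp
    then show False using t_nz by simp
  qed
qed

section \<open>The indecomposable tau-rigid modules\<close>

text \<open>The translates are equal, so composition with the isomorphism carries homomorphisms into
  the translate from one module to the other.\<close>

lemma tau_rigid_of_iso_uni:
  assumes l: "0 < l" "l \<le> 5" and M: "is_rep A2bar M" and iso: "rep_iso A2bar (uni i l) (M :: (vertex, arrow, 'k) rep)"
    and rigid: "tau_rigid A2bar \<W> M"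
  shows "tau_rigid A2bar \<W> (uni i l)"
proof -
  let ?T = "ar_translate A2bar \<W> (uni i l)" and ?U = "uni i l :: (vertex, arrow, 'k) rep"
  have Tr: "is_rep A2bar ?T" using ar_translate_uni[OF l, of i] by (simp add: is_ar_translate_def)
  have T: "ar_translate A2bar \<W> M = ?T" by (rule ar_translate_iso[OF is_rep_uni M iso, symmetric])
  obtain \<phi> \<psi> where \<phi>: "\<phi> \<in> rep_hom A2bar ?U M" and \<psi>: "\<psi> \<in> rep_hom A2bar M ?U" and inv: "\<forall>j. \<psi> j * \<phi> j = 1\<^sub>m (rdim ?U j)"
    using iso unfolding rep_iso_def by blast
  show ?thesis
    unfolding tau_rigid_def
  proof (rule rep_hom_zero_only[OF is_rep_uni Tr])
    fix h assume h: "h \<in> rep_hom A2bar ?U ?T"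
    have "(\<lambda>j. h j * \<psi> j) \<in> rep_hom A2bar M ?T" by (rule rep_hom_comp[OF M is_rep_uni Tr \<psi> h])
    then have z: "(\<lambda>j. h j * \<psi> j) = (\<lambda>j. 0\<^sub>m (rdim ?T j) (rdim M j))" using rigid unfolding tau_rigid_def T by blast
    show "h = (\<lambda>j. 0\<^sub>m (rdim ?T j) (rdim ?U j))"
    proof
      fix j
      note c = rep_hom_carrier[OF h, of j] rep_hom_carrier[OF \<psi>, of j] rep_hom_carrier[OF \<phi>, of j]
      have "h j = h j * (\<psi> j * \<phi> j)" using c(1) inv by (metis right_mult_one_mat)
      also have "\<dots> = h j * \<psi> j * \<phi> j" by (rule assoc_mult_mat[OF c, symmetric])
      also have "\<dots> = 0\<^sub>m (rdim ?T j) (rdim ?U j)" unfolding fun_cong[OF z] by (rule left_mult_zero_mat[OF c(3)])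
      finally show "h j = 0\<^sub>m (rdim ?T j) (rdim ?U j)" .
    qed
  qed
qed

lemma indec_tau_rigidE:
  assumes M: "(M :: (vertex, arrow, 'k) rep) \<in> indec_tau_rigid"
  obtains i l where "l \<in> {1, 5}" "rep_iso A2bar (uni i l) M" "is_rep A2bar M"
proof -
  have Mm: "is_module A2bar \<W> M" and ind: "indecomposable A2bar \<W> M"
    and rigid: "tau_rigid A2bar \<W> M" using M by (simp_all add: indec_tau_rigid_def)
  have Mr: "is_rep A2bar M" using Mm by (simp add: is_module_def)
  obtain i l where il: "0 < l" "l \<le> 5" "rep_iso A2bar (uni i l) M" using indecomposable_is_uni[OF char3 Mm ind] .
  have "\<not> (2 \<le> l \<and> l < 5)"
    using tau_rigid_of_iso_uni[OF il(1,2) Mr il(3) rigid] not_tau_rigid_uni[of l i] by blast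
  then have "l \<in> {1, 5}" using il(1,2) by auto
  then show thesis using il(3) Mr by (rule that)
qed

lemma uni_in_indec_tau_rigid:
  assumes "l \<in> {1, 5}"
  shows "(uni i l :: (vertex, arrow, 'k) rep) \<in> indec_tau_rigid"
  using assms is_module_uni[of l i] indecomposable_uni[of l _ i] tau_rigid_uni_1[of i] tau_rigid_uni_5[of i]
  unfolding indec_tau_rigid_def by auto

lemma CC_iso_uni:
  assumes l: "0 < l" "l \<le> 5" and M: "is_rep A2bar M" and iso: "rep_iso A2bar (uni i l) (M :: (vertex, arrow, 'k) rep)"
  shows "CC A2bar \<W> M = cc_value i l"
proof -
  have g: "g_vector A2bar \<W> M =
      (\<lambda>j. int (if j = i then 1 else 0) - int (if l \<noteq> 5 \<and> j = vtx i l then 1 else 0))"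
    unfolding g_vector_iso[OF is_rep_uni M iso, symmetric] g_vector_uni[OF l] by auto
  have one: "(of_int n :: vertex laurent) * Poly_Mapping.single a 1 = Poly_Mapping.single a n" for n a
    by (simp add: single_of_int[symmetric] mult_single del: single_of_int)
  show ?thesis
    unfolding CC_def sum_euler_char_uni[OF M iso] lmono_def one g cc_value_def by simp
qed

text \<open>Each module is isomorphic to some \<open>uni i l\<close> with \<open>l\<close> equal to
  1 or 5, and the value of \<open>CC\<close> recovers \<open>i\<close> and \<open>l\<close>. So the
  isomorphism relation is the kernel of \<open>CC\<close>.\<close>

lemma indec_tau_rigid_iso_iff:
  assumes M: "(M :: (vertex, arrow, 'k) rep) \<in> indec_tau_rigid" and N: "N \<in> indec_tau_rigid"
  shows "(M, N) \<in> indec_tau_rigid_iso \<longleftrightarrow> CC A2bar \<W> M = CC A2bar \<W> N"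
proof -
  obtain i l where l: "l \<in> {1, 5}" and iM: "rep_iso A2bar (uni i l) M" and Mr: "is_rep A2bar M" using indec_tau_rigidE[OF M] .
  obtain i' l' where l': "l' \<in> {1, 5}" and iN: "rep_iso A2bar (uni i' l') N" and Nr: "is_rep A2bar N" using indec_tau_rigidE[OF N] .
  have b: "0 < l" "l \<le> 5" "0 < l'" "l' \<le> 5" using l l' by auto
  have CM: "CC A2bar \<W> M = cc_value i l" by (rule CC_iso_uni[OF b(1,2) Mr iM])
  have CN: "CC A2bar \<W> N = cc_value i' l'" by (rule CC_iso_uni[OF b(3,4) Nr iN])
  show ?thesis
  proof
    assume "(M, N) \<in> indec_tau_rigid_iso"
    then have "rep_iso A2bar M N" by (simp add: indec_tau_rigid_iso_def)
    then have "rep_iso A2bar (uni i l) N" by (rule rep_iso_trans[OF is_rep_uni Mr Nr iM])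
    then show "CC A2bar \<W> M = CC A2bar \<W> N" unfolding CM by (rule CC_iso_uni[OF b(1,2) Nr, symmetric])
  next
    assume "CC A2bar \<W> M = CC A2bar \<W> N"
    then have "i = i' \<and> l = l'" unfolding CM CN by (rule cc_value_inj[OF _ l l'])
    then have "rep_iso A2bar (uni i l) N" using iN by simp
    then have "rep_iso A2bar M N" by (rule rep_iso_trans[OF Mr is_rep_uni Nr rep_iso_sym[OF iM]])
    then show "(M, N) \<in> indec_tau_rigid_iso" using M N by (simp add: indec_tau_rigid_iso_def)
  qed
qed

text \<open>As the kernel of \<open>CC\<close>, the relation is reflexive and transitive; symmetry
  is that of isomorphism.\<close>

lemma equiv_indec_tau_rigid_iso: "equiv (indec_tau_rigid :: (vertex, arrow, 'k) rep set) indec_tau_rigid_iso"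
proof (rule equivI)
  let ?r = "indec_tau_rigid_iso :: ((vertex, arrow, 'k) rep \<times> (vertex, arrow, 'k) rep) set"
  show "?r \<subseteq> indec_tau_rigid \<times> indec_tau_rigid" by (auto simp: indec_tau_rigid_iso_def)
  show "refl_on indec_tau_rigid ?r" using indec_tau_rigid_iso_iff by (intro refl_onI) simp_all
  show "sym ?r" by (rule symI) (auto simp: indec_tau_rigid_iso_def rep_iso_sym)
  show "trans ?r"
  proof (rule transI)
    fix L M N assume "(L, M) \<in> ?r" "(M, N) \<in> ?r"
    then show "(L, N) \<in> ?r"
      using indec_tau_rigid_iso_iff[of L M] indec_tau_rigid_iso_iff[of M N] indec_tau_rigid_iso_iff[of L N]
      unfolding indec_tau_rigid_iso_def by auto
  qed
qed

lemma CC_indec_tau_rigid: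
  "CC A2bar \<W> ` indec_tau_rigid =
    {2 * lvar V2 * lvar_inv V1, 2 * lvar V1 * lvar_inv V2, 6 * lvar_inv V1, 6 * lvar_inv V2}" (is "?L = ?R")
proof -
  have R: "?R = {cc_value i l | i l. l \<in> {1, 5}}"
  proof (intro equalityI subsetI)
    fix z assume "z \<in> {cc_value i l | i l. l \<in> {1, 5}}"
    then obtain i l where "z = cc_value i l" "l \<in> {1, 5}" by blast
    then show "z \<in> ?R" unfolding cc_value_cluster[symmetric] by (cases i) auto
  qed (unfold cc_value_cluster[symmetric], blast)
  show ?thesis
    unfolding R
  proof (intro equalityI subsetI)
    fix z assume "z \<in> ?L"
    then obtain M :: "(vertex, arrow, 'k) rep" where M: "M \<in> indec_tau_rigid" "z = CC A2bar \<W> M" by blast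
    obtain i l where l: "l \<in> {1, 5}" and iso: "rep_iso A2bar (uni i l) M" and Mr: "is_rep A2bar M" using indec_tau_rigidE[OF M(1)] .
    have "z = cc_value i l" unfolding M(2) by (rule CC_iso_uni[OF _ _ Mr iso]) (use l in auto)
    then show "z \<in> {cc_value i l | i l. l \<in> {1, 5}}" using l by blast
  next
    fix z assume "z \<in> {cc_value i l | i l. l \<in> {1, 5}}"
    then obtain i l where l: "z = cc_value i l" "l \<in> {1, 5}" by blast
    have "CC A2bar \<W> (uni i l) = z"
      unfolding l(1) by (rule CC_iso_uni[OF _ _ is_rep_uni rep_iso_refl[OF is_rep_uni]]) (use l(2) in auto)
    then show "z \<in> ?L" using uni_in_indec_tau_rigid[OF l(2), of i] by blast
  qed
qed

end

theorem theorem4p13: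
  assumes "(3 :: 'k::alg_closed_field) \<noteq> 0"
  shows "equiv (indec_tau_rigid :: (vertex, arrow, 'k) rep set) indec_tau_rigid_iso \<and>
    CC A2bar (A2bar_potential :: (vertex, arrow, 'k) series) respects indec_tau_rigid_iso \<and>
    bij_betw (\<lambda>C. the_elem (CC A2bar (A2bar_potential :: (vertex, arrow, 'k) series) ` C))
      (indec_tau_rigid // indec_tau_rigid_iso)
      (cluster_variables A2bar_cluster_algebra - initial_variables A2bar_cluster_algebra) \<and>
    cluster_variables A2bar_cluster_algebra - initial_variables A2bar_cluster_algebra =
      {2 * lvar V2 * lvar_inv V1, 2 * lvar V1 * lvar_inv V2, 6 * lvar_inv V1, 6 * lvar_inv V2}"
proof (intro conjI)
  note iff = indec_tau_rigid_iso_iff[OF assms]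
  show equiv: "equiv (indec_tau_rigid :: (vertex, arrow, 'k) rep set) indec_tau_rigid_iso"
    by (rule equiv_indec_tau_rigid_iso[OF assms])
  show resp: "CC A2bar (A2bar_potential :: (vertex, arrow, 'k) series) respects indec_tau_rigid_iso"
  proof (rule congruentI)
    fix M N :: "(vertex, arrow, 'k) rep" assume MN: "(M, N) \<in> indec_tau_rigid_iso"
    then have "M \<in> indec_tau_rigid" "N \<in> indec_tau_rigid" by (simp_all add: indec_tau_rigid_iso_def)
    then show "CC A2bar (A2bar_potential :: (vertex, arrow, 'k) series) M = CC A2bar A2bar_potential N" using iff MN by blast
  qed
  show "bij_betw (\<lambda>C. the_elem (CC A2bar (A2bar_potential :: (vertex, arrow, 'k) series) ` C))
      (indec_tau_rigid // indec_tau_rigid_iso)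
      (cluster_variables A2bar_cluster_algebra - initial_variables A2bar_cluster_algebra)"
    \<comment> \<open>The codomain is rewritten as the image of \<open>CC\<close>, so surjectivity
      is automatic and injectivity on classes is \<open>iff\<close>.\<close>
    unfolding noninitial_cluster_variables CC_indec_tau_rigid[OF assms, symmetric]
    using equiv resp iff by (intro bij_betw_quotient_the_elem) simp_all
qed (rule noninitial_cluster_variables)

end
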